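(* Assume that the cost functions $F,G:\mathbb{R}\times\mathbb{T}^n\times\mathcal{P}(\mathbb{T}^n)\to\mathbb{R}$ and $C:\mathbb{R}\times\mathbb{T}^n\times\mathbb{R}^n\to\mathbb{R}$ satisfy the following. 1. The function $\alpha\mapsto C(s,x,\alpha)$ has a Lipschitz gradient, with Lipschitz constant uniform in $(s,x)$. 2. (State-by-state monotonicity) For every $s\in\mathbb{R}$ and every $\rho^1\ne\rho^2\in\mathcal{P}(\mathbb{T}^n)$, $$\int_{\mathbb{T}^n}\big(\rho^1(x)-\rho^2(x)\big)\big(F(s,x,\rho^1)-F(s,x,\rho^2)\big)\,dx\ge0$$ and $$\int_{\mathbb{T}^n}\big(\rho^1(x)-\rho^2(x)\big)\big(G(s,x,\rho^1)-G(s,x,\rho^2)\big)\,dx\ge0.$$ Let $(u_1,m_1)$ and $(u_2,m_2)$ be two classical solutions, with $u_i=u_i(t,z,x)$ and $m_i=m_i(s,t,z,x)$ for $s\in\mathbb{R}$, $t\in[0,T]$, $z\in\mathbb{R}$, $x\in\mathbb{T}^n$, of the mean field game system $$\begin{cases} -\partial_tu+H(t,z,x,D_xu)-r_t(z)\,\partial_zu-\frac{\sigma^2}{2}\partial_{zz}u-\frac{\sigma'^2}{2}\Delta_xu=\tilde F(t,z,x,m),\\[2pt] \partial_tm+\operatorname{div}_x\big(-D_pH(t,z,x,D_xu)\,m\big)+s\,\partial_zm-\frac{\sigma^2}{2}\partial_{zz}m-\frac{\sigma'^2}{2}\Delta_xm=0\quad\text{for every } s\in\mathbb{R},\\[2pt]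 u(T,z,x)=\tilde G(z,x,m),\\[2pt] m(s,0,z,x)=\bar\rho(x)\,\delta_0(z)\quad\text{for every } s\in\mathbb{R}. \end{cases}$$ Then $u_1=u_2$, and $m_1(s,t,\cdot,\cdot)=m_2(s,t,\cdot,\cdot)$ for almost every $(s,t)$.
   Context: $\mathbb{T}^n=\mathbb{R}^n/\mathbb{Z}^n$ is the $n$-dimensional torus, and $\mathcal{P}(\mathbb{T}^n)$ is the set of Borel probability measures on $\mathbb{T}^n$; in the monotonicity condition, $(\rho^1(x)-\rho^2(x))\,dx$ denotes integration against the signed measure $\rho^1-\rho^2$. The time horizon $T>0$ and the constants $\sigma>0$, $\sigma'>0$ are fixed, and $\bar\rho$ is a given probability density on $\mathbb{T}^n$ (the initial density of positions). The variable $s\in\mathbb{R}$ is the (unknown) state, $z\in\mathbb{R}$ the aggregated signal, $x\in\mathbb{T}^n$ the position. $\varphi_{\mu,v}$ denotes the density of the normal distribution on $\mathbb{R}$ with mean $\mu$ and variance $v$. Set $$r_t(z)=\frac{z}{t+\sigma^2},\qquad \sigma_t^2=\frac{\sigma^2}{\sigma^2+t}.$$ For each $s$ and $t$, $m(s,t,\cdot,\cdot)$ is a probability density over $(z,x)\in\mathbb{R}\times\mathbb{T}^n$ (at $t=0$, the measure $\bar\rho(x)\,dx\otimes\delta_0(dz)$, where $\delta_0$ is the Dirac mass at $0$; the initial condition is understood in the sense of measures). Let $\rho_{s,t}\in\mathcal{P}(\mathbb{T}^n)$ be its marginal over positions, with density $x\mapsto\int_{\mathbb{R}}m(s,t,z,x)\,dz$.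 The expected costs are $$\tilde F(t,z,x,m)=\int_{\mathbb{R}}\varphi_{r_t(z),\sigma_t^2}(s)\,F(s,x,\rho_{s,t})\,ds,\qquad \tilde G(z,x,m)=\int_{\mathbb{R}}\varphi_{r_T(z),\sigma_T^2}(s)\,G(s,x,\rho_{s,T})\,ds,$$ $$\tilde C(t,z,x,\alpha)=\int_{\mathbb{R}}\varphi_{r_t(z),\sigma_t^2}(s)\,C(s,x,\alpha)\,ds,$$ and the Hamiltonian is, for $p\in\mathbb{R}^n$, $$H(t,z,x,p)=\sup_{\alpha\in\mathbb{R}^n}\left\{-\alpha\cdot p-\tilde C(t,z,x,\alpha)\right\}.$$ It is implicit in writing the system that these integrals are well defined and that $H$ is finite and differentiable in $p$.
   Formalization: Classical solutions are also required to have u, ∂_z u and the expected costs of |F| and |G| of order exp(εz²) for every ε>0, uniformly in t and x; without a growth bound in z, Tychonoff-type solutions (F=G=0, C=|α|²/2) break uniqueness of u. *)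

theory Defs
  imports "HOL-Probability.Probability"
begin

section \<open>The torus\<close>

quotient_type 'n torus = "real ^ 'n::finite" / "\<lambda>x y. \<forall>i. x $ i - y $ i \<in> \<int>"
  morphisms rep_torus to_torus
proof (rule equivpI)
  show "symp (\<lambda>x y :: real ^ 'n. \<forall>i. x $ i - y $ i \<in> \<int>)"
    by (rule sympI) (metis Ints_minus minus_diff_eq)
  show "transp (\<lambda>x y :: real ^ 'n. \<forall>i. x $ i - y $ i \<in> \<int>)"
  proof (rule transpI, rule allI)
    fix x y z :: "real ^ 'n" and i
    assume "\<forall>i. x $ i - y $ i \<in> \<int>" "\<forall>i. y $ i - z $ i \<in> \<int>"
    then have "(x $ i - y $ i) + (y $ i - z $ i) \<in> \<int>"
      by (blast intro: Ints_add)
    then show "x $ i - z $ i \<in> \<int>"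
      by simp
  qed
qed (simp add: reflp_def)

text \<open>The quotient topology.\<close>

instantiation torus :: (finite) topological_space
begin

definition open_torus :: "'a torus set \<Rightarrow> bool" where
  "open_torus U \<longleftrightarrow> open (to_torus -` U)"

instance
  by standard (auto simp: open_torus_def vimage_Union intro!: open_UN)

end

text \<open>The measure \<open>dx\<close>: Lebesgue measure of a fundamental domain, pushed to the quotient.\<close>

definition torus_lebesgue :: "('n::finite) torus measure" where
  "torus_lebesgue = distr (restrict_space lborel {y. \<forall>i. 0 \<le> y $ i \<and> y $ i < 1}) borel to_torus"

lift_definition torus_shift :: "('n::finite) torus \<Rightarrow> real ^ 'n \<Rightarrow> 'n torus" is "(+)"
  by simp

text \<open>\<open>\<P>(\<T>\<^sup>n)\<close>; it is also the underlying set of the measurable space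
  \<^term>\<open>prob_algebra (borel :: ('n::finite) torus measure)\<close>.\<close>

definition torus_probs :: "('n::finite) torus measure set" where
  "torus_probs = {\<rho>. prob_space \<rho> \<and> sets \<rho> = sets borel}"

section \<open>Derivatives\<close>

definition tdifferentiable :: "'n \<Rightarrow> (('n::finite) torus \<Rightarrow> real) \<Rightarrow> 'n torus \<Rightarrow> bool" where
  "tdifferentiable i f x \<longleftrightarrow> (\<lambda>h. f (torus_shift x (axis i h))) differentiable (at 0)"

definition tpartial :: "'n \<Rightarrow> (('n::finite) torus \<Rightarrow> real) \<Rightarrow> 'n torus \<Rightarrow> real" where
  "tpartial i f x = deriv (\<lambda>h. f (torus_shift x (axis i h))) 0"

definition d_t :: "(real \<Rightarrow> real \<Rightarrow> 'x \<Rightarrow> real) \<Rightarrow> real \<Rightarrow> real \<Rightarrow> 'x \<Rightarrow> real" where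
  "d_t f t z x = deriv (\<lambda>t'. f t' z x) t"

definition d_z :: "(real \<Rightarrow> real \<Rightarrow> 'x \<Rightarrow> real) \<Rightarrow> real \<Rightarrow> real \<Rightarrow> 'x \<Rightarrow> real" where
  "d_z f t z x = deriv (\<lambda>z'. f t z' x) z"

definition d_x :: "'n \<Rightarrow> (real \<Rightarrow> real \<Rightarrow> ('n::finite) torus \<Rightarrow> real) \<Rightarrow> real \<Rightarrow> real \<Rightarrow> 'n torus \<Rightarrow> real" where
  "d_x i f t z x = tpartial i (f t z) x"

definition D_x :: "(real \<Rightarrow> real \<Rightarrow> ('n::finite) torus \<Rightarrow> real) \<Rightarrow> real \<Rightarrow> real \<Rightarrow> 'n torus \<Rightarrow> real ^ 'n" where
  "D_x f t z x = (\<chi> i. d_x i f t z x)"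

definition laplacian_x :: "(real \<Rightarrow> real \<Rightarrow> ('n::finite) torus \<Rightarrow> real) \<Rightarrow> real \<Rightarrow> real \<Rightarrow> 'n torus \<Rightarrow> real" where
  "laplacian_x f t z x = (\<Sum>i\<in>UNIV. d_x i (d_x i f) t z x)"

definition div_x :: "(real \<Rightarrow> real \<Rightarrow> ('n::finite) torus \<Rightarrow> real ^ 'n) \<Rightarrow> real \<Rightarrow> real \<Rightarrow> 'n torus \<Rightarrow> real" where
  "div_x V t z x = (\<Sum>i\<in>UNIV. d_x i (\<lambda>t z x. V t z x $ i) t z x)"

definition grad :: "('a::real_inner \<Rightarrow> real) \<Rightarrow> 'a \<Rightarrow> 'a" where
  "grad f p = (THE D. GDERIV f p :> D)"

definition jointly_continuous_on ::
    "real set \<Rightarrow> (real \<Rightarrow> real \<Rightarrow> 'x::topological_space \<Rightarrow> 'b::topological_space) \<Rightarrow> bool" where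
  "jointly_continuous_on A f \<longleftrightarrow> continuous_on (A \<times> UNIV \<times> UNIV) (\<lambda>(t, z, x). f t z x)"

text \<open>\<open>C\<^sup>1\<close> in \<open>t\<close> and \<open>C\<^sup>2\<close> in \<open>(z, x)\<close>, asking only for the derivatives that the system contains
  (no mixed second derivatives). \<open>A\<close> is meant to be open.\<close>

definition C12_on :: "real set \<Rightarrow> (real \<Rightarrow> real \<Rightarrow> ('n::finite) torus \<Rightarrow> real) \<Rightarrow> bool" where
  "C12_on A f \<longleftrightarrow>
     (\<forall>t\<in>A. \<forall>z x.
        (\<lambda>t'. f t' z x) differentiable (at t) \<and>
        (\<lambda>z'. f t z' x) differentiable (at z) \<and>
        (\<lambda>z'. d_z f t z' x) differentiable (at z) \<and>
        (\<forall>i. tdifferentiable i (f t z) x \<and> tdifferentiable i (d_x i f t z) x)) \<and>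
     jointly_continuous_on A f \<and>
     jointly_continuous_on A (d_t f) \<and>
     jointly_continuous_on A (d_z f) \<and>
     jointly_continuous_on A (d_z (d_z f)) \<and>
     (\<forall>i. jointly_continuous_on A (d_x i f) \<and> jointly_continuous_on A (d_x i (d_x i f)))"

section \<open>Expected costs and Hamiltonian\<close>

text \<open>\<^const>\<open>normal_density\<close> takes the standard deviation.\<close>

definition gauss :: "real \<Rightarrow> real \<Rightarrow> real \<Rightarrow> real" where
  "gauss \<mu> v s = normal_density \<mu> (sqrt v) s"

definition post_mean :: "real \<Rightarrow> real \<Rightarrow> real \<Rightarrow> real" where
  "post_mean \<sigma> t z = z / (t + \<sigma>\<^sup>2)"

definition post_var :: "real \<Rightarrow> real \<Rightarrow> real" where
  "post_var \<sigma> t = \<sigma>\<^sup>2 / (\<sigma>\<^sup>2 + t)"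

definition post_density :: "real \<Rightarrow> real \<Rightarrow> real \<Rightarrow> real \<Rightarrow> real" where
  "post_density \<sigma> t z s = gauss (post_mean \<sigma> t z) (post_var \<sigma> t) s"

definition post_integrable :: "real \<Rightarrow> real \<Rightarrow> real \<Rightarrow> (real \<Rightarrow> real) \<Rightarrow> bool" where
  "post_integrable \<sigma> t z g \<longleftrightarrow> integrable lborel (\<lambda>s. post_density \<sigma> t z s * g s)"

definition post_expectation :: "real \<Rightarrow> real \<Rightarrow> real \<Rightarrow> (real \<Rightarrow> real) \<Rightarrow> real" where
  "post_expectation \<sigma> t z g = (\<integral>s. post_density \<sigma> t z s * g s \<partial>lborel)"

text \<open>The density \<open>m s t z x\<close> is only meaningful for \<open>t > 0\<close>; the datum at \<open>t = 0\<close> is a measure without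
  density. Accordingly \<open>position_law m s t\<close> is only used for \<open>t > 0\<close>.\<close>

definition position_law ::
    "(real \<Rightarrow> real \<Rightarrow> real \<Rightarrow> ('n::finite) torus \<Rightarrow> real) \<Rightarrow> real \<Rightarrow> real \<Rightarrow> 'n torus measure" where
  "position_law m s t = density torus_lebesgue (\<lambda>x. \<integral>\<^sup>+ z. ennreal (m s t z x) \<partial>lborel)"

definition control_cost ::
    "real \<Rightarrow> (real \<Rightarrow> 'n torus \<Rightarrow> real ^ 'n \<Rightarrow> real) \<Rightarrow> real \<Rightarrow> real \<Rightarrow> ('n::finite) torus \<Rightarrow> real ^ 'n \<Rightarrow> real" where
  "control_cost \<sigma> C t z x \<alpha> = post_expectation \<sigma> t z (\<lambda>s. C s x \<alpha>)"

definition crowd_cost ::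
    "real \<Rightarrow> (real \<Rightarrow> 'n torus \<Rightarrow> 'n torus measure \<Rightarrow> real) \<Rightarrow>
     (real \<Rightarrow> real \<Rightarrow> real \<Rightarrow> 'n torus \<Rightarrow> real) \<Rightarrow> real \<Rightarrow> real \<Rightarrow> ('n::finite) torus \<Rightarrow> real" where
  "crowd_cost \<sigma> F m t z x = post_expectation \<sigma> t z (\<lambda>s. F s x (position_law m s t))"

definition Hamiltonian ::
    "real \<Rightarrow> (real \<Rightarrow> 'n torus \<Rightarrow> real ^ 'n \<Rightarrow> real) \<Rightarrow> real \<Rightarrow> real \<Rightarrow> ('n::finite) torus \<Rightarrow> real ^ 'n \<Rightarrow> real" where
  "Hamiltonian \<sigma> C t z x p = (SUP \<alpha>. - (\<alpha> \<bullet> p) - control_cost \<sigma> C t z x \<alpha>)"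

text \<open>The real-valued \<open>SUP\<close> is the true supremum only for sets bounded above, hence the second
  clause below.\<close>

definition Hamiltonian_well_defined ::
    "real \<Rightarrow> real \<Rightarrow> (real \<Rightarrow> ('n::finite) torus \<Rightarrow> real ^ 'n \<Rightarrow> real) \<Rightarrow> bool" where
  "Hamiltonian_well_defined T \<sigma> C \<longleftrightarrow>
     (\<forall>t\<in>{0..T}. \<forall>z x.
        (\<forall>\<alpha>. post_integrable \<sigma> t z (\<lambda>s. C s x \<alpha>)) \<and>
        (\<forall>p. bdd_above (range (\<lambda>\<alpha>. - (\<alpha> \<bullet> p) - control_cost \<sigma> C t z x \<alpha>))) \<and>
        (\<forall>p. Hamiltonian \<sigma> C t z x differentiable (at p)))"

section \<open>Assumptions on the costs\<close>

definition uniformly_Lipschitz_gradient ::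
    "(real \<Rightarrow> ('n::finite) torus \<Rightarrow> real ^ 'n \<Rightarrow> real) \<Rightarrow> bool" where
  "uniformly_Lipschitz_gradient C \<longleftrightarrow>
     (\<exists>L. \<forall>s x. (\<forall>\<alpha>. C s x differentiable (at \<alpha>)) \<and> L-lipschitz_on UNIV (grad (C s x)))"

text \<open>Integrability has to be stated because the Bochner integral of a non-integrable function is \<open>0\<close>.\<close>

definition state_by_state_monotone ::
    "(real \<Rightarrow> ('n::finite) torus \<Rightarrow> 'n torus measure \<Rightarrow> real) \<Rightarrow> bool" where
  "state_by_state_monotone F \<longleftrightarrow>
     (\<forall>s. \<forall>\<rho>1\<in>torus_probs. \<forall>\<rho>2\<in>torus_probs. \<rho>1 \<noteq> \<rho>2 \<longrightarrow>
        integrable \<rho>1 (\<lambda>x. F s x \<rho>1 - F s x \<rho>2) \<and>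
        integrable \<rho>2 (\<lambda>x. F s x \<rho>1 - F s x \<rho>2) \<and>
        (\<integral>x. F s x \<rho>1 - F s x \<rho>2 \<partial>\<rho>1) - (\<integral>x. F s x \<rho>1 - F s x \<rho>2 \<partial>\<rho>2) \<ge> 0)"

definition Borel_cost :: "(real \<Rightarrow> ('n::finite) torus \<Rightarrow> 'n torus measure \<Rightarrow> real) \<Rightarrow> bool" where
  "Borel_cost F \<longleftrightarrow>
     (\<lambda>(s, x, \<rho>). F s x \<rho>) \<in> borel_measurable (borel \<Otimes>\<^sub>M borel \<Otimes>\<^sub>M prob_algebra borel)"

definition torus_density :: "(('n::finite) torus \<Rightarrow> real) \<Rightarrow> bool" where
  "torus_density \<rho> \<longleftrightarrow> \<rho> \<in> borel_measurable borel \<and> (\<forall>x. 0 \<le> \<rho> x) \<and>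
     (\<integral>\<^sup>+ x. ennreal (\<rho> x) \<partial>torus_lebesgue) = 1"

section \<open>The mean field game system\<close>

definition HJB ::
    "real \<Rightarrow> real \<Rightarrow> real \<Rightarrow> (real \<Rightarrow> 'n torus \<Rightarrow> 'n torus measure \<Rightarrow> real) \<Rightarrow>
     (real \<Rightarrow> 'n torus \<Rightarrow> 'n torus measure \<Rightarrow> real) \<Rightarrow> (real \<Rightarrow> 'n torus \<Rightarrow> real ^ 'n \<Rightarrow> real) \<Rightarrow>
     (real \<Rightarrow> real \<Rightarrow> ('n::finite) torus \<Rightarrow> real) \<Rightarrow> (real \<Rightarrow> real \<Rightarrow> real \<Rightarrow> 'n torus \<Rightarrow> real) \<Rightarrow> bool" where
  "HJB T \<sigma> \<sigma>' F G C u m \<longleftrightarrow>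
     (\<forall>t\<in>{0<..<T}. \<forall>z x.
        post_integrable \<sigma> t z (\<lambda>s. F s x (position_law m s t)) \<and>
        - d_t u t z x + Hamiltonian \<sigma> C t z x (D_x u t z x)
          - post_mean \<sigma> t z * d_z u t z x - \<sigma>\<^sup>2 / 2 * d_z (d_z u) t z x
          - \<sigma>'\<^sup>2 / 2 * laplacian_x u t z x
        = crowd_cost \<sigma> F m t z x) \<and>
     (\<forall>z x.
        post_integrable \<sigma> T z (\<lambda>s. G s x (position_law m s T)) \<and>
        u T z x = crowd_cost \<sigma> G m T z x)"

definition drift ::
    "real \<Rightarrow> (real \<Rightarrow> 'n torus \<Rightarrow> real ^ 'n \<Rightarrow> real) \<Rightarrow> (real \<Rightarrow> real \<Rightarrow> ('n::finite) torus \<Rightarrow> real) \<Rightarrow>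
     real \<Rightarrow> real \<Rightarrow> 'n torus \<Rightarrow> real ^ 'n" where
  "drift \<sigma> C u t z x = - grad (Hamiltonian \<sigma> C t z x) (D_x u t z x)"

definition Fokker_Planck ::
    "real \<Rightarrow> real \<Rightarrow> real \<Rightarrow> (('n::finite) torus \<Rightarrow> real) \<Rightarrow> (real \<Rightarrow> real \<Rightarrow> 'n torus \<Rightarrow> real ^ 'n) \<Rightarrow>
     real \<Rightarrow> (real \<Rightarrow> real \<Rightarrow> 'n torus \<Rightarrow> real) \<Rightarrow> bool" where
  "Fokker_Planck T \<sigma> \<sigma>' \<rho>0 b s \<mu> \<longleftrightarrow>
     (\<forall>t\<in>{0<..<T}. \<forall>z x.
        d_t \<mu> t z x + div_x (\<lambda>t z x. \<mu> t z x *\<^sub>R b t z x) t z x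
          + s * d_z \<mu> t z x - \<sigma>\<^sup>2 / 2 * d_z (d_z \<mu>) t z x
          - \<sigma>'\<^sup>2 / 2 * laplacian_x \<mu> t z x = 0) \<and>
     (\<forall>f :: real \<times> 'n torus \<Rightarrow> real. continuous_on UNIV f \<and> bounded (range f) \<longrightarrow>
        ((\<lambda>t. \<integral>(z, x). f (z, x) * \<mu> t z x \<partial>(lborel \<Otimes>\<^sub>M torus_lebesgue))
          \<longlongrightarrow> (\<integral>x. f (0, x) * \<rho>0 x \<partial>torus_lebesgue)) (at_right 0))"

text \<open>Growth in the non-compact variable \<open>z\<close>, slower than every \<open>exp (\<epsilon> z\<^sup>2)\<close>. Some such bound belongs to
  the notion of solution: already the linear equation
  \<open>- \<partial>\<^sub>t u - r\<^sub>t(z) \<partial>\<^sub>z u - \<sigma>\<^sup>2/2 \<partial>\<^sub>z\<^sub>z u = 0\<close>, \<open>u(T) = 0\<close>, has non-zero smooth (Tychonoff) solutions.\<close>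

definition subgaussian_growth :: "real set \<Rightarrow> (real \<Rightarrow> real \<Rightarrow> 'x \<Rightarrow> real) \<Rightarrow> bool" where
  "subgaussian_growth A f \<longleftrightarrow>
     (\<forall>\<epsilon>>0. \<exists>K. \<forall>t\<in>A. \<forall>z x. \<bar>f t z x\<bar> \<le> K * exp (\<epsilon> * z\<^sup>2))"

definition classical_solution ::
    "real \<Rightarrow> real \<Rightarrow> real \<Rightarrow> (real \<Rightarrow> 'n torus \<Rightarrow> 'n torus measure \<Rightarrow> real) \<Rightarrow>
     (real \<Rightarrow> 'n torus \<Rightarrow> 'n torus measure \<Rightarrow> real) \<Rightarrow> (real \<Rightarrow> 'n torus \<Rightarrow> real ^ 'n \<Rightarrow> real) \<Rightarrow>
     ('n torus \<Rightarrow> real) \<Rightarrow>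
     (real \<Rightarrow> real \<Rightarrow> ('n::finite) torus \<Rightarrow> real) \<Rightarrow> (real \<Rightarrow> real \<Rightarrow> real \<Rightarrow> 'n torus \<Rightarrow> real) \<Rightarrow> bool" where
  "classical_solution T \<sigma> \<sigma>' F G C \<rho>0 u m \<longleftrightarrow>
     \<comment> \<open>regularity of \<open>u\<close> and of the drift; at \<open>t = 0\<close> only \<open>D_x u\<close> is needed\<close>
     jointly_continuous_on {0..T} u \<and> C12_on {0<..<T} u \<and>
     (\<forall>z x i. tdifferentiable i (u 0 z) x) \<and>
     jointly_continuous_on {0..<T} (D_x u) \<and>
     jointly_continuous_on {0..<T} (drift \<sigma> C u) \<and>
     \<comment> \<open>each \<open>m s t\<close> is a probability density, regular for \<open>t > 0\<close>\<close>
     (\<forall>s. \<forall>t\<in>{0<..T}. (\<forall>z x. 0 \<le> m s t z x) \<and>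
        (\<integral>\<^sup>+ (z, x). ennreal (m s t z x) \<partial>(lborel \<Otimes>\<^sub>M torus_lebesgue)) = 1) \<and>
     (\<forall>s. jointly_continuous_on {0<..T} (m s) \<and> C12_on {0<..<T} (m s)) \<and>
     (\<forall>s i. let V = (\<lambda>t z x. (m s t z x *\<^sub>R drift \<sigma> C u t z x) $ i) in
        (\<forall>t\<in>{0<..<T}. \<forall>z x. tdifferentiable i (V t z) x) \<and>
        jointly_continuous_on {0<..<T} (d_x i V)) \<and>
     \<comment> \<open>growth in \<open>z\<close>\<close>
     subgaussian_growth {0..T} u \<and> subgaussian_growth {0<..<T} (d_z u) \<and>
     subgaussian_growth {0<..<T} (crowd_cost \<sigma> (\<lambda>s x \<rho>. \<bar>F s x \<rho>\<bar>) m) \<and>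
     subgaussian_growth {T} (crowd_cost \<sigma> (\<lambda>s x \<rho>. \<bar>G s x \<rho>\<bar>) m) \<and>
     \<comment> \<open>the system\<close>
     HJB T \<sigma> \<sigma>' F G C u m \<and>
     (\<forall>s. Fokker_Planck T \<sigma> \<sigma>' \<rho>0 (drift \<sigma> C u) s (m s))"

end

theory Submission
  imports Defs
begin

text \<open>Put the prior \<open>N(0, 1)\<close> on the state \<open>s\<close>. The state enters the forward equation only as the drift of the
  signal, so by Girsanov's formula \<open>m s = exp (s z / \<sigma>\<^sup>2 - s\<^sup>2 t / (2 \<sigma>\<^sup>2)) m 0\<close>, and by Bayes' formula the prior
  times this factor is the posterior density times a weight \<open>k(t, z)\<close>. The weight solves the backward heat
  equation and satisfies \<open>\<sigma>\<^sup>2 \<partial>\<^sub>z k = r\<^sub>t(z) k\<close>, so that the Lasry--Lions computation applies to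
  \<open>\<integral> (u1 - u2) k (m1 0 - m2 0)\<close>: the generator of the state \<open>0\<close> acting on \<open>k (u1 - u2)\<close> gives \<open>k\<close> times
  the operator of the HJB equation, and by Fubini the cost terms become the average of the monotonicity
  integrals over the prior. A Lipschitz gradient of the cost makes the Hamiltonian strongly convex, hence
  \<open>D_x u1 = D_x u2\<close> wherever \<open>m1 0 + m2 0 > 0\<close>. There the two drifts agree, so both densities solve the same linear
  Fokker--Planck equation, whose solutions are unique although the drift is only locally bounded and the
  initial datum is singular. With \<open>m1 = m2\<close>, the maximum principle for \<open>u1 - u2\<close> gives \<open>u1 = u2\<close>.\<close>

subsection \<open>The torus\<close>

text \<open>The obstacle is the unbounded variable \<open>z\<close>. The drift is controlled only
  for bounded \<open>z\<close>, so every integration by parts is done under a cutoff, and removing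
  the cutoff takes moments. These are available because the drift moves positions only: in state
  \<open>s\<close> the signal is exactly normal with mean \<open>s * t\<close> and variance
  \<open>\<sigma>\<^sup>2 * t\<close>, whatever the drift. The weight grows like \<open>exp
  (z\<^sup>2 / (2 * \<sigma>\<^sup>2 * (t + \<sigma>\<^sup>2)))\<close>, while the signal in state 0
  decays like \<open>exp (- z\<^sup>2 / (2 * \<sigma>\<^sup>2 * t))\<close>. The rates differ by
  \<open>1 / (2 * t * (t + \<sigma>\<^sup>2))\<close>, at least
  \<open>1 / (2 * T * (T + \<sigma>\<^sup>2))\<close>; half of this margin, the constant
  \<open>1 / (4 * T * (T + \<sigma>\<^sup>2))\<close>, is left to the growth of values and costs. At
  time 0 the densities are known only as measures, and weak convergence does not control the
  \<open>L1\<close> norm of the difference of two solutions. Duality with the heat flow of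
  trigonometric polynomials does, because its gradient bound is integrable in time.\<close>

lemma to_torus_eq_iff: "to_torus x = to_torus y \<longleftrightarrow> (\<forall>i. x $ i - y $ i \<in> \<int>)"
  by (rule torus.abs_eq_iff)

lemma to_torus_rep_torus [simp]: "to_torus (rep_torus x) = x"
  by (meson Quotient_torus Quotient_abs_rep)

lemma rep_torus_to_torus: "rep_torus (to_torus y) $ i - y $ i \<in> \<int>"
  using to_torus_rep_torus[of "to_torus y"] unfolding to_torus_eq_iff by blast

lemma torus_shift_to_torus: "torus_shift (to_torus y) v = to_torus (y + v)"
  by (rule torus_shift.abs_eq)

lemma torus_shift_shift: "torus_shift (torus_shift x v) w = torus_shift x (v + w)"
  by (metis to_torus_rep_torus torus_shift_to_torus add.assoc)

lemma torus_shift_0 [simp]: "torus_shift x 0 = x"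
  by (metis to_torus_rep_torus torus_shift_to_torus add.right_neutral)

lemma axis_add: "axis i a + axis i b = (axis i (a + b) :: real ^ 'n::finite)"
  by (simp add: vec_eq_iff axis_def)

lemma axis_0: "axis i 0 = (0 :: real ^ 'n::finite)"
  by (simp add: vec_eq_iff axis_def)

lemma torus_shift_axis_0 [simp]: "torus_shift x (axis i 0) = x"
  by (simp add: axis_0)

lemma open_torus_iff: "open U \<longleftrightarrow> open (to_torus -` U)"
  by (fact open_torus_def)

lemma continuous_on_torus_iff:
  "continuous_on UNIV f \<longleftrightarrow> continuous_on UNIV (\<lambda>y. f (to_torus y))"
  by (simp add: continuous_on_open_vimage open_torus_iff vimage_def)

lemma continuous_on_to_torus: "continuous_on UNIV to_torus"
  by (simp add: continuous_on_open_vimage open_torus_iff)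

text \<open>The saturation of \<open>S\<close> is the union of its translates by integer vectors, so
  the quotient map is open. Images of a countable basis of the covering space therefore form a basis
  of the torus.\<close>

lemma open_image_to_torus:
  assumes "open S" shows "open (to_torus ` (S :: (real ^ 'n::finite) set))"
proof -
  have "to_torus -` to_torus ` S = (\<Union>k\<in>{k. \<forall>i. k $ i \<in> \<int>}. (\<lambda>x. k + x) ` S)"
  proof (intro equalityI subsetI)
    fix y assume "y \<in> to_torus -` to_torus ` S"
    then obtain x where "x \<in> S" "\<forall>i. y $ i - x $ i \<in> \<int>"
      by (auto simp: to_torus_eq_iff)
    then show "y \<in> (\<Union>k\<in>{k. \<forall>i. k $ i \<in> \<int>}. (\<lambda>x. k + x) ` S)"
      by (intro UN_I[of "y - x"] image_eqI[of _ _ x]) auto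
  next
    fix y assume "y \<in> (\<Union>k\<in>{k. \<forall>i. k $ i \<in> \<int>}. (\<lambda>x. k + x) ` S)"
    then obtain k x where "\<forall>i. k $ i \<in> \<int>" "x \<in> S" "y = k + x"
      by blast
    then have "to_torus y = to_torus x" "x \<in> S"
      by (auto simp: to_torus_eq_iff)
    then show "y \<in> to_torus -` to_torus ` S"
      by simp
  qed
  then show ?thesis
    unfolding open_torus_iff using assms by (auto intro!: open_UN open_translation)
qed

text \<open>Second countability makes the Borel sets of pairs (signal, position) the product of the
  Borel sets, so that continuous functions of such pairs are measurable for the product measure
  (\<open>sets_zx\<close>).\<close>

instance torus :: (finite) second_countable_topology
proof
  obtain B :: "(real ^ 'a) set set" where B: "countable B" "topological_basis B"
    using ex_countable_basis by blast
  have "topological_basis ((`) to_torus ` B)"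
  proof (rule topological_basisI)
    fix S assume "S \<in> (`) to_torus ` B"
    then show "open S"
      using B(2) by (auto intro!: open_image_to_torus simp: topological_basis_open)
  next
    fix S :: "'a torus set" and x assume *: "open S" "x \<in> S"
    then have "open (to_torus -` S)" "rep_torus x \<in> to_torus -` S"
      by (auto simp: open_torus_iff)
    then obtain b where "b \<in> B" "rep_torus x \<in> b" "b \<subseteq> to_torus -` S"
      using topological_basisE[OF B(2)] by metis
    then show "\<exists>B'\<in>(`) to_torus ` B. x \<in> B' \<and> B' \<subseteq> S"
      by (intro bexI[of _ "to_torus ` b"]) (auto intro!: image_eqI[of _ _ "rep_torus x"])
  qed
  with B(1) show "\<exists>B::'a torus set set. countable B \<and> open = generate_topology B"
    by (intro exI[of _ "(`) to_torus ` B"]) (auto intro: topological_basis_imp_subbasis)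
qed

abbreviation torus_cube :: "(real ^ 'n::finite) set" where
  "torus_cube \<equiv> {y. \<forall>i. 0 \<le> y $ i \<and> y $ i < 1}"

lemma ex_cube_rep: "\<exists>y\<in>torus_cube. to_torus y = x"
proof -
  let ?y = "\<chi> i. frac (rep_torus x $ i)"
  have "to_torus ?y = to_torus (rep_torus x)"
    unfolding to_torus_eq_iff by (auto simp: frac_def)
  then show ?thesis
    by (intro bexI[of _ ?y]) (auto simp: frac_lt_1)
qed

lemma compact_UNIV_torus: "compact (UNIV :: ('n::finite) torus set)"
proof -
  have "(UNIV :: 'n torus set) = to_torus ` cbox 0 (\<chi> i. 1)"
  proof (intro equalityI subsetI)
    fix x :: "'n torus" assume "x \<in> UNIV"
    obtain y where "y \<in> torus_cube" "to_torus y = x"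
      using ex_cube_rep by blast
    then show "x \<in> to_torus ` cbox 0 (\<chi> i. 1)"
      by (auto intro!: image_eqI[of _ _ y] simp: mem_box_cart less_imp_le)
  qed auto
  then show ?thesis
    using compact_continuous_image[OF continuous_on_subset[OF continuous_on_to_torus] compact_cbox]
    by (metis subset_UNIV)
qed

lemma continuous_on_torus_shift: "continuous_on UNIV (\<lambda>x. torus_shift x v)"
  unfolding continuous_on_torus_iff torus_shift_to_torus
  by (intro continuous_on_compose2[OF continuous_on_to_torus] continuous_intros) auto

lemma sets_torus_lebesgue [simp, measurable_cong]: "sets torus_lebesgue = sets borel"
  by (simp add: torus_lebesgue_def)

lemma space_torus_lebesgue [simp]: "space torus_lebesgue = UNIV"
  by (simp add: torus_lebesgue_def)

lemma measurable_to_torus [measurable]: "to_torus \<in> borel_measurable borel"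
  by (rule borel_measurable_continuous_onI[OF continuous_on_to_torus])

lemma measurable_torus_shift [measurable]: "(\<lambda>x. torus_shift x v) \<in> borel_measurable borel"
  by (rule borel_measurable_continuous_onI[OF continuous_on_torus_shift])

lemma torus_cube_borel [measurable]: "torus_cube \<in> sets (borel :: (real ^ 'n::finite) measure)"
proof -
  have "torus_cube = (\<Inter>i. {y. 0 \<le> y $ i \<and> y $ i < 1} :: (real ^ 'n) set)"
    by auto
  also have "\<dots> \<in> sets borel"
    by (intro sets.countable_INT'' sets.finite_INT) (auto intro!: sets.countable_INT)
  finally show ?thesis .
qed

lemma emeasure_torus_lebesgue:
  assumes "A \<in> sets borel"
  shows "emeasure torus_lebesgue A = emeasure lborel (torus_cube \<inter> to_torus -` A)"
proof -
  have m: "to_torus \<in> measurable (restrict_space lborel torus_cube) borel"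
    by (intro measurable_restrict_space1) simp
  have "to_torus -` A \<in> sets borel"
    using measurable_sets_borel[OF measurable_to_torus assms] by simp
  then show ?thesis
    unfolding torus_lebesgue_def
    by (subst emeasure_distr[OF m assms], subst emeasure_restrict_space)
       (auto simp: space_restrict_space intro!: arg_cong[where f = "emeasure lborel"])
qed

lemma emeasure_lborel_translate:
  assumes "S \<in> sets borel"
  shows "emeasure lborel {y. y + v \<in> S} = emeasure lborel (S :: 'a::euclidean_space set)"
proof -
  have "emeasure lborel S = emeasure (distr lborel borel ((+) v)) S"
    by (subst lborel_distr_plus) simp
  also have "\<dots> = emeasure lborel ((+) v -` S)"
    using assms by (subst emeasure_distr) auto
  finally show ?thesis
    by (simp add: vimage_def add.commute)
qed

text \<open>Cut and paste. By periodicity \<open>h\<close> may be replaced by its fractional part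
  \<open>g\<close>. The shifted cube leaves the unit cube through the slab
  \<open>1 \<le> y $ i < 1 + g\<close>, and translating this slab back by one period fills the gap
  \<open>0 \<le> y $ i < g\<close>.\<close>

lemma emeasure_torus_lebesgue_shift:
  assumes A: "A \<in> sets borel"
  shows "emeasure torus_lebesgue {x. torus_shift x (axis i h) \<in> A} = emeasure torus_lebesgue (A :: ('n::finite) torus set)"
proof -
  define g where "g = frac h"
  have g: "0 \<le> g" "g < 1"
    by (auto simp: g_def frac_lt_1)
  define P where "P = (to_torus -` A :: (real ^ 'n) set)"
  have P [measurable]: "P \<in> sets borel"
    unfolding P_def using measurable_sets_borel[OF measurable_to_torus A] by simp
  have sh: "to_torus (y + axis i h) = to_torus (y + axis i g)" for y :: "real ^ 'n"
    unfolding to_torus_eq_iff by (auto simp: axis_def g_def frac_def)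
  have per: "y + axis i (-1) \<in> P \<longleftrightarrow> y \<in> P" for y
  proof -
    have "to_torus (y + axis i (-1)) = to_torus y"
      unfolding to_torus_eq_iff by (auto simp: axis_def)
    then show ?thesis by (simp add: P_def)
  qed
  have coord [measurable]: "(\<lambda>y. y $ i) \<in> borel_measurable (borel :: (real ^ 'n) measure)" for i
    by (intro borel_measurable_continuous_onI continuous_intros)
  define B where "B = {y :: real ^ 'n. \<forall>j. j \<noteq> i \<longrightarrow> 0 \<le> y $ j \<and> y $ j < 1}"
  have B [measurable]: "B \<in> sets borel"
  proof -
    have "B = (\<Inter>j. {y. j \<noteq> i \<longrightarrow> 0 \<le> y $ j \<and> y $ j < 1} :: (real ^ 'n) set)"
      by (auto simp: B_def)
    also have "\<dots> \<in> sets borel"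
      by (intro sets.finite_INT) auto
    finally show ?thesis .
  qed
  have Q: "torus_cube = {y \<in> B. 0 \<le> y $ i \<and> y $ i < 1}"
    by (auto simp: B_def)
  have Bax: "y + axis i c \<in> B \<longleftrightarrow> y \<in> B" for y c
    by (auto simp: B_def axis_def)
  have "emeasure torus_lebesgue {x. torus_shift x (axis i h) \<in> A}
      = emeasure lborel (torus_cube \<inter> to_torus -` {x. torus_shift x (axis i h) \<in> A})"
  proof (rule emeasure_torus_lebesgue)
    show "{x. torus_shift x (axis i h) \<in> A} \<in> sets borel"
      using measurable_sets_borel[OF measurable_torus_shift A, of "axis i h"] by (simp add: vimage_def)
  qed
  also have "torus_cube \<inter> to_torus -` {x. torus_shift x (axis i h) \<in> A}
      = {y. y + axis i g \<in> {y \<in> B. g \<le> y $ i \<and> y $ i < 1 + g \<and> y \<in> P}}"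
    unfolding Q using Bax by (auto simp: torus_shift_to_torus sh P_def add.commute)
  also have "emeasure lborel \<dots> = emeasure lborel {y \<in> B. g \<le> y $ i \<and> y $ i < 1 + g \<and> y \<in> P}"
    by (rule emeasure_lborel_translate) measurable
  also have "{y \<in> B. g \<le> y $ i \<and> y $ i < 1 + g \<and> y \<in> P}
      = {y \<in> B. g \<le> y $ i \<and> y $ i < 1 \<and> y \<in> P} \<union> {y \<in> B. 1 \<le> y $ i \<and> y $ i < 1 + g \<and> y \<in> P}"
    using g by auto
  also have "emeasure lborel \<dots> = emeasure lborel {y \<in> B. g \<le> y $ i \<and> y $ i < 1 \<and> y \<in> P}
      + emeasure lborel {y \<in> B. 1 \<le> y $ i \<and> y $ i < 1 + g \<and> y \<in> P}"
    by (rule plus_emeasure[symmetric]) auto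
  also have "{y \<in> B. 1 \<le> y $ i \<and> y $ i < 1 + g \<and> y \<in> P}
      = {y. y + axis i (-1) \<in> {y \<in> B. 0 \<le> y $ i \<and> y $ i < g \<and> y \<in> P}}"
    using per Bax by auto
  also have "emeasure lborel \<dots> = emeasure lborel {y \<in> B. 0 \<le> y $ i \<and> y $ i < g \<and> y \<in> P}"
    by (rule emeasure_lborel_translate) measurable
  also have "emeasure lborel {y \<in> B. g \<le> y $ i \<and> y $ i < 1 \<and> y \<in> P} + \<dots>
     = emeasure lborel ({y \<in> B. g \<le> y $ i \<and> y $ i < 1 \<and> y \<in> P} \<union> {y \<in> B. 0 \<le> y $ i \<and> y $ i < g \<and> y \<in> P})"
    by (rule plus_emeasure) auto
  also have "{y \<in> B. g \<le> y $ i \<and> y $ i < 1 \<and> y \<in> P} \<union> {y \<in> B. 0 \<le> y $ i \<and> y $ i < g \<and> y \<in> P}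
      = torus_cube \<inter> to_torus -` A"
    unfolding Q using g by (auto simp: P_def)
  also have "emeasure lborel \<dots> = emeasure torus_lebesgue A"
    by (rule emeasure_torus_lebesgue[symmetric, OF A])
  finally show ?thesis .
qed

lemma distr_torus_lebesgue_shift:
  "distr torus_lebesgue torus_lebesgue (\<lambda>x. torus_shift x (axis i h)) = torus_lebesgue"
proof (rule measure_eqI)
  fix A assume "A \<in> sets (distr torus_lebesgue torus_lebesgue (\<lambda>x. torus_shift x (axis i h)))"
  then show "emeasure (distr torus_lebesgue torus_lebesgue (\<lambda>x. torus_shift x (axis i h))) A = emeasure torus_lebesgue A"
    using emeasure_torus_lebesgue_shift[of A i h] by (subst emeasure_distr) (auto simp: vimage_def)
qed simp

lemma prob_space_torus_lebesgue: "prob_space (torus_lebesgue :: ('n::finite) torus measure)"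
proof
  let ?Q = "torus_cube :: (real ^ 'n) set"
  let ?o = "(\<chi> i. 1) :: real ^ 'n"
  have 1: "(\<Prod>b\<in>(Basis :: (real ^ 'n) set). ?o \<bullet> b) = 1"
    by (intro prod.neutral) (auto simp: Basis_vec_def inner_axis)
  have *: "0 \<le> ?o \<bullet> b" if "b \<in> Basis" for b
    using that by (auto simp: Basis_vec_def inner_axis)
  have "emeasure lborel (box 0 ?o) \<le> emeasure lborel ?Q"
    by (intro emeasure_mono) (auto simp: mem_box_cart less_imp_le)
  moreover have "emeasure lborel ?Q \<le> emeasure lborel (cbox 0 ?o)"
    by (intro emeasure_mono) (auto simp: mem_box_cart less_imp_le)
  moreover have "emeasure lborel (box 0 ?o) = 1" "emeasure lborel (cbox 0 ?o) = 1"
    using 1 * by (auto simp: emeasure_lborel_box_eq emeasure_lborel_cbox_eq)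
  ultimately have "emeasure lborel ?Q = 1"
    by simp
  then show "emeasure (torus_lebesgue :: 'n torus measure) (space torus_lebesgue) = 1"
    by (simp add: emeasure_torus_lebesgue)
qed

interpretation torus_lebesgue: prob_space "torus_lebesgue :: ('n::finite) torus measure"
  by (rule prob_space_torus_lebesgue)

text \<open>This is what turns a vanishing integral of a continuous nonnegative function into a
  pointwise statement. A point of the half-open cube may lie on a lower face, so the small box that
  witnesses positive measure extends from it in the positive directions only.\<close>

lemma emeasure_torus_lebesgue_open_pos:
  assumes "open U" "x \<in> (U :: ('n::finite) torus set)"
  shows "emeasure torus_lebesgue U > 0"
proof -
  obtain y where y: "y \<in> torus_cube" "to_torus y = x"
    using ex_cube_rep by blast
  have "open (to_torus -` U)" "y \<in> to_torus -` U"
    using assms y by (auto simp: open_torus_iff)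
  then obtain e where e: "e > 0" "ball y e \<subseteq> to_torus -` U"
    using open_contains_ball by blast
  define w where "w = (\<lambda>d. y + (\<chi> i. d) :: real ^ 'n)"
  \<comment> \<open>The first entry keeps the box inside the ball: the norm of its diagonal is at
    most the sum of the coordinates, \<open>CARD('n) * d \<le> e / 2\<close>. The other entries keep
    it away from the upper faces of the cube.\<close>
  define d where "d = Min (insert (e / (2 * CARD('n))) (range (\<lambda>i. (1 - y $ i) / 2)))"
  have d1: "d \<le> e / (2 * CARD('n))" and d2: "d \<le> (1 - y $ i) / 2" for i
    unfolding d_def by (rule Min_le; simp)+
  have "d \<in> insert (e / (2 * CARD('n))) (range (\<lambda>i. (1 - y $ i) / 2))"
    unfolding d_def by (intro Min_in) auto
  then have d3: "d > 0"
    using e(1) y(1) by auto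
  have "norm (w d - y) \<le> (\<Sum>i\<in>UNIV. \<bar>(w d - y) $ i\<bar>)"
    by (rule norm_le_l1_cart)
  also have "\<dots> = CARD('n) * d"
    using d3 by (simp add: w_def)
  also have "\<dots> < e"
    using mult_left_mono[OF d1, of "CARD('n)"] e(1) by simp
  finally have "norm (w d - y) < e" .
  moreover have "d < 1 - y $ i" for i
    using d2[of i] d3 by simp
  ultimately have d: "norm (w d - y) < e" "\<forall>i. d < 1 - y $ i" "d > 0"
    using d3 by auto
  have sub: "box y (w d) \<subseteq> torus_cube \<inter> to_torus -` U"
  proof
    fix v assume v: "v \<in> box y (w d)"
    have v': "y $ i < v $ i" "v $ i < y $ i + d" for i
      using v by (auto simp: mem_box_cart w_def)
    have "norm ((v - y) $ i) \<le> norm ((w d - y) $ i)" for i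
      using v'[of i] by (simp add: w_def)
    then have "norm (v - y) \<le> norm (w d - y)"
      by (intro norm_le_componentwise_cart) auto
    then have "v \<in> ball y e"
      using d(1) by (simp add: dist_norm norm_minus_commute)
    moreover have "v \<in> torus_cube"
    proof (intro CollectI allI conjI)
      fix i
      have "0 \<le> y $ i" "d < 1 - y $ i"
        using d(2) y(1) by auto
      with v'[of i] show "0 \<le> v $ i" "v $ i < 1" by linarith+
    qed
    ultimately show "v \<in> torus_cube \<inter> to_torus -` U"
      using e by auto
  qed
  have "0 < emeasure lborel (box y (w d))"
    using d(3) unfolding emeasure_lborel_box_eq
    by (auto simp: Basis_vec_def inner_axis w_def inner_diff_left intro!: prod_pos)
  also have "\<dots> \<le> emeasure lborel (torus_cube \<inter> to_torus -` U)"
    using assms(1) measurable_sets_borel[OF measurable_to_torus, of U] sub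
    by (intro emeasure_mono sub sets.Int) auto
  also have "\<dots> = emeasure torus_lebesgue U"
    using assms(1) by (subst emeasure_torus_lebesgue) auto
  finally show ?thesis .
qed

subsection \<open>Calculus on the strip\<close>

abbreviation zx :: "(real \<times> ('n::finite) torus) measure" where
  "zx \<equiv> lborel \<Otimes>\<^sub>M torus_lebesgue"

abbreviation strip :: "real \<Rightarrow> (real \<times> ('n::finite) torus) set" where
  "strip R \<equiv> {-R..R} \<times> UNIV"

interpretation zx: pair_sigma_finite lborel "torus_lebesgue :: ('n::finite) torus measure" ..

lemma sets_zx: "sets zx = sets (borel :: (real \<times> ('n::finite) torus) measure)"
  unfolding borel_prod[symmetric] by (intro sets_pair_measure_cong) auto

lemma borel_measurable_zx_iff: "f \<in> borel_measurable zx \<longleftrightarrow> f \<in> borel_measurable borel"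
  unfolding measurable_cong_sets[OF sets_zx refl] ..

lemma continuous_measurable_zx:
  "continuous_on UNIV f \<Longrightarrow> f \<in> borel_measurable (zx :: (real \<times> ('n::finite) torus) measure)"
  by (simp add: borel_measurable_zx_iff borel_measurable_continuous_onI)

lemma emeasure_zx_strip: "emeasure zx (strip R :: (real \<times> ('n::finite) torus) set) < \<infinity>"
proof -
  have "emeasure zx (strip R :: (real \<times> 'n torus) set) = emeasure lborel {-R..R} * emeasure torus_lebesgue (UNIV :: 'n torus set)"
    by (rule torus_lebesgue.emeasure_pair_measure_Times) auto
  also have "\<dots> < \<infinity>"
    using torus_lebesgue.emeasure_space_1[where 'n = 'n]
    by (cases "R \<ge> 0") (auto simp: emeasure_lborel_Icc_eq ennreal_mult_less_top)
  finally show ?thesis .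
qed

lemma strip_sets [measurable]: "strip R \<in> sets (zx :: (real \<times> ('n::finite) torus) measure)"
  by (intro pair_measureI) (auto simp: torus_lebesgue_def)

lemma integrable_strip_indicator:
  "integrable (zx :: (real \<times> ('n::finite) torus) measure) (\<lambda>p. B * indicator (strip R) p :: real)"
  using emeasure_zx_strip by (intro integrable_mult_right integrable_real_indicator) auto

lemma integrable_strip:
  assumes "f \<in> borel_measurable (zx :: (real \<times> ('n::finite) torus) measure)"
    and "\<And>p. \<bar>f p\<bar> \<le> B * indicator (strip R) p"
  shows "integrable zx (f :: _ \<Rightarrow> real)"
proof (rule Bochner_Integration.integrable_bound[OF integrable_strip_indicator[of B R] assms(1)])
  show "AE p in zx. norm (f p) \<le> norm (B * indicator (strip R) p)"
    using assms(2) order_trans[OF assms(2) abs_ge_self] by (intro AE_I2) simp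
qed

lemma compact_strip: "compact (strip R :: (real \<times> ('n::finite) torus) set)"
  by (intro compact_Times compact_Icc compact_UNIV_torus)

text \<open>The torus is compact, so confining \<open>t\<close> and \<open>z\<close> makes the whole
  domain compact.\<close>

lemma bounded_on_strip:
  fixes f :: "real \<Rightarrow> real \<Rightarrow> ('n::finite) torus \<Rightarrow> real"
  assumes "jointly_continuous_on A f" "compact K" "K \<subseteq> A"
  obtains B where "B \<ge> 0" "\<And>t z x. t \<in> K \<Longrightarrow> \<bar>z\<bar> \<le> R \<Longrightarrow> \<bar>f t z x\<bar> \<le> B"
proof -
  have "compact ((\<lambda>(t, z, x). f t z x) ` (K \<times> {-R..R} \<times> UNIV))"
    using assms unfolding jointly_continuous_on_def
    by (intro compact_continuous_image compact_Times compact_UNIV_torus compact_Icc)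
       (auto intro: continuous_on_subset)
  then have "bounded ((\<lambda>(t, z, x). f t z x) ` (K \<times> {-R..R} \<times> UNIV))"
    by (rule compact_imp_bounded)
  then obtain B where "B > 0" "\<forall>y\<in>(\<lambda>(t, z, x). f t z x) ` (K \<times> {-R..R} \<times> UNIV). norm y \<le> B"
    using bounded_pos by blast
  then have "\<bar>f t z x\<bar> \<le> B" if "t \<in> K" "\<bar>z\<bar> \<le> R" for t z x
    using that by (force simp: abs_le_iff)
  with \<open>B > 0\<close> show ?thesis
    by (intro that[of B]) auto
qed

lemma integrable_continuous_strip:
  fixes f :: "real \<times> ('n::finite) torus \<Rightarrow> real"
  assumes "continuous_on UNIV f" "\<And>z x. \<bar>z\<bar> > R \<Longrightarrow> f (z, x) = 0"
  shows "integrable zx f"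
proof -
  have "jointly_continuous_on UNIV (\<lambda>_::real. \<lambda>z x. f (z, x))"
    unfolding jointly_continuous_on_def split_def
    by (simp add: continuous_on_compose2[OF assms(1) continuous_on_snd[OF continuous_on_id]])
  then obtain B where "B \<ge> 0" "\<And>t z x. t \<in> {0 :: real} \<Longrightarrow> \<bar>z\<bar> \<le> R \<Longrightarrow> \<bar>f (z, x)\<bar> \<le> B"
    by (rule bounded_on_strip[where K = "{0}" and R = R]) auto
  then have B: "\<bar>f (z, x)\<bar> \<le> B" if "\<bar>z\<bar> \<le> R" for z x
    using that by simp
  have "\<bar>f p\<bar> \<le> B * indicator (strip R) p" for p
  proof (cases p)
    case (Pair z x)
    then show ?thesis
      using B[of z x] assms(2)[of z x] by (cases "\<bar>z\<bar> \<le> R") (auto simp: indicator_def)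
  qed
  then show ?thesis
    by (intro integrable_strip[of f B R] continuous_measurable_zx assms(1))
qed

text \<open>The mean value inequality bounds the difference quotients by the bound on
  \<open>G'\<close>, a multiple of the indicator of a strip of finite measure. Dominated convergence
  along sequences does the rest.\<close>

lemma leibniz_strip:
  fixes G G' :: "real \<Rightarrow> real \<times> ('n::finite) torus \<Rightarrow> real"
  assumes e: "e > 0"
    and der: "\<And>h p. \<bar>h - t0\<bar> < e \<Longrightarrow> ((\<lambda>h. G h p) has_real_derivative G' h p) (at h)"
    and bound: "\<And>h p. \<bar>h - t0\<bar> < e \<Longrightarrow> \<bar>G' h p\<bar> \<le> B * indicator (strip R) p"
    and int: "\<And>h. \<bar>h - t0\<bar> < e \<Longrightarrow> integrable zx (G h)"
    and meas: "G' t0 \<in> borel_measurable zx"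
  shows "((\<lambda>h. integral\<^sup>L zx (G h)) has_real_derivative integral\<^sup>L zx (G' t0)) (at t0)"
  unfolding has_field_derivative_iff tendsto_at_iff_sequentially comp_def
proof (intro allI impI)
  fix X :: "nat \<Rightarrow> real"
  assume X: "\<forall>i. X i \<in> UNIV - {t0}" "X \<longlonglongrightarrow> t0"
  then have "eventually (\<lambda>i. \<bar>X i - t0\<bar> < e) sequentially"
    using tendstoD[OF X(2) e] by (simp add: dist_real_def)
  then obtain N where N: "\<And>i. i \<ge> N \<Longrightarrow> \<bar>X i - t0\<bar> < e"
    unfolding eventually_sequentially by blast
  \<comment> \<open>Dropping the first \<open>N\<close> terms keeps the whole sequence in the
    neighbourhood of \<open>t0\<close>, so that the domination holds for every index.\<close>
  define Y where "Y i = X (i + N)" for i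
  have Y: "\<bar>Y i - t0\<bar> < e" "Y i \<noteq> t0" for i
    using N X(1) by (auto simp: Y_def)
  have Yl: "Y \<longlonglongrightarrow> t0"
    unfolding Y_def using X(2) by (rule LIMSEQ_ignore_initial_segment)
  have meas': "G h \<in> borel_measurable zx" if "\<bar>h - t0\<bar> < e" for h
    using int[OF that] by auto
  have quot: "\<bar>(G (Y i) p - G t0 p) / (Y i - t0)\<bar> \<le> B * indicator (strip R) p" for i p
  proof -
    have "\<bar>G (Y i) p - G t0 p\<bar> \<le> (B * indicator (strip R) p) * \<bar>Y i - t0\<bar>"
    proof -
      have "norm (G (Y i) p - G t0 p) \<le> (B * indicator (strip R) p) * norm (Y i - t0)"
      proof (rule field_differentiable_bound[where S = "ball t0 e" and f' = "\<lambda>h. G' h p"])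
        show "((\<lambda>h. G h p) has_field_derivative G' h p) (at h within ball t0 e)" if "h \<in> ball t0 e" for h
          using that by (auto intro!: has_field_derivative_at_within[OF der] simp: dist_real_def abs_minus_commute)
        show "norm (G' h p) \<le> B * indicator (strip R) p" if "h \<in> ball t0 e" for h
          using bound[of h p] that by (auto simp: dist_real_def abs_minus_commute)
      qed (use Y[of i] e in \<open>auto simp: dist_real_def abs_minus_commute\<close>)
      then show ?thesis by simp
    qed
    then show ?thesis
      using Y(2)[of i] by (simp add: field_simps)
  qed
  have "(\<lambda>i. LINT p|zx. (G (Y i) p - G t0 p) / (Y i - t0)) \<longlonglongrightarrow> integral\<^sup>L zx (G' t0)"
  proof (rule integral_dominated_convergence[where w = "\<lambda>p. B * indicator (strip R) p"])
    show "(\<lambda>p. (G (Y i) p - G t0 p) / (Y i - t0)) \<in> borel_measurable zx" for i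
      using meas'[of "Y i"] meas'[of t0] Y[of i] e by (intro borel_measurable_divide borel_measurable_diff) auto
    show "AE p in zx. (\<lambda>i. (G (Y i) p - G t0 p) / (Y i - t0)) \<longlonglongrightarrow> G' t0 p"
    proof (intro AE_I2)
      fix p
      have "((\<lambda>h. G h p) has_real_derivative G' t0 p) (at t0)"
        using der[of t0 p] e by simp
      then have "((\<lambda>h. (G h p - G t0 p) / (h - t0)) \<longlongrightarrow> G' t0 p) (at t0)"
        unfolding has_field_derivative_iff .
      then show "(\<lambda>i. (G (Y i) p - G t0 p) / (Y i - t0)) \<longlonglongrightarrow> G' t0 p"
        using Y(2) Yl unfolding tendsto_at_iff_sequentially comp_def by auto
    qed
    show "integrable zx (\<lambda>p :: real \<times> 'n torus. B * indicator (strip R) p)"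
      by (rule integrable_strip_indicator)
    show "AE p in zx. norm ((G (Y i) p - G t0 p) / (Y i - t0)) \<le> B * indicator (strip R) p" for i
      using quot[of i] by (intro AE_I2) simp
  qed (rule meas)
  moreover have "(LINT p|zx. (G (Y i) p - G t0 p) / (Y i - t0))
      = (integral\<^sup>L zx (G (Y i)) - integral\<^sup>L zx (G t0)) / (Y i - t0)" for i
  proof -
    have "integrable zx (G (Y i))" "integrable zx (G t0)"
      using int Y[of i] e by auto
    then show ?thesis
      by (simp only: Bochner_Integration.integral_diff integral_divide_zero)
  qed
  ultimately have "(\<lambda>i. (integral\<^sup>L zx (G (Y i)) - integral\<^sup>L zx (G t0)) / (Y i - t0)) \<longlonglongrightarrow> integral\<^sup>L zx (G' t0)"
    by (simp only:)
  then show "(\<lambda>i. (integral\<^sup>L zx (G (X i)) - integral\<^sup>L zx (G t0)) / (X i - t0)) \<longlonglongrightarrow> integral\<^sup>L zx (G' t0)"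
    unfolding Y_def
    by (rule LIMSEQ_offset[of "\<lambda>i. (integral\<^sup>L zx (G (X i)) - integral\<^sup>L zx (G t0)) / (X i - t0)" N])
qed

section \<open>Invariance under translations, and integrals of derivatives\<close>

lemma distr_zx_z_shift:
  "distr zx zx (\<lambda>(z, x). (z + h, x)) = (zx :: (real \<times> ('n::finite) torus) measure)"
proof -
  have "distr lborel lborel (\<lambda>z. z + h) = (lborel :: real measure)"
    using lborel_distr_plus[of h] by (simp add: add.commute cong: distr_cong)
  moreover have "distr torus_lebesgue torus_lebesgue (\<lambda>x. x) = (torus_lebesgue :: 'n torus measure)"
    by (rule distr_id)
  ultimately show ?thesis
    using pair_measure_distr[of "\<lambda>z. z + h" lborel lborel "\<lambda>x. x" torus_lebesgue "torus_lebesgue :: 'n torus measure"]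
    by (simp add: torus_lebesgue.sigma_finite_measure_axioms)
qed

lemma distr_zx_x_shift:
  "distr zx zx (\<lambda>(z, x). (z, torus_shift x (axis i h))) = (zx :: (real \<times> ('n::finite) torus) measure)"
proof -
  have "(\<lambda>x. torus_shift x (axis i h)) \<in> measurable torus_lebesgue (torus_lebesgue :: 'n torus measure)"
    by (simp add: measurable_cong_sets[OF sets_torus_lebesgue sets_torus_lebesgue])
  moreover have "distr lborel lborel (\<lambda>z. z) = (lborel :: real measure)"
    by (rule distr_id)
  ultimately show ?thesis
    using pair_measure_distr[of "\<lambda>z. z" "lborel :: real measure" lborel "\<lambda>x. torus_shift x (axis i h)" torus_lebesgue "torus_lebesgue :: 'n torus measure"]
    by (simp add: torus_lebesgue.sigma_finite_measure_axioms distr_torus_lebesgue_shift del: sets_torus_lebesgue)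
qed

lemma continuous_bounded_strip:
  fixes f :: "real \<times> ('n::finite) torus \<Rightarrow> real"
  assumes "continuous_on UNIV f" 
  obtains B where "B \<ge> 0" "\<And>z x. \<bar>z\<bar> \<le> R \<Longrightarrow> \<bar>f (z, x)\<bar> \<le> B"
proof -
  have "jointly_continuous_on UNIV (\<lambda>_::real. \<lambda>z x. f (z, x))"
    unfolding jointly_continuous_on_def split_def
    by (simp add: continuous_on_compose2[OF assms(1) continuous_on_snd[OF continuous_on_id]])
  then obtain B where "B \<ge> 0" "\<And>t z x. t \<in> {0 :: real} \<Longrightarrow> \<bar>z\<bar> \<le> R \<Longrightarrow> \<bar>f (z, x)\<bar> \<le> B"
    by (rule bounded_on_strip[where K = "{0}" and R = R]) auto
  then show ?thesis
    using that[of B] by simp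
qed

text \<open>By translation invariance the integral of \<open>g (z + h, x)\<close> does not depend on
  \<open>h\<close>; differentiating under the integral at \<open>h = 0\<close> gives the
  claim.\<close>

lemma integral_partial_z_eq_0:
  fixes g g' :: "real \<times> ('n::finite) torus \<Rightarrow> real"
  assumes g: "continuous_on UNIV g" and g': "continuous_on UNIV g'"
    and der: "\<And>z x. ((\<lambda>z. g (z, x)) has_real_derivative g' (z, x)) (at z)"
    and supp: "\<And>z x. \<bar>z\<bar> > R \<Longrightarrow> g (z, x) = 0"
  shows "integral\<^sup>L zx g' = 0"
proof -
  have supp': "g' (z, x) = 0" if "\<bar>z\<bar> > R" for z x
  proof -
    have "((\<lambda>z. g (z, x)) has_real_derivative 0) (at z)"
    proof (rule has_field_derivative_transform_within_open[OF DERIV_const[of 0]])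
      show "open {z. \<bar>z\<bar> > R}" by (intro open_Collect_less continuous_intros)
    qed (use that supp in auto)
    then show ?thesis using der DERIV_unique by blast
  qed
  obtain B where B: "B \<ge> 0" "\<And>z x. \<bar>z\<bar> \<le> R \<Longrightarrow> \<bar>g' (z, x)\<bar> \<le> B"
    using continuous_bounded_strip[OF g'] by blast
  define G where "G h = (\<lambda>(z, x). g (z + h, x))" for h
  define G' where "G' h = (\<lambda>(z, x). g' (z + h, x))" for h
  have ig: "integrable zx g"
    by (rule integrable_continuous_strip[OF g supp])
  have cst: "integral\<^sup>L zx (G h) = integral\<^sup>L zx g" for h
  proof -
    have "integral\<^sup>L zx g = integral\<^sup>L (distr zx zx (\<lambda>(z, x). (z + h, x))) g"
      by (simp add: distr_zx_z_shift)
    also have "\<dots> = integral\<^sup>L zx (\<lambda>p. g ((\<lambda>(z, x). (z + h, x)) p))"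
      using ig by (intro integral_distr) auto
    finally show ?thesis by (simp add: G_def split_def)
  qed
  have contG: "continuous_on UNIV (G h)" "continuous_on UNIV (G' h)" for h
    unfolding G_def G'_def split_def
    by (intro continuous_on_compose2[OF g] continuous_on_compose2[OF g'] continuous_intros; simp)+
  have "((\<lambda>h. integral\<^sup>L zx (G h)) has_real_derivative integral\<^sup>L zx (G' 0)) (at 0)"
  \<comment> \<open>Shifts with \<open>\<bar>h\<bar> < 1\<close> move the support by less than 1,
    whence the radius \<open>R + 1\<close>.\<close>
  proof (rule leibniz_strip[where e = 1 and B = B and R = "R + 1"])
    fix h :: real and p :: "real \<times> 'n torus" assume h: "\<bar>h - 0\<bar> < 1"
    obtain z x where p: "p = (z, x)" by force
    show "((\<lambda>h. G h p) has_real_derivative G' h p) (at h)"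
      unfolding G_def G'_def p using der[of x "z + h"] by (simp add: DERIV_shift add.commute)
    show "\<bar>G' h p\<bar> \<le> B * indicator (strip (R + 1)) p"
      unfolding G'_def p using B(2)[of "z + h" x] supp'[of "z + h" x] h B(1)
      by (cases "\<bar>z + h\<bar> \<le> R"; cases "\<bar>z\<bar> \<le> R + 1") (auto simp: indicator_def)
    show "integrable zx (G h)"
      by (rule integrable_continuous_strip[OF contG(1), of "R + 1"]) (use h supp in \<open>auto simp: G_def\<close>)
  qed (use contG in \<open>auto intro: continuous_measurable_zx\<close>)
  then have "integral\<^sup>L zx (G' 0) = 0"
    unfolding cst by (simp add: DERIV_const DERIV_unique)
  then show ?thesis by (simp add: G'_def)
qed

text \<open>The relational form of \<open>tpartial\<close>: the value of the derivative is an
  argument, so that rules of differentiation can be chained.\<close>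

definition has_tpartial :: "'n \<Rightarrow> (('n::finite) torus \<Rightarrow> real) \<Rightarrow> real \<Rightarrow> 'n torus \<Rightarrow> bool" where
  "has_tpartial i f D x \<longleftrightarrow> ((\<lambda>h. f (torus_shift x (axis i h))) has_real_derivative D) (at 0)"

text \<open>Shifts along one axis add up, so derivatives at the base points give the derivative
  along the whole line.\<close>

lemma has_tpartial_at:
  assumes "\<And>x. has_tpartial i f (f' x) x"
  shows "((\<lambda>h. f (torus_shift x (axis i h))) has_real_derivative f' (torus_shift x (axis i h))) (at h)"
proof -
  have "((\<lambda>k. f (torus_shift (torus_shift x (axis i h)) (axis i k))) has_real_derivative f' (torus_shift x (axis i h))) (at 0)"
    using assms[of "torus_shift x (axis i h)"] by (simp add: has_tpartial_def)
  then have "((\<lambda>k. f (torus_shift x (axis i (k + h)))) has_real_derivative f' (torus_shift x (axis i h))) (at 0)"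
    by (simp add: torus_shift_shift axis_add add.commute)
  then show ?thesis
    using DERIV_shift[of "\<lambda>h. f (torus_shift x (axis i h))" _ 0 h] by simp
qed

text \<open>Shifts of the torus along the axis \<open>i\<close> take the place of the translations
  in \<open>z\<close>; periodicity leaves no boundary term.\<close>

lemma integral_partial_x_eq_0:
  fixes g g' :: "real \<times> ('n::finite) torus \<Rightarrow> real"
  assumes g: "continuous_on UNIV g" and g': "continuous_on UNIV g'"
    and der: "\<And>z x. has_tpartial i (\<lambda>x. g (z, x)) (g' (z, x)) x"
    and supp: "\<And>z x. \<bar>z\<bar> > R \<Longrightarrow> g (z, x) = 0"
  shows "integral\<^sup>L zx g' = 0"
proof -
  have supp': "g' (z, x) = 0" if "\<bar>z\<bar> > R" for z x
  proof -
    have "((\<lambda>_. 0) has_real_derivative g' (z, x)) (at 0)"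
      using der[of z x] supp[OF that] by (simp add: has_tpartial_def)
    then show ?thesis
      using DERIV_unique[OF DERIV_const] by metis
  qed
  obtain B where B: "B \<ge> 0" "\<And>z x. \<bar>z\<bar> \<le> R \<Longrightarrow> \<bar>g' (z, x)\<bar> \<le> B"
    using continuous_bounded_strip[OF g'] by blast
  define G where "G h = (\<lambda>(z, x). g (z, torus_shift x (axis i h)))" for h
  define G' where "G' h = (\<lambda>(z, x). g' (z, torus_shift x (axis i h)))" for h
  have ig: "integrable zx g"
    by (rule integrable_continuous_strip[OF g supp])
  have [measurable]: "(\<lambda>(z, x). (z, torus_shift x (axis i h))) \<in> measurable zx (zx :: (real \<times> 'n torus) measure)" for h
    unfolding split_def
    by (intro measurable_Pair measurable_fst measurable_compose[OF measurable_snd]) simp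
  have cst: "integral\<^sup>L zx (G h) = integral\<^sup>L zx g" for h
  proof -
    have "integral\<^sup>L zx g = integral\<^sup>L (distr zx zx (\<lambda>(z, x). (z, torus_shift x (axis i h)))) g"
      by (simp add: distr_zx_x_shift)
    also have "\<dots> = integral\<^sup>L zx (\<lambda>p. g ((\<lambda>(z, x). (z, torus_shift x (axis i h))) p))"
      using ig by (intro integral_distr) auto
    finally show ?thesis by (simp add: G_def split_def)
  qed
  have contG: "continuous_on UNIV (G h)" "continuous_on UNIV (G' h)" for h
    unfolding G_def G'_def split_def
    by (intro continuous_on_compose2[OF g] continuous_on_compose2[OF g'] continuous_on_Pair
          continuous_on_compose2[OF continuous_on_torus_shift] continuous_intros; simp)+
  have "((\<lambda>h. integral\<^sup>L zx (G h)) has_real_derivative integral\<^sup>L zx (G' 0)) (at 0)"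
  proof (rule leibniz_strip[where e = 1 and B = B and R = R])
    fix h :: real and p :: "real \<times> 'n torus" assume h: "\<bar>h - 0\<bar> < 1"
    obtain z x where p: "p = (z, x)" by force
    show "((\<lambda>h. G h p) has_real_derivative G' h p) (at h)"
      unfolding G_def G'_def p using has_tpartial_at[of i "\<lambda>x. g (z, x)", OF der] by simp
    show "\<bar>G' h p\<bar> \<le> B * indicator (strip R) p"
      unfolding G'_def p using B(2)[of z "torus_shift x (axis i h)"] supp'[of z "torus_shift x (axis i h)"] B(1)
      by (cases "\<bar>z\<bar> \<le> R") (auto simp: indicator_def)
    show "integrable zx (G h)"
      by (rule integrable_continuous_strip[OF contG(1), of R]) (use supp in \<open>auto simp: G_def\<close>)
  qed (use contG in \<open>auto intro: continuous_measurable_zx\<close>)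
  then have "integral\<^sup>L zx (G' 0) = 0"
    unfolding cst by (simp add: DERIV_const DERIV_unique)
  then show ?thesis by (simp add: G'_def)
qed

section \<open>Rules for joint continuity and for partial derivatives\<close>

lemma jc_add: "jointly_continuous_on A f \<Longrightarrow> jointly_continuous_on A g \<Longrightarrow>
    jointly_continuous_on A (\<lambda>t z x. f t z x + g t z x :: real)"
  unfolding jointly_continuous_on_def split_def by (intro continuous_on_add)

lemma jc_diff: "jointly_continuous_on A f \<Longrightarrow> jointly_continuous_on A g \<Longrightarrow>
    jointly_continuous_on A (\<lambda>t z x. f t z x - g t z x :: real)"
  unfolding jointly_continuous_on_def split_def by (intro continuous_on_diff)

lemma jc_minus: "jointly_continuous_on A f \<Longrightarrow> jointly_continuous_on A (\<lambda>t z x. - f t z x :: real)"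
  unfolding jointly_continuous_on_def split_def by (intro continuous_on_minus)

lemma jc_mult: "jointly_continuous_on A f \<Longrightarrow> jointly_continuous_on A g \<Longrightarrow>
    jointly_continuous_on A (\<lambda>t z x. f t z x * g t z x :: real)"
  unfolding jointly_continuous_on_def split_def by (intro continuous_on_mult)

lemma jc_const: "jointly_continuous_on A (\<lambda>t z x. c)"
  unfolding jointly_continuous_on_def split_def by (intro continuous_on_const)

lemma jc_sum: "(\<And>i. i \<in> I \<Longrightarrow> jointly_continuous_on A (f i)) \<Longrightarrow>
    jointly_continuous_on A (\<lambda>t z x. \<Sum>i\<in>I. f i t z x :: real)"
  unfolding jointly_continuous_on_def split_def by (intro continuous_on_sum)

lemma jc_comp: "continuous_on UNIV \<phi> \<Longrightarrow> jointly_continuous_on A f \<Longrightarrow>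
    jointly_continuous_on A (\<lambda>t z x. \<phi> (f t z x))"
  unfolding jointly_continuous_on_def split_def by (rule continuous_on_compose2[where t = UNIV]) auto

lemma jc_z: "continuous_on UNIV \<phi> \<Longrightarrow> jointly_continuous_on A (\<lambda>t z x. \<phi> z)"
  unfolding jointly_continuous_on_def split_def
  by (rule continuous_on_compose2[where t = UNIV]) (auto intro!: continuous_intros)

lemma jc_tz: "continuous_on (A \<times> UNIV) (\<lambda>(t, z). \<phi> t z) \<Longrightarrow> jointly_continuous_on A (\<lambda>t z x. \<phi> t z)"
  unfolding jointly_continuous_on_def split_def
  by (rule continuous_on_compose2[where t = "A \<times> UNIV" and g = "\<lambda>p. \<phi> (fst p) (snd p)" and
        f = "\<lambda>p. (fst p, fst (snd p))", simplified]) (auto intro!: continuous_intros)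

lemma jc_subset: "jointly_continuous_on A f \<Longrightarrow> B \<subseteq> A \<Longrightarrow> jointly_continuous_on B f"
  unfolding jointly_continuous_on_def by (rule continuous_on_subset) auto

lemma jc_reparam:
  assumes "jointly_continuous_on A f" "continuous_on B \<theta>" "\<theta> ` B \<subseteq> A"
  shows "jointly_continuous_on B (\<lambda>t z x. f (\<theta> t) z x)"
proof -
  have F: "continuous_on (A \<times> UNIV \<times> UNIV) (\<lambda>(t, z, x). f t z x)"
    using assms(1) by (simp add: jointly_continuous_on_def)
  have "continuous_on (B \<times> UNIV \<times> UNIV) (\<lambda>p. (\<theta> (fst p), snd p))"
    by (intro continuous_on_Pair continuous_on_compose2[OF assms(2)] continuous_intros) auto
  from continuous_on_compose2[OF F this] assms(3) show ?thesis
    unfolding jointly_continuous_on_def split_def by force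
qed

lemma jc_vec_nth: "jointly_continuous_on A b \<Longrightarrow> jointly_continuous_on A (\<lambda>t z x. b t z x $ i)"
  unfolding jointly_continuous_on_def split_def by (intro continuous_on_component)

lemmas jc_intros = jc_add jc_diff jc_minus jc_mult jc_const jc_sum

lemma jc_slice:
  assumes "jointly_continuous_on A f" "t \<in> A"
  shows "continuous_on UNIV (\<lambda>(z, x). f t z x)"
proof -
  have "continuous_on UNIV (\<lambda>p. (t, p))"
    by (intro continuous_intros)
  then have "continuous_on UNIV (\<lambda>p. (\<lambda>(t, z, x). f t z x) (t, p))"
    using assms(2) by (intro continuous_on_compose2[OF assms(1)[unfolded jointly_continuous_on_def]]) auto
  then show ?thesis by (simp add: split_def)
qed

lemma jc_slice_t:
  assumes "jointly_continuous_on A f"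
  shows "continuous_on A (\<lambda>t. f t z x)"
proof -
  have "continuous_on A (\<lambda>t. (t, z, x))"
    by (intro continuous_intros)
  then have "continuous_on A (\<lambda>t. (\<lambda>(t, z, x). f t z x) (t, z, x))"
    by (intro continuous_on_compose2[OF assms(1)[unfolded jointly_continuous_on_def]]) auto
  then show ?thesis by (simp add: split_def)
qed

lemma has_tpartial_mult:
  "has_tpartial i f f' x \<Longrightarrow> has_tpartial i g g' x \<Longrightarrow> has_tpartial i (\<lambda>x. f x * g x) (f' * g x + f x * g') x"
  unfolding has_tpartial_def by (drule (1) DERIV_mult) (simp add: mult.commute)

lemma has_tpartial_add:
  "has_tpartial i f f' x \<Longrightarrow> has_tpartial i g g' x \<Longrightarrow> has_tpartial i (\<lambda>x. f x + g x) (f' + g') x"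
  unfolding has_tpartial_def by (rule DERIV_add)

lemma has_tpartial_diff:
  "has_tpartial i f f' x \<Longrightarrow> has_tpartial i g g' x \<Longrightarrow> has_tpartial i (\<lambda>x. f x - g x) (f' - g') x"
  unfolding has_tpartial_def by (rule DERIV_diff)

lemma has_tpartial_const: "has_tpartial i (\<lambda>x. c) 0 x"
  unfolding has_tpartial_def by (rule DERIV_const)

lemma has_tpartial_cmult:
  "has_tpartial i f f' x \<Longrightarrow> has_tpartial i (\<lambda>x. c * f x) (c * f') x"
  unfolding has_tpartial_def by (rule DERIV_cmult)

lemma has_tpartial_chain:
  "(\<phi> has_real_derivative d) (at (f x)) \<Longrightarrow> has_tpartial i f f' x \<Longrightarrow> has_tpartial i (\<lambda>x. \<phi> (f x)) (d * f') x"
  unfolding has_tpartial_def using DERIV_chain2[of \<phi> d "\<lambda>h. f (torus_shift x (axis i h))" 0 f' UNIV] by simp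

lemma has_tpartial_cong: "has_tpartial i f d x \<Longrightarrow> d = d' \<Longrightarrow> has_tpartial i f d' x"
  by simp

text \<open>The derivatives are arguments, so that products with weights, differences and time
  reversals carry explicit derivatives instead of \<open>deriv\<close> terms.\<close>

definition C12_with where
  "C12_with A f ft fz fzz fi fii \<longleftrightarrow>
     (\<forall>t\<in>A. \<forall>z x. ((\<lambda>t. f t z x) has_real_derivative ft t z x) (at t)
        \<and> ((\<lambda>z. f t z x) has_real_derivative fz t z x) (at z)
        \<and> ((\<lambda>z. fz t z x) has_real_derivative fzz t z x) (at z)
        \<and> (\<forall>i. has_tpartial i (f t z) (fi i t z x) x \<and> has_tpartial i (fi i t z) (fii i t z x) x))
     \<and> jointly_continuous_on A f \<and> jointly_continuous_on A ft
     \<and> jointly_continuous_on A fz \<and> jointly_continuous_on A fzz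
     \<and> (\<forall>i. jointly_continuous_on A (fi i) \<and> jointly_continuous_on A (fii i))"

lemma C12_withD:
  assumes "C12_with A f ft fz fzz fi fii"
  shows "t \<in> A \<Longrightarrow> ((\<lambda>t. f t z x) has_real_derivative ft t z x) (at t)"
    "t \<in> A \<Longrightarrow> ((\<lambda>z. f t z x) has_real_derivative fz t z x) (at z)"
    "t \<in> A \<Longrightarrow> ((\<lambda>z. fz t z x) has_real_derivative fzz t z x) (at z)"
    "t \<in> A \<Longrightarrow> has_tpartial i (f t z) (fi i t z x) x"
    "t \<in> A \<Longrightarrow> has_tpartial i (fi i t z) (fii i t z x) x"
    "jointly_continuous_on A f" "jointly_continuous_on A ft"
    "jointly_continuous_on A fz" "jointly_continuous_on A fzz"
    "jointly_continuous_on A (fi i)" "jointly_continuous_on A (fii i)"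
  using assms unfolding C12_with_def by auto

text \<open>A balance law: \<open>g\<close> changes by the divergence of the flux
  \<open>(fz, fi)\<close> up to the source \<open>D\<close>. The divergence integrates to zero,
  since everything has bounded support in \<open>z\<close> and is periodic in \<open>x\<close>. The
  weak form and Kato's form of the forward equation are both instances with suitable fluxes.\<close>

lemma derivative_integral_flux:
  fixes g :: "real \<Rightarrow> real \<Rightarrow> ('n::finite) torus \<Rightarrow> real"
  assumes A: "open A" "t0 \<in> A"
    and g: "jointly_continuous_on A g" "jointly_continuous_on A gt"
    and g_t: "\<And>t z x. t \<in> A \<Longrightarrow> ((\<lambda>t. g t z x) has_real_derivative gt t z x) (at t)"
    and g_supp: "\<And>t z x. \<bar>z\<bar> > R \<Longrightarrow> g t z x = 0"
    and fz: "jointly_continuous_on A fz" "jointly_continuous_on A fz'"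
    and fz_z: "\<And>z x. ((\<lambda>z. fz t0 z x) has_real_derivative fz' t0 z x) (at z)"
    and fz_supp: "\<And>t z x. \<bar>z\<bar> > R \<Longrightarrow> fz t z x = 0"
    and fi: "\<And>i. jointly_continuous_on A (fi i)" "\<And>i. jointly_continuous_on A (fi' i)"
    and fi_i: "\<And>i z x. has_tpartial i (fi i t0 z) (fi' i t0 z x) x"
    and fi_supp: "\<And>i t z x. \<bar>z\<bar> > R \<Longrightarrow> fi i t z x = 0"
    and eq: "\<And>z x. gt t0 z x + fz' t0 z x + (\<Sum>i\<in>UNIV. fi' i t0 z x) = D z x"
  shows "((\<lambda>t. \<integral>(z, x). g t z x \<partial>zx) has_real_derivative (\<integral>(z, x). D z x \<partial>zx)) (at t0)"
    and "integrable zx (\<lambda>(z, x). D z x)"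
proof -
  obtain e0 where e0: "e0 > 0" "cball t0 e0 \<subseteq> A"
    using A open_contains_cball by blast
  obtain B where B: "B \<ge> 0" "\<And>t z x. t \<in> cball t0 e0 \<Longrightarrow> \<bar>z\<bar> \<le> R \<Longrightarrow> \<bar>gt t z x\<bar> \<le> B"
    by (rule bounded_on_strip[OF g(2) compact_cball e0(2), where R = R]) blast
  have gt_supp: "gt t z x = 0" if "\<bar>z\<bar> > R" "t \<in> A" for t z x
  proof -
    have "((\<lambda>_. 0) has_real_derivative gt t z x) (at t)"
      using g_t[of t z x] g_supp[OF that(1)] that(2) by simp
    then show ?thesis using DERIV_unique[OF DERIV_const] by metis
  qed
  have tA: "t \<in> cball t0 e0" "t \<in> A" if "\<bar>t - t0\<bar> < e0" for t
    using that e0(2) by (auto simp: dist_real_def abs_minus_commute)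
  have fz'_supp: "fz' t0 z x = 0" if "\<bar>z\<bar> > R" for z x
  proof -
    have "((\<lambda>z. fz t0 z x) has_real_derivative 0) (at z)"
    proof (rule has_field_derivative_transform_within_open[OF DERIV_const[of 0]])
      show "open {z. \<bar>z\<bar> > R}" by (intro open_Collect_less continuous_intros)
    qed (use that fz_supp in auto)
    then show ?thesis using fz_z DERIV_unique by blast
  qed
  have fi'_supp: "fi' i t0 z x = 0" if "\<bar>z\<bar> > R" for i z x
  proof -
    have "((\<lambda>_. 0) has_real_derivative fi' i t0 z x) (at 0)"
      using fi_i[of i z x] fi_supp[OF that] by (simp add: has_tpartial_def)
    then show ?thesis using DERIV_unique[OF DERIV_const] by metis
  qed
  define G where "G t = (\<lambda>(z, x). g t z x)" for t
  define G' where "G' t = (\<lambda>(z, x). gt t z x)" for t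
  have 1: "((\<lambda>t. integral\<^sup>L zx (G t)) has_real_derivative integral\<^sup>L zx (G' t0)) (at t0)"
  proof (rule leibniz_strip[where e = e0 and B = B and R = R])
    fix h :: real and p :: "real \<times> 'n torus" assume h: "\<bar>h - t0\<bar> < e0"
    obtain z x where p: "p = (z, x)" by force
    show "((\<lambda>h. G h p) has_real_derivative G' h p) (at h)"
      unfolding G_def G'_def p using g_t[OF tA(2)[OF h]] by simp
    show "\<bar>G' h p\<bar> \<le> B * indicator (strip R) p"
      unfolding G'_def p using B(2)[OF tA(1)[OF h], of z x] gt_supp[OF _ tA(2)[OF h], of z x] B(1)
      by (cases "\<bar>z\<bar> \<le> R") (auto simp: indicator_def)
    show "integrable zx (G h)"
      unfolding G_def by (rule integrable_continuous_strip[OF jc_slice[OF g(1) tA(2)[OF h]]])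
        (use g_supp in auto)
  next
    show "G' t0 \<in> borel_measurable zx"
      unfolding G'_def by (intro continuous_measurable_zx jc_slice[OF g(2)] A)
  qed (use e0 in auto)
  have ig: "integrable zx (\<lambda>(z, x). gt t0 z x)"
    by (rule integrable_continuous_strip[OF jc_slice[OF g(2) A(2)]]) (use gt_supp A in auto)
  have iz: "integrable zx (\<lambda>(z, x). fz' t0 z x)"
    by (rule integrable_continuous_strip[OF jc_slice[OF fz(2) A(2)]]) (use fz'_supp in auto)
  have ii: "integrable zx (\<lambda>(z, x). fi' i t0 z x)" for i
    by (rule integrable_continuous_strip[OF jc_slice[OF fi(2) A(2)]]) (use fi'_supp in auto)
  have 2: "(\<integral>(z, x). fz' t0 z x \<partial>zx) = 0"
    by (rule integral_partial_z_eq_0[OF jc_slice[OF fz(1) A(2)] jc_slice[OF fz(2) A(2)], where R = R])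
       (use fz_z fz_supp in auto)
  have 3: "(\<integral>(z, x). fi' i t0 z x \<partial>zx) = 0" for i
    by (rule integral_partial_x_eq_0[OF jc_slice[OF fi(1) A(2)] jc_slice[OF fi(2) A(2)], where R = R and i = i])
       (use fi_i fi_supp in auto)
  have D: "(\<lambda>(z, x). D z x) = (\<lambda>p. (\<lambda>(z, x). gt t0 z x) p + (\<lambda>(z, x). fz' t0 z x) p + (\<Sum>i\<in>UNIV. (\<lambda>(z, x). fi' i t0 z x) p))"
    by (auto simp: fun_eq_iff eq)
  show "integrable zx (\<lambda>(z, x). D z x)"
    unfolding D by (intro Bochner_Integration.integrable_add Bochner_Integration.integrable_sum ig iz ii)
  have isum: "integrable zx (\<lambda>p. \<Sum>i\<in>UNIV. (\<lambda>(z, x). fi' i t0 z x) p)"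
    by (intro Bochner_Integration.integrable_sum ii)
  have "(\<integral>(z, x). D z x \<partial>zx) = (\<integral>(z, x). gt t0 z x \<partial>zx) + (\<integral>(z, x). fz' t0 z x \<partial>zx)
      + (\<integral>p. (\<Sum>i\<in>UNIV. (\<lambda>(z, x). fi' i t0 z x) p) \<partial>zx)"
    unfolding D
    using Bochner_Integration.integral_add[OF Bochner_Integration.integrable_add[OF ig iz] isum]
      Bochner_Integration.integral_add[OF ig iz]
    by simp
  also have "(\<integral>p. (\<Sum>i\<in>UNIV. (\<lambda>(z, x). fi' i t0 z x) p) \<partial>zx) = (\<Sum>i\<in>UNIV. \<integral>(z, x). fi' i t0 z x \<partial>zx)"
    by (intro Bochner_Integration.integral_sum ii)
  finally have "(\<integral>(z, x). D z x \<partial>zx) = integral\<^sup>L zx (G' t0)"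
    by (simp add: 2 3 G'_def)
  then show "((\<lambda>t. \<integral>(z, x). g t z x \<partial>zx) has_real_derivative (\<integral>(z, x). D z x \<partial>zx)) (at t0)"
    using 1 by (simp add: G_def)
qed

text \<open>The third power is the lowest integer power of the positive part that is twice
  continuously differentiable, and it keeps the derivatives explicit, of sizes \<open>1 / R\<close>
  and \<open>1 / R\<^sup>2\<close>.\<close>

definition cutoff :: "real \<Rightarrow> real \<Rightarrow> real" where
  "cutoff R z = (max 0 (1 - (z / R)\<^sup>2)) ^ 3"

definition cutoff' :: "real \<Rightarrow> real \<Rightarrow> real" where
  "cutoff' R z = - 6 * z / R\<^sup>2 * (max 0 (1 - (z / R)\<^sup>2)) ^ 2"

definition cutoff'' :: "real \<Rightarrow> real \<Rightarrow> real" where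
  "cutoff'' R z = - 6 / R\<^sup>2 * (max 0 (1 - (z / R)\<^sup>2)) ^ 2 + 24 * z\<^sup>2 / R ^ 4 * max 0 (1 - (z / R)\<^sup>2)"

lemma DERIV_max_power:
  assumes n: "n \<ge> 2"
  shows "((\<lambda>v. (max 0 v) ^ n) has_real_derivative real n * (max 0 v) ^ (n - 1)) (at v)"
proof -
  consider "v > 0" | "v < 0" | "v = 0" by linarith
  then show ?thesis
  proof cases
    case 1
    have "((\<lambda>v. v ^ n) has_real_derivative real n * v ^ (n - 1)) (at v)"
      using DERIV_pow[of n v] by simp
    then have "((\<lambda>v. (max 0 v) ^ n) has_real_derivative real n * v ^ (n - 1)) (at v)"
      by (rule has_field_derivative_transform_within_open[where S = "{0<..}"]) (use 1 in auto)
    then show ?thesis using 1 by (simp add: max_def)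
  next
    case 2
    have "((\<lambda>v. (max 0 v) ^ n) has_real_derivative 0) (at v)"
      by (rule has_field_derivative_transform_within_open[OF DERIV_const[of 0], where S = "{..<0}"]) (use 2 n in auto)
    moreover have "max 0 v ^ (n - 1) = 0" using 2 n by (simp add: max_def zero_power)
    ultimately show ?thesis by (metis mult_zero_right)
  next
    case 3
    have "((\<lambda>h. ((max 0 h) ^ n - (max 0 0) ^ n) / (h - 0)) \<longlongrightarrow> (0 :: real)) (at 0)"
    proof (rule Lim_null_comparison)
      have "norm (((max 0 h) ^ n - (max 0 0) ^ n) / (h - 0)) \<le> \<bar>h\<bar> ^ (n - 1)" if "h \<noteq> 0" for h :: real
      proof -
        obtain m where m: "n = Suc m" "m \<ge> 1" using n by (cases n) auto
        show ?thesis using that m by (cases "h > 0") (auto simp: max_def)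
      qed
      then show "eventually (\<lambda>h :: real. norm (((max 0 h) ^ n - (max 0 0) ^ n) / (h - 0)) \<le> \<bar>h\<bar> ^ (n - 1)) (at 0)"
        unfolding eventually_at_filter by (intro always_eventually) simp
      have "((\<lambda>h :: real. \<bar>h\<bar> ^ (n - 1)) \<longlongrightarrow> \<bar>0\<bar> ^ (n - 1)) (at 0)"
        by (intro tendsto_intros)
      moreover have "\<bar>0 :: real\<bar> ^ (n - 1) = 0"
        using n by (simp add: zero_power)
      ultimately show "((\<lambda>h :: real. \<bar>h\<bar> ^ (n - 1)) \<longlongrightarrow> 0) (at 0)"
        by (simp only:)
    qed
    then have "((\<lambda>v. (max 0 v) ^ n) has_real_derivative 0) (at 0)"
      unfolding has_field_derivative_iff .
    moreover have "real n * (max 0 v) ^ (n - 1) = 0"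
      using 3 n by (simp add: zero_power)
    ultimately show ?thesis using 3 by (simp only:)
  qed
qed

lemma cutoff_props:
  assumes "R > 0"
  shows DERIV_cutoff: "(cutoff R has_real_derivative cutoff' R z) (at z)"
    and DERIV_cutoff': "(cutoff' R has_real_derivative cutoff'' R z) (at z)"
    and cutoff_nonneg: "0 \<le> cutoff R z" and cutoff_le_1: "cutoff R z \<le> 1"
    and cutoff_supp: "\<bar>z\<bar> > R \<Longrightarrow> cutoff R z = 0"
    and cutoff'_supp: "\<bar>z\<bar> > R \<Longrightarrow> cutoff' R z = 0"
    and cutoff''_supp: "\<bar>z\<bar> > R \<Longrightarrow> cutoff'' R z = 0"
    and cutoff'_bound: "\<bar>cutoff' R z\<bar> \<le> 6 / R"
    and cutoff''_bound: "\<bar>cutoff'' R z\<bar> \<le> 30 / R\<^sup>2"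
    and cutoff_tail: "1 - cutoff R z \<le> 3 * z\<^sup>2 / R\<^sup>2"
proof -
  have d0: "((\<lambda>z. 1 - (z / R)\<^sup>2) has_real_derivative - (2 * z / R\<^sup>2)) (at z)"
    using assms by (auto intro!: derivative_eq_intros simp: power2_eq_square)
  have d3: "((\<lambda>z. (max 0 (1 - (z / R)\<^sup>2)) ^ 3) has_real_derivative 3 * (max 0 (1 - (z / R)\<^sup>2)) ^ 2 * - (2 * z / R\<^sup>2)) (at z)"
    using DERIV_chain2[OF DERIV_max_power[of 3] d0] by simp
  have d2: "((\<lambda>z. (max 0 (1 - (z / R)\<^sup>2)) ^ 2) has_real_derivative 2 * (max 0 (1 - (z / R)\<^sup>2)) * - (2 * z / R\<^sup>2)) (at z)"
    using DERIV_chain2[OF DERIV_max_power[of 2] d0] by simp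
  have "cutoff R = (\<lambda>z. (max 0 (1 - (z / R)\<^sup>2)) ^ 3)"
    by (simp add: cutoff_def fun_eq_iff)
  then show "(cutoff R has_real_derivative cutoff' R z) (at z)"
    using d3 by (simp add: cutoff'_def algebra_simps)
  have e: "cutoff' R = (\<lambda>z. (- 6 / R\<^sup>2) * (z * (max 0 (1 - (z / R)\<^sup>2)) ^ 2))"
    by (simp add: cutoff'_def fun_eq_iff)
  have "((\<lambda>z. z * (max 0 (1 - (z / R)\<^sup>2)) ^ 2) has_real_derivative
      1 * (max 0 (1 - (z / R)\<^sup>2)) ^ 2 + (2 * (max 0 (1 - (z / R)\<^sup>2)) * - (2 * z / R\<^sup>2)) * z) (at z)"
    by (rule DERIV_mult[OF DERIV_ident d2])
  from DERIV_cmult[OF this, of "- 6 / R\<^sup>2"]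
  show "(cutoff' R has_real_derivative cutoff'' R z) (at z)"
    unfolding e by (rule DERIV_cong) (use assms in \<open>simp add: cutoff''_def field_simps power2_eq_square power4_eq_xxxx\<close>)
  define m where "m = max 0 (1 - (z / R)\<^sup>2)"
  have m: "0 \<le> m" "m \<le> 1" "1 - (z / R)\<^sup>2 \<le> m"
    by (auto simp: m_def)
  have zR: "m = 0" if "\<bar>z\<bar> > R"
  proof -
    have "(\<bar>z\<bar> / R)\<^sup>2 \<ge> 1\<^sup>2" using that assms by (intro power_mono) auto
    then show ?thesis by (simp add: m_def power_divide)
  qed
  show "0 \<le> cutoff R z" "cutoff R z \<le> 1"
    using m by (auto simp: cutoff_def m_def[symmetric] power_le_one)
  show "cutoff R z = 0" "cutoff' R z = 0" "cutoff'' R z = 0" if "\<bar>z\<bar> > R"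
    using zR[OF that] by (auto simp: cutoff_def cutoff'_def cutoff''_def m_def[symmetric])
  show "\<bar>cutoff' R z\<bar> \<le> 6 / R"
  proof (cases "\<bar>z\<bar> > R")
    case True
    then show ?thesis using zR assms by (simp add: cutoff'_def m_def[symmetric])
  next
    case False
    have "\<bar>cutoff' R z\<bar> = 6 * \<bar>z\<bar> / R\<^sup>2 * m\<^sup>2"
      using m by (simp add: cutoff'_def m_def[symmetric] abs_mult)
    also have "\<dots> \<le> 6 * R / R\<^sup>2 * 1"
      using False m assms by (intro mult_mono divide_right_mono) (auto simp: power_le_one)
    finally show ?thesis using assms by (simp add: power2_eq_square)
  qed
  show "\<bar>cutoff'' R z\<bar> \<le> 30 / R\<^sup>2"
  proof (cases "\<bar>z\<bar> > R")
    case True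
    then show ?thesis using zR assms by (simp add: cutoff''_def m_def[symmetric])
  next
    case False
    have z2: "z\<^sup>2 \<le> R\<^sup>2"
      using False assms abs_le_square_iff[of z R] by simp
    have "\<bar>cutoff'' R z\<bar> \<le> 6 / R\<^sup>2 * m\<^sup>2 + 24 * z\<^sup>2 / R ^ 4 * m"
      unfolding cutoff''_def m_def[symmetric]
      using m assms by (intro order_trans[OF abs_triangle_ineq] add_mono) (auto simp: abs_mult)
    also have "\<dots> \<le> 6 / R\<^sup>2 * 1 + 24 * R\<^sup>2 / R ^ 4 * 1"
      using z2 m assms by (intro add_mono mult_mono divide_right_mono) (auto simp: power_le_one)
    also have "\<dots> = 30 / R\<^sup>2"
      using assms by (simp add: field_simps power2_eq_square power4_eq_xxxx)
    finally show ?thesis .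
  qed
  have "1 - m ^ 3 \<le> 3 * (1 - m)"
  proof -
    have "(1 - m) * (1 + m + m\<^sup>2) \<le> (1 - m) * 3"
      using m power_le_one[of m 2] by (intro mult_left_mono) linarith+
    then show ?thesis by (simp add: algebra_simps power2_eq_square power3_eq_cube)
  qed
  also have "\<dots> \<le> 3 * (z / R)\<^sup>2"
    using m by simp
  finally show "1 - cutoff R z \<le> 3 * z\<^sup>2 / R\<^sup>2"
    by (simp add: cutoff_def m_def power_divide)
qed

lemma continuous_cutoff:
  "continuous_on UNIV (cutoff R)" "continuous_on UNIV (cutoff' R)" "continuous_on UNIV (cutoff'' R)"
  unfolding cutoff_def cutoff'_def cutoff''_def divide_inverse by (intro continuous_intros)+

lemmas jc_cutoff = jc_z[OF continuous_cutoff(1)] jc_z[OF continuous_cutoff(2)] jc_z[OF continuous_cutoff(3)]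

subsection \<open>Weak forms of the Fokker--Planck equation\<close>

text \<open>Again all derivatives are named. \<open>vi i\<close> is the derivative of the whole flux
  component \<open>\<mu> * b $ i\<close>: the drift itself is only known to be continuous, and the
  product is what a classical solution may differentiate.\<close>

definition FP_with where
  "FP_with T \<sigma> \<sigma>' s b \<mu> \<mu>t \<mu>z \<mu>zz \<mu>i \<mu>ii vi \<longleftrightarrow>
     C12_with {0<..<T :: real} \<mu> \<mu>t \<mu>z \<mu>zz \<mu>i \<mu>ii
     \<and> (\<forall>i. jointly_continuous_on {0<..<T} (\<lambda>t z x. b t z x $ i))
     \<and> (\<forall>i. jointly_continuous_on {0<..<T} (vi i))
     \<and> (\<forall>i. \<forall>t\<in>{0<..<T}. \<forall>z x. has_tpartial i (\<lambda>x. \<mu> t z x * b t z x $ i) (vi i t z x) x)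
     \<and> (\<forall>t\<in>{0<..<T}. \<forall>z x. \<mu>t t z x + (\<Sum>i\<in>UNIV. vi i t z x) + s * \<mu>z t z x
          - \<sigma>\<^sup>2 / 2 * \<mu>zz t z x - \<sigma>'\<^sup>2 / 2 * (\<Sum>i\<in>UNIV. \<mu>ii i t z x) = 0)"

lemma FP_withD:
  assumes "FP_with T \<sigma> \<sigma>' s b \<mu> \<mu>t \<mu>z \<mu>zz \<mu>i \<mu>ii vi"
  shows "C12_with {0<..<T} \<mu> \<mu>t \<mu>z \<mu>zz \<mu>i \<mu>ii"
    and "jointly_continuous_on {0<..<T} (\<lambda>t z x. b t z x $ i)"
    and "jointly_continuous_on {0<..<T} (vi i)"
    and "t \<in> {0<..<T} \<Longrightarrow> has_tpartial i (\<lambda>x. \<mu> t z x * b t z x $ i) (vi i t z x) x"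
    and "t \<in> {0<..<T} \<Longrightarrow> \<mu>t t z x = - (\<Sum>i\<in>UNIV. vi i t z x) - s * \<mu>z t z x
          + \<sigma>\<^sup>2 / 2 * \<mu>zz t z x + \<sigma>'\<^sup>2 / 2 * (\<Sum>i\<in>UNIV. \<mu>ii i t z x)"
proof -
  show "\<mu>t t z x = - (\<Sum>i\<in>UNIV. vi i t z x) - s * \<mu>z t z x
          + \<sigma>\<^sup>2 / 2 * \<mu>zz t z x + \<sigma>'\<^sup>2 / 2 * (\<Sum>i\<in>UNIV. \<mu>ii i t z x)" if "t \<in> {0<..<T}"
  proof -
    have "\<mu>t t z x + (\<Sum>i\<in>UNIV. vi i t z x) + s * \<mu>z t z x
          - \<sigma>\<^sup>2 / 2 * \<mu>zz t z x - \<sigma>'\<^sup>2 / 2 * (\<Sum>i\<in>UNIV. \<mu>ii i t z x) = 0"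
      using assms that unfolding FP_with_def by blast
    then show ?thesis by linarith
  qed
qed (use assms in \<open>auto simp: FP_with_def\<close>)

text \<open>The forward equation is tested with \<open>cutoff R z * \<Psi>\<close>. The first
  bracket in \<open>D\<close> is the adjoint operator applied to \<open>\<Psi>\<close>; the terms
  with \<open>cutoff'\<close> and \<open>cutoff''\<close> are its commutator with the cutoff and
  disappear as \<open>R\<close> grows.\<close>

lemma weak_form:
  fixes \<mu> :: "real \<Rightarrow> real \<Rightarrow> ('n::finite) torus \<Rightarrow> real"
  assumes FP: "FP_with T \<sigma> \<sigma>' s b \<mu> \<mu>t \<mu>z \<mu>zz \<mu>i \<mu>ii vi"
    and \<Psi>: "C12_with {0<..<T} \<Psi> \<Psi>t \<Psi>z \<Psi>zz \<Psi>i \<Psi>ii"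
    and t: "t \<in> {0<..<T}" and R: "R > 0"
    and D: "\<And>z x. D z x = \<mu> t z x * (cutoff R z * (\<Psi>t t z x + (\<Sum>i\<in>UNIV. b t z x $ i * \<Psi>i i t z x) + s * \<Psi>z t z x
              + \<sigma>\<^sup>2 / 2 * \<Psi>zz t z x + \<sigma>'\<^sup>2 / 2 * (\<Sum>i\<in>UNIV. \<Psi>ii i t z x))
            + cutoff' R z * (s * \<Psi> t z x + \<sigma>\<^sup>2 * \<Psi>z t z x) + \<sigma>\<^sup>2 / 2 * cutoff'' R z * \<Psi> t z x)"
  shows "((\<lambda>t. \<integral>(z, x). cutoff R z * \<Psi> t z x * \<mu> t z x \<partial>zx) has_real_derivative (\<integral>(z, x). D z x \<partial>zx)) (at t)"
    and "integrable zx (\<lambda>(z, x). D z x)"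
proof -
  note jb = FP_withD(2)[OF FP] and jv = FP_withD(3)[OF FP] and dv = FP_withD(4)[OF FP t]
    and eq = FP_withD(5)[OF FP t] and c = C12_withD[OF FP_withD(1)[OF FP]] and p = C12_withD[OF \<Psi>]
  let ?g = "\<lambda>t z x. cutoff R z * \<Psi> t z x * \<mu> t z x"
  let ?gt = "\<lambda>t z x. cutoff R z * (\<Psi>t t z x * \<mu> t z x + \<Psi> t z x * \<mu>t t z x)"
  \<comment> \<open>The fluxes come from Green's formula. With
    \<open>\<phi> = cutoff R z * \<Psi>\<close> the transport contributes
    \<open>s * \<phi> * \<mu>\<close>, and the diffusion in \<open>z\<close> contributes
    \<open>\<sigma>\<^sup>2 / 2\<close> times \<open>\<mu>\<close> times the derivative of
    \<open>\<phi>\<close> minus \<open>\<phi>\<close> times the derivative of \<open>\<mu>\<close>;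
    likewise in each \<open>x\<close>-direction, with the drift.\<close>
  let ?fz = "\<lambda>t z x. s * (cutoff R z * \<Psi> t z x * \<mu> t z x)
     + \<sigma>\<^sup>2 / 2 * (\<mu> t z x * (cutoff' R z * \<Psi> t z x + cutoff R z * \<Psi>z t z x) - cutoff R z * \<Psi> t z x * \<mu>z t z x)"
  let ?fz' = "\<lambda>t z x. s * (cutoff' R z * \<Psi> t z x * \<mu> t z x + cutoff R z * \<Psi>z t z x * \<mu> t z x + cutoff R z * \<Psi> t z x * \<mu>z t z x)
     + \<sigma>\<^sup>2 / 2 * (\<mu> t z x * (cutoff'' R z * \<Psi> t z x + 2 * cutoff' R z * \<Psi>z t z x + cutoff R z * \<Psi>zz t z x)
          - cutoff R z * \<Psi> t z x * \<mu>zz t z x)"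
  let ?fi = "\<lambda>i t z x. cutoff R z * (\<Psi> t z x * (\<mu> t z x * b t z x $ i)
     + \<sigma>'\<^sup>2 / 2 * (\<mu> t z x * \<Psi>i i t z x - \<Psi> t z x * \<mu>i i t z x))"
  let ?fi' = "\<lambda>i t z x. cutoff R z * ((\<Psi>i i t z x * (\<mu> t z x * b t z x $ i) + \<Psi> t z x * vi i t z x)
     + \<sigma>'\<^sup>2 / 2 * (\<mu> t z x * \<Psi>ii i t z x - \<Psi> t z x * \<mu>ii i t z x))"
  have gt: "((\<lambda>t. ?g t z x) has_real_derivative ?gt t' z x) (at t')" if t': "t' \<in> {0<..<T}" for t' z x
  proof -
    have "((\<lambda>t. cutoff R z * (\<Psi> t z x * \<mu> t z x)) has_real_derivative cutoff R z * (\<Psi>t t' z x * \<mu> t' z x + \<mu>t t' z x * \<Psi> t' z x)) (at t')"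
      by (intro DERIV_cmult DERIV_mult p(1)[OF t'] c(1)[OF t'])
    then show ?thesis by (simp only: ac_simps)
  qed
  have fz': "((\<lambda>z. ?fz t z x) has_real_derivative ?fz' t z x) (at z)" for z x
    by (rule DERIV_cong, (rule DERIV_add DERIV_diff DERIV_cmult DERIV_mult DERIV_cutoff[OF R] DERIV_cutoff'[OF R] c(2)[OF t] p(2)[OF t] c(3)[OF t] p(3)[OF t])+)
       (simp add: algebra_simps)
  have fi': "has_tpartial i (?fi i t z) (?fi' i t z x) x" for i z x
    by (rule has_tpartial_cong, (rule has_tpartial_cmult has_tpartial_add has_tpartial_diff 
          has_tpartial_mult[OF p(4)[OF t] dv] has_tpartial_mult[OF c(4)[OF t] p(5)[OF t]] has_tpartial_mult[OF p(4)[OF t] c(5)[OF t]])+)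
       (simp add: algebra_simps)
  have fl: "?gt t z x + ?fz' t z x + (\<Sum>i\<in>UNIV. ?fi' i t z x) = D z x" for z x
  proof -
    have s: "(\<Sum>i\<in>UNIV. ?fi' i t z x) = cutoff R z * (\<mu> t z x * (\<Sum>i\<in>UNIV. b t z x $ i * \<Psi>i i t z x)
        + \<Psi> t z x * (\<Sum>i\<in>UNIV. vi i t z x) + \<sigma>'\<^sup>2 / 2 * (\<mu> t z x * (\<Sum>i\<in>UNIV. \<Psi>ii i t z x)
          - \<Psi> t z x * (\<Sum>i\<in>UNIV. \<mu>ii i t z x)))"
      by (simp add: sum_distrib_left sum.distrib sum_subtractf algebra_simps)
    show ?thesis
      unfolding s D eq by (simp add: algebra_simps)
  qed
  have jc: "jointly_continuous_on {0<..<T} ?g" "jointly_continuous_on {0<..<T} ?gt"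
    "jointly_continuous_on {0<..<T} ?fz" "jointly_continuous_on {0<..<T} ?fz'"
    "jointly_continuous_on {0<..<T} (?fi i)" "jointly_continuous_on {0<..<T} (?fi' i)" for i
    by (intro jc_intros jc_cutoff jb jv c p)+
  note 1 = derivative_integral_flux[where A = "{0<..<T}" and R = R and gt = ?gt and fz = ?fz and fz' = ?fz'
        and fi = ?fi and fi' = ?fi', OF _ t jc(1,2) gt _ jc(3,4) fz' _ jc(5,6) fi' _ fl]
  show "((\<lambda>t. \<integral>(z, x). cutoff R z * \<Psi> t z x * \<mu> t z x \<partial>zx) has_real_derivative (\<integral>(z, x). D z x \<partial>zx)) (at t)"
    "integrable zx (\<lambda>(z, x). D z x)"
    by (rule 1; use R in \<open>auto simp: cutoff_supp cutoff'_supp\<close>)+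
qed

text \<open>The equation is multiplied by \<open>cutoff R z * \<beta>' \<mu>\<close>. Integration by
  parts moves one \<open>x\<close>-derivative onto \<open>\<beta>' \<mu>\<close>, so the drift meets
  only the factor \<open>\<beta>'' \<mu> * \<mu>i i\<close>, next to a quadratic diffusion term that
  can absorb it. The drift is never differentiated.\<close>

lemma kato_form:
  fixes \<mu> :: "real \<Rightarrow> real \<Rightarrow> ('n::finite) torus \<Rightarrow> real" and \<beta> :: "real \<Rightarrow> real"
  assumes FP: "FP_with T \<sigma> \<sigma>' s b \<mu> \<mu>t \<mu>z \<mu>zz \<mu>i \<mu>ii vi"
    and \<beta>: "\<And>v. (\<beta> has_real_derivative \<beta>' v) (at v)" "\<And>v. (\<beta>' has_real_derivative \<beta>'' v) (at v)"
      "continuous_on UNIV \<beta>''"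
    and t: "t \<in> {0<..<T}" and R: "R > 0"
    and D: "\<And>z x. D z x = \<beta> (\<mu> t z x) * (s * cutoff' R z + \<sigma>\<^sup>2 / 2 * cutoff'' R z)
      - \<sigma>\<^sup>2 / 2 * cutoff R z * \<beta>'' (\<mu> t z x) * (\<mu>z t z x)\<^sup>2
      + (\<Sum>i\<in>UNIV. cutoff R z * \<beta>'' (\<mu> t z x) * \<mu>i i t z x * (\<mu> t z x * b t z x $ i - \<sigma>'\<^sup>2 / 2 * \<mu>i i t z x))"
  shows "((\<lambda>t. \<integral>(z, x). cutoff R z * \<beta> (\<mu> t z x) \<partial>zx) has_real_derivative (\<integral>(z, x). D z x \<partial>zx)) (at t)"
    and "integrable zx (\<lambda>(z, x). D z x)"
proof -
  note jb = FP_withD(2)[OF FP] and jv = FP_withD(3)[OF FP] and dv = FP_withD(4)[OF FP t]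
    and eq = FP_withD(5)[OF FP t] and c = C12_withD[OF FP_withD(1)[OF FP]]
  have \<beta>c: "continuous_on UNIV \<beta>" "continuous_on UNIV \<beta>'"
    using \<beta>(1,2) by (meson DERIV_isCont continuous_at_imp_continuous_on)+
  note jB = jc_comp[OF \<beta>c(1) c(6)] jc_comp[OF \<beta>c(2) c(6)] jc_comp[OF \<beta>(3) c(6)]
  let ?g = "\<lambda>t z x. cutoff R z * \<beta> (\<mu> t z x)"
  let ?gt = "\<lambda>t z x. cutoff R z * (\<beta>' (\<mu> t z x) * \<mu>t t z x)"
  let ?fz = "\<lambda>t z x. s * (cutoff R z * \<beta> (\<mu> t z x))
     - \<sigma>\<^sup>2 / 2 * (cutoff R z * (\<beta>' (\<mu> t z x) * \<mu>z t z x) - cutoff' R z * \<beta> (\<mu> t z x))"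
  let ?fz' = "\<lambda>t z x. s * (cutoff' R z * \<beta> (\<mu> t z x) + cutoff R z * (\<beta>' (\<mu> t z x) * \<mu>z t z x))
     - \<sigma>\<^sup>2 / 2 * (cutoff R z * (\<beta>'' (\<mu> t z x) * (\<mu>z t z x * \<mu>z t z x) + \<beta>' (\<mu> t z x) * \<mu>zz t z x) - cutoff'' R z * \<beta> (\<mu> t z x))"
  let ?fi = "\<lambda>i t z x. cutoff R z * (\<beta>' (\<mu> t z x) * (\<mu> t z x * b t z x $ i - \<sigma>'\<^sup>2 / 2 * \<mu>i i t z x))"
  let ?fi' = "\<lambda>i t z x. cutoff R z * ((\<beta>'' (\<mu> t z x) * \<mu>i i t z x) * (\<mu> t z x * b t z x $ i - \<sigma>'\<^sup>2 / 2 * \<mu>i i t z x)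
      + \<beta>' (\<mu> t z x) * (vi i t z x - \<sigma>'\<^sup>2 / 2 * \<mu>ii i t z x))"
  have gt: "((\<lambda>t. ?g t z x) has_real_derivative ?gt t' z x) (at t')" if t': "t' \<in> {0<..<T}" for t' z x
    by (intro DERIV_cmult DERIV_chain2[OF \<beta>(1) c(1)[OF t']])
  have fz': "((\<lambda>z. ?fz t z x) has_real_derivative ?fz' t z x) (at z)" for z x
    by (rule DERIV_cong, (rule DERIV_diff DERIV_cmult DERIV_chain2[OF \<beta>(1) c(2)[OF t]]
          DERIV_chain2[OF \<beta>(2) c(2)[OF t]] DERIV_mult DERIV_cutoff[OF R] DERIV_cutoff'[OF R] c(3)[OF t])+)
       (simp add: algebra_simps)
  have fi': "has_tpartial i (?fi i t z) (?fi' i t z x) x" for i z x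
    by (rule has_tpartial_cong, (rule has_tpartial_mult[OF has_tpartial_chain[OF \<beta>(2) c(4)[OF t]]] 
          has_tpartial_diff dv c(5)[OF t] has_tpartial_cmult)+)
       (simp add: algebra_simps)
  have fl: "?gt t z x + ?fz' t z x + (\<Sum>i\<in>UNIV. ?fi' i t z x) = D z x" for z x
  proof -
    have s: "(\<Sum>i\<in>UNIV. ?fi' i t z x) = 
        (\<Sum>i\<in>UNIV. cutoff R z * \<beta>'' (\<mu> t z x) * \<mu>i i t z x * (\<mu> t z x * b t z x $ i - \<sigma>'\<^sup>2 / 2 * \<mu>i i t z x))
        + cutoff R z * \<beta>' (\<mu> t z x) * ((\<Sum>i\<in>UNIV. vi i t z x) - \<sigma>'\<^sup>2 / 2 * (\<Sum>i\<in>UNIV. \<mu>ii i t z x))"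
      by (simp add: sum_distrib_left sum.distrib sum_subtractf algebra_simps)
    show ?thesis
      unfolding s D eq by (simp add: algebra_simps power2_eq_square)
  qed
  have jc: "jointly_continuous_on {0<..<T} ?g" "jointly_continuous_on {0<..<T} ?gt"
    "jointly_continuous_on {0<..<T} ?fz" "jointly_continuous_on {0<..<T} ?fz'"
    "jointly_continuous_on {0<..<T} (?fi i)" "jointly_continuous_on {0<..<T} (?fi' i)" for i
    by (intro jc_intros jc_cutoff jb jv c jB)+
  note 1 = derivative_integral_flux[where A = "{0<..<T}" and R = R and gt = ?gt and fz = ?fz and fz' = ?fz'
        and fi = ?fi and fi' = ?fi', OF _ t jc(1,2) gt _ jc(3,4) fz' _ jc(5,6) fi' _ fl]
  show "((\<lambda>t. \<integral>(z, x). cutoff R z * \<beta> (\<mu> t z x) \<partial>zx) has_real_derivative (\<integral>(z, x). D z x \<partial>zx)) (at t)"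
    "integrable zx (\<lambda>(z, x). D z x)"
    by (rule 1; use R in \<open>auto simp: cutoff_supp cutoff'_supp\<close>)+
qed

subsection \<open>A maximum principle\<close>

lemma second_derivative_at_max:
  fixes f :: "real \<Rightarrow> real"
  assumes d: "\<And>x. (f has_real_derivative f' x) (at x)" and d2: "(f' has_real_derivative l) (at x0)"
    and max: "\<And>x. f x \<le> f x0"
  shows "f' x0 = 0" "l \<le> 0"
proof -
  show 0: "f' x0 = 0"
    by (rule DERIV_local_max[OF d[of x0], of 1]) (use max in auto)
  show "l \<le> 0"
  proof (rule ccontr)
    assume "\<not> l \<le> 0"
    then obtain e where e: "e > 0" "\<And>h. 0 < h \<Longrightarrow> h < e \<Longrightarrow> f' x0 < f' (x0 + h)"
      using DERIV_pos_inc_right[OF d2] by auto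
    have "\<exists>z. x0 < z \<and> z < x0 + e / 2 \<and> f (x0 + e / 2) - f x0 = (x0 + e / 2 - x0) * f' z"
      by (rule MVT2) (use e(1) d in simp_all)
    then obtain z where z: "x0 < z" "z < x0 + e / 2" "f (x0 + e / 2) - f x0 = e / 2 * f' z"
      by (metis add_diff_cancel_left')
    have "f' z > 0"
      using e(2)[of "z - x0"] z 0 by simp
    then have "f (x0 + e / 2) > f x0"
      using z(3) e(1) mult_pos_pos[of "e / 2" "f' z"] by linarith
    then show False using max[of "x0 + e / 2"] by simp
  qed
qed

text \<open>One-sided, because in \<open>maximum_principle\<close> the maximum may be attained at
  the left end of the time interval.\<close>

lemma derivative_at_right_max:
  fixes f :: "real \<Rightarrow> real"
  assumes d: "(f has_real_derivative l) (at x0)" and "x0 < b" and max: "\<And>x. x0 \<le> x \<Longrightarrow> x \<le> b \<Longrightarrow> f x \<le> f x0"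
  shows "l \<le> 0"
proof (rule ccontr)
  assume "\<not> l \<le> 0"
  then obtain e where e: "e > 0" "\<And>h. 0 < h \<Longrightarrow> h < e \<Longrightarrow> f x0 < f (x0 + h)"
    using DERIV_pos_inc_right[OF d] by auto
  define h where "h = min (e / 2) (b - x0)"
  have "0 < h" "h < e" "x0 + h \<le> b"
    using e(1) assms(2) by (auto simp: h_def)
  then show False
    using e(2)[of h] max[of "x0 + h"] by simp
qed

text \<open>The barrier depends on \<open>(t, z)\<close> only, so at a maximum point all \<open>x\<close>-derivatives of \<open>W\<close>
  vanish: the differential inequality is only needed there.\<close>

lemma maximum_principle:
  fixes W :: "real \<Rightarrow> real \<Rightarrow> ('n::finite) torus \<Rightarrow> real"
  assumes cont: "jointly_continuous_on {a..b} W"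
    and Wt: "\<And>t z x. t \<in> {a..<b} \<Longrightarrow> ((\<lambda>t. W t z x) has_real_derivative Wt t z x) (at t)"
    and Wz: "\<And>t z x. t \<in> {a..<b} \<Longrightarrow> ((\<lambda>z. W t z x) has_real_derivative Wz t z x) (at z)"
    and Wzz: "\<And>t z x. t \<in> {a..<b} \<Longrightarrow> ((\<lambda>z. Wz t z x) has_real_derivative Wzz t z x) (at z)"
    and Wi: "\<And>t z x i. t \<in> {a..<b} \<Longrightarrow> has_tpartial i (W t z) (Wi i t z x) x"
    and Wii: "\<And>t z x i. t \<in> {a..<b} \<Longrightarrow> has_tpartial i (Wi i t z) (Wii i t z x) x"
    and ineq: "\<And>t z x. t \<in> {a..<b} \<Longrightarrow> (\<And>i. Wi i t z x = 0) \<Longrightarrow>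
        0 \<le> Wt t z x + r t z * Wz t z x + c * Wzz t z x + d * (\<Sum>i\<in>UNIV. Wii i t z x)"
    and r: "\<And>t z. t \<in> {a..<b} \<Longrightarrow> \<bar>r t z\<bar> \<le> \<rho> * \<bar>z\<bar>" and \<rho>: "\<rho> \<ge> 0" and c: "c \<ge> 0" and d: "d \<ge> 0"
    and fin: "\<And>z x. W b z x \<le> 0"
    and growth: "\<And>\<epsilon>. \<epsilon> > 0 \<Longrightarrow> \<exists>K. \<forall>t\<in>{a..b}. \<forall>z x. W t z x \<le> K * exp (\<epsilon> * z\<^sup>2)"
    and t1: "t1 \<in> {a..b}"
  shows "W t1 z1 x1 \<le> 0"
proof (rule ccontr)
  assume "\<not> W t1 z1 x1 \<le> 0"
  then have w: "W t1 z1 x1 > 0" by simp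
  \<comment> \<open>\<open>\<Lambda>\<close> is a strict supersolution of the backward operator. The
    decay rate \<open>B\<close> of \<open>A\<close> spends \<open>2 * \<rho>\<close> on the
    first-order term and 1 on \<open>4 * c * A\<^sup>2 * z\<^sup>2 \<le> A * z\<^sup>2\<close>; the
    summand \<open>b - t\<close> in the exponent supplies \<open>- 1\<close> against
    \<open>2 * c * A \<le> 1 / 2\<close>. Both bounds rest on \<open>4 * c * A \<le> 1\<close>,
    which fixes the denominator of \<open>\<alpha>\<close>.\<close>
  define B where "B = 2 * \<rho> + 2"
  define \<alpha> where "\<alpha> = exp (- B * (b - a)) / (4 * (c + 1))"
  define A where "A t = \<alpha> * exp (B * (b - t))" for t
  define \<Lambda> where "\<Lambda> t z = exp (A t * z\<^sup>2 + (b - t))" for t z :: real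
  have B: "B > 0" using \<rho> by (simp add: B_def)
  have \<alpha>: "\<alpha> > 0" using c by (simp add: \<alpha>_def)
  have A1: "\<alpha> \<le> A t" if "t \<le> b" for t
    using B \<alpha> that by (simp add: A_def)
  have A2: "A t \<le> 1 / (4 * (c + 1))" if "a \<le> t" for t
  proof -
    have "A t \<le> \<alpha> * exp (B * (b - a))"
      unfolding A_def using B \<alpha> that by (intro mult_left_mono) auto
    also have "\<dots> = 1 / (4 * (c + 1))"
      by (simp add: \<alpha>_def exp_minus divide_simps)
    finally show ?thesis .
  qed
  have \<Lambda>pos: "\<Lambda> t z > 0" for t z by (simp add: \<Lambda>_def)
  have A_der: "(A has_real_derivative - B * A t) (at t)" for t
    unfolding A_def by (auto intro!: derivative_eq_intros)
  have \<Lambda>t: "((\<lambda>t. \<Lambda> t z) has_real_derivative (- B * A t * z\<^sup>2 - 1) * \<Lambda> t z) (at t)" for t z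
    unfolding \<Lambda>_def by (auto intro!: derivative_eq_intros A_der)
  have \<Lambda>z: "(\<Lambda> t has_real_derivative 2 * A t * z * \<Lambda> t z) (at z)" for t z
    unfolding \<Lambda>_def by (auto intro!: derivative_eq_intros)
  have \<Lambda>zz: "((\<lambda>z. 2 * A t * z * \<Lambda> t z) has_real_derivative (4 * (A t)\<^sup>2 * z\<^sup>2 + 2 * A t) * \<Lambda> t z) (at z)" for t z
    by (rule DERIV_cong[OF DERIV_mult[OF DERIV_cmult[OF DERIV_ident] \<Lambda>z]])
       (simp add: algebra_simps power2_eq_square)
  \<comment> \<open>With this multiple the barrier takes away half of the positive value at
    \<open>(t1, z1, x1)\<close>, so \<open>\<Phi>\<close> is still positive there.\<close>
  define \<delta> where "\<delta> = W t1 z1 x1 / (2 * \<Lambda> t1 z1)"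
  have \<delta>: "\<delta> > 0" using w \<Lambda>pos by (simp add: \<delta>_def)
  have "\<exists>K. \<forall>t\<in>{a..b}. \<forall>z x. W t z x \<le> K * exp (\<alpha> / 2 * z\<^sup>2)"
    by (rule growth) (use \<alpha> in simp)
  then obtain K0 where K0: "\<And>t z x. t \<in> {a..b} \<Longrightarrow> W t z x \<le> K0 * exp (\<alpha> / 2 * z\<^sup>2)"
    by blast
  define K where "K = max K0 0"
  have K: "W t z x \<le> K * exp (\<alpha> / 2 * z\<^sup>2)" if "t \<in> {a..b}" for t z x
    using K0[OF that, of z x] by (rule order_trans) (auto simp: K_def)
  have K_nonneg: "K \<ge> 0" by (simp add: K_def)
  \<comment> \<open>Beyond the first summand the barrier, of rate at least \<open>\<alpha>\<close>,
    beats the growth of \<open>W\<close>, taken with rate \<open>\<alpha> / 2\<close>. The second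
    summand keeps \<open>z1\<close> inside the compact region.\<close>
  define Z where "Z = sqrt (2 * K / (\<alpha> * \<delta>)) + \<bar>z1\<bar>"
  define \<Phi> where "\<Phi> t z x = W t z x - \<delta> * \<Lambda> t z" for t z x
  have far: "\<Phi> t z x \<le> 0" if "t \<in> {a..b}" "\<bar>z\<bar> > Z" for t z x
  proof -
    have "sqrt (2 * K / (\<alpha> * \<delta>)) \<le> \<bar>z\<bar>"
      using that(2) by (simp add: Z_def)
    then have "2 * K / (\<alpha> * \<delta>) \<le> z\<^sup>2"
      using power_mono[of "sqrt (2 * K / (\<alpha> * \<delta>))" "\<bar>z\<bar>" 2] K_nonneg \<alpha> \<delta> by simp
    then have "K / \<delta> \<le> \<alpha> / 2 * z\<^sup>2"
      using \<alpha> \<delta> by (simp add: field_simps)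
    also have "\<dots> \<le> exp (\<alpha> / 2 * z\<^sup>2)"
      using exp_ge_add_one_self[of "\<alpha> / 2 * z\<^sup>2"] by linarith
    finally have "K \<le> \<delta> * exp (\<alpha> / 2 * z\<^sup>2)"
      using \<delta> by (simp add: field_simps)
    then have "W t z x \<le> \<delta> * exp (\<alpha> / 2 * z\<^sup>2) * exp (\<alpha> / 2 * z\<^sup>2)"
      by (intro order_trans[OF K[OF that(1), of z x]] mult_right_mono) auto
    also have "\<dots> = \<delta> * exp (\<alpha> * z\<^sup>2)"
      by (simp add: mult.assoc exp_add[symmetric])
    also have "\<dots> \<le> \<delta> * \<Lambda> t z"
    proof -
      have "\<alpha> * z\<^sup>2 \<le> A t * z\<^sup>2" using A1[of t] that(1) by (intro mult_right_mono) auto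
      then show ?thesis using \<delta> that(1) by (simp add: \<Lambda>_def)
    qed
    finally show ?thesis by (simp add: \<Phi>_def)
  qed
  have "jointly_continuous_on {a..b} \<Phi>"
    unfolding \<Phi>_def \<Lambda>_def A_def
    by (intro jc_intros cont jc_tz) (auto simp: split_def intro!: continuous_intros)
  then have cont\<Phi>: "continuous_on ({a..b} \<times> {-Z..Z} \<times> UNIV) (\<lambda>(t, z, x). \<Phi> t z x)"
    unfolding jointly_continuous_on_def by (rule continuous_on_subset) auto
  have comp: "compact ({a..b} \<times> {-Z..Z} \<times> (UNIV :: 'n torus set))"
    by (intro compact_Times compact_Icc compact_UNIV_torus)
  have in1: "(t1, z1, x1) \<in> {a..b} \<times> {-Z..Z} \<times> UNIV"
  proof -
    have "0 \<le> sqrt (2 * K / (\<alpha> * \<delta>))" using K_nonneg \<alpha> \<delta> by simp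
    then have "\<bar>z1\<bar> \<le> Z" by (simp add: Z_def)
    then show ?thesis using t1 by auto
  qed
  then have ne: "{a..b} \<times> {-Z..Z} \<times> (UNIV :: 'n torus set) \<noteq> {}" by blast
  obtain p where p: "p \<in> {a..b} \<times> {-Z..Z} \<times> UNIV"
    "\<forall>q\<in>{a..b} \<times> {-Z..Z} \<times> UNIV. (\<lambda>(t, z, x). \<Phi> t z x) q \<le> (\<lambda>(t, z, x). \<Phi> t z x) p"
    using continuous_attains_sup[OF comp ne cont\<Phi>] by blast
  obtain t0 z0 x0 where p_eq: "p = (t0, z0, x0)" by (cases p) auto
  have t0: "t0 \<in> {a..b}" using p(1) p_eq by auto
  have max1: "\<Phi> t z x \<le> \<Phi> t0 z0 x0" if "t \<in> {a..b}" "\<bar>z\<bar> \<le> Z" for t z x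
    using bspec[OF p(2), of "(t, z, x)"] that p_eq by (auto simp: abs_le_iff)
  have "\<Phi> t1 z1 x1 = W t1 z1 x1 / 2"
    using \<Lambda>pos[of t1 z1] by (simp add: \<Phi>_def \<delta>_def field_simps)
  then have pos: "\<Phi> t0 z0 x0 > 0"
    using max1[of t1 z1 x1] in1 w by (auto simp: abs_le_iff)
  have max: "\<Phi> t z x \<le> \<Phi> t0 z0 x0" if "t \<in> {a..b}" for t z x
    using max1[OF that, of z x] far[OF that, of z x] pos by (cases "\<bar>z\<bar> \<le> Z") auto
  have "\<Phi> b z0 x0 < 0"
    using fin[of z0 x0] mult_pos_pos[OF \<delta> \<Lambda>pos[of b z0]] by (simp add: \<Phi>_def)
  then have "t0 \<noteq> b" using pos by force
  then have t0': "t0 \<in> {a..<b}" using t0 by auto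
  have 1: "Wt t0 z0 x0 - \<delta> * ((- B * A t0 * z0\<^sup>2 - 1) * \<Lambda> t0 z0) \<le> 0"
  proof (rule derivative_at_right_max[where b = b and f = "\<lambda>t. \<Phi> t z0 x0" and ?x0.0 = t0])
    show "((\<lambda>t. \<Phi> t z0 x0) has_real_derivative Wt t0 z0 x0 - \<delta> * ((- B * A t0 * z0\<^sup>2 - 1) * \<Lambda> t0 z0)) (at t0)"
      unfolding \<Phi>_def by (intro DERIV_diff DERIV_cmult Wt[OF t0'] \<Lambda>t)
  qed (use t0' max in auto)
  have z1: "((\<lambda>z. \<Phi> t0 z x0) has_real_derivative Wz t0 z x0 - \<delta> * (2 * A t0 * z * \<Lambda> t0 z)) (at z)" for z
    unfolding \<Phi>_def by (intro DERIV_diff DERIV_cmult Wz[OF t0'] \<Lambda>z)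
  have z2: "((\<lambda>z. Wz t0 z x0 - \<delta> * (2 * A t0 * z * \<Lambda> t0 z)) has_real_derivative
        Wzz t0 z0 x0 - \<delta> * ((4 * (A t0)\<^sup>2 * z0\<^sup>2 + 2 * A t0) * \<Lambda> t0 z0)) (at z0)"
    by (intro DERIV_diff DERIV_cmult[of _ _ _ _ \<delta>] Wzz[OF t0'] \<Lambda>zz)
  note 2 = second_derivative_at_max[OF z1 z2 max[OF t0]]
  have x1: "((\<lambda>h. W t0 z0 (torus_shift x0 (axis i h))) has_real_derivative Wi i t0 z0 (torus_shift x0 (axis i h))) (at h)" for i h
    by (rule has_tpartial_at[OF Wi[OF t0']])
  have x2: "((\<lambda>h. Wi i t0 z0 (torus_shift x0 (axis i h))) has_real_derivative Wii i t0 z0 x0) (at 0)" for i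
    using Wii[OF t0', of i z0 x0] by (simp add: has_tpartial_def)
  have x3: "W t0 z0 (torus_shift x0 (axis i h)) \<le> W t0 z0 (torus_shift x0 (axis i 0))" for i h
    using max[OF t0, of z0 "torus_shift x0 (axis i h)"] by (simp add: \<Phi>_def)
  have 3: "Wi i t0 z0 x0 = 0" "Wii i t0 z0 x0 \<le> 0" for i
    using second_derivative_at_max[OF x1 x2 x3, of i] by simp_all
  have At: "0 < A t0" "A t0 \<le> 1 / (4 * (c + 1))"
    using A1[of t0] A2[of t0] \<alpha> t0 by auto
  have cA: "4 * c * A t0 \<le> 1"
  proof -
    have "4 * c * A t0 \<le> 4 * c * (1 / (4 * (c + 1)))"
      using At c by (intro mult_left_mono) auto
    also have "\<dots> \<le> 1" using c by (simp add: field_simps)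
    finally show ?thesis .
  qed
  have "0 \<le> Wt t0 z0 x0 + r t0 z0 * Wz t0 z0 x0 + c * Wzz t0 z0 x0 + d * (\<Sum>i\<in>UNIV. Wii i t0 z0 x0)"
    using ineq[OF t0'] 3(1) by blast
  also have "\<dots> \<le> \<delta> * ((- B * A t0 * z0\<^sup>2 - 1) * \<Lambda> t0 z0) + r t0 z0 * (\<delta> * (2 * A t0 * z0 * \<Lambda> t0 z0))
      + c * (\<delta> * ((4 * (A t0)\<^sup>2 * z0\<^sup>2 + 2 * A t0) * \<Lambda> t0 z0)) + d * 0"
  proof -
    have wz: "Wz t0 z0 x0 = \<delta> * (2 * A t0 * z0 * \<Lambda> t0 z0)"
      and wt: "Wt t0 z0 x0 \<le> \<delta> * ((- B * A t0 * z0\<^sup>2 - 1) * \<Lambda> t0 z0)"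
      and wzz: "Wzz t0 z0 x0 \<le> \<delta> * ((4 * (A t0)\<^sup>2 * z0\<^sup>2 + 2 * A t0) * \<Lambda> t0 z0)"
      using 1 2 by linarith+
    show ?thesis
      unfolding wz by (intro add_mono mult_left_mono order_refl sum_nonpos 3(2) c d wt wzz)
  qed
  also have "\<dots> = \<delta> * \<Lambda> t0 z0 * (- B * A t0 * z0\<^sup>2 - 1 + 2 * A t0 * (r t0 z0 * z0) + 4 * c * A t0 * (A t0 * z0\<^sup>2) + 2 * c * A t0)"
    by (simp add: algebra_simps power2_eq_square)
  also have "\<dots> < 0"
  proof -
    have "r t0 z0 * z0 \<le> \<bar>r t0 z0\<bar> * \<bar>z0\<bar>"
      by (metis abs_ge_self abs_mult)
    also have "\<dots> \<le> \<rho> * \<bar>z0\<bar> * \<bar>z0\<bar>"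
      by (intro mult_right_mono r[OF t0']) auto
    finally have "r t0 z0 * z0 \<le> \<rho> * z0\<^sup>2"
      by (simp add: power2_eq_square)
    then have "2 * A t0 * (r t0 z0 * z0) \<le> 2 * A t0 * (\<rho> * z0\<^sup>2)"
      using At by (intro mult_left_mono) auto
    moreover have "4 * c * A t0 * (A t0 * z0\<^sup>2) \<le> 1 * (A t0 * z0\<^sup>2)"
      using cA At by (intro mult_right_mono) auto
    moreover have "A t0 * z0\<^sup>2 \<ge> 0" using At by simp
    ultimately have "- B * A t0 * z0\<^sup>2 - 1 + 2 * A t0 * (r t0 z0 * z0) + 4 * c * A t0 * (A t0 * z0\<^sup>2) + 2 * c * A t0 < 0"
      using cA by (simp add: B_def algebra_simps)
    then show ?thesis using \<delta> \<Lambda>pos[of t0 z0] by (simp add: mult_pos_neg)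
  qed
  finally show False by simp
qed

subsection \<open>The heat equation on the strip\<close>

text \<open>It depends on the chosen representative and is meaningful only modulo
  \<open>2 * pi\<close>; it is used only inside sines and cosines.\<close>

definition phase :: "('n::finite \<Rightarrow> int) \<Rightarrow> 'n torus \<Rightarrow> real" where
  "phase k x = 2 * pi * (\<Sum>i\<in>UNIV. of_int (k i) * rep_torus x $ i)"

lemma phase_to_torus: "\<exists>m :: int. phase k (to_torus y) = 2 * pi * (\<Sum>i\<in>UNIV. of_int (k i) * y $ i) + 2 * pi * m"
proof -
  have "(\<Sum>i\<in>UNIV. of_int (k i) * (rep_torus (to_torus y) $ i - y $ i)) \<in> \<int>"
    by (intro Ints_sum Ints_mult Ints_of_int rep_torus_to_torus)
  then obtain m :: int where "(\<Sum>i\<in>UNIV. of_int (k i) * (rep_torus (to_torus y) $ i - y $ i)) = m"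
    by (rule Ints_cases)
  then have "(\<Sum>i\<in>UNIV. of_int (k i) * rep_torus (to_torus y) $ i) = (\<Sum>i\<in>UNIV. of_int (k i) * y $ i) + m"
    by (simp add: algebra_simps sum_subtractf)
  then show ?thesis
    unfolding phase_def by (intro exI[of _ m]) (simp only: distrib_left)
qed

lemma cos_phase_to_torus: "cos (phase k (to_torus y) + c) = cos (2 * pi * (\<Sum>i\<in>UNIV. of_int (k i) * y $ i) + c)"
proof -
  obtain m :: int where m: "phase k (to_torus y) = 2 * pi * (\<Sum>i\<in>UNIV. of_int (k i) * y $ i) + 2 * pi * m"
    using phase_to_torus by blast
  have "phase k (to_torus y) + c = (2 * pi * (\<Sum>i\<in>UNIV. of_int (k i) * y $ i) + c) + 2 * pi * m"
    using m by simp
  then have "sin (phase k (to_torus y) + c) = sin (2 * pi * (\<Sum>i\<in>UNIV. of_int (k i) * y $ i) + c)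
      \<and> cos (phase k (to_torus y) + c) = cos (2 * pi * (\<Sum>i\<in>UNIV. of_int (k i) * y $ i) + c)"
    unfolding sin_cos_eq_iff by (rule exI[of _ m])
  then show ?thesis ..
qed

lemma cos_phase_shift: "cos (phase k (torus_shift x (axis i h)) + c) = cos (phase k x + 2 * pi * of_int (k i) * h + c)"
proof -
  have "cos (phase k (torus_shift (to_torus (rep_torus x)) (axis i h)) + c)
      = cos (2 * pi * (\<Sum>j\<in>UNIV. of_int (k j) * (rep_torus x + axis i h) $ j) + c)"
    unfolding torus_shift_to_torus by (rule cos_phase_to_torus)
  also have "(\<Sum>j\<in>UNIV. of_int (k j) * (rep_torus x + axis i h) $ j)
      = (\<Sum>j\<in>UNIV. of_int (k j) * rep_torus x $ j + (if j = i then of_int (k i) * h else 0))"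
    by (intro sum.cong) (auto simp: axis_def distrib_left)
  also have "\<dots> = (\<Sum>j\<in>UNIV. of_int (k j) * rep_torus x $ j) + of_int (k i) * h"
    by (simp add: sum.distrib)
  also have "2 * pi * \<dots> + c = phase k x + 2 * pi * of_int (k i) * h + c"
    unfolding phase_def by (simp only: distrib_left mult.assoc)
  finally show ?thesis
    by simp
qed

lemma continuous_cos_phase: "continuous_on UNIV (\<lambda>x. cos (phase k x + c))"
  unfolding continuous_on_torus_iff cos_phase_to_torus by (intro continuous_intros)

lemma continuous_sin_phase: "continuous_on UNIV (\<lambda>x. sin (phase k x))"
proof -
  have "sin (phase k x) = cos (phase k x + (- pi / 2))" for x
    by (simp add: cos_diff)
  then show ?thesis
    using continuous_cos_phase[of k "- pi / 2"] by (simp only:)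
qed

text \<open>The separated solution of the heat equation with frequencies \<open>l\<close> in
  \<open>z\<close> and \<open>2 * pi * k\<close> in \<open>x\<close>. The offset
  \<open>\<theta>\<close> covers sines and cosines at once: a derivative in \<open>z\<close> or
  \<open>x\<close> is a factor times a shift of \<open>\<theta>\<close> by
  \<open>pi / 2\<close>.\<close>

definition wave :: "real \<Rightarrow> real \<Rightarrow> real \<Rightarrow> ('n::finite \<Rightarrow> int) \<Rightarrow> real \<Rightarrow> real \<Rightarrow> real \<Rightarrow> 'n torus \<Rightarrow> real" where
  "wave \<sigma> \<sigma>' l k \<theta> \<tau> z x =
     exp (- (\<sigma>\<^sup>2 / 2 * l\<^sup>2 + \<sigma>'\<^sup>2 / 2 * (\<Sum>i\<in>UNIV. (2 * pi * of_int (k i))\<^sup>2)) * \<tau>) * cos (phase k x + (l * z + \<theta>))"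

text \<open>Finite combinations of waves: a class of explicit solutions closed under all derivatives
  that occur, as Bernstein's method requires.\<close>

inductive heat_sol :: "real \<Rightarrow> real \<Rightarrow> (real \<Rightarrow> real \<Rightarrow> ('n::finite) torus \<Rightarrow> real) \<Rightarrow> bool" for \<sigma> \<sigma>' where
  heat_sol_wave: "heat_sol \<sigma> \<sigma>' (wave \<sigma> \<sigma>' l k \<theta>)"
| heat_sol_add: "heat_sol \<sigma> \<sigma>' \<psi> \<Longrightarrow> heat_sol \<sigma> \<sigma>' \<xi> \<Longrightarrow> heat_sol \<sigma> \<sigma>' (\<lambda>\<tau> z x. \<psi> \<tau> z x + \<xi> \<tau> z x)"
| heat_sol_scale: "heat_sol \<sigma> \<sigma>' \<psi> \<Longrightarrow> heat_sol \<sigma> \<sigma>' (\<lambda>\<tau> z x. c * \<psi> \<tau> z x)"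

lemma jc_wave: "jointly_continuous_on UNIV (wave \<sigma> \<sigma>' l k \<theta>)"
proof -
  have *: "jointly_continuous_on UNIV (\<lambda>t z x. f x)" if "continuous_on UNIV f" for f :: "'a torus \<Rightarrow> real"
    unfolding jointly_continuous_on_def split_def
    by (rule continuous_on_compose2[OF that]) (auto intro!: continuous_intros)
  have eq: "wave \<sigma> \<sigma>' l k \<theta> = (\<lambda>t z x. exp (- (\<sigma>\<^sup>2 / 2 * l\<^sup>2 + \<sigma>'\<^sup>2 / 2 * (\<Sum>i\<in>UNIV. (2 * pi * of_int (k i))\<^sup>2)) * t) *
     (cos (phase k x + 0) * cos (l * z + \<theta>) - sin (phase k x) * sin (l * z + \<theta>)))"
    unfolding wave_def fun_eq_iff by (simp add: cos_add)
  show ?thesis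
    unfolding eq
    by (intro jc_intros * continuous_cos_phase continuous_sin_phase jc_z jc_tz[of _ "\<lambda>t z. exp (_ * t)"])
       (auto intro!: continuous_intros simp: split_def)
qed

lemma jc_heat_sol: "heat_sol \<sigma> \<sigma>' \<psi> \<Longrightarrow> jointly_continuous_on UNIV \<psi>"
  by (induction rule: heat_sol.induct) (auto intro!: jc_wave jc_intros)

text \<open>Boundedness for nonnegative times supplies the growth condition of
  \<open>maximum_principle\<close>.\<close>

lemma heat_sol_bounded: "heat_sol \<sigma> \<sigma>' \<psi> \<Longrightarrow> \<exists>M. \<forall>\<tau>\<ge>0. \<forall>z x. \<bar>\<psi> \<tau> z x\<bar> \<le> M"
proof (induction rule: heat_sol.induct)
  case (heat_sol_wave l k \<theta>)
  have "\<bar>wave \<sigma> \<sigma>' l k \<theta> \<tau> z x\<bar> \<le> 1 * 1" if "\<tau> \<ge> 0" for \<tau> z x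
  proof -
    have "0 \<le> (\<sigma>\<^sup>2 / 2 * l\<^sup>2 + \<sigma>'\<^sup>2 / 2 * (\<Sum>i\<in>UNIV. (2 * pi * of_int (k i))\<^sup>2)) * \<tau>"
      using that by (intro mult_nonneg_nonneg add_nonneg_nonneg sum_nonneg) auto
    then have "\<bar>exp (- (\<sigma>\<^sup>2 / 2 * l\<^sup>2 + \<sigma>'\<^sup>2 / 2 * (\<Sum>i\<in>UNIV. (2 * pi * of_int (k i))\<^sup>2)) * \<tau>)\<bar> \<le> 1"
      by (simp only: mult_minus_left abs_exp_cancel exp_le_one_iff neg_le_0_iff_le)
    then show ?thesis
      unfolding wave_def abs_mult by (intro mult_mono abs_cos_le_one) auto
  qed
  then show ?case by auto
next
  case (heat_sol_add \<psi> \<xi>)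
  then obtain M N where "\<forall>\<tau>\<ge>0. \<forall>z x. \<bar>\<psi> \<tau> z x\<bar> \<le> M" "\<forall>\<tau>\<ge>0. \<forall>z x. \<bar>\<xi> \<tau> z x\<bar> \<le> N"
    by blast
  then show ?case
    by (intro exI[of _ "M + N"]) (auto intro!: order_trans[OF abs_triangle_ineq] add_mono)
next
  case (heat_sol_scale \<psi> c)
  then obtain M where "\<forall>\<tau>\<ge>0. \<forall>z x. \<bar>\<psi> \<tau> z x\<bar> \<le> M"
    by blast
  then show ?case
    by (intro exI[of _ "\<bar>c\<bar> * M"]) (auto simp: abs_mult intro!: mult_left_mono)
qed

text \<open>Every derivative is again a \<open>heat_sol\<close>, so it has a jet of its own; this is
  how the maximum principle gets applied to expressions in first derivatives.\<close>

definition heat_jet where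
  "heat_jet \<sigma> \<sigma>' \<psi> \<psi>t \<psi>z \<psi>zz \<psi>i \<psi>ii \<longleftrightarrow>
     heat_sol \<sigma> \<sigma>' \<psi> \<and> heat_sol \<sigma> \<sigma>' \<psi>t \<and> heat_sol \<sigma> \<sigma>' \<psi>z \<and> heat_sol \<sigma> \<sigma>' \<psi>zz \<and>
     (\<forall>i. heat_sol \<sigma> \<sigma>' (\<psi>i i) \<and> heat_sol \<sigma> \<sigma>' (\<psi>ii i)) \<and>
     C12_with UNIV \<psi> \<psi>t \<psi>z \<psi>zz \<psi>i \<psi>ii \<and>
     (\<forall>\<tau> z x. \<psi>t \<tau> z x = \<sigma>\<^sup>2 / 2 * \<psi>zz \<tau> z x + \<sigma>'\<^sup>2 / 2 * (\<Sum>i\<in>UNIV. \<psi>ii i \<tau> z x))"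

lemma heat_jetD:
  assumes "heat_jet \<sigma> \<sigma>' \<psi> \<psi>t \<psi>z \<psi>zz \<psi>i \<psi>ii"
  shows "heat_sol \<sigma> \<sigma>' \<psi>" "heat_sol \<sigma> \<sigma>' \<psi>t" "heat_sol \<sigma> \<sigma>' \<psi>z" "heat_sol \<sigma> \<sigma>' \<psi>zz"
    "heat_sol \<sigma> \<sigma>' (\<psi>i i)" "heat_sol \<sigma> \<sigma>' (\<psi>ii i)"
    "C12_with UNIV \<psi> \<psi>t \<psi>z \<psi>zz \<psi>i \<psi>ii"
    "\<psi>t \<tau> z x = \<sigma>\<^sup>2 / 2 * \<psi>zz \<tau> z x + \<sigma>'\<^sup>2 / 2 * (\<Sum>i\<in>UNIV. \<psi>ii i \<tau> z x)"
  using assms unfolding heat_jet_def by blast+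

lemma wave_derivatives:
  shows "((\<lambda>\<tau>. wave \<sigma> \<sigma>' l k \<theta> \<tau> z x) has_real_derivative
      - (\<sigma>\<^sup>2 / 2 * l\<^sup>2 + \<sigma>'\<^sup>2 / 2 * (\<Sum>i\<in>UNIV. (2 * pi * of_int (k i))\<^sup>2)) * wave \<sigma> \<sigma>' l k \<theta> \<tau> z x) (at \<tau>)"
    and "((\<lambda>z. wave \<sigma> \<sigma>' l k \<theta> \<tau> z x) has_real_derivative l * wave \<sigma> \<sigma>' l k (\<theta> + pi / 2) \<tau> z x) (at z)"
    and "((\<lambda>z. l * wave \<sigma> \<sigma>' l k (\<theta> + pi / 2) \<tau> z x) has_real_derivative - l\<^sup>2 * wave \<sigma> \<sigma>' l k \<theta> \<tau> z x) (at z)"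
    and "has_tpartial i (wave \<sigma> \<sigma>' l k \<theta> \<tau> z) (2 * pi * of_int (k i) * wave \<sigma> \<sigma>' l k (\<theta> + pi / 2) \<tau> z x) x"
    and "has_tpartial i (\<lambda>x. 2 * pi * of_int (k i) * wave \<sigma> \<sigma>' l k (\<theta> + pi / 2) \<tau> z x) (- (2 * pi * of_int (k i))\<^sup>2 * wave \<sigma> \<sigma>' l k \<theta> \<tau> z x) x"
proof -
  have c: "cos (a + (b + (\<theta> + pi / 2))) = - sin (a + (b + \<theta>))" for a b
    using cos_add[of "a + (b + \<theta>)" "pi / 2"] by (simp add: algebra_simps)
  show "((\<lambda>\<tau>. wave \<sigma> \<sigma>' l k \<theta> \<tau> z x) has_real_derivative
      - (\<sigma>\<^sup>2 / 2 * l\<^sup>2 + \<sigma>'\<^sup>2 / 2 * (\<Sum>i\<in>UNIV. (2 * pi * of_int (k i))\<^sup>2)) * wave \<sigma> \<sigma>' l k \<theta> \<tau> z x) (at \<tau>)"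
    unfolding wave_def by (auto intro!: derivative_eq_intros)
  show "((\<lambda>z. wave \<sigma> \<sigma>' l k \<theta> \<tau> z x) has_real_derivative l * wave \<sigma> \<sigma>' l k (\<theta> + pi / 2) \<tau> z x) (at z)"
    unfolding wave_def c by (auto intro!: derivative_eq_intros)
  show "((\<lambda>z. l * wave \<sigma> \<sigma>' l k (\<theta> + pi / 2) \<tau> z x) has_real_derivative - l\<^sup>2 * wave \<sigma> \<sigma>' l k \<theta> \<tau> z x) (at z)"
    unfolding wave_def c by (auto intro!: derivative_eq_intros simp: power2_eq_square)
  show "has_tpartial i (wave \<sigma> \<sigma>' l k \<theta> \<tau> z) (2 * pi * of_int (k i) * wave \<sigma> \<sigma>' l k (\<theta> + pi / 2) \<tau> z x) x"
    unfolding has_tpartial_def wave_def cos_phase_shift unfolding c by (auto intro!: derivative_eq_intros)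
  have "has_tpartial i (wave \<sigma> \<sigma>' l k (\<theta> + pi / 2) \<tau> z) (- (2 * pi * of_int (k i)) * wave \<sigma> \<sigma>' l k \<theta> \<tau> z x) x"
    unfolding has_tpartial_def wave_def cos_phase_shift unfolding c
    by (auto intro!: derivative_eq_intros)
  from has_tpartial_cmult[OF this, of "2 * pi * of_int (k i)"]
  show "has_tpartial i (\<lambda>x. 2 * pi * of_int (k i) * wave \<sigma> \<sigma>' l k (\<theta> + pi / 2) \<tau> z x) (- (2 * pi * of_int (k i))\<^sup>2 * wave \<sigma> \<sigma>' l k \<theta> \<tau> z x) x"
    by (rule has_tpartial_cong) (simp add: power2_eq_square)
qed

lemma ex_heat_jet: "heat_sol \<sigma> \<sigma>' \<psi> \<Longrightarrow> \<exists>\<psi>t \<psi>z \<psi>zz \<psi>i \<psi>ii. heat_jet \<sigma> \<sigma>' \<psi> \<psi>t \<psi>z \<psi>zz \<psi>i \<psi>ii"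
proof (induction rule: heat_sol.induct)
  case (heat_sol_wave l k \<theta>)
  let ?w = "wave \<sigma> \<sigma>' l k"
  have hs: "heat_sol \<sigma> \<sigma>' (\<lambda>\<tau> z x. c * ?w \<theta> \<tau> z x)" for c \<theta>
    by (intro heat_sol.intros)
  have "heat_jet \<sigma> \<sigma>' (?w \<theta>) (\<lambda>\<tau> z x. - (\<sigma>\<^sup>2 / 2 * l\<^sup>2 + \<sigma>'\<^sup>2 / 2 * (\<Sum>i\<in>UNIV. (2 * pi * of_int (k i))\<^sup>2)) * ?w \<theta> \<tau> z x)
     (\<lambda>\<tau> z x. l * ?w (\<theta> + pi / 2) \<tau> z x) (\<lambda>\<tau> z x. - l\<^sup>2 * ?w \<theta> \<tau> z x)
     (\<lambda>i \<tau> z x. 2 * pi * of_int (k i) * ?w (\<theta> + pi / 2) \<tau> z x) (\<lambda>i \<tau> z x. - (2 * pi * of_int (k i))\<^sup>2 * ?w \<theta> \<tau> z x)"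
    unfolding heat_jet_def C12_with_def
  proof (intro conjI allI ballI hs heat_sol.heat_sol_wave jc_heat_sol[OF hs] jc_wave wave_derivatives)
    fix \<tau> z x
    have "(\<Sum>i\<in>UNIV. - (2 * pi * of_int (k i))\<^sup>2 * ?w \<theta> \<tau> z x) = - (\<Sum>i\<in>UNIV. (2 * pi * of_int (k i))\<^sup>2) * ?w \<theta> \<tau> z x"
      by (simp add: sum_distrib_right sum_negf)
    then show "- (\<sigma>\<^sup>2 / 2 * l\<^sup>2 + \<sigma>'\<^sup>2 / 2 * (\<Sum>i\<in>UNIV. (2 * pi * of_int (k i))\<^sup>2)) * ?w \<theta> \<tau> z x =
      \<sigma>\<^sup>2 / 2 * (- l\<^sup>2 * ?w \<theta> \<tau> z x) + \<sigma>'\<^sup>2 / 2 * (\<Sum>i\<in>UNIV. - (2 * pi * of_int (k i))\<^sup>2 * ?w \<theta> \<tau> z x)"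
      by (simp only:) (simp add: algebra_simps)
  qed
  then show ?case by blast
next
  case (heat_sol_add \<psi> \<xi>)
  then obtain \<psi>t \<psi>z \<psi>zz \<psi>i \<psi>ii \<xi>t \<xi>z \<xi>zz \<xi>i \<xi>ii where
    h: "heat_jet \<sigma> \<sigma>' \<psi> \<psi>t \<psi>z \<psi>zz \<psi>i \<psi>ii" "heat_jet \<sigma> \<sigma>' \<xi> \<xi>t \<xi>z \<xi>zz \<xi>i \<xi>ii"
    by blast
  have "heat_jet \<sigma> \<sigma>' (\<lambda>\<tau> z x. \<psi> \<tau> z x + \<xi> \<tau> z x) (\<lambda>\<tau> z x. \<psi>t \<tau> z x + \<xi>t \<tau> z x) (\<lambda>\<tau> z x. \<psi>z \<tau> z x + \<xi>z \<tau> z x)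
     (\<lambda>\<tau> z x. \<psi>zz \<tau> z x + \<xi>zz \<tau> z x) (\<lambda>i \<tau> z x. \<psi>i i \<tau> z x + \<xi>i i \<tau> z x) (\<lambda>i \<tau> z x. \<psi>ii i \<tau> z x + \<xi>ii i \<tau> z x)"
    unfolding heat_jet_def C12_with_def
    by (intro conjI allI ballI heat_sol.heat_sol_add DERIV_add has_tpartial_add jc_add
          heat_jetD(1-6)[OF h(1)] heat_jetD(1-6)[OF h(2)] C12_withD[OF heat_jetD(7)[OF h(1)]] C12_withD[OF heat_jetD(7)[OF h(2)]] UNIV_I)
       (simp add: heat_jetD(8)[OF h(1)] heat_jetD(8)[OF h(2)] sum.distrib distrib_left)
  then show ?case by blast
next
  case (heat_sol_scale \<psi> c)
  then obtain \<psi>t \<psi>z \<psi>zz \<psi>i \<psi>ii where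
    h: "heat_jet \<sigma> \<sigma>' \<psi> \<psi>t \<psi>z \<psi>zz \<psi>i \<psi>ii"
    by blast
  have "heat_jet \<sigma> \<sigma>' (\<lambda>\<tau> z x. c * \<psi> \<tau> z x) (\<lambda>\<tau> z x. c * \<psi>t \<tau> z x) (\<lambda>\<tau> z x. c * \<psi>z \<tau> z x)
     (\<lambda>\<tau> z x. c * \<psi>zz \<tau> z x) (\<lambda>i \<tau> z x. c * \<psi>i i \<tau> z x) (\<lambda>i \<tau> z x. c * \<psi>ii i \<tau> z x)"
    unfolding heat_jet_def C12_with_def
    by (intro conjI allI ballI heat_sol.heat_sol_scale DERIV_cmult has_tpartial_cmult jc_mult jc_const
          heat_jetD(1-6)[OF h] C12_withD[OF heat_jetD(7)[OF h]] UNIV_I)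
       (simp add: heat_jetD(8)[OF h] sum_distrib_left[symmetric] algebra_simps)
  then show ?case by blast
qed

text \<open>Bernstein's method: for a directional derivative \<open>\<xi>\<close> of a solution \<open>\<psi>\<close> of the heat equation,
  \<open>\<tau> e\<^sup>2 \<xi>\<^sup>2 + \<psi>\<^sup>2\<close> is a subsolution.\<close>

lemma bernstein:
  assumes \<psi>: "heat_jet \<sigma> \<sigma>' \<psi> \<psi>t \<psi>z \<psi>zz \<psi>i (\<psi>ii :: 'n::finite \<Rightarrow> _)" and \<xi>: "heat_jet \<sigma> \<sigma>' \<xi> \<xi>t \<xi>z \<xi>zz \<xi>i \<xi>ii"
    and e: "\<And>\<tau> z x. e\<^sup>2 * (\<xi> \<tau> z x)\<^sup>2 \<le> \<sigma>\<^sup>2 * (\<psi>z \<tau> z x)\<^sup>2 + \<sigma>'\<^sup>2 * (\<Sum>i\<in>UNIV. (\<psi>i i \<tau> z x)\<^sup>2)"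
    and S: "\<And>z x. \<bar>\<psi> 0 z x\<bar> \<le> S" and \<tau>: "\<tau> \<ge> 0"
  shows "\<tau> * e\<^sup>2 * (\<xi> \<tau> z x)\<^sup>2 + (\<psi> \<tau> z x)\<^sup>2 \<le> S\<^sup>2"
proof (cases "\<tau> = 0")
  case True
  then show ?thesis using S[of z x] by (simp add: abs_le_square_iff[symmetric])
next
  case False
  have P: "C12_with UNIV \<psi> \<psi>t \<psi>z \<psi>zz \<psi>i \<psi>ii" and P2: "\<And>\<tau> z x. \<psi>t \<tau> z x = \<sigma>\<^sup>2 / 2 * \<psi>zz \<tau> z x + \<sigma>'\<^sup>2 / 2 * (\<Sum>i\<in>UNIV. \<psi>ii i \<tau> z x)"
    using \<psi> by (auto simp: heat_jet_def)
  have C: "C12_with UNIV \<xi> \<xi>t \<xi>z \<xi>zz \<xi>i \<xi>ii" and C2: "\<And>\<tau> z x. \<xi>t \<tau> z x = \<sigma>\<^sup>2 / 2 * \<xi>zz \<tau> z x + \<sigma>'\<^sup>2 / 2 * (\<Sum>i\<in>UNIV. \<xi>ii i \<tau> z x)"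
    using \<xi> by (auto simp: heat_jet_def)
  note p = C12_withD(1-5)[OF P UNIV_I] C12_withD(6-11)[OF P] and c = C12_withD(1-5)[OF C UNIV_I] C12_withD(6-11)[OF C]
  \<comment> \<open>Time is reversed: \<open>maximum_principle\<close> carries a bound from the
    final time backwards, and the final time \<open>t = \<tau>\<close> is the initial time of
    \<open>\<psi>\<close>.\<close>
  define f where "f t z x = (\<tau> - t) * e\<^sup>2 * (\<xi> (\<tau> - t) z x)\<^sup>2 + (\<psi> (\<tau> - t) z x)\<^sup>2 - S\<^sup>2" for t z x
  have rev: "((\<lambda>t. g (\<tau> - t)) has_real_derivative - g' (\<tau> - t)) (at t)"
    if "\<And>t. (g has_real_derivative g' t) (at t)" for g g' t
  proof -
    have "((\<lambda>t. \<tau> - t) has_real_derivative - 1) (at t)"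
      by (auto intro!: derivative_eq_intros)
    from DERIV_chain2[OF that this] show ?thesis by simp
  qed
  have "f 0 z x \<le> 0"
  proof (rule maximum_principle[where a = 0 and b = \<tau> and r = "\<lambda>t z. 0" and \<rho> = 0 and c = "\<sigma>\<^sup>2 / 2" and d = "\<sigma>'\<^sup>2 / 2" and W = f
      and Wt = "\<lambda>t z x. - e\<^sup>2 * (\<xi> (\<tau> - t) z x)\<^sup>2 - (\<tau> - t) * e\<^sup>2 * (2 * \<xi> (\<tau> - t) z x * \<xi>t (\<tau> - t) z x) - 2 * \<psi> (\<tau> - t) z x * \<psi>t (\<tau> - t) z x"
      and Wz = "\<lambda>t z x. (\<tau> - t) * e\<^sup>2 * (2 * \<xi> (\<tau> - t) z x * \<xi>z (\<tau> - t) z x) + 2 * \<psi> (\<tau> - t) z x * \<psi>z (\<tau> - t) z x"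
      and Wzz = "\<lambda>t z x. (\<tau> - t) * e\<^sup>2 * (2 * ((\<xi>z (\<tau> - t) z x)\<^sup>2 + \<xi> (\<tau> - t) z x * \<xi>zz (\<tau> - t) z x))
          + 2 * ((\<psi>z (\<tau> - t) z x)\<^sup>2 + \<psi> (\<tau> - t) z x * \<psi>zz (\<tau> - t) z x)"
      and Wi = "\<lambda>i t z x. (\<tau> - t) * e\<^sup>2 * (2 * (\<xi> (\<tau> - t) z x * \<xi>i i (\<tau> - t) z x)) + 2 * (\<psi> (\<tau> - t) z x * \<psi>i i (\<tau> - t) z x)"
      and Wii = "\<lambda>i t z x. (\<tau> - t) * e\<^sup>2 * (2 * (\<xi>i i (\<tau> - t) z x * \<xi>i i (\<tau> - t) z x + \<xi> (\<tau> - t) z x * \<xi>ii i (\<tau> - t) z x))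
          + 2 * (\<psi>i i (\<tau> - t) z x * \<psi>i i (\<tau> - t) z x + \<psi> (\<tau> - t) z x * \<psi>ii i (\<tau> - t) z x)"])
    show "jointly_continuous_on {0..\<tau>} f"
    proof -
      have "jointly_continuous_on {0..\<tau>} (\<lambda>t z x. \<xi> (\<tau> - t) z x)" "jointly_continuous_on {0..\<tau>} (\<lambda>t z x. \<psi> (\<tau> - t) z x)"
        by (rule jc_reparam[OF c(6)] jc_reparam[OF p(6)]; auto intro!: continuous_intros)+
      then show ?thesis
        unfolding f_def power2_eq_square
        by (intro jc_intros jc_tz[of _ "\<lambda>t z. \<tau> - t"]) (auto intro!: continuous_intros simp: split_def)
    qed
    fix t z x
    show "((\<lambda>t. f t z x) has_real_derivative - e\<^sup>2 * (\<xi> (\<tau> - t) z x)\<^sup>2 - (\<tau> - t) * e\<^sup>2 * (2 * \<xi> (\<tau> - t) z x * \<xi>t (\<tau> - t) z x) - 2 * \<psi> (\<tau> - t) z x * \<psi>t (\<tau> - t) z x) (at t)"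
      unfolding f_def
      by (rule DERIV_cong, (rule derivative_intros rev[of "\<lambda>t. \<xi> t z x" "\<lambda>t. \<xi>t t z x", OF c(1)] rev[of "\<lambda>t. \<psi> t z x" "\<lambda>t. \<psi>t t z x", OF p(1)])+)
         (simp add: algebra_simps)
    show "((\<lambda>z. f t z x) has_real_derivative (\<tau> - t) * e\<^sup>2 * (2 * \<xi> (\<tau> - t) z x * \<xi>z (\<tau> - t) z x) + 2 * \<psi> (\<tau> - t) z x * \<psi>z (\<tau> - t) z x) (at z)"
      unfolding f_def by (rule DERIV_cong, (rule derivative_intros c(2) p(2))+) (simp add: algebra_simps)
    show "((\<lambda>z. (\<tau> - t) * e\<^sup>2 * (2 * \<xi> (\<tau> - t) z x * \<xi>z (\<tau> - t) z x) + 2 * \<psi> (\<tau> - t) z x * \<psi>z (\<tau> - t) z x) has_real_derivative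
       (\<tau> - t) * e\<^sup>2 * (2 * ((\<xi>z (\<tau> - t) z x)\<^sup>2 + \<xi> (\<tau> - t) z x * \<xi>zz (\<tau> - t) z x))
          + 2 * ((\<psi>z (\<tau> - t) z x)\<^sup>2 + \<psi> (\<tau> - t) z x * \<psi>zz (\<tau> - t) z x)) (at z)"
      by (rule DERIV_cong, (rule derivative_intros c(2) p(2) c(3) p(3))+) (simp add: algebra_simps power2_eq_square)
    show "has_tpartial i (f t z) ((\<tau> - t) * e\<^sup>2 * (2 * (\<xi> (\<tau> - t) z x * \<xi>i i (\<tau> - t) z x)) + 2 * (\<psi> (\<tau> - t) z x * \<psi>i i (\<tau> - t) z x)) x" for i
      unfolding f_def[abs_def] power2_eq_square
      by (rule has_tpartial_cong, (rule has_tpartial_diff has_tpartial_add has_tpartial_cmult has_tpartial_const has_tpartial_mult[OF c(4) c(4)] has_tpartial_mult[OF p(4) p(4)])+)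
         (simp add: algebra_simps)
    show "has_tpartial i (\<lambda>x. (\<tau> - t) * e\<^sup>2 * (2 * (\<xi> (\<tau> - t) z x * \<xi>i i (\<tau> - t) z x)) + 2 * (\<psi> (\<tau> - t) z x * \<psi>i i (\<tau> - t) z x))
         ((\<tau> - t) * e\<^sup>2 * (2 * (\<xi>i i (\<tau> - t) z x * \<xi>i i (\<tau> - t) z x + \<xi> (\<tau> - t) z x * \<xi>ii i (\<tau> - t) z x))
          + 2 * (\<psi>i i (\<tau> - t) z x * \<psi>i i (\<tau> - t) z x + \<psi> (\<tau> - t) z x * \<psi>ii i (\<tau> - t) z x)) x" for i
      by (rule has_tpartial_cong, (rule has_tpartial_add has_tpartial_cmult has_tpartial_mult[OF c(4) c(5)] has_tpartial_mult[OF p(4) p(5)])+)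
         (simp add: algebra_simps)
    show "f \<tau> z x \<le> 0"
      using S[of z x] by (simp add: f_def abs_le_square_iff[symmetric])
  next
    fix t z x assume t: "t \<in> {0..<\<tau>}"
    let ?h = "\<tau> - t"
    have s: "(\<Sum>i\<in>UNIV. A * (2 * (\<xi>i i ?h z x * \<xi>i i ?h z x + \<xi> ?h z x * \<xi>ii i ?h z x))
          + 2 * (\<psi>i i ?h z x * \<psi>i i ?h z x + \<psi> ?h z x * \<psi>ii i ?h z x))
       = A * (2 * ((\<Sum>i\<in>UNIV. (\<xi>i i ?h z x)\<^sup>2) + \<xi> ?h z x * (\<Sum>i\<in>UNIV. \<xi>ii i ?h z x)))
          + 2 * ((\<Sum>i\<in>UNIV. (\<psi>i i ?h z x)\<^sup>2) + \<psi> ?h z x * (\<Sum>i\<in>UNIV. \<psi>ii i ?h z x))" for A :: real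
      by (simp add: sum_distrib_left sum.distrib power2_eq_square algebra_simps)
    \<comment> \<open>Once the two heat equations have cancelled, the factor
      \<open>\<tau> - t\<close> leaves \<open>- e\<^sup>2 * \<xi>\<^sup>2\<close>, which assumption
      \<open>e\<close> pays with the gradient of \<open>\<psi>\<close>. The gradient of
      \<open>\<xi>\<close> enters with the favourable sign, recorded here.\<close>
    have "0 \<le> ?h * e\<^sup>2 * (\<sigma>\<^sup>2 * (\<xi>z ?h z x)\<^sup>2 + \<sigma>'\<^sup>2 * (\<Sum>i\<in>UNIV. (\<xi>i i ?h z x)\<^sup>2))"
      using t by (intro mult_nonneg_nonneg add_nonneg_nonneg sum_nonneg) auto
    then show "0 \<le> - e\<^sup>2 * (\<xi> ?h z x)\<^sup>2 - ?h * e\<^sup>2 * (2 * \<xi> ?h z x * \<xi>t ?h z x) - 2 * \<psi> ?h z x * \<psi>t ?h z x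
       + 0 * (?h * e\<^sup>2 * (2 * \<xi> ?h z x * \<xi>z ?h z x) + 2 * \<psi> ?h z x * \<psi>z ?h z x)
       + \<sigma>\<^sup>2 / 2 * (?h * e\<^sup>2 * (2 * ((\<xi>z ?h z x)\<^sup>2 + \<xi> ?h z x * \<xi>zz ?h z x)) + 2 * ((\<psi>z ?h z x)\<^sup>2 + \<psi> ?h z x * \<psi>zz ?h z x))
       + \<sigma>'\<^sup>2 / 2 * (\<Sum>i\<in>UNIV. ?h * e\<^sup>2 * (2 * (\<xi>i i ?h z x * \<xi>i i ?h z x + \<xi> ?h z x * \<xi>ii i ?h z x))
          + 2 * (\<psi>i i ?h z x * \<psi>i i ?h z x + \<psi> ?h z x * \<psi>ii i ?h z x))"
      unfolding s C2 P2 using e[of ?h z x] by (simp add: algebra_simps)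
  next
    fix \<epsilon> :: real assume "\<epsilon> > 0"
    obtain M where M: "\<And>\<tau> z x. \<tau> \<ge> 0 \<Longrightarrow> \<bar>\<psi> \<tau> z x\<bar> \<le> M"
      using heat_sol_bounded[of \<sigma> \<sigma>' \<psi>] \<psi> unfolding heat_jet_def by blast
    obtain N where N: "\<And>\<tau> z x. \<tau> \<ge> 0 \<Longrightarrow> \<bar>\<xi> \<tau> z x\<bar> \<le> N"
      using heat_sol_bounded[of \<sigma> \<sigma>' \<xi>] \<xi> unfolding heat_jet_def by blast
    have "f t z x \<le> (\<tau> * e\<^sup>2 * N\<^sup>2 + M\<^sup>2) * exp (\<epsilon> * z\<^sup>2)" if t: "t \<in> {0..\<tau>}" for t z x
    proof -
      have "(\<psi> (\<tau> - t) z x)\<^sup>2 \<le> M\<^sup>2" "(\<xi> (\<tau> - t) z x)\<^sup>2 \<le> N\<^sup>2"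
        using M[of "\<tau> - t" z x] N[of "\<tau> - t" z x] t by (auto intro: power2_le_iff_abs_le[THEN iffD2])
      then have "f t z x \<le> \<tau> * e\<^sup>2 * N\<^sup>2 + M\<^sup>2 - 0"
        unfolding f_def using t by (intro diff_mono add_mono mult_mono) auto
      also have "\<dots> = (\<tau> * e\<^sup>2 * N\<^sup>2 + M\<^sup>2) * 1" by simp
      also have "\<dots> \<le> (\<tau> * e\<^sup>2 * N\<^sup>2 + M\<^sup>2) * exp (\<epsilon> * z\<^sup>2)"
        using \<tau> \<open>\<epsilon> > 0\<close> by (intro mult_left_mono) auto
      finally show ?thesis .
    qed
    then show "\<exists>K. \<forall>t\<in>{0..\<tau>}. \<forall>z x. f t z x \<le> K * exp (\<epsilon> * z\<^sup>2)" by blast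
  qed (use \<tau> in auto)
  then show ?thesis by (simp add: f_def)
qed

text \<open>Three instances of \<open>bernstein\<close>: \<open>e = 0\<close> for the supremum,
  \<open>e = \<sigma>\<close> with the \<open>z\<close>-derivative, and \<open>e = \<sigma>'\<close>
  with one \<open>x\<close>-derivative. The last two give the smoothing rate
  \<open>1 / sqrt \<tau>\<close>.\<close>

lemma heat_bounds:
  assumes \<psi>: "heat_jet \<sigma> \<sigma>' \<psi> \<psi>t \<psi>z \<psi>zz \<psi>i (\<psi>ii :: 'n::finite \<Rightarrow> _)"
    and S: "\<And>z x. \<bar>\<psi> 0 z x\<bar> \<le> S" and \<tau>: "\<tau> \<ge> 0"
  shows heat_sup_bound: "\<bar>\<psi> \<tau> z x\<bar> \<le> S"
    and heat_gradient_z_bound: "\<sigma> > 0 \<Longrightarrow> \<tau> > 0 \<Longrightarrow> \<bar>\<psi>z \<tau> z x\<bar> \<le> S / (\<sigma> * sqrt \<tau>)"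
    and heat_gradient_x_bound: "\<sigma>' > 0 \<Longrightarrow> \<tau> > 0 \<Longrightarrow> \<bar>\<psi>i j \<tau> z x\<bar> \<le> S / (\<sigma>' * sqrt \<tau>)"
proof -
  have S0: "S \<ge> 0" using S[of 0 undefined] by linarith
  have *: "\<bar>v\<bar> \<le> S / (e * sqrt \<tau>)" if "\<tau> * e\<^sup>2 * v\<^sup>2 \<le> S\<^sup>2" "e > 0" "\<tau> > 0" for v e
  proof -
    have "(e * sqrt \<tau> * \<bar>v\<bar>)\<^sup>2 \<le> S\<^sup>2"
      using that by (simp add: power_mult_distrib mult_ac)
    then have "e * sqrt \<tau> * \<bar>v\<bar> \<le> S"
      using S0 by (rule power2_le_imp_le)
    then show ?thesis using that by (simp add: pos_le_divide_eq mult_ac)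
  qed
  have "\<tau> * 0\<^sup>2 * (\<psi> \<tau> z x)\<^sup>2 + (\<psi> \<tau> z x)\<^sup>2 \<le> S\<^sup>2"
    by (rule bernstein[OF \<psi> \<psi> _ S \<tau>]) (auto intro!: add_nonneg_nonneg mult_nonneg_nonneg sum_nonneg)
  then show "\<bar>\<psi> \<tau> z x\<bar> \<le> S"
    using S0 by (simp add: abs_le_square_iff[symmetric])
  obtain a b c d f where z: "heat_jet \<sigma> \<sigma>' \<psi>z a b c d f"
    using ex_heat_jet[OF heat_jetD(3)[OF \<psi>]] by blast
  have "\<tau> * \<sigma>\<^sup>2 * (\<psi>z \<tau> z x)\<^sup>2 + (\<psi> \<tau> z x)\<^sup>2 \<le> S\<^sup>2"
    by (rule bernstein[OF \<psi> z _ S \<tau>]) (auto intro!: mult_nonneg_nonneg sum_nonneg)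
  then have "\<tau> * \<sigma>\<^sup>2 * (\<psi>z \<tau> z x)\<^sup>2 \<le> S\<^sup>2"
    by (smt (verit) zero_le_power2)
  then show "\<sigma> > 0 \<Longrightarrow> \<tau> > 0 \<Longrightarrow> \<bar>\<psi>z \<tau> z x\<bar> \<le> S / (\<sigma> * sqrt \<tau>)"
    by (rule *)
  obtain a b c d f where z: "heat_jet \<sigma> \<sigma>' (\<psi>i j) a b c d f"
    using ex_heat_jet[OF heat_jetD(5)[OF \<psi>]] by blast
  have "\<tau> * \<sigma>'\<^sup>2 * (\<psi>i j \<tau> z x)\<^sup>2 + (\<psi> \<tau> z x)\<^sup>2 \<le> S\<^sup>2"
  proof (rule bernstein[OF \<psi> z _ S \<tau>])
    fix \<tau> z x
    have "(\<psi>i j \<tau> z x)\<^sup>2 \<le> (\<Sum>i\<in>UNIV. (\<psi>i i \<tau> z x)\<^sup>2)"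
      by (intro member_le_sum) auto
    then have "\<sigma>'\<^sup>2 * (\<psi>i j \<tau> z x)\<^sup>2 \<le> \<sigma>'\<^sup>2 * (\<Sum>i\<in>UNIV. (\<psi>i i \<tau> z x)\<^sup>2)"
      by (intro mult_left_mono) auto
    then show "\<sigma>'\<^sup>2 * (\<psi>i j \<tau> z x)\<^sup>2 \<le> \<sigma>\<^sup>2 * (\<psi>z \<tau> z x)\<^sup>2 + \<sigma>'\<^sup>2 * (\<Sum>i\<in>UNIV. (\<psi>i i \<tau> z x)\<^sup>2)"
      by (simp add: add_increasing)
  qed
  then have "\<tau> * \<sigma>'\<^sup>2 * (\<psi>i j \<tau> z x)\<^sup>2 \<le> S\<^sup>2"
    by (smt (verit) zero_le_power2)
  then show "\<sigma>' > 0 \<Longrightarrow> \<tau> > 0 \<Longrightarrow> \<bar>\<psi>i j \<tau> z x\<bar> \<le> S / (\<sigma>' * sqrt \<tau>)"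
    by (rule *)
qed

section \<open>Trigonometric polynomials and uniform approximation\<close>

inductive trig :: "(real \<Rightarrow> ('n::finite) torus \<Rightarrow> real) \<Rightarrow> bool" where
  trig_cos: "trig (\<lambda>z x. cos (phase k x + (l * z + \<theta>)))"
| trig_add: "trig p \<Longrightarrow> trig q \<Longrightarrow> trig (\<lambda>z x. p z x + q z x)"
| trig_scale: "trig p \<Longrightarrow> trig (\<lambda>z x. c * p z x)"

lemma trig_heat_sol: "trig p \<Longrightarrow> \<exists>\<psi>. heat_sol \<sigma> \<sigma>' \<psi> \<and> \<psi> 0 = p"
proof (induction rule: trig.induct)
  case (trig_cos k l \<theta>)
  have "wave \<sigma> \<sigma>' l k \<theta> 0 = (\<lambda>z x. cos (phase k x + (l * z + \<theta>)))"
    by (simp add: wave_def fun_eq_iff)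
  then show ?case using heat_sol_wave by blast
next
  case (trig_add p q)
  then obtain \<psi> \<xi> where "heat_sol \<sigma> \<sigma>' \<psi>" "\<psi> 0 = p" "heat_sol \<sigma> \<sigma>' \<xi>" "\<xi> 0 = q"
    by blast
  then show ?case
    by (intro exI[of _ "\<lambda>\<tau> z x. \<psi> \<tau> z x + \<xi> \<tau> z x"]) (simp add: heat_sol_add)
next
  case (trig_scale p c)
  then obtain \<psi> where "heat_sol \<sigma> \<sigma>' \<psi>" "\<psi> 0 = p"
    by blast
  then show ?case
    by (intro exI[of _ "\<lambda>\<tau> z x. c * \<psi> \<tau> z x"]) (simp add: heat_sol_scale)
qed

text \<open>The product-to-sum formula. It makes the class an algebra, so that a polynomial in the
  coordinates of \<open>embed\<close> stays inside it.\<close>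

lemma trig_mult: "trig p \<Longrightarrow> trig q \<Longrightarrow> trig (\<lambda>z x. p z x * q z x)"
proof (induction rule: trig.induct)
  case (trig_cos k l \<theta>)
  then show ?case
  proof (induction rule: trig.induct)
    case (trig_cos k' l' \<theta>')
    have ph: "phase (\<lambda>i. k i + k' i) x = phase k x + phase k' x" "phase (\<lambda>i. k i - k' i) x = phase k x - phase k' x" for x
      by (simp_all add: phase_def algebra_simps sum.distrib sum_subtractf)
    have eq: "cos (phase k x + (l * z + \<theta>)) * cos (phase k' x + (l' * z + \<theta>')) =
       1 / 2 * cos (phase (\<lambda>i. k i - k' i) x + ((l - l') * z + (\<theta> - \<theta>')))
       + 1 / 2 * cos (phase (\<lambda>i. k i + k' i) x + ((l + l') * z + (\<theta> + \<theta>')))" for z x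
    proof -
      have 1: "phase (\<lambda>i. k i - k' i) x + ((l - l') * z + (\<theta> - \<theta>')) = (phase k x + (l * z + \<theta>)) - (phase k' x + (l' * z + \<theta>'))"
        and 2: "phase (\<lambda>i. k i + k' i) x + ((l + l') * z + (\<theta> + \<theta>')) = (phase k x + (l * z + \<theta>)) + (phase k' x + (l' * z + \<theta>'))"
        by (simp_all add: ph left_diff_distrib distrib_right)
      show ?thesis unfolding 1 2 cos_add[of "phase k x + (l * z + \<theta>)"] cos_diff[of "phase k x + (l * z + \<theta>)"]
        by (simp add: field_simps)
    qed
    show ?case unfolding eq by (intro trig.intros)
  next
    case (trig_add p q)
    then show ?case by (simp add: distrib_left trig.trig_add)
  next
    case (trig_scale p c)
    then show ?case by (simp add: mult.left_commute trig.trig_scale)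
  qed
next
  case (trig_add p q)
  then show ?case by (simp add: distrib_right trig.trig_add)
next
  case (trig_scale p c)
  then show ?case by (simp add: mult.assoc trig.trig_scale)
qed

lemma trig_const: "trig (\<lambda>z x. c)"
  using trig_scale[OF trig_cos[of "\<lambda>_. 0" 0 0], of c] by (simp add: phase_def)

lemma trig_sum: "finite I \<Longrightarrow> (\<And>i. i \<in> I \<Longrightarrow> trig (p i)) \<Longrightarrow> trig (\<lambda>z x. \<Sum>i\<in>I. p i z x)"
  by (induction I rule: finite_induct) (auto intro: trig_const trig_add)

text \<open>A map of signal and position into a Euclidean space whose coordinates are trigonometric
  polynomials. It carries approximation by ordinary polynomials on a compact set over to the
  strip.\<close>

definition embed :: "real \<Rightarrow> real \<times> ('n::finite) torus \<Rightarrow> real \<times> real \<times> (real ^ 'n) \<times> (real ^ 'n)" where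
  "embed l p = (cos (l * fst p), sin (l * fst p),
     (\<chi> i. cos (2 * pi * rep_torus (snd p) $ i)), (\<chi> i. sin (2 * pi * rep_torus (snd p) $ i)))"

lemma phase_unit: "phase (\<lambda>j. if j = i then 1 else 0) x = 2 * pi * rep_torus x $ i"
proof -
  have "(\<Sum>j\<in>UNIV. of_int (if j = i then 1 else 0) * rep_torus x $ j) = (\<Sum>j\<in>UNIV. if j = i then rep_torus x $ i else 0)"
    by (intro sum.cong) auto
  then show ?thesis by (simp add: phase_def)
qed

lemma continuous_embed: "continuous_on UNIV (embed l :: real \<times> ('n::finite) torus \<Rightarrow> _)"
proof -
  have 1: "continuous_on UNIV (\<lambda>p :: real \<times> 'n torus. cos (l * fst p))" "continuous_on UNIV (\<lambda>p :: real \<times> 'n torus. sin (l * fst p))"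
    by (rule continuous_on_compose2[of UNIV "\<lambda>z. cos (l * z)"] continuous_on_compose2[of UNIV "\<lambda>z. sin (l * z)"];
        auto intro!: continuous_intros)+
  have 2: "continuous_on UNIV (\<lambda>p :: real \<times> 'n torus. cos (phase k (snd p)))" "continuous_on UNIV (\<lambda>p :: real \<times> 'n torus. sin (phase k (snd p)))" for k
    using continuous_on_compose2[OF continuous_sin_phase continuous_on_snd[OF continuous_on_id]]
      continuous_on_compose2[OF continuous_cos_phase[where c = 0] continuous_on_snd[OF continuous_on_id]] by auto
  show ?thesis
    unfolding embed_def phase_unit[symmetric]
    by (intro continuous_on_Pair continuous_on_vec_lambda 1 2)
qed

lemma trig_polynomial: "real_polynomial_function f \<Longrightarrow> trig (\<lambda>z x. f (embed l (z, x)))"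
proof (induction rule: real_polynomial_function.induct)
  case (linear f)
  then interpret bounded_linear f .
  let ?k = "\<lambda>i j. if j = i then 1 else 0 :: int"
  have expand: "f (a, b, u, v) = a * f (1, 0, 0, 0) + b * f (0, 1, 0, 0)
      + (\<Sum>i\<in>UNIV. u $ i * f (0, 0, axis i 1, 0)) + (\<Sum>i\<in>UNIV. v $ i * f (0, 0, 0, axis i 1))" for a b u v
  proof -
    have u: "(0, 0, u, 0) = (\<Sum>i\<in>UNIV. u $ i *\<^sub>R (0, 0, axis i 1, 0))"
      and v: "(0, 0, 0, v) = (\<Sum>i\<in>UNIV. v $ i *\<^sub>R (0, 0, 0, axis i 1))"
      using basis_expansion[of u] basis_expansion[of v]
      by (simp_all add: sum_prod prod_eq_iff fst_sum snd_sum scalar_mult_eq_scaleR)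
    have "(a, b, u, v) = a *\<^sub>R (1, 0, 0, 0) + b *\<^sub>R (0, 1, 0, 0) + (0, 0, u, 0) + (0, 0, 0, v)"
      by simp
    then have "f (a, b, u, v) = a * f (1, 0, 0, 0) + b * f (0, 1, 0, 0) + f (0, 0, u, 0) + f (0, 0, 0, v)"
      by (simp only: add scaleR real_scaleR_def)
    moreover have "f (0, 0, u, 0) = (\<Sum>i\<in>UNIV. u $ i * f (0, 0, axis i 1, 0))"
      "f (0, 0, 0, v) = (\<Sum>i\<in>UNIV. v $ i * f (0, 0, 0, axis i 1))"
      by (subst u v; simp only: sum scaleR real_scaleR_def)+
    ultimately show ?thesis by (simp only:)
  qed
  have c: "trig (\<lambda>z x. cos (l * z))" and s: "trig (\<lambda>z x. sin (l * z))"
    using trig_cos[of "\<lambda>_. 0" l 0] trig_cos[of "\<lambda>_. 0" l "- pi / 2"] by (simp_all add: phase_def cos_diff)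
  have ci: "trig (\<lambda>z x. cos (2 * pi * rep_torus x $ i))" and si: "trig (\<lambda>z x. sin (2 * pi * rep_torus x $ i))" for i :: 'a
    using trig_cos[of "?k i" 0 0] trig_cos[of "?k i" 0 "- pi / 2"] by (simp_all add: phase_unit cos_diff)
  have eq: "f (embed l (z, x)) = cos (l * z) * f (1, 0, 0, 0) + sin (l * z) * f (0, 1, 0, 0)
      + (\<Sum>i\<in>UNIV. cos (2 * pi * rep_torus x $ i) * f (0, 0, axis i 1, 0))
      + (\<Sum>i\<in>UNIV. sin (2 * pi * rep_torus x $ i) * f (0, 0, 0, axis i 1))" for z x
    unfolding embed_def fst_conv snd_conv by (subst expand) (simp only: vec_lambda_beta)
  show ?case
    unfolding eq by (intro trig_add trig_sum trig_mult c s ci si trig_const) auto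
qed (auto intro: trig_const trig_add trig_mult)

text \<open>The frequency is such that \<open>l * z\<close> stays in the interval from
  \<open>- pi / 2\<close> to \<open>pi / 2\<close>, where the sine is injective. Sine and cosine of
  \<open>2 * pi\<close> times a coordinate determine it modulo 1.\<close>

lemma inj_on_embed:
  assumes "R > 0" "l = pi / (2 * R)"
  shows "inj_on (embed l) (strip R :: (real \<times> ('n::finite) torus) set)"
proof (rule inj_onI, clarify)
  fix z x z' and x' :: "'n torus"
  assume z: "z \<in> {-R..R}" "z' \<in> {-R..R}" and eq: "embed l (z, x) = embed l (z', x')"
  have "sin (l * z) = sin (l * z')"
    using eq by (simp add: embed_def)
  moreover have "\<bar>l * v\<bar> \<le> pi / 2" if "v \<in> {-R..R}" for v
  proof -
    have "\<bar>l * v\<bar> \<le> pi / (2 * R) * R"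
      unfolding abs_mult assms(2) using that assms(1) by (intro mult_mono) auto
    then show ?thesis using assms(1) by simp
  qed
  then have "- (pi / 2) \<le> l * z" "l * z \<le> pi / 2" "- (pi / 2) \<le> l * z'" "l * z' \<le> pi / 2"
    using z unfolding abs_le_iff by (auto simp: minus_le_iff)
  ultimately have "l * z = l * z'"
    by (rule sin_inj_pi[rotated -1])
  then have "z = z'" using assms by simp
  have "rep_torus x $ i - rep_torus x' $ i \<in> \<int>" for i
  proof -
    have "sin (2 * pi * rep_torus x $ i) = sin (2 * pi * rep_torus x' $ i) \<and> cos (2 * pi * rep_torus x $ i) = cos (2 * pi * rep_torus x' $ i)"
      using eq by (simp add: embed_def vec_eq_iff)
    then obtain n :: int where "2 * pi * rep_torus x $ i = 2 * pi * rep_torus x' $ i + 2 * pi * n"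
      unfolding sin_cos_eq_iff by blast
    then have "2 * pi * (rep_torus x $ i - rep_torus x' $ i) = 2 * pi * n"
      by (simp add: right_diff_distrib)
    then have "rep_torus x $ i - rep_torus x' $ i = n"
      by simp
    then show ?thesis by simp
  qed
  then have "to_torus (rep_torus x) = to_torus (rep_torus x')"
    unfolding to_torus_eq_iff by blast
  then show "z = z' \<and> x = x'"
    using \<open>z = z'\<close> by simp
qed

text \<open>The approximation is needed on the strip only, but the bound
  \<open>1 + \<epsilon>\<close> for every \<open>z\<close>, since the heat flow sees all initial
  values. Hence the function transported by \<open>embed\<close> is first extended by Tietze's
  theorem with the same bound 1, and then approximated on a cube that contains the image of every
  point.\<close>

lemma trig_approximation:
  fixes f :: "real \<times> ('n::finite) torus \<Rightarrow> real"
  assumes f: "continuous_on (strip R) f" "\<And>p. p \<in> strip R \<Longrightarrow> \<bar>f p\<bar> \<le> 1" and R: "R > 0" and \<epsilon>: "\<epsilon> > 0"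
  obtains p where "trig p" "\<And>z x. \<bar>p z x\<bar> \<le> 1 + \<epsilon>" "\<And>z x. \<bar>z\<bar> \<le> R \<Longrightarrow> \<bar>p z x - f (z, x)\<bar> \<le> \<epsilon>"
proof -
  define l where "l = pi / (2 * R)"
  let ?S = "embed l ` (strip R :: (real \<times> 'n torus) set)"
  let ?K = "{-1..1} \<times> {-1..1} \<times> cbox (- 1) 1 \<times> cbox (- 1) 1 :: (real \<times> real \<times> (real ^ 'n) \<times> (real ^ 'n)) set"
  obtain g where "homeomorphism (strip R) ?S (embed l) g"
    using homeomorphism_compact[OF compact_strip continuous_on_subset[OF continuous_embed] refl inj_on_embed[OF R l_def]]
    by blast
  then have g: "continuous_on ?S g" "g ` ?S = strip R" "\<And>p. p \<in> strip R \<Longrightarrow> g (embed l p) = p"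
    by (auto simp: homeomorphism_def)
  have S: "compact ?S"
    by (intro compact_continuous_image continuous_on_subset[OF continuous_embed] compact_strip) auto
  have "continuous_on ?S (\<lambda>y. f (g y))"
    by (rule continuous_on_compose2[OF f(1) g(1)]) (use g(2) in auto)
  moreover have "closedin (top_of_set UNIV) ?S"
    using S by (simp add: compact_imp_closed)
  moreover have "norm (f (g y)) \<le> 1" if "y \<in> ?S" for y
  proof -
    have "g y \<in> strip R" using g(2) that by blast
    then show ?thesis using f(2) by simp
  qed
  ultimately obtain h where h: "continuous_on UNIV h" "\<And>y. y \<in> ?S \<Longrightarrow> h y = f (g y)" "\<And>y. y \<in> UNIV \<Longrightarrow> norm (h y) \<le> 1"
    using Tietze[of ?S "\<lambda>y. f (g y)" UNIV 1] zero_le_one by blast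
  have K: "compact ?K"
    by (intro compact_Times compact_Icc compact_cbox)
  obtain q where q: "real_polynomial_function q" "\<And>y. y \<in> ?K \<Longrightarrow> \<bar>h y - q y\<bar> < \<epsilon>"
    using Stone_Weierstrass_real_polynomial_function[OF K continuous_on_subset[OF h(1)] \<epsilon>] by blast
  have inK: "embed l p \<in> ?K" for p
    by (auto simp: embed_def mem_box_cart)
  show thesis
  proof (rule that[of "\<lambda>z x. q (embed l (z, x))"])
    show "trig (\<lambda>z x. q (embed l (z, x)))"
      by (rule trig_polynomial[OF q(1)])
    show "\<bar>q (embed l (z, x))\<bar> \<le> 1 + \<epsilon>" for z x
      using q(2)[OF inK, of "(z, x)"] h(3)[OF UNIV_I, of "embed l (z, x)"] unfolding real_norm_def by linarith
    show "\<bar>q (embed l (z, x)) - f (z, x)\<bar> \<le> \<epsilon>" if "\<bar>z\<bar> \<le> R" for z x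
    proof -
      have "(z, x) \<in> strip R" using that by (auto simp: abs_le_iff)
      then have "h (embed l (z, x)) = f (z, x)"
        using h(2)[of "embed l (z, x)"] g(3)[of "(z, x)"] by auto
      then show ?thesis
        using q(2)[OF inK, of "(z, x)"] by linarith
    qed
  qed
qed

subsection \<open>Uniqueness for the Fokker--Planck equation\<close>

lemma zx_integral_mono:
  assumes "integrable zx (\<lambda>(z, x). f z x)" "integrable zx (\<lambda>(z, x). g z x)" "\<And>z x. f z x \<le> g z x"
  shows "(\<integral>(z, x). f z x \<partial>zx) \<le> (\<integral>(z, x). g z x \<partial>(zx :: (real \<times> ('n::finite) torus) measure) :: real)"
  by (rule Bochner_Integration.integral_mono[OF assms(1,2)]) (use assms(3) in auto)

lemma zx_integrable_bound:
  fixes f g :: "real \<Rightarrow> ('n::finite) torus \<Rightarrow> real"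
  assumes "(\<lambda>(z, x). f z x) \<in> borel_measurable zx" "integrable zx (\<lambda>(z, x). g z x)" "\<And>z x. \<bar>f z x\<bar> \<le> g z x"
  shows "integrable zx (\<lambda>(z, x). f z x)" "\<bar>\<integral>(z, x). f z x \<partial>zx\<bar> \<le> (\<integral>(z, x). g z x \<partial>zx)"
proof -
  show i: "integrable zx (\<lambda>(z, x). f z x)"
    by (rule Bochner_Integration.integrable_bound[OF assms(2,1)])
       (use order_trans[OF assms(3) abs_ge_self] in \<open>auto intro!: AE_I2\<close>)
  have "\<bar>\<integral>(z, x). f z x \<partial>zx\<bar> \<le> (\<integral>p. \<bar>(\<lambda>(z, x). f z x) p\<bar> \<partial>zx)"
    using integral_norm_bound[of zx "\<lambda>(z, x). f z x"] by simp
  also have "\<dots> \<le> (\<integral>(z, x). g z x \<partial>zx)"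
    by (rule Bochner_Integration.integral_mono) (use i assms in auto)
  finally show "\<bar>\<integral>(z, x). f z x \<partial>zx\<bar> \<le> (\<integral>(z, x). g z x \<partial>zx)" .
qed

lemma zx_cmult:
  "integrable zx (\<lambda>(z, x). f z x) \<Longrightarrow> integrable zx (\<lambda>(z, x). c * f z x :: real)"
  "(\<integral>(z, x). c * f z x \<partial>zx) = c * (\<integral>(z, x). f z x \<partial>zx :: real)"
  by (simp_all add: split_def)

lemma zx_add:
  assumes "integrable zx (\<lambda>(z, x). f z x)" "integrable zx (\<lambda>(z, x). g z x)"
  shows "integrable zx (\<lambda>(z, x). f z x + g z x :: real)"
  "(\<integral>(z, x). f z x + g z x \<partial>zx) = (\<integral>(z, x). f z x \<partial>zx) + (\<integral>(z, x). g z x \<partial>zx :: real)"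
  using assms by (simp_all add: split_def)

lemma zx_diff:
  assumes "integrable zx (\<lambda>(z, x). f z x)" "integrable zx (\<lambda>(z, x). g z x)"
  shows "integrable zx (\<lambda>(z, x). f z x - g z x :: real)"
  "(\<integral>(z, x). f z x - g z x \<partial>zx) = (\<integral>(z, x). f z x \<partial>zx) - (\<integral>(z, x). g z x \<partial>zx :: real)"
  using assms by (simp_all add: split_def)

lemma zx_abs:
  "integrable zx (\<lambda>(z, x). f z x) \<Longrightarrow> integrable zx (\<lambda>(z, x). \<bar>f z x\<bar> :: real)"
  by (drule integrable_abs) (simp add: split_def)

lemma measurable_jc:
  assumes "jointly_continuous_on A f" "t \<in> A"
  shows "(\<lambda>(z, x). f t z x) \<in> borel_measurable (zx :: (real \<times> ('n::finite) torus) measure)"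
  by (rule continuous_measurable_zx[OF jc_slice[OF assms]])

lemma open_sets_zx: "open S \<Longrightarrow> S \<in> sets (zx :: (real \<times> ('n::finite) torus) measure)"
  unfolding sets_zx by (rule borel_open)

lemma emeasure_zx_open_pos:
  fixes S :: "(real \<times> ('n::finite) torus) set"
  assumes "open S" "p \<in> S"
  shows "emeasure zx S > 0"
proof -
  obtain U V where UV: "open U" "open V" "p \<in> U \<times> V" "U \<times> V \<subseteq> S"
    using open_prod_elim[OF assms] by blast
  then obtain e where e: "e > 0" "ball (fst p) e \<subseteq> U"
    using open_contains_ball by (metis mem_Times_iff)
  have "emeasure lborel {fst p<..<fst p + e} \<le> emeasure lborel U"
    using e UV(1) by (intro emeasure_mono) (auto simp: subset_iff dist_real_def)
  then have "0 < emeasure lborel U"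
    using e(1) by (simp add: emeasure_lborel_Ioo) (metis ennreal_less_zero_iff less_le_trans)
  moreover have "0 < emeasure torus_lebesgue V"
    using emeasure_torus_lebesgue_open_pos[OF UV(2), of "snd p"] UV(3) by (simp add: mem_Times_iff)
  moreover have "emeasure zx (U \<times> V) = emeasure lborel U * emeasure torus_lebesgue V"
    using UV(1,2) by (intro torus_lebesgue.emeasure_pair_measure_Times) auto
  ultimately have "0 < emeasure zx (U \<times> V)"
    by (simp add: ennreal_zero_less_mult_iff)
  also have "\<dots> \<le> emeasure zx S"
    by (rule emeasure_mono[OF UV(4) open_sets_zx[OF assms(1)]])
  finally show ?thesis .
qed

lemma continuous_integral_zero:
  fixes f :: "real \<times> ('n::finite) torus \<Rightarrow> real"
  assumes f: "continuous_on UNIV f" "integrable zx f" "\<And>p. f p \<ge> 0" "integral\<^sup>L zx f = 0"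
  shows "f p = 0"
proof (rule ccontr)
  assume "f p \<noteq> 0"
  then have p: "p \<in> {p. f p > 0}" using f(3)[of p] by simp
  have o: "open {p. f p > 0}"
    by (intro open_Collect_less continuous_on_const f(1))
  have "AE p in zx. f p = 0"
    using integral_nonneg_eq_0_iff_AE[OF f(2)] f(3,4) by auto
  then have "AE p in zx. p \<notin> {p. f p > 0}"
    by (rule AE_mp) (auto intro!: AE_I2)
  then have "emeasure zx {p. f p > 0} = 0"
    by (subst (asm) AE_iff_measurable[OF open_sets_zx[OF o]]) (auto simp: space_pair_measure)
  then show False
    using emeasure_zx_open_pos[OF o p] by simp
qed

text \<open>Bounds on time derivatives are integrated by comparison with an explicit antiderivative
  \<open>h\<close>. Only continuity is asked at the ends, so \<open>h'\<close> may be singular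
  there, as for \<open>h\<close> built from \<open>sqrt (t1 - t)\<close>.\<close>

lemma increment_bound:
  fixes I h :: "real \<Rightarrow> real"
  assumes ab: "a \<le> b" and c: "continuous_on {a..b} I" "continuous_on {a..b} h"
    and d: "\<And>t. a < t \<Longrightarrow> t < b \<Longrightarrow> (I has_real_derivative I' t) (at t)"
      "\<And>t. a < t \<Longrightarrow> t < b \<Longrightarrow> (h has_real_derivative h' t) (at t)"
      "\<And>t. a < t \<Longrightarrow> t < b \<Longrightarrow> I' t \<le> h' t"
  shows "I b - I a \<le> h b - h a"
proof (cases "a = b")
  case False
  have "(\<lambda>t. h t - I t) a \<le> (\<lambda>t. h t - I t) b"
  proof (rule DERIV_nonneg_imp_increasing_open[OF ab])
    show "\<exists>y. ((\<lambda>t. h t - I t) has_real_derivative y) (at t) \<and> 0 \<le> y" if "a < t" "t < b" for t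
      using DERIV_diff[OF d(2)[OF that] d(1)[OF that]] d(3)[OF that] by (intro exI[of _ "h' t - I' t"]) simp
    show "continuous_on {a..b} (\<lambda>t. h t - I t)"
      by (intro continuous_on_diff c)
  qed
  then show ?thesis by simp
qed simp

lemma abs_increment_bound:
  fixes I h :: "real \<Rightarrow> real"
  assumes ab: "a \<le> b" and c: "continuous_on {a..b} I" "continuous_on {a..b} h"
    and d: "\<And>t. a < t \<Longrightarrow> t < b \<Longrightarrow> (I has_real_derivative I' t) (at t)"
      "\<And>t. a < t \<Longrightarrow> t < b \<Longrightarrow> (h has_real_derivative h' t) (at t)"
      "\<And>t. a < t \<Longrightarrow> t < b \<Longrightarrow> \<bar>I' t\<bar> \<le> h' t"
  shows "\<bar>I b - I a\<bar> \<le> h b - h a"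
proof -
  have "I b - I a \<le> h b - h a"
    by (rule increment_bound[OF ab c d(1,2)]) (use d(3) abs_ge_self order_trans in blast)+
  moreover have "- I b - - I a \<le> h b - h a"
    by (rule increment_bound[OF ab continuous_on_minus[OF c(1)] c(2) DERIV_minus[OF d(1)] d(2)])
       (use d(3) abs_ge_minus_self order_trans in blast)+
  ultimately show ?thesis by linarith
qed

lemma jc_uniform_at:
  fixes f :: "real \<Rightarrow> real \<Rightarrow> ('n::finite) torus \<Rightarrow> real"
  assumes f: "jointly_continuous_on A f" "t0 \<in> A" and e: "e > 0"
  shows "eventually (\<lambda>t. \<forall>z x. \<bar>z\<bar> \<le> R \<longrightarrow> \<bar>f t z x - f t0 z x\<bar> \<le> e) (at t0 within A)"
proof -
  have "continuous_on (A \<times> strip R) (\<lambda>(t, z, x). f t z x)"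
    using f(1) unfolding jointly_continuous_on_def by (rule continuous_on_subset) auto
  from continuous_on_prod_compactE[OF this compact_strip f(2) e]
  obtain X0 where X0: "t0 \<in> X0" "open X0" 
    "\<forall>t\<in>X0 \<inter> A. \<forall>p\<in>strip R. dist ((\<lambda>(t, z, x). f t z x) (t, p)) ((\<lambda>(t, z, x). f t z x) (t0, p)) \<le> e"
    by blast
  have "\<bar>f t z x - f t0 z x\<bar> \<le> e" if "t \<in> X0" "t \<in> A" "\<bar>z\<bar> \<le> R" for t z x
  proof -
    have "(z, x) \<in> strip R" using that(3) by (auto simp: abs_le_iff)
    then show ?thesis using X0(3) that by (fastforce simp: dist_real_def)
  qed
  then show ?thesis
    unfolding eventually_at_topological using X0(1,2) by blast
qed

lemma tendsto_test:
  fixes \<mu> \<Psi> :: "real \<Rightarrow> real \<Rightarrow> ('n::finite) torus \<Rightarrow> real"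
  assumes \<Psi>: "jointly_continuous_on A \<Psi>" and t0: "t0 \<in> A" and R: "R > 0"
    and i: "\<And>t. t \<in> B \<Longrightarrow> integrable zx (\<lambda>(z, x). \<mu> t z x)"
    and K: "\<And>t. t \<in> B \<Longrightarrow> (\<integral>(z, x). \<bar>\<mu> t z x\<bar> \<partial>zx) \<le> K" and B: "B \<subseteq> A"
    and lim: "((\<lambda>t. \<integral>(z, x). cutoff R z * \<Psi> t0 z x * \<mu> t z x \<partial>zx) \<longlongrightarrow> L) (at t0 within B)"
  shows "((\<lambda>t. \<integral>(z, x). cutoff R z * \<Psi> t z x * \<mu> t z x \<partial>zx) \<longlongrightarrow> L) (at t0 within B)"
proof -
  have c: "\<bar>cutoff R z\<bar> \<le> 1" for z
    using cutoff_nonneg[OF R, of z] cutoff_le_1[OF R, of z] by simp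
  have ib: "integrable zx (\<lambda>(z, x). cutoff R z * \<Psi> u z x * \<mu> t z x)"
    if u: "u \<in> A" and t: "t \<in> B" for u t
  proof -
    obtain M where M: "M \<ge> 0" "\<And>t z x. t \<in> {u} \<Longrightarrow> \<bar>z\<bar> \<le> R \<Longrightarrow> \<bar>\<Psi> t z x\<bar> \<le> M"
      by (rule bounded_on_strip[OF \<Psi>, of "{u}" R]) (use u in auto)
    have "\<bar>cutoff R z * \<Psi> u z x * \<mu> t z x\<bar> \<le> M * \<bar>\<mu> t z x\<bar>" for z x
    proof (cases "\<bar>z\<bar> \<le> R")
      case True
      have "\<bar>cutoff R z * \<Psi> u z x\<bar> \<le> 1 * M"
        unfolding abs_mult using M(2)[of u z x] c True by (intro mult_mono) auto
      then show ?thesis unfolding abs_mult[of _ "\<mu> t z x"] by (intro mult_right_mono) auto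
    qed (use R M in \<open>auto simp: cutoff_supp\<close>)
    moreover have "(\<lambda>(z, x). cutoff R z * \<Psi> u z x * \<mu> t z x) \<in> borel_measurable zx"
    proof -
      have "(\<lambda>(z, x). cutoff R z * \<Psi> u z x) \<in> borel_measurable zx"
        by (rule measurable_jc[OF jc_mult[OF jc_cutoff(1) \<Psi>] u])
      moreover have "(\<lambda>(z, x). \<mu> t z x) \<in> borel_measurable zx"
        using i[OF t] by auto
      ultimately show ?thesis unfolding split_def by (rule borel_measurable_times)
    qed
    ultimately show ?thesis
      using zx_integrable_bound(1)[OF _ zx_cmult(1)[OF zx_abs[OF i[OF t]]]] by blast
  qed
  have "((\<lambda>t. (\<integral>(z, x). cutoff R z * \<Psi> t z x * \<mu> t z x \<partial>zx) - (\<integral>(z, x). cutoff R z * \<Psi> t0 z x * \<mu> t z x \<partial>zx)) \<longlongrightarrow> 0) (at t0 within B)"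
  proof (rule tendstoI)
    fix e :: real assume e: "e > 0"
    define k where "k = \<bar>K\<bar> + 1"
    have k: "k > 0" by (simp add: k_def)
    define e' where "e' = e / (2 * k)"
    have e': "e' > 0" "e' * K < e"
    proof -
      show "e' > 0" using e k by (simp add: e'_def)
      have "e' * K \<le> e' * k" using \<open>e' > 0\<close> by (intro mult_left_mono) (auto simp: k_def)
      also have "\<dots> = e / 2" using k by (simp add: e'_def)
      finally show "e' * K < e" using e by simp
    qed
    have "eventually (\<lambda>t. \<forall>z x. \<bar>z\<bar> \<le> R \<longrightarrow> \<bar>\<Psi> t z x - \<Psi> t0 z x\<bar> \<le> e') (at t0 within B)"
      using jc_uniform_at[OF \<Psi> t0 e'(1)] B by (rule filter_leD[OF at_le, rotated])
    moreover have "eventually (\<lambda>t. t \<in> B) (at t0 within B)"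
      by (simp add: eventually_at_filter)
    ultimately show "eventually (\<lambda>t. dist ((\<integral>(z, x). cutoff R z * \<Psi> t z x * \<mu> t z x \<partial>zx) - (\<integral>(z, x). cutoff R z * \<Psi> t0 z x * \<mu> t z x \<partial>zx)) 0 < e) (at t0 within B)"
    proof eventually_elim
      case (elim t)
      have tA: "t \<in> A" using elim(2) B by blast
      have "(\<integral>(z, x). cutoff R z * \<Psi> t z x * \<mu> t z x \<partial>zx) - (\<integral>(z, x). cutoff R z * \<Psi> t0 z x * \<mu> t z x \<partial>zx)
          = (\<integral>(z, x). cutoff R z * \<Psi> t z x * \<mu> t z x - cutoff R z * \<Psi> t0 z x * \<mu> t z x \<partial>zx)"
        by (rule zx_diff(2)[symmetric, OF ib[OF tA elim(2)] ib[OF t0 elim(2)]])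
      also have "\<bar>\<dots>\<bar> \<le> (\<integral>(z, x). e' * \<bar>\<mu> t z x\<bar> \<partial>zx)"
      proof (rule zx_integrable_bound(2))
        show "(\<lambda>(z, x). cutoff R z * \<Psi> t z x * \<mu> t z x - cutoff R z * \<Psi> t0 z x * \<mu> t z x) \<in> borel_measurable zx"
          using zx_diff(1)[OF ib[OF tA elim(2)] ib[OF t0 elim(2)]] by (rule borel_measurable_integrable)
        show "integrable zx (\<lambda>(z, x). e' * \<bar>\<mu> t z x\<bar>)"
          by (rule zx_cmult(1)[OF zx_abs[OF i[OF elim(2)]]])
        show "\<bar>cutoff R z * \<Psi> t z x * \<mu> t z x - cutoff R z * \<Psi> t0 z x * \<mu> t z x\<bar> \<le> e' * \<bar>\<mu> t z x\<bar>" for z x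
        proof (cases "\<bar>z\<bar> \<le> R")
          case True
          have "\<bar>cutoff R z * (\<Psi> t z x - \<Psi> t0 z x)\<bar> \<le> 1 * e'"
            unfolding abs_mult using elim(1) True c by (intro mult_mono) auto
          then have "\<bar>cutoff R z * (\<Psi> t z x - \<Psi> t0 z x)\<bar> * \<bar>\<mu> t z x\<bar> \<le> e' * \<bar>\<mu> t z x\<bar>"
            by (intro mult_right_mono) auto
          then show ?thesis by (simp add: abs_mult[symmetric] algebra_simps)
        qed (use R e' in \<open>auto simp: cutoff_supp\<close>)
      qed
      also have "\<dots> = e' * (\<integral>(z, x). \<bar>\<mu> t z x\<bar> \<partial>zx)"
        by (rule zx_cmult(2))
      also have "\<dots> \<le> e' * K"
        using K[OF elim(2)] e'(1) by (intro mult_left_mono) auto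
      finally show ?case using e'(2) by simp
    qed
  qed
  from tendsto_add[OF this lim] show ?thesis by simp
qed

text \<open>A smooth convex approximation of the modulus within \<open>\<delta>\<close>. Its point
  is that the second derivative times \<open>v\<^sup>2\<close> is at most \<open>\<delta>\<close>:
  the drift term in \<open>kato_form\<close> becomes proportional to
  \<open>\<delta>\<close>.\<close>

definition smooth_abs :: "real \<Rightarrow> real \<Rightarrow> real" where
  "smooth_abs \<delta> v = sqrt (v\<^sup>2 + \<delta>\<^sup>2) - \<delta>"

lemma smooth_abs_props:
  assumes "\<delta> > 0"
  shows DERIV_smooth_abs: "(smooth_abs \<delta> has_real_derivative v / sqrt (v\<^sup>2 + \<delta>\<^sup>2)) (at v)"
    and DERIV2_smooth_abs: "((\<lambda>v. v / sqrt (v\<^sup>2 + \<delta>\<^sup>2)) has_real_derivative \<delta>\<^sup>2 / sqrt (v\<^sup>2 + \<delta>\<^sup>2) ^ 3) (at v)"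
    and "continuous_on UNIV (\<lambda>v. \<delta>\<^sup>2 / sqrt (v\<^sup>2 + \<delta>\<^sup>2) ^ 3)"
    and "0 \<le> smooth_abs \<delta> v" "smooth_abs \<delta> v \<le> \<bar>v\<bar>" "\<bar>v\<bar> - \<delta> \<le> smooth_abs \<delta> v"
    and "0 \<le> \<delta>\<^sup>2 / sqrt (v\<^sup>2 + \<delta>\<^sup>2) ^ 3" "\<delta>\<^sup>2 / sqrt (v\<^sup>2 + \<delta>\<^sup>2) ^ 3 * v\<^sup>2 \<le> \<delta>"
proof -
  have pos: "v\<^sup>2 + \<delta>\<^sup>2 > 0" for v using assms by (simp add: add_nonneg_pos)
  have nz: "v\<^sup>2 + \<delta>\<^sup>2 \<noteq> 0" for v using less_imp_neq[OF pos] by metis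
  define w where "w = sqrt (v\<^sup>2 + \<delta>\<^sup>2)"
  have w: "w > 0" "w\<^sup>2 = v\<^sup>2 + \<delta>\<^sup>2"
    using pos[of v] by (auto simp: w_def)
  have sq: "((\<lambda>v. sqrt (v\<^sup>2 + \<delta>\<^sup>2)) has_real_derivative v / sqrt (v\<^sup>2 + \<delta>\<^sup>2)) (at v)"
    using pos[of v] by (auto intro!: derivative_eq_intros simp: field_simps)
  show "(smooth_abs \<delta> has_real_derivative v / sqrt (v\<^sup>2 + \<delta>\<^sup>2)) (at v)"
    unfolding smooth_abs_def[abs_def] using DERIV_diff[OF sq DERIV_const[of \<delta>]] by simp
  have "((\<lambda>v. v / sqrt (v\<^sup>2 + \<delta>\<^sup>2)) has_real_derivative (1 * w - v * (v / w)) / (w * w)) (at v)"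
    unfolding w_def by (rule DERIV_divide[OF DERIV_ident sq]) (use pos[of v] in auto)
  moreover have "(1 * w - v * (v / w)) / (w * w) = \<delta>\<^sup>2 / w ^ 3"
    using w by (simp add: field_simps power2_eq_square power3_eq_cube)
  ultimately show "((\<lambda>v. v / sqrt (v\<^sup>2 + \<delta>\<^sup>2)) has_real_derivative \<delta>\<^sup>2 / sqrt (v\<^sup>2 + \<delta>\<^sup>2) ^ 3) (at v)"
    unfolding w_def by simp
  show "continuous_on UNIV (\<lambda>v. \<delta>\<^sup>2 / sqrt (v\<^sup>2 + \<delta>\<^sup>2) ^ 3)"
    using nz by (intro continuous_intros) auto
  have "\<delta> \<le> w" unfolding w_def by (rule real_le_rsqrt) simp
  then show "0 \<le> smooth_abs \<delta> v" by (simp add: smooth_abs_def w_def)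
  have "w \<le> \<bar>v\<bar> + \<delta>"
    unfolding w_def by (rule real_le_lsqrt) (use assms in \<open>auto simp: power2_sum\<close>)
  then show "smooth_abs \<delta> v \<le> \<bar>v\<bar>" by (simp add: smooth_abs_def w_def)
  have "\<bar>v\<bar> \<le> w" unfolding w_def by (rule real_le_rsqrt) simp
  then show "\<bar>v\<bar> - \<delta> \<le> smooth_abs \<delta> v" by (simp add: smooth_abs_def w_def)
  show "0 \<le> \<delta>\<^sup>2 / sqrt (v\<^sup>2 + \<delta>\<^sup>2) ^ 3" by simp
  have "\<delta>\<^sup>2 / w ^ 3 * v\<^sup>2 \<le> \<delta>\<^sup>2 / w ^ 3 * w\<^sup>2"
    using w by (intro mult_left_mono) auto
  also have "\<dots> = \<delta> * (\<delta> / w)"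
    using w by (simp add: power2_eq_square power3_eq_cube)
  also have "\<dots> \<le> \<delta> * 1"
    using w \<open>\<delta> \<le> w\<close> assms by (intro mult_left_mono) auto
  finally show "\<delta>\<^sup>2 / sqrt (v\<^sup>2 + \<delta>\<^sup>2) ^ 3 * v\<^sup>2 \<le> \<delta>"
    by (simp add: w_def)
qed

lemma integral_cutoff_le:
  assumes "R > 0"
  shows "integrable zx (\<lambda>(z, x :: ('n::finite) torus). cutoff R z)" "(\<integral>(z, x :: 'n torus). cutoff R z \<partial>zx) \<le> 2 * R"
proof -
  show i: "integrable zx (\<lambda>(z, x :: ('n::finite) torus). cutoff R z)"
    by (rule integrable_continuous_strip[of _ R])
       (use assms in \<open>auto simp: cutoff_supp split_def intro!: continuous_on_compose2[OF continuous_cutoff(1)] continuous_intros\<close>)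
  have s: "measure zx (strip R :: (real \<times> 'n torus) set) = 2 * R"
  proof -
    have "emeasure zx (strip R :: (real \<times> 'n torus) set) = emeasure lborel {-R..R} * emeasure torus_lebesgue (UNIV :: 'n torus set)"
      by (rule torus_lebesgue.emeasure_pair_measure_Times) auto
    then show ?thesis
      using torus_lebesgue.emeasure_space_1[where 'n = 'n] assms
      by (simp add: measure_def emeasure_lborel_Icc)
  qed
  have "(\<integral>(z, x :: 'n torus). cutoff R z \<partial>zx) \<le> (\<integral>p. indicator (strip R) p \<partial>(zx :: (real \<times> 'n torus) measure))"
  proof (rule Bochner_Integration.integral_mono[OF i])
    show "integrable (zx :: (real \<times> 'n torus) measure) (indicator (strip R) :: _ \<Rightarrow> real)"
      using emeasure_zx_strip by (intro integrable_real_indicator) auto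
    show "(\<lambda>(z, x :: 'n torus). cutoff R z) p \<le> indicator (strip R) p" for p
    proof (cases p)
      case (Pair z x)
      then show ?thesis
        using cutoff_le_1[OF assms, of z] cutoff_supp[OF assms, of z] by (cases "\<bar>z\<bar> \<le> R") (auto simp: indicator_def)
    qed
  qed
  also have "\<dots> = 2 * R" using s by simp
  finally show "(\<integral>(z, x :: 'n torus). cutoff R z \<partial>zx) \<le> 2 * R" .
qed

lemma LIMSEQ_over_Suc:
  "(\<lambda>n. a / real (Suc n)) \<longlonglongrightarrow> 0" "(\<lambda>n. a / (real (Suc n))\<^sup>2) \<longlonglongrightarrow> 0"
proof -
  have 1: "(\<lambda>n. b / real (Suc n)) \<longlonglongrightarrow> 0" for b
    by (rule LIMSEQ_Suc[OF lim_const_over_n])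
  show "(\<lambda>n. a / real (Suc n)) \<longlonglongrightarrow> 0" by (rule 1)
  have "(\<lambda>n. a / real (Suc n) * (1 / real (Suc n))) \<longlonglongrightarrow> 0 * 0"
    by (rule tendsto_mult[OF 1 1])
  then show "(\<lambda>n. a / (real (Suc n))\<^sup>2) \<longlonglongrightarrow> 0"
    by (simp add: power2_eq_square)
qed

lemma cutoff_tendsto: "(\<lambda>n. cutoff (real (Suc n)) z) \<longlonglongrightarrow> 1"
proof (rule tendsto_sandwich)
  have "(\<lambda>n. 1 - 3 * z\<^sup>2 / (real (Suc n))\<^sup>2) \<longlonglongrightarrow> 1 - 0"
    by (intro tendsto_diff tendsto_const LIMSEQ_over_Suc)
  then show "(\<lambda>n. 1 - 3 * z\<^sup>2 / (real (Suc n))\<^sup>2) \<longlonglongrightarrow> 1" by simp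
  show "eventually (\<lambda>n. 1 - 3 * z\<^sup>2 / (real (Suc n))\<^sup>2 \<le> cutoff (real (Suc n)) z) sequentially"
    using cutoff_tail[of "real (Suc _)" z] by (intro always_eventually allI) (smt (verit) of_nat_0_less_iff zero_less_Suc)
  show "eventually (\<lambda>n. cutoff (real (Suc n)) z \<le> 1) sequentially"
    by (intro always_eventually allI cutoff_le_1) simp
qed simp

lemma cutoff_integral_tendsto:
  fixes f :: "real \<Rightarrow> ('n::finite) torus \<Rightarrow> real"
  assumes f: "integrable zx (\<lambda>(z, x). f z x)"
  shows "(\<lambda>n. \<integral>(z, x). cutoff (real (Suc n)) z * f z x \<partial>zx) \<longlonglongrightarrow> (\<integral>(z, x). f z x \<partial>zx)"
proof (rule integral_dominated_convergence[where w = "\<lambda>(z, x). \<bar>f z x\<bar>"])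
  show fm: "(\<lambda>(z, x). f z x) \<in> borel_measurable zx" using f by auto
  show "(\<lambda>(z, x). cutoff (real (Suc n)) z * f z x) \<in> borel_measurable zx" for n
  proof -
    have "(\<lambda>p. cutoff (real (Suc n)) (fst p)) \<in> borel_measurable (zx :: (real \<times> 'n torus) measure)"
      by (intro measurable_compose[OF measurable_fst]) (simp add: borel_measurable_continuous_onI[OF continuous_cutoff(1)])
    then show ?thesis
      using fm unfolding split_def by (rule borel_measurable_times)
  qed
  show "integrable zx (\<lambda>(z, x). \<bar>f z x\<bar>)" by (rule zx_abs[OF f])
  show "AE p in zx. (\<lambda>n. (\<lambda>(z, x). cutoff (real (Suc n)) z * f z x) p) \<longlonglongrightarrow> (\<lambda>(z, x). f z x) p"
    using tendsto_mult[OF cutoff_tendsto tendsto_const] by (intro AE_I2) (auto simp: split_def)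
  show "AE p in zx. norm ((\<lambda>(z, x). cutoff (real (Suc n)) z * f z x) p) \<le> (\<lambda>(z, x). \<bar>f z x\<bar>) p" for n
  proof (intro AE_I2)
    fix p :: "real \<times> 'n torus"
    have "\<bar>cutoff (real (Suc n)) (fst p)\<bar> \<le> 1"
      using cutoff_nonneg[of "real (Suc n)" "fst p"] cutoff_le_1[of "real (Suc n)" "fst p"] by simp
    then show "norm ((\<lambda>(z, x). cutoff (real (Suc n)) z * f z x) p) \<le> (\<lambda>(z, x). \<bar>f z x\<bar>) p"
      by (simp add: split_def abs_mult mult_left_le_one_le)
  qed
qed

text \<open>Kato's inequality: \<open>\<integral>|\<mu>|\<close> does not increase. The drift is only locally bounded, but the error term
  of the regularised modulus vanishes before the cutoff is removed.\<close>

lemma FP_mass_decreasing: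
  fixes \<mu> :: "real \<Rightarrow> real \<Rightarrow> ('n::finite) torus \<Rightarrow> real"
  assumes FP: "FP_with T \<sigma> \<sigma>' s b \<mu> \<mu>t \<mu>z \<mu>zz \<mu>i \<mu>ii vi" and \<sigma>': "\<sigma>' > 0"
    and i: "\<And>t. t \<in> {0<..<T} \<Longrightarrow> integrable zx (\<lambda>(z, x). \<mu> t z x)"
    and K: "\<And>t. t \<in> {0<..<T} \<Longrightarrow> (\<integral>(z, x). \<bar>\<mu> t z x\<bar> \<partial>zx) \<le> K"
    and ac: "0 < a" "a \<le> c" "c < T"
  shows "(\<integral>(z, x). \<bar>\<mu> c z x\<bar> \<partial>zx) \<le> (\<integral>(z, x). \<bar>\<mu> a z x\<bar> \<partial>zx)"
proof -
  let ?N = "\<lambda>t. \<integral>(z, x). \<bar>\<mu> t z x\<bar> \<partial>zx"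
  note jm = C12_withD(6)[OF FP_withD(1)[OF FP]]
  have ia: "integrable zx (\<lambda>(z, x). \<bar>\<mu> t z x\<bar>)" if "t \<in> {0<..<T}" for t
    by (rule zx_abs[OF i[OF that]])
  have icut: "integrable zx (\<lambda>(z, x). cutoff R z * f t z x)"
    if "R > 0" "jointly_continuous_on {0<..<T} f" "t \<in> {0<..<T}" for R f t
    by (rule integrable_continuous_strip[OF jc_slice[OF jc_mult[OF jc_cutoff(1) that(2)] that(3)], of R])
       (use that(1) in \<open>auto simp: cutoff_supp\<close>)
  \<comment> \<open>For fixed \<open>R\<close> the regularisation \<open>\<delta>\<close> is removed
    first. What remains is the flow through the cutoff region, of order \<open>1 / R\<close> times
    the mass bound \<open>K\<close>.\<close>
  have step: "(\<integral>(z, x). cutoff R z * \<bar>\<mu> c z x\<bar> \<partial>zx) \<le> ?N a + (c - a) * ((6 * \<bar>s\<bar> / R + \<sigma>\<^sup>2 / 2 * (30 / R\<^sup>2)) * K)"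
    if R: "R > 0" for R
  proof -
    obtain B where B: "\<And>i. B i \<ge> 0" "\<And>i t z x. t \<in> {a..c} \<Longrightarrow> \<bar>z\<bar> \<le> R \<Longrightarrow> \<bar>b t z x $ i\<bar> \<le> B i"
    proof -
      have "\<exists>B\<ge>0. \<forall>t\<in>{a..c}. \<forall>z x. \<bar>z\<bar> \<le> R \<longrightarrow> \<bar>b t z x $ i\<bar> \<le> B" for i
        by (rule bounded_on_strip[OF FP_withD(2)[OF FP], of "{a..c}" R i]) (use ac in auto)
      then show ?thesis using that by metis
    qed
    \<comment> \<open>The bounds \<open>B\<close>, and with them \<open>E\<close>, may grow with
      \<open>R\<close> in an uncontrolled way. \<open>E\<close> enters only with the factor
      \<open>\<delta>\<close>, which tends to 0 while \<open>R\<close> is fixed.\<close>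
    define E where "E = (\<Sum>i\<in>UNIV. (B i)\<^sup>2 / (2 * \<sigma>'\<^sup>2)) * (2 * R)"
    define c0 where "c0 = 6 * \<bar>s\<bar> / R + \<sigma>\<^sup>2 / 2 * (30 / R\<^sup>2)"
    have c0: "c0 \<ge> 0" using R by (simp add: c0_def)
    have "(\<integral>(z, x). cutoff R z * \<bar>\<mu> c z x\<bar> \<partial>zx) \<le> ?N a + (c - a) * (c0 * K) + \<delta> * ((c - a) * E + 2 * R)"
      if \<delta>: "\<delta> > 0" for \<delta>
    proof -
      let ?\<beta> = "smooth_abs \<delta>" and ?\<beta>' = "\<lambda>v. v / sqrt (v\<^sup>2 + \<delta>\<^sup>2)" and ?\<beta>'' = "\<lambda>v. \<delta>\<^sup>2 / sqrt (v\<^sup>2 + \<delta>\<^sup>2) ^ 3"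
      note sa = smooth_abs_props[OF \<delta>]
      define D where "D t z x = ?\<beta> (\<mu> t z x) * (s * cutoff' R z + \<sigma>\<^sup>2 / 2 * cutoff'' R z)
        - \<sigma>\<^sup>2 / 2 * cutoff R z * ?\<beta>'' (\<mu> t z x) * (\<mu>z t z x)\<^sup>2
        + (\<Sum>i\<in>UNIV. cutoff R z * ?\<beta>'' (\<mu> t z x) * \<mu>i i t z x * (\<mu> t z x * b t z x $ i - \<sigma>'\<^sup>2 / 2 * \<mu>i i t z x))" for t z x
      define I where "I t = (\<integral>(z, x). cutoff R z * ?\<beta> (\<mu> t z x) \<partial>zx)" for t
      have dI: "(I has_real_derivative (\<integral>(z, x). D t z x \<partial>zx)) (at t)" and iD: "integrable zx (\<lambda>(z, x). D t z x)"
        if "t \<in> {0<..<T}" for t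
        using kato_form[OF FP sa(1,2,3) that R, of "D t"] unfolding I_def[abs_def] D_def by blast+
      have bound: "(\<integral>(z, x). D t z x \<partial>zx) \<le> c0 * K + \<delta> * E" if t: "a < t" "t < c" for t
      proof -
        have tT: "t \<in> {0<..<T}" using t ac by auto
        define S where "S = (\<Sum>i\<in>UNIV. (B i)\<^sup>2 / (2 * \<sigma>'\<^sup>2))"
        have S0: "0 \<le> S" by (auto simp: S_def intro!: sum_nonneg)
        have pw: "D t z x \<le> c0 * \<bar>\<mu> t z x\<bar> + (\<delta> * S) * cutoff R z" for z x
        proof (cases "\<bar>z\<bar> \<le> R")
          case True
          let ?b2 = "?\<beta>'' (\<mu> t z x)"
          have c1: "0 \<le> cutoff R z" by (rule cutoff_nonneg[OF R])
          have 1: "?\<beta> (\<mu> t z x) * (s * cutoff' R z + \<sigma>\<^sup>2 / 2 * cutoff'' R z) \<le> c0 * \<bar>\<mu> t z x\<bar>"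
          proof -
            have "s * cutoff' R z + \<sigma>\<^sup>2 / 2 * cutoff'' R z \<le> \<bar>s * cutoff' R z\<bar> + \<bar>\<sigma>\<^sup>2 / 2 * cutoff'' R z\<bar>"
              by linarith
            also have "\<dots> \<le> \<bar>s\<bar> * (6 / R) + \<sigma>\<^sup>2 / 2 * (30 / R\<^sup>2)"
              unfolding abs_mult using cutoff'_bound[OF R, of z] cutoff''_bound[OF R, of z]
              by (intro add_mono mult_mono) auto
            finally have le: "s * cutoff' R z + \<sigma>\<^sup>2 / 2 * cutoff'' R z \<le> c0"
              by (simp add: c0_def mult.commute)
            have "?\<beta> (\<mu> t z x) * (s * cutoff' R z + \<sigma>\<^sup>2 / 2 * cutoff'' R z) \<le> ?\<beta> (\<mu> t z x) * c0"
              by (rule mult_left_mono[OF le sa(4)])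
            also have "\<dots> \<le> \<bar>\<mu> t z x\<bar> * c0"
              by (rule mult_right_mono[OF sa(5) c0])
            finally show ?thesis by (simp add: mult.commute)
          qed
          have 2: "0 \<le> \<sigma>\<^sup>2 / 2 * cutoff R z * ?b2 * (\<mu>z t z x)\<^sup>2"
            by (intro mult_nonneg_nonneg c1 sa(7)) auto
          have 3: "cutoff R z * ?b2 * \<mu>i i t z x * (\<mu> t z x * b t z x $ i - \<sigma>'\<^sup>2 / 2 * \<mu>i i t z x)
              \<le> (\<delta> * cutoff R z) * ((B i)\<^sup>2 / (2 * \<sigma>'\<^sup>2))" for i
          proof -
            \<comment> \<open>Young's inequality: the diffusion term completes the drift term to a
              square. What is left is a multiple of \<open>\<mu>\<^sup>2\<close>, to be met by the
              second derivative of the regularised modulus.\<close>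
            have y: "\<mu>i i t z x * (\<mu> t z x * b t z x $ i - \<sigma>'\<^sup>2 / 2 * \<mu>i i t z x) \<le> (\<mu> t z x)\<^sup>2 * ((b t z x $ i)\<^sup>2 / (2 * \<sigma>'\<^sup>2))"
            proof -
              have "0 \<le> (\<mu> t z x * b t z x $ i / \<sigma>' - \<sigma>' * \<mu>i i t z x)\<^sup>2 / 2" by simp
              then show ?thesis using \<sigma>' by (simp add: power2_eq_square field_simps)
            qed
            have "\<bar>b t z x $ i\<bar> \<le> \<bar>B i\<bar>"
              using B(2)[of t z x i] B(1)[of i] t True by simp
            then have b2: "(b t z x $ i)\<^sup>2 / (2 * \<sigma>'\<^sup>2) \<le> (B i)\<^sup>2 / (2 * \<sigma>'\<^sup>2)"
              by (intro divide_right_mono) (simp_all add: abs_le_square_iff)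
            have "cutoff R z * ?b2 * \<mu>i i t z x * (\<mu> t z x * b t z x $ i - \<sigma>'\<^sup>2 / 2 * \<mu>i i t z x)
               = (cutoff R z * ?b2) * (\<mu>i i t z x * (\<mu> t z x * b t z x $ i - \<sigma>'\<^sup>2 / 2 * \<mu>i i t z x))"
              by (simp only: mult.assoc)
            also have "\<dots> \<le> (cutoff R z * ?b2) * ((\<mu> t z x)\<^sup>2 * ((b t z x $ i)\<^sup>2 / (2 * \<sigma>'\<^sup>2)))"
              by (rule mult_left_mono[OF y mult_nonneg_nonneg[OF c1 sa(7)]])
            also have "\<dots> = (?b2 * (\<mu> t z x)\<^sup>2) * (cutoff R z * ((b t z x $ i)\<^sup>2 / (2 * \<sigma>'\<^sup>2)))"
              by (simp only: mult_ac)
            also have "\<dots> \<le> \<delta> * (cutoff R z * ((B i)\<^sup>2 / (2 * \<sigma>'\<^sup>2)))"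
              using b2 c1 \<delta> by (intro mult_mono sa(8) mult_left_mono mult_nonneg_nonneg) auto
            finally show ?thesis by (simp only: mult_ac)
          qed
          have "(\<Sum>i\<in>UNIV. cutoff R z * ?b2 * \<mu>i i t z x * (\<mu> t z x * b t z x $ i - \<sigma>'\<^sup>2 / 2 * \<mu>i i t z x))
              \<le> (\<Sum>i\<in>UNIV. (\<delta> * cutoff R z) * ((B i)\<^sup>2 / (2 * \<sigma>'\<^sup>2)))"
            by (intro sum_mono 3)
          also have "\<dots> = (\<delta> * S) * cutoff R z"
            unfolding S_def by (simp only: sum_distrib_left[symmetric] mult_ac)
          finally show ?thesis
            using 1 2 unfolding D_def by linarith
        next
          case False
          then show ?thesis
            using R c0 by (simp add: D_def cutoff_supp cutoff'_supp cutoff''_supp)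
        qed
        have "(\<integral>(z, x). D t z x \<partial>zx) \<le> (\<integral>(z, x). c0 * \<bar>\<mu> t z x\<bar> + (\<delta> * S) * cutoff R z \<partial>zx)"
          by (rule zx_integral_mono[OF iD[OF tT] zx_add(1)[OF zx_cmult(1)[OF ia[OF tT]] zx_cmult(1)[OF integral_cutoff_le(1)[OF R]]] pw])
        also have "\<dots> = c0 * ?N t + (\<delta> * S) * (\<integral>(z, x :: 'n torus). cutoff R z \<partial>zx)"
          by (simp only: zx_add(2)[OF zx_cmult(1)[OF ia[OF tT]] zx_cmult(1)[OF integral_cutoff_le(1)[OF R]]] zx_cmult(2))
        also have "\<dots> \<le> c0 * K + (\<delta> * S) * (2 * R)"
          using c0 S0 \<delta> by (intro add_mono mult_left_mono K[OF tT] integral_cutoff_le(2)[OF R]) auto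
        finally show ?thesis by (simp add: E_def S_def mult.assoc)
      qed
      have "I c - I a \<le> (\<lambda>t. (c0 * K + \<delta> * E) * t) c - (\<lambda>t. (c0 * K + \<delta> * E) * t) a"
      proof (rule increment_bound[OF ac(2), where h' = "\<lambda>t. c0 * K + \<delta> * E" and I' = "\<lambda>t. \<integral>(z, x). D t z x \<partial>zx"])
        show "continuous_on {a..c} I"
          by (rule continuous_at_imp_continuous_on) (use ac in \<open>auto intro!: DERIV_isCont dI\<close>)
        show "(I has_real_derivative (\<integral>(z, x). D t z x \<partial>zx)) (at t)" if "a < t" "t < c" for t
          by (rule dI) (use that ac in auto)
        show "((\<lambda>t. (c0 * K + \<delta> * E) * t) has_real_derivative c0 * K + \<delta> * E) (at t)" for t
          using DERIV_cmult_Id by simp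
      qed (auto intro!: continuous_intros bound)
      moreover have "I a \<le> ?N a"
      proof -
        have "cutoff R z * ?\<beta> (\<mu> a z x) \<le> \<bar>\<mu> a z x\<bar>" for z x
          using mult_mono[OF cutoff_le_1[OF R, of z] sa(5)[of "\<mu> a z x"]] sa(4)[of "\<mu> a z x"] by simp
        then show ?thesis
          unfolding I_def using ac
          by (intro zx_integral_mono icut[OF R jc_comp[OF _ jm]] ia) (auto simp: smooth_abs_def intro!: continuous_intros)
      qed
      moreover have "(\<integral>(z, x). cutoff R z * \<bar>\<mu> c z x\<bar> \<partial>zx) \<le> I c + \<delta> * (2 * R)"
      proof -
        have cT: "c \<in> {0<..<T}" using ac by auto
        have i1: "integrable zx (\<lambda>(z, x). cutoff R z * ?\<beta> (\<mu> c z x))"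
          by (rule icut[OF R jc_comp[OF _ jm] cT]) (auto simp: smooth_abs_def intro!: continuous_intros)
        have i2: "integrable zx (\<lambda>(z, x). cutoff R z * \<bar>\<mu> c z x\<bar>)"
          by (rule icut[OF R jc_comp[OF _ jm] cT]) (auto intro!: continuous_intros)
        have "(\<integral>(z, x). cutoff R z * \<bar>\<mu> c z x\<bar> \<partial>zx) \<le> (\<integral>(z, x). cutoff R z * ?\<beta> (\<mu> c z x) + \<delta> * cutoff R z \<partial>zx)"
        proof (rule zx_integral_mono[OF i2 zx_add(1)[OF i1 zx_cmult(1)[OF integral_cutoff_le(1)[OF R]]]])
          fix z x
          have "cutoff R z * \<bar>\<mu> c z x\<bar> \<le> cutoff R z * (?\<beta> (\<mu> c z x) + \<delta>)"
            using sa(6)[of "\<mu> c z x"] by (intro mult_left_mono cutoff_nonneg[OF R]) auto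
          then show "cutoff R z * \<bar>\<mu> c z x\<bar> \<le> cutoff R z * ?\<beta> (\<mu> c z x) + \<delta> * cutoff R z"
            by (simp add: algebra_simps)
        qed
        also have "\<dots> = I c + \<delta> * (\<integral>(z, x :: 'n torus). cutoff R z \<partial>zx)"
          by (simp only: zx_add(2)[OF i1 zx_cmult(1)[OF integral_cutoff_le(1)[OF R]]] zx_cmult(2) I_def)
        also have "\<dots> \<le> I c + \<delta> * (2 * R)"
          using \<delta> by (intro add_left_mono mult_left_mono integral_cutoff_le(2)[OF R]) auto
        finally show ?thesis .
      qed
      ultimately show ?thesis by (simp add: algebra_simps)
    qed
    then have "eventually (\<lambda>\<delta>. (\<integral>(z, x). cutoff R z * \<bar>\<mu> c z x\<bar> \<partial>zx) \<le> ?N a + (c - a) * (c0 * K) + \<delta> * ((c - a) * E + 2 * R)) (at_right 0)"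
      by (simp add: eventually_at_right_less eventually_mono[OF eventually_at_right_less])
    moreover have "((\<lambda>\<delta>. ?N a + (c - a) * (c0 * K) + \<delta> * ((c - a) * E + 2 * R)) \<longlongrightarrow> ?N a + (c - a) * (c0 * K) + 0 * ((c - a) * E + 2 * R)) (at_right 0)"
      by (intro tendsto_intros)
    ultimately have "(\<integral>(z, x). cutoff R z * \<bar>\<mu> c z x\<bar> \<partial>zx) \<le> ?N a + (c - a) * (c0 * K) + 0 * ((c - a) * E + 2 * R)"
      by (intro tendsto_lowerbound[of _ _ "at_right 0"]) auto
    then show ?thesis by (simp add: c0_def)
  qed
  have cT: "c \<in> {0<..<T}" using ac by auto
  have lim1: "(\<lambda>n. \<integral>(z, x). cutoff (real (Suc n)) z * \<bar>\<mu> c z x\<bar> \<partial>zx) \<longlonglongrightarrow> ?N c"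
    by (rule cutoff_integral_tendsto[OF ia[OF cT]])
  have lim2: "(\<lambda>n. ?N a + (c - a) * ((6 * \<bar>s\<bar> / real (Suc n) + \<sigma>\<^sup>2 / 2 * (30 / (real (Suc n))\<^sup>2)) * K)) \<longlonglongrightarrow> ?N a + (c - a) * ((0 + \<sigma>\<^sup>2 / 2 * 0) * K)"
    by (intro tendsto_add tendsto_mult tendsto_const LIMSEQ_over_Suc)
  have "?N c \<le> ?N a + (c - a) * ((0 + \<sigma>\<^sup>2 / 2 * 0) * K)"
    by (rule LIMSEQ_le[OF lim1 lim2]) (use step in auto)
  then show ?thesis by simp
qed

lemma at_within_Ioo_at_right: "a < b \<Longrightarrow> at a within {a<..<b} = at_right (a :: real)"
  by (rule at_within_nhd[of _ "{..<b}"]) auto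

text \<open>Duhamel's formula against the backward heat flow \<open>\<Psi>(t) = \<psi>(t\<^sub>1 - t)\<close>, where \<open>\<psi>(0)\<close> approximates the
  sign of \<open>\<mu>(t\<^sub>1)\<close>: the gradient bound \<open>(t\<^sub>1 - t)\<^sup>-\<^sup>1\<^sup>/\<^sup>2\<close> is integrable, so the initial layer carries no
  mass.\<close>

lemma FP_initial_layer:
  fixes \<mu> :: "real \<Rightarrow> real \<Rightarrow> ('n::finite) torus \<Rightarrow> real"
  assumes T: "T > 0" and \<sigma>: "\<sigma> > 0" and \<sigma>': "\<sigma>' > 0"
    and FP: "FP_with T \<sigma> \<sigma>' s b \<mu> \<mu>t \<mu>z \<mu>zz \<mu>i \<mu>ii vi"
    and b: "\<And>i. jointly_continuous_on {0..<T} (\<lambda>t z x. b t z x $ i)"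
    and i: "\<And>t. t \<in> {0<..<T} \<Longrightarrow> integrable zx (\<lambda>(z, x). \<mu> t z x)"
    and K: "\<And>t. t \<in> {0<..<T} \<Longrightarrow> (\<integral>(z, x). \<bar>\<mu> t z x\<bar> \<partial>zx) \<le> K"
    and init: "\<And>f. continuous_on UNIV (\<lambda>(z, x). f z x) \<Longrightarrow>
        ((\<lambda>t. \<integral>(z, x). cutoff 2 z * f z x * \<mu> t z x \<partial>zx) \<longlongrightarrow> 0) (at_right 0)"
  shows "\<exists>C. \<forall>t\<in>{0<..T/2}. (\<integral>(z, x). cutoff 2 z * \<bar>\<mu> t z x\<bar> \<partial>zx) \<le> C * (sqrt t + t)"
proof -
  note jm = C12_withD(6)[OF FP_withD(1)[OF FP]]
  have R: "(2 :: real) > 0" by simp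
  obtain B where B: "\<And>i. B i \<ge> 0" "\<And>i t z x. t \<in> {0..T/2} \<Longrightarrow> \<bar>z\<bar> \<le> 2 \<Longrightarrow> \<bar>b t z x $ i\<bar> \<le> B i"
  proof -
    have "\<exists>B\<ge>0. \<forall>t\<in>{0..T/2}. \<forall>z x. \<bar>z\<bar> \<le> 2 \<longrightarrow> \<bar>b t z x $ i\<bar> \<le> B" for i
      by (rule bounded_on_strip[OF b, of "{0..T/2}" 2 i]) (use T in auto)
    then show ?thesis using that by metis
  qed
  define nB where "nB = (\<Sum>i\<in>UNIV. B i)"
  have nB: "nB \<ge> 0" by (auto simp: nB_def intro!: sum_nonneg B)
  \<comment> \<open>\<open>C1\<close> collects the terms with a gradient, \<open>C2\<close> the
    others. They use the bound 2 for \<open>\<psi>\<close>, the gradient bounds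
    \<open>2 / (\<sigma> * sqrt h)\<close> and \<open>2 / (\<sigma>' * sqrt h)\<close>, and, for the
    cutoff of radius 2, the bounds \<open>6 / 2 = 3\<close> and \<open>30 / 4\<close>.\<close>
  define C1 where "C1 = nB * (2 / \<sigma>') + \<bar>s\<bar> * (2 / \<sigma>) + 3 * (\<sigma>\<^sup>2 * (2 / \<sigma>))"
  define C2 where "C2 = 3 * (\<bar>s\<bar> * 2) + \<sigma>\<^sup>2 / 2 * (30 / 4) * 2"
  have C: "C1 \<ge> 0" "C2 \<ge> 0"
    using nB \<sigma> \<sigma>' by (auto simp: C1_def C2_def)
  have K0: "K \<ge> 0"
  proof -
    have "0 \<le> (\<integral>(z, x). \<bar>\<mu> (T/2) z x\<bar> \<partial>zx)"
      by (rule integral_nonneg_AE) (auto intro!: AE_I2)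
    then show ?thesis using K[of "T/2"] T by simp
  qed
  have main: "(\<integral>(z, x). cutoff 2 z * \<bar>\<mu> t1 z x\<bar> \<partial>zx) \<le> K * (2 * C1 * sqrt t1 + C2 * t1) + \<delta> * (K + 4)"
    if t1: "t1 \<in> {0<..T/2}" and \<delta>: "0 < \<delta>" "\<delta> \<le> 1" for t1 \<delta>
  proof -
    have t1T: "t1 \<in> {0<..<T}" using t1 T by auto
    \<comment> \<open>A continuous substitute for the sign of \<open>\<mu> t1\<close>:
      \<open>f * \<mu>\<close> differs from the modulus by at most \<open>\<delta>\<close>.\<close>
    define f where "f p = (\<lambda>(z, x). \<mu> t1 z x) p / (\<bar>(\<lambda>(z, x). \<mu> t1 z x) p\<bar> + \<delta>)" for p
    have fc: "continuous_on (strip 2) f"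
    proof -
      have "continuous_on UNIV f"
        unfolding f_def by (intro continuous_on_divide continuous_on_add continuous_on_rabs jc_slice[OF jm t1T] continuous_on_const)
          (use \<delta> in \<open>smt (verit)\<close>)
      then show ?thesis by (rule continuous_on_subset) auto
    qed
    have f1: "\<bar>f p\<bar> \<le> 1" for p
      unfolding f_def abs_divide using \<delta> by (simp add: divide_le_eq)
    obtain p where p: "trig p" "\<And>z x. \<bar>p z x\<bar> \<le> 1 + \<delta>" "\<And>z x. \<bar>z\<bar> \<le> 2 \<Longrightarrow> \<bar>p z x - f (z, x)\<bar> \<le> \<delta>"
      using trig_approximation[OF fc f1 R \<delta>(1)] by blast
    obtain \<psi> where \<psi>: "heat_sol \<sigma> \<sigma>' \<psi>" "\<psi> 0 = p"
      using trig_heat_sol[OF p(1)] by blast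
    obtain \<psi>t \<psi>z \<psi>zz \<psi>i \<psi>ii where jet: "heat_jet \<sigma> \<sigma>' \<psi> \<psi>t \<psi>z \<psi>zz \<psi>i \<psi>ii"
      using ex_heat_jet[OF \<psi>(1)] by blast
    have S: "\<bar>\<psi> 0 z x\<bar> \<le> 2" for z x
      using p(2)[of z x] \<delta>(2) \<psi>(2) by simp
    note hb = heat_bounds[OF jet S]
    note hC = C12_withD[OF heat_jetD(7)[OF jet]]
    have rev: "((\<lambda>t. g (t1 - t)) has_real_derivative - g' (t1 - t)) (at t)"
      if "\<And>t. (g has_real_derivative g' t) (at t)" for g g' t
    proof -
      have "((\<lambda>t. t1 - t) has_real_derivative - 1) (at t)"
        by (auto intro!: derivative_eq_intros)
      from DERIV_chain2[OF that this] show ?thesis by simp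
    qed
    have jr: "jointly_continuous_on A (\<lambda>t z x. g (t1 - t) z x)" if "jointly_continuous_on UNIV g" for g :: "real \<Rightarrow> real \<Rightarrow> 'n torus \<Rightarrow> real" and A
      by (rule jc_reparam[OF that]) (auto intro!: continuous_intros)
    have C12: "C12_with {0<..<T} (\<lambda>t z x. \<psi> (t1 - t) z x) (\<lambda>t z x. - \<psi>t (t1 - t) z x) (\<lambda>t z x. \<psi>z (t1 - t) z x) (\<lambda>t z x. \<psi>zz (t1 - t) z x)
       (\<lambda>i t z x. \<psi>i i (t1 - t) z x) (\<lambda>i t z x. \<psi>ii i (t1 - t) z x)"
      unfolding C12_with_def
      by (intro conjI ballI allI rev[of "\<lambda>t. \<psi> t _ _" "\<lambda>t. \<psi>t t _ _"] hC(1-5)[OF UNIV_I] jr jc_minus hC(6-11))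
    define D where "D t z x = \<mu> t z x * (cutoff 2 z * (- \<psi>t (t1 - t) z x + (\<Sum>i\<in>UNIV. b t z x $ i * \<psi>i i (t1 - t) z x) + s * \<psi>z (t1 - t) z x
              + \<sigma>\<^sup>2 / 2 * \<psi>zz (t1 - t) z x + \<sigma>'\<^sup>2 / 2 * (\<Sum>i\<in>UNIV. \<psi>ii i (t1 - t) z x))
            + cutoff' 2 z * (s * \<psi> (t1 - t) z x + \<sigma>\<^sup>2 * \<psi>z (t1 - t) z x) + \<sigma>\<^sup>2 / 2 * cutoff'' 2 z * \<psi> (t1 - t) z x)" for t z x
    define I where "I t = (\<integral>(z, x). cutoff 2 z * \<psi> (t1 - t) z x * \<mu> t z x \<partial>zx)" for t
    have dI: "(I has_real_derivative (\<integral>(z, x). D t z x \<partial>zx)) (at t)" and iD: "integrable zx (\<lambda>(z, x). D t z x)"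
      if "t \<in> {0<..<T}" for t
      using weak_form[OF FP C12 that R, of "D t"] unfolding I_def[abs_def] D_def by blast+
    have bound: "\<bar>\<integral>(z, x). D t z x \<partial>zx\<bar> \<le> K * (C1 / sqrt (t1 - t) + C2)" if t: "0 < t" "t < t1" for t
    proof -
      have tT: "t \<in> {0<..<T}" and t2: "t \<in> {0..T/2}" using t t1 T by auto
      define h where "h = t1 - t"
      have h: "h > 0" "h \<ge> 0" using t by (auto simp: h_def)
      define c where "c = C1 / sqrt h + C2"
      have c0: "c \<ge> 0" using C h by (simp add: c_def)
      have pw: "\<bar>D t z x\<bar> \<le> c * \<bar>\<mu> t z x\<bar>" for z x
      proof (cases "\<bar>z\<bar> \<le> 2")
        case True
        define A where "A = cutoff 2 z * ((\<Sum>i\<in>UNIV. b t z x $ i * \<psi>i i h z x) + s * \<psi>z h z x)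
            + cutoff' 2 z * (s * \<psi> h z x + \<sigma>\<^sup>2 * \<psi>z h z x) + \<sigma>\<^sup>2 / 2 * cutoff'' 2 z * \<psi> h z x"
        have D: "D t z x = \<mu> t z x * A"
          unfolding D_def A_def h_def[symmetric] heat_jetD(8)[OF jet] by (simp add: algebra_simps)
        have gz: "\<bar>\<psi>z h z x\<bar> \<le> (2 / \<sigma>) / sqrt h"
          using hb(2)[OF h(2) \<sigma> h(1), of z x] by simp
        have gi: "\<bar>\<psi>i i h z x\<bar> \<le> (2 / \<sigma>') / sqrt h" for i
          using hb(3)[OF h(2) \<sigma>' h(1), of i z x] by simp
        have bi: "\<bar>b t z x $ i * \<psi>i i h z x\<bar> \<le> B i * ((2 / \<sigma>') / sqrt h)" for i
          unfolding abs_mult by (rule mult_mono[OF B(2)[OF t2 True] gi B(1) abs_ge_zero])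
        have "\<bar>\<Sum>i\<in>UNIV. b t z x $ i * \<psi>i i h z x\<bar> \<le> (\<Sum>i\<in>UNIV. B i * ((2 / \<sigma>') / sqrt h))"
          by (rule order_trans[OF sum_abs sum_mono]) (rule bi)
        also have "\<dots> = nB * (2 / \<sigma>') / sqrt h"
          unfolding nB_def sum_distrib_right[symmetric] by simp
        finally have 1: "\<bar>\<Sum>i\<in>UNIV. b t z x $ i * \<psi>i i h z x\<bar> \<le> nB * (2 / \<sigma>') / sqrt h" .
        have 2: "\<bar>s * \<psi>z h z x\<bar> \<le> \<bar>s\<bar> * ((2 / \<sigma>) / sqrt h)"
          unfolding abs_mult by (intro mult_left_mono gz) auto
        have 3: "\<bar>s * \<psi> h z x + \<sigma>\<^sup>2 * \<psi>z h z x\<bar> \<le> \<bar>s\<bar> * 2 + \<sigma>\<^sup>2 * ((2 / \<sigma>) / sqrt h)"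
        proof -
          have "\<bar>s * \<psi> h z x\<bar> \<le> \<bar>s\<bar> * 2"
            unfolding abs_mult by (rule mult_left_mono[OF hb(1)[OF h(2)] abs_ge_zero])
          moreover have "\<bar>\<sigma>\<^sup>2 * \<psi>z h z x\<bar> \<le> \<sigma>\<^sup>2 * ((2 / \<sigma>) / sqrt h)"
            unfolding abs_mult abs_power2 by (rule mult_left_mono[OF gz zero_le_power2])
          ultimately show ?thesis by linarith
        qed
        have 4: "\<bar>cutoff 2 z * ((\<Sum>i\<in>UNIV. b t z x $ i * \<psi>i i h z x) + s * \<psi>z h z x)\<bar>
            \<le> 1 * (nB * (2 / \<sigma>') / sqrt h + \<bar>s\<bar> * ((2 / \<sigma>) / sqrt h))"
        proof -
          have "\<bar>(\<Sum>i\<in>UNIV. b t z x $ i * \<psi>i i h z x) + s * \<psi>z h z x\<bar> \<le> nB * (2 / \<sigma>') / sqrt h + \<bar>s\<bar> * ((2 / \<sigma>) / sqrt h)"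
            using 1 2 by linarith
          moreover have "\<bar>cutoff 2 z\<bar> \<le> 1"
            using cutoff_nonneg[OF R, of z] cutoff_le_1[OF R, of z] by simp
          ultimately show ?thesis
            unfolding abs_mult[of "cutoff 2 z"] by (intro mult_mono) auto
        qed
        have 5: "\<bar>cutoff' 2 z * (s * \<psi> h z x + \<sigma>\<^sup>2 * \<psi>z h z x)\<bar> \<le> 3 * (\<bar>s\<bar> * 2 + \<sigma>\<^sup>2 * ((2 / \<sigma>) / sqrt h))"
          unfolding abs_mult[of "cutoff' 2 z"] by (rule mult_mono[OF _ 3]) (use cutoff'_bound[OF R, of z] in auto)
        have 6: "\<bar>\<sigma>\<^sup>2 / 2 * cutoff'' 2 z * \<psi> h z x\<bar> \<le> \<sigma>\<^sup>2 / 2 * (30 / 4) * 2"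
          unfolding abs_mult using cutoff''_bound[OF R, of z] hb(1)[OF h(2), of z x] by (intro mult_mono) auto
        have "\<bar>A\<bar> \<le> 1 * (nB * (2 / \<sigma>') / sqrt h + \<bar>s\<bar> * ((2 / \<sigma>) / sqrt h))
            + 3 * (\<bar>s\<bar> * 2 + \<sigma>\<^sup>2 * ((2 / \<sigma>) / sqrt h)) + \<sigma>\<^sup>2 / 2 * (30 / 4) * 2"
          unfolding A_def using 4 5 6 by linarith
        also have "\<dots> = c"
          by (simp add: c_def C1_def C2_def add_divide_distrib algebra_simps)
        finally have "\<bar>\<mu> t z x\<bar> * \<bar>A\<bar> \<le> \<bar>\<mu> t z x\<bar> * c"
          by (intro mult_left_mono) auto
        then show ?thesis unfolding D by (simp add: abs_mult mult.commute)
      next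
        case False
        then show ?thesis using c0 by (simp add: D_def cutoff_supp cutoff'_supp cutoff''_supp)
      qed
      have "\<bar>\<integral>(z, x). D t z x \<partial>zx\<bar> \<le> (\<integral>(z, x). c * \<bar>\<mu> t z x\<bar> \<partial>zx)"
        by (rule zx_integrable_bound(2)[OF borel_measurable_integrable[OF iD[OF tT]] zx_cmult(1)[OF zx_abs[OF i[OF tT]]] pw])
      also have "\<dots> = c * (\<integral>(z, x). \<bar>\<mu> t z x\<bar> \<partial>zx)"
        by (rule zx_cmult(2))
      also have "\<dots> \<le> c * K"
        by (rule mult_left_mono[OF K[OF tT] c0])
      finally show ?thesis by (simp add: c_def h_def mult.commute)
    qed
    \<comment> \<open>An antiderivative of the bound \<open>K * (C1 / sqrt (t1 - t) + C2)\<close>.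
      It is continuous up to \<open>t1\<close>, so the singularity of the gradient bound does no
      harm.\<close>
    define H where "H t = K * (- 2 * C1 * sqrt (t1 - t) + C2 * t)" for t
    have inc: "\<bar>I t1 - I a\<bar> \<le> H t1 - H a" if a: "0 < a" "a \<le> t1" for a
    proof (rule abs_increment_bound[OF a(2), where I' = "\<lambda>t. \<integral>(z, x). D t z x \<partial>zx" and h' = "\<lambda>t. K * (C1 / sqrt (t1 - t) + C2)"])
      show "continuous_on {a..t1} I"
        by (rule continuous_at_imp_continuous_on) (use a t1T in \<open>auto intro!: DERIV_isCont dI\<close>)
      show "continuous_on {a..t1} H"
        unfolding H_def by (intro continuous_intros)
      fix t assume t: "a < t" "t < t1"
      show "(I has_real_derivative (\<integral>(z, x). D t z x \<partial>zx)) (at t)"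
        by (rule dI) (use t a t1T in auto)
      show "(H has_real_derivative K * (C1 / sqrt (t1 - t) + C2)) (at t)"
        unfolding H_def[abs_def] using t by (auto intro!: derivative_eq_intros simp: field_simps)
      show "\<bar>\<integral>(z, x). D t z x \<partial>zx\<bar> \<le> K * (C1 / sqrt (t1 - t) + C2)"
        by (rule bound) (use t a in auto)
    qed
    \<comment> \<open>At time 0 the dual function is the fixed continuous function
      \<open>\<psi> t1\<close>, to which the weak initial condition applies.\<close>
    have lim: "(I \<longlongrightarrow> 0) (at_right 0)"
    proof -
      have "((\<lambda>t. \<integral>(z, x). cutoff 2 z * (\<lambda>t z x. \<psi> (t1 - t) z x) t z x * \<mu> t z x \<partial>zx) \<longlongrightarrow> 0) (at 0 within {0<..<T})"
      proof (rule tendsto_test[where A = UNIV and K = K])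
        show "((\<lambda>t. \<integral>(z, x). cutoff 2 z * \<psi> (t1 - 0) z x * \<mu> t z x \<partial>zx) \<longlongrightarrow> 0) (at 0 within {0<..<T})"
          using init[OF jc_slice[OF hC(6) UNIV_I, of t1]] by (simp add: at_within_Ioo_at_right[OF T])
      qed (use R i K in \<open>auto intro: jr[OF hC(6)]\<close>)
      then show ?thesis
        unfolding I_def[abs_def] by (simp add: at_within_Ioo_at_right[OF T])
    qed
    have limH: "(H \<longlongrightarrow> K * (- 2 * C1 * sqrt (t1 - 0) + C2 * 0)) (at_right 0)"
      unfolding H_def[abs_def] by (intro tendsto_intros)
    have "eventually (\<lambda>a. \<bar>I t1 - I a\<bar> \<le> H t1 - H a) (at_right 0)"
      using eventually_at_right_real[of 0 t1] t1 by (auto elim!: eventually_mono intro!: inc)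
    then have "\<bar>I t1 - 0\<bar> \<le> H t1 - K * (- 2 * C1 * sqrt (t1 - 0) + C2 * 0)"
      using lim limH by (intro tendsto_le[of "at_right 0" "\<lambda>a. H t1 - H a" _ "\<lambda>a. \<bar>I t1 - I a\<bar>"] tendsto_intros) auto
    then have I1: "I t1 \<le> K * (2 * C1 * sqrt t1 + C2 * t1)"
      unfolding H_def by (simp add: algebra_simps)
    have ic: "integrable zx (\<lambda>(z, x). cutoff 2 z * g z x)" if "continuous_on UNIV (\<lambda>(z, x :: 'n torus). g z x)" for g
      by (rule integrable_continuous_strip[of _ 2])
         (auto simp: cutoff_supp split_def intro!: continuous_on_mult continuous_on_compose2[OF continuous_cutoff(1)] that[unfolded split_def] continuous_intros)
    have pc: "continuous_on UNIV (\<lambda>(z, x). p z x)"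
      using jc_slice[OF hC(6) UNIV_I, of 0] \<psi>(2) by simp
    have mc: "continuous_on UNIV (\<lambda>(z, x). \<mu> t1 z x)"
      by (rule jc_slice[OF jm t1T])
    have ipm: "integrable zx (\<lambda>(z, x). cutoff 2 z * (p z x * \<mu> t1 z x))"
      by (rule ic) (use continuous_on_mult[OF pc mc] in \<open>simp add: split_def\<close>)
    have iam: "integrable zx (\<lambda>(z, x). cutoff 2 z * \<bar>\<mu> t1 z x\<bar>)"
      by (rule ic) (use continuous_on_rabs[OF mc] in \<open>simp add: split_def\<close>)
    have "(\<integral>(z, x). cutoff 2 z * \<bar>\<mu> t1 z x\<bar> \<partial>zx)
        \<le> (\<integral>(z, x). cutoff 2 z * (p z x * \<mu> t1 z x) + (\<delta> * \<bar>\<mu> t1 z x\<bar> + \<delta> * cutoff 2 z) \<partial>zx)"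
    proof (rule zx_integral_mono[OF iam])
      show "integrable zx (\<lambda>(z, x). cutoff 2 z * (p z x * \<mu> t1 z x) + (\<delta> * \<bar>\<mu> t1 z x\<bar> + \<delta> * cutoff 2 z))"
        by (intro zx_add(1) ipm zx_cmult(1) zx_abs i[OF t1T] integral_cutoff_le(1)[OF R])
      fix z x
      show "cutoff 2 z * \<bar>\<mu> t1 z x\<bar> \<le> cutoff 2 z * (p z x * \<mu> t1 z x) + (\<delta> * \<bar>\<mu> t1 z x\<bar> + \<delta> * cutoff 2 z)"
      proof (cases "\<bar>z\<bar> \<le> 2")
        case True
        let ?m = "\<mu> t1 z x"
        have c: "0 \<le> cutoff 2 z" "cutoff 2 z \<le> 1" using cutoff_nonneg[OF R] cutoff_le_1[OF R] by auto
        have "\<bar>?m\<bar> - \<delta> \<le> f (z, x) * ?m"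
        proof -
          have "(\<bar>?m\<bar> - \<delta>) * (\<bar>?m\<bar> + \<delta>) \<le> ?m * ?m"
            by (simp add: algebra_simps)
          then show ?thesis using \<delta>(1) by (simp add: f_def pos_le_divide_eq)
        qed
        moreover have "\<bar>(p z x - f (z, x)) * ?m\<bar> \<le> \<delta> * \<bar>?m\<bar>"
          unfolding abs_mult by (intro mult_right_mono p(3) True) auto
        then have "f (z, x) * ?m - \<delta> * \<bar>?m\<bar> \<le> p z x * ?m"
          by (simp add: algebra_simps abs_le_iff)
        ultimately have "\<bar>?m\<bar> \<le> p z x * ?m + (\<delta> * \<bar>?m\<bar> + \<delta>)"
          by linarith
        then have "cutoff 2 z * \<bar>?m\<bar> \<le> cutoff 2 z * (p z x * ?m + (\<delta> * \<bar>?m\<bar> + \<delta>))"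
          by (rule mult_left_mono[OF _ c(1)])
        also have "\<dots> = cutoff 2 z * (p z x * ?m) + (cutoff 2 z * (\<delta> * \<bar>?m\<bar>) + \<delta> * cutoff 2 z)"
          by (simp add: algebra_simps)
        also have "\<dots> \<le> cutoff 2 z * (p z x * ?m) + (1 * (\<delta> * \<bar>?m\<bar>) + \<delta> * cutoff 2 z)"
          using c \<delta> by (intro add_mono mult_right_mono order_refl) auto
        finally show ?thesis by simp
      qed (use \<delta> in \<open>auto simp: cutoff_supp\<close>)
    qed
    also have "\<dots> = (\<integral>(z, x). cutoff 2 z * (p z x * \<mu> t1 z x) \<partial>zx) + (\<delta> * (\<integral>(z, x). \<bar>\<mu> t1 z x\<bar> \<partial>zx) + \<delta> * (\<integral>(z, x :: 'n torus). cutoff 2 z \<partial>zx))"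
      by (simp only: zx_add(2)[OF ipm zx_add(1)[OF zx_cmult(1)[OF zx_abs[OF i[OF t1T]]] zx_cmult(1)[OF integral_cutoff_le(1)[OF R]]]]
           zx_add(2)[OF zx_cmult(1)[OF zx_abs[OF i[OF t1T]]] zx_cmult(1)[OF integral_cutoff_le(1)[OF R]]] zx_cmult(2))
    also have "(\<integral>(z, x). cutoff 2 z * (p z x * \<mu> t1 z x) \<partial>zx) = I t1"
      by (simp add: I_def \<psi>(2) mult.assoc)
    also have "I t1 + (\<delta> * (\<integral>(z, x). \<bar>\<mu> t1 z x\<bar> \<partial>zx) + \<delta> * (\<integral>(z, x :: 'n torus). cutoff 2 z \<partial>zx))
        \<le> K * (2 * C1 * sqrt t1 + C2 * t1) + (\<delta> * K + \<delta> * (2 * 2))"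
      using \<delta> by (intro add_mono I1 mult_left_mono K[OF t1T] integral_cutoff_le(2)[OF R]) auto
    finally show ?thesis by (simp add: algebra_simps)
  qed
  show ?thesis
  proof (intro exI ballI)
    fix t1 assume t1: "t1 \<in> {0<..T/2}"
    have "eventually (\<lambda>\<delta>. (\<integral>(z, x). cutoff 2 z * \<bar>\<mu> t1 z x\<bar> \<partial>zx) \<le> K * (2 * C1 * sqrt t1 + C2 * t1) + \<delta> * (K + 4)) (at_right 0)"
      using eventually_at_right_real[of 0 1] by (auto elim!: eventually_mono intro!: main t1)
    moreover have "((\<lambda>\<delta>. K * (2 * C1 * sqrt t1 + C2 * t1) + \<delta> * (K + 4)) \<longlongrightarrow> K * (2 * C1 * sqrt t1 + C2 * t1) + 0 * (K + 4)) (at_right 0)"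
      by (intro tendsto_intros)
    ultimately have "(\<integral>(z, x). cutoff 2 z * \<bar>\<mu> t1 z x\<bar> \<partial>zx) \<le> K * (2 * C1 * sqrt t1 + C2 * t1) + 0 * (K + 4)"
      by (intro tendsto_lowerbound[of _ _ "at_right 0"]) auto
    also have "\<dots> \<le> K * ((2 * C1 + C2) * sqrt t1 + (2 * C1 + C2) * t1)"
    proof -
      have "2 * C1 * sqrt t1 + C2 * t1 \<le> (2 * C1 + C2) * sqrt t1 + (2 * C1 + C2) * t1"
        using t1 C by (intro add_mono mult_right_mono) auto
      then show ?thesis using mult_left_mono[OF _ K0] by simp
    qed
    also have "\<dots> = (K * (2 * C1 + C2)) * (sqrt t1 + t1)"
      by (simp add: algebra_simps)
    finally show "(\<integral>(z, x). cutoff 2 z * \<bar>\<mu> t1 z x\<bar> \<partial>zx) \<le> (K * (2 * C1 + C2)) * (sqrt t1 + t1)" .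
  qed
qed

text \<open>The mass at \<open>t\<close> is at most the mass at any earlier time \<open>a\<close>.
  As \<open>a\<close> tends to 0 the part near \<open>z = 0\<close> vanishes by the estimate of the
  initial layer, and the part away from it by the assumption \<open>tail\<close>.\<close>

lemma FP_unique:
  fixes \<mu> :: "real \<Rightarrow> real \<Rightarrow> ('n::finite) torus \<Rightarrow> real"
  assumes T: "T > 0" and \<sigma>: "\<sigma> > 0" and \<sigma>': "\<sigma>' > 0"
    and FP: "FP_with T \<sigma> \<sigma>' s b \<mu> \<mu>t \<mu>z \<mu>zz \<mu>i \<mu>ii vi"
    and b: "\<And>i. jointly_continuous_on {0..<T} (\<lambda>t z x. b t z x $ i)"
    and i: "\<And>t. t \<in> {0<..<T} \<Longrightarrow> integrable zx (\<lambda>(z, x). \<mu> t z x)"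
    and K: "\<And>t. t \<in> {0<..<T} \<Longrightarrow> (\<integral>(z, x). \<bar>\<mu> t z x\<bar> \<partial>zx) \<le> K"
    and init: "\<And>f. continuous_on UNIV (\<lambda>(z, x). f z x) \<Longrightarrow>
        ((\<lambda>t. \<integral>(z, x). cutoff 2 z * f z x * \<mu> t z x \<partial>zx) \<longlongrightarrow> 0) (at_right 0)"
    and tail: "((\<lambda>t. \<integral>(z, x). min 1 (z\<^sup>2) * \<bar>\<mu> t z x\<bar> \<partial>zx) \<longlongrightarrow> 0) (at_right 0)"
    and t: "t \<in> {0<..<T}"
  shows "\<mu> t z x = 0"
proof -
  let ?N = "\<lambda>t. \<integral>(z, x). \<bar>\<mu> t z x\<bar> \<partial>zx"
  note jm = C12_withD(6)[OF FP_withD(1)[OF FP]]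
  obtain C where C: "\<And>t. t \<in> {0<..T/2} \<Longrightarrow> (\<integral>(z, x). cutoff 2 z * \<bar>\<mu> t z x\<bar> \<partial>zx) \<le> C * (sqrt t + t)"
    using FP_initial_layer[OF T \<sigma> \<sigma>' FP b i K init] by blast
  have N: "?N a \<le> 4 * (C * (sqrt a + a)) + (\<integral>(z, x). min 1 (z\<^sup>2) * \<bar>\<mu> a z x\<bar> \<partial>zx)" if a: "a \<in> {0<..T/2}" for a
  proof -
    have aT: "a \<in> {0<..<T}" using a T by auto
    have "(\<lambda>(z, x :: 'n torus). cutoff 2 z) \<in> borel_measurable zx" "(\<lambda>(z, x :: 'n torus). min 1 (z\<^sup>2)) \<in> borel_measurable zx"
      by (auto simp: split_def intro!: continuous_measurable_zx continuous_on_compose2[OF continuous_cutoff(1)] continuous_intros)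
    note m = borel_measurable_times[OF this(1)] borel_measurable_times[OF this(2)]
    have am: "(\<lambda>(z, x). \<bar>\<mu> a z x\<bar>) \<in> borel_measurable zx" using zx_abs[OF i[OF aT]] by auto
    have i1: "integrable zx (\<lambda>(z, x). cutoff 2 z * \<bar>\<mu> a z x\<bar>)"
      by (rule zx_integrable_bound(1)[OF _ zx_abs[OF i[OF aT]]])
         (use m(1)[OF am] cutoff_nonneg[of 2] cutoff_le_1[of 2] in \<open>auto simp: split_def abs_mult intro!: mult_left_le_one_le\<close>)
    have i2: "integrable zx (\<lambda>(z, x). min 1 (z\<^sup>2) * \<bar>\<mu> a z x\<bar>)"
      by (rule zx_integrable_bound(1)[OF _ zx_abs[OF i[OF aT]]])
         (use m(2)[OF am] in \<open>auto simp: split_def abs_mult intro!: mult_left_le_one_le\<close>)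
    have "?N a \<le> (\<integral>(z, x). 4 * (cutoff 2 z * \<bar>\<mu> a z x\<bar>) + min 1 (z\<^sup>2) * \<bar>\<mu> a z x\<bar> \<partial>zx)"
    proof (rule zx_integral_mono[OF zx_abs[OF i[OF aT]] zx_add(1)[OF zx_cmult(1)[OF i1] i2]])
      fix z x
      \<comment> \<open>For \<open>\<bar>z\<bar> < 1\<close> the cutoff of radius 2 is at least
        \<open>(3 / 4) ^ 3\<close>, more than \<open>1 / 4\<close>; for larger
        \<open>\<bar>z\<bar>\<close> the minimum equals 1.\<close>
      have "1 \<le> 4 * cutoff 2 z + min 1 (z\<^sup>2)"
      proof (cases "z\<^sup>2 \<ge> 1")
        case True
        then show ?thesis using cutoff_nonneg[of 2 z] by simp
      next
        case False
        then have "(3 / 4) ^ 3 \<le> (max 0 (1 - (z / 2)\<^sup>2)) ^ 3"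
          by (intro power_mono) (auto simp: power_divide)
        then have "1 \<le> 4 * cutoff 2 z"
          unfolding cutoff_def by (simp add: power3_eq_cube)
        moreover have "0 \<le> min 1 (z\<^sup>2)" by simp
        ultimately show ?thesis by linarith
      qed
      then have "1 * \<bar>\<mu> a z x\<bar> \<le> (4 * cutoff 2 z + min 1 (z\<^sup>2)) * \<bar>\<mu> a z x\<bar>"
        by (rule mult_right_mono) simp
      then show "\<bar>\<mu> a z x\<bar> \<le> 4 * (cutoff 2 z * \<bar>\<mu> a z x\<bar>) + min 1 (z\<^sup>2) * \<bar>\<mu> a z x\<bar>"
        by (simp add: distrib_right)
    qed
    also have "\<dots> = 4 * (\<integral>(z, x). cutoff 2 z * \<bar>\<mu> a z x\<bar> \<partial>zx) + (\<integral>(z, x). min 1 (z\<^sup>2) * \<bar>\<mu> a z x\<bar> \<partial>zx)"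
      by (simp only: zx_add(2)[OF zx_cmult(1)[OF i1] i2] zx_cmult(2))
    also have "\<dots> \<le> 4 * (C * (sqrt a + a)) + (\<integral>(z, x). min 1 (z\<^sup>2) * \<bar>\<mu> a z x\<bar> \<partial>zx)"
      using C[OF a] by simp
    finally show ?thesis .
  qed
  have "((\<lambda>a. 4 * (C * (sqrt a + a)) + (\<integral>(z, x). min 1 (z\<^sup>2) * \<bar>\<mu> a z x\<bar> \<partial>zx)) \<longlongrightarrow> 4 * (C * (sqrt 0 + 0)) + 0) (at_right 0)"
    by (intro tendsto_intros tail)
  moreover have "eventually (\<lambda>a. ?N t \<le> 4 * (C * (sqrt a + a)) + (\<integral>(z, x). min 1 (z\<^sup>2) * \<bar>\<mu> a z x\<bar> \<partial>zx)) (at_right 0)"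
  proof -
    have "?N t \<le> 4 * (C * (sqrt a + a)) + (\<integral>(z, x). min 1 (z\<^sup>2) * \<bar>\<mu> a z x\<bar> \<partial>zx)" if "a \<in> {0<..<min t (T/2)}" for a
      using FP_mass_decreasing[OF FP \<sigma>' i K, of a t] N[of a] that t by simp
    moreover have "0 < min t (T/2)" using t T by simp
    ultimately show ?thesis
      using eventually_at_right_real[of 0 "min t (T/2)"] by (auto elim!: eventually_mono)
  qed
  ultimately have "?N t \<le> 4 * (C * (sqrt 0 + 0)) + 0"
    by (intro tendsto_lowerbound[of _ _ "at_right 0"]) auto
  moreover have "0 \<le> ?N t"
    by (rule integral_nonneg_AE) (auto intro!: AE_I2)
  ultimately have "?N t = 0" by simp
  then have "(\<lambda>(z, x). \<bar>\<mu> t z x\<bar>) (z, x) = 0"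
  proof (intro continuous_integral_zero[OF _ zx_abs[OF i[OF t]]])
    show "continuous_on UNIV (\<lambda>(z, x). \<bar>\<mu> t z x\<bar>)"
      using continuous_on_rabs[OF jc_slice[OF jm t]] by (simp add: split_def)
  qed auto
  then show ?thesis by simp
qed

subsection \<open>The law of the signal\<close>

text \<open>It brings estimates up to the time \<open>t = T\<close>, where the equation is not
  assumed and the integrals have no known derivative.\<close>

lemma continuous_cutoff_integral:
  fixes g :: "real \<Rightarrow> real \<Rightarrow> ('n::finite) torus \<Rightarrow> real"
  assumes g: "jointly_continuous_on A g" and R: "R > 0"
  shows "continuous_on A (\<lambda>t. \<integral>(z, x). cutoff R z * g t z x \<partial>zx)"
  unfolding continuous_on_def
proof (intro ballI tendstoI)
  fix t0 and e :: real assume t0: "t0 \<in> A" and e: "e > 0"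
  define e' where "e' = e / (4 * R)"
  have e': "e' > 0" "e' * (2 * R) < e" using e R by (auto simp: e'_def)
  have ig: "integrable zx (\<lambda>(z, x). cutoff R z * g t z x)" if "t \<in> A" for t
    by (rule integrable_continuous_strip[OF jc_slice[OF jc_mult[OF jc_cutoff(1) g] that], of R])
       (use R in \<open>auto simp: cutoff_supp\<close>)
  have "eventually (\<lambda>t. t \<in> A) (at t0 within A)"
    by (simp add: eventually_at_filter)
  with jc_uniform_at[OF g t0 e'(1), of R]
  show "eventually (\<lambda>t. dist (\<integral>(z, x). cutoff R z * g t z x \<partial>zx) (\<integral>(z, x). cutoff R z * g t0 z x \<partial>zx) < e) (at t0 within A)"
  proof eventually_elim
    case (elim t)
    have "(\<integral>(z, x). cutoff R z * g t z x \<partial>zx) - (\<integral>(z, x). cutoff R z * g t0 z x \<partial>zx)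
        = (\<integral>(z, x). cutoff R z * g t z x - cutoff R z * g t0 z x \<partial>zx)"
      by (rule zx_diff(2)[symmetric, OF ig[OF elim(2)] ig[OF t0]])
    also have "\<bar>\<dots>\<bar> \<le> (\<integral>(z, x :: 'n torus). e' * cutoff R z \<partial>zx)"
    proof (rule zx_integrable_bound(2)[OF borel_measurable_integrable[OF zx_diff(1)[OF ig[OF elim(2)] ig[OF t0]]] zx_cmult(1)[OF integral_cutoff_le(1)[OF R]]])
      fix z x
      show "\<bar>cutoff R z * g t z x - cutoff R z * g t0 z x\<bar> \<le> e' * cutoff R z"
      proof (cases "\<bar>z\<bar> \<le> R")
        case True
        have "\<bar>cutoff R z * (g t z x - g t0 z x)\<bar> \<le> cutoff R z * e'"
          unfolding abs_mult using elim(1) True cutoff_nonneg[OF R, of z] by (intro mult_mono) auto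
        then show ?thesis by (simp add: right_diff_distrib mult.commute)
      qed (use R in \<open>auto simp: cutoff_supp\<close>)
    qed
    also have "\<dots> = e' * (\<integral>(z, x :: 'n torus). cutoff R z \<partial>zx)" by (rule zx_cmult(2))
    also have "\<dots> \<le> e' * (2 * R)"
      using e' by (intro mult_left_mono integral_cutoff_le(2)[OF R]) auto
    finally show ?case using e'(2) by (simp add: dist_real_def)
  qed
qed

text \<open>Multiplying the standard normal density by \<open>exp (\<gamma> * y\<^sup>2)\<close>
  gives, up to the constant \<open>c\<close>, the centred normal density of variance
  \<open>1 / (1 - 2 * \<gamma>)\<close>, whose second moment is finite.\<close>

lemma gaussian_exp_moment:
  assumes "\<gamma> < 1 / 2"
  shows "(\<integral>\<^sup>+y. ennreal ((1 + y\<^sup>2) * exp (\<gamma> * y\<^sup>2)) \<partial>std_normal_distribution) < \<infinity>"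
proof -
  define \<tau> where "\<tau> = 1 / sqrt (1 - 2 * \<gamma>)"
  have \<tau>: "\<tau> > 0" "\<tau>\<^sup>2 = 1 / (1 - 2 * \<gamma>)"
    using assms by (auto simp: \<tau>_def power_divide)
  define c where "c = sqrt (2 * pi * \<tau>\<^sup>2) / sqrt (2 * pi)"
  have eq: "std_normal_density y * ((1 + y\<^sup>2) * exp (\<gamma> * y\<^sup>2)) = c * (normal_density 0 \<tau> y * (y - 0) ^ 0 + normal_density 0 \<tau> y * (y - 0) ^ 2)" for y
  proof -
    have E: "exp (- y\<^sup>2 / 2) * exp (\<gamma> * y\<^sup>2) = exp (- y\<^sup>2 / (2 * \<tau>\<^sup>2))"
      unfolding \<tau>(2) mult_exp_exp using assms by (intro arg_cong[where f = exp]) (simp add: field_simps)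
    have c': "c * (1 / sqrt (2 * pi * \<tau>\<^sup>2)) = 1 / sqrt (2 * pi)"
      using \<tau>(1) by (simp add: c_def)
    have "std_normal_density y * ((1 + y\<^sup>2) * exp (\<gamma> * y\<^sup>2)) = (1 / sqrt (2 * pi)) * (1 + y\<^sup>2) * (exp (- y\<^sup>2 / 2) * exp (\<gamma> * y\<^sup>2))"
      by (simp add: std_normal_density_def)
    also have "\<dots> = (c * (1 / sqrt (2 * pi * \<tau>\<^sup>2))) * (1 + y\<^sup>2) * exp (- y\<^sup>2 / (2 * \<tau>\<^sup>2))"
      by (simp only: E c')
    also have "\<dots> = c * (normal_density 0 \<tau> y * (y - 0) ^ 0 + normal_density 0 \<tau> y * (y - 0) ^ 2)"
      by (simp add: normal_density_def algebra_simps add_divide_distrib)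
    finally show ?thesis .
  qed
  have "integrable lborel (\<lambda>y. std_normal_density y * ((1 + y\<^sup>2) * exp (\<gamma> * y\<^sup>2)))"
    unfolding eq
    by (intro integrable_mult_right Bochner_Integration.integrable_add integrable_normal_moment[OF \<tau>(1)])
  then have "(\<integral>\<^sup>+y. ennreal (norm (std_normal_density y * ((1 + y\<^sup>2) * exp (\<gamma> * y\<^sup>2)))) \<partial>lborel) < \<infinity>"
    unfolding integrable_iff_bounded by blast
  then show ?thesis
    by (subst nn_integral_density) (auto simp: ennreal_mult' abs_mult abs_of_nonneg add_nonneg_nonneg cong: nn_integral_cong)
qed

definition is_FP where
  "is_FP T \<sigma> \<sigma>' s b \<mu> \<longleftrightarrow> (\<exists>\<mu>t \<mu>z \<mu>zz \<mu>i \<mu>ii vi. FP_with T \<sigma> \<sigma>' s b \<mu> \<mu>t \<mu>z \<mu>zz \<mu>i \<mu>ii vi)"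

text \<open>The forward equation in all states for an arbitrary given drift, separated from the
  game. It can thus be applied to the densities of one solution with the drift of the other.\<close>

locale signal_flow =
  fixes T \<sigma> \<sigma>' :: real and \<rho>0 :: "('n::finite) torus \<Rightarrow> real"
    and b :: "real \<Rightarrow> real \<Rightarrow> 'n torus \<Rightarrow> real ^ 'n" and m :: "real \<Rightarrow> real \<Rightarrow> real \<Rightarrow> 'n torus \<Rightarrow> real"
  assumes T: "T > 0" and \<sigma>: "\<sigma> > 0" and \<sigma>': "\<sigma>' > 0"
    and \<rho>0: "torus_density \<rho>0"
    and FP: "\<And>s. is_FP T \<sigma> \<sigma>' s b (m s)"
    and b: "\<And>i. jointly_continuous_on {0..<T} (\<lambda>t z x. b t z x $ i)"
    and m_cont: "\<And>s. jointly_continuous_on {0<..T} (m s)"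
    and m_nonneg: "\<And>s t z x. t \<in> {0<..T} \<Longrightarrow> 0 \<le> m s t z x"
    and m_mass: "\<And>s t. t \<in> {0<..T} \<Longrightarrow> (\<integral>\<^sup>+ (z, x). ennreal (m s t z x) \<partial>zx) = 1"
    and m_init: "\<And>s f. continuous_on UNIV f \<Longrightarrow> bounded (range f) \<Longrightarrow>
        ((\<lambda>t. \<integral>(z, x). f (z, x) * m s t z x \<partial>zx) \<longlongrightarrow> (\<integral>x. f (0, x) * \<rho>0 x \<partial>torus_lebesgue)) (at_right 0)"
begin

lemma m_measurable: "t \<in> {0<..T} \<Longrightarrow> (\<lambda>(z, x). m s t z x) \<in> borel_measurable zx"
  by (rule measurable_jc[OF m_cont])

lemma m_integrable: "t \<in> {0<..T} \<Longrightarrow> integrable zx (\<lambda>(z, x). m s t z x)"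
  by (rule integrableI_nonneg)
     (use m_measurable m_nonneg m_mass[of t s] in \<open>auto simp: split_def intro!: AE_I2\<close>)

lemma m_integral: "t \<in> {0<..T} \<Longrightarrow> (\<integral>(z, x). m s t z x \<partial>zx) = 1"
  by (rule integral_eq_nn_integral[THEN trans])
     (use m_measurable m_nonneg m_mass[of t s] in \<open>auto simp: split_def intro!: AE_I2\<close>)

lemma m_abs: "t \<in> {0<..T} \<Longrightarrow> \<bar>m s t z x\<bar> = m s t z x"
  by (simp add: m_nonneg)

lemma \<rho>0_integral: "(\<integral>x. c * \<rho>0 x \<partial>torus_lebesgue) = c"
proof -
  have "(\<integral>x. \<rho>0 x \<partial>torus_lebesgue) = 1"
    by (rule integral_eq_nn_integral[THEN trans])
       (use \<rho>0 in \<open>auto simp: torus_density_def measurable_cong_sets[OF sets_torus_lebesgue refl]\<close>)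
  then show ?thesis by simp
qed

lemma \<rho>0_integral_1: "(\<integral>x. \<rho>0 x \<partial>torus_lebesgue) = 1"
  using \<rho>0_integral[of 1] by simp

text \<open>The test function \<open>exp (\<kappa> * t) * cos (l * (z - s * t) + \<theta>)\<close>
  solves the backward equation of the signal. It does not depend on \<open>x\<close>, so the drift
  drops out and its integral keeps the initial value \<open>cos \<theta>\<close>.\<close>

lemma marginal_cos:
  assumes t: "t \<in> {0<..T}"
  shows "(\<integral>(z, x). cos (l * (z - s * t) + \<theta>) * m s t z x \<partial>zx) = exp (- l\<^sup>2 * \<sigma>\<^sup>2 / 2 * t) * cos \<theta>"
proof -
  define \<kappa> where "\<kappa> = l\<^sup>2 * \<sigma>\<^sup>2 / 2"
  define \<Psi> where "\<Psi> t z x = exp (\<kappa> * t) * cos (l * (z - s * t) + \<theta>)" for t z and x :: "'n torus"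
  define \<Psi>z where "\<Psi>z t z x = - l * exp (\<kappa> * t) * sin (l * (z - s * t) + \<theta>)" for t z and x :: "'n torus"
  define \<Psi>t where "\<Psi>t t z x = \<kappa> * \<Psi> t z x - s * \<Psi>z t z x" for t z x
  have C12: "C12_with A \<Psi> \<Psi>t \<Psi>z (\<lambda>t z x. - l\<^sup>2 * \<Psi> t z x) (\<lambda>i t z x. 0) (\<lambda>i t z x. 0)" for A
  proof -
    have jP: "jointly_continuous_on A \<Psi>" "jointly_continuous_on A \<Psi>z"
      unfolding \<Psi>_def[abs_def] \<Psi>z_def[abs_def] by (rule jc_tz; auto simp: split_def intro!: continuous_intros)+
    have "jointly_continuous_on A \<Psi>t" unfolding \<Psi>t_def[abs_def] by (intro jc_intros jP)
    moreover have "jointly_continuous_on A (\<lambda>t z x. - l\<^sup>2 * \<Psi> t z x)" by (intro jc_intros jP)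
    moreover have "((\<lambda>t. \<Psi> t z x) has_real_derivative \<Psi>t t z x) (at t)" for t z x
      unfolding \<Psi>_def \<Psi>t_def \<Psi>z_def by (auto intro!: derivative_eq_intros simp: algebra_simps)
    moreover have "((\<lambda>z. \<Psi> t z x) has_real_derivative \<Psi>z t z x) (at z)" for t z x
      unfolding \<Psi>_def \<Psi>z_def by (auto intro!: derivative_eq_intros)
    moreover have "((\<lambda>z. \<Psi>z t z x) has_real_derivative - l\<^sup>2 * \<Psi> t z x) (at z)" for t z x
      unfolding \<Psi>_def \<Psi>z_def by (auto intro!: derivative_eq_intros simp: power2_eq_square)
    moreover have "has_tpartial i (\<Psi> t z) 0 x" for i t z x
      unfolding \<Psi>_def[abs_def] by (rule has_tpartial_const)
    ultimately show ?thesis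
      unfolding C12_with_def using jP by (auto intro: jc_const has_tpartial_const)
  qed
  define E where "E = exp (\<kappa> * T)"
  have \<kappa>: "\<kappa> \<ge> 0" by (simp add: \<kappa>_def)
  have E: "\<bar>\<Psi> t z x\<bar> \<le> E" "\<bar>\<Psi>z t z x\<bar> \<le> \<bar>l\<bar> * E" if "t \<in> {0..T}" for t z x
  proof -
    have e: "exp (\<kappa> * t) \<le> E" using that \<kappa> by (auto simp: E_def intro: mult_left_mono)
    have "exp (\<kappa> * t) * \<bar>cos (l * (z - s * t) + \<theta>)\<bar> \<le> E * 1"
      by (rule mult_mono[OF e abs_cos_le_one]) (auto simp: E_def)
    then show "\<bar>\<Psi> t z x\<bar> \<le> E" by (simp add: \<Psi>_def abs_mult)
    have "exp (\<kappa> * t) * \<bar>sin (l * (z - s * t) + \<theta>)\<bar> \<le> E * 1"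
      by (rule mult_mono[OF e abs_sin_le_one]) (auto simp: E_def)
    then have "\<bar>l\<bar> * (exp (\<kappa> * t) * \<bar>sin (l * (z - s * t) + \<theta>)\<bar>) \<le> \<bar>l\<bar> * E"
      by (intro mult_left_mono) auto
    then show "\<bar>\<Psi>z t z x\<bar> \<le> \<bar>l\<bar> * E" by (simp add: \<Psi>z_def abs_mult)
  qed
  obtain \<mu>t \<mu>z \<mu>zz \<mu>i \<mu>ii vi where F: "FP_with T \<sigma> \<sigma>' s b (m s) \<mu>t \<mu>z \<mu>zz \<mu>i \<mu>ii vi"
    using FP unfolding is_FP_def by blast
  \<comment> \<open>The commutator with the cutoff is the only term left in the time derivative;
    \<open>q R\<close> bounds it and tends to 0 as \<open>R\<close> grows.\<close>
  define q where "q R = 6 / R * (\<bar>s\<bar> * E + \<sigma>\<^sup>2 * (\<bar>l\<bar> * E)) + \<sigma>\<^sup>2 / 2 * (30 / R\<^sup>2) * E" for R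
  have step: "\<bar>(\<integral>(z, x). cutoff R z * \<Psi> t z x * m s t z x \<partial>zx) - cos \<theta>\<bar> \<le> q R * t" if R: "R \<ge> 1" for R
  proof -
    have R0: "R > 0" using R by simp
    define I where "I t = (\<integral>(z, x). cutoff R z * \<Psi> t z x * m s t z x \<partial>zx)" for t
    define D where "D t z x = m s t z x * (cutoff R z * (\<Psi>t t z x + (\<Sum>i\<in>UNIV. b t z x $ i * 0) + s * \<Psi>z t z x
              + \<sigma>\<^sup>2 / 2 * (- l\<^sup>2 * \<Psi> t z x) + \<sigma>'\<^sup>2 / 2 * (\<Sum>i::'n\<in>UNIV. 0))
            + cutoff' R z * (s * \<Psi> t z x + \<sigma>\<^sup>2 * \<Psi>z t z x) + \<sigma>\<^sup>2 / 2 * cutoff'' R z * \<Psi> t z x)" for t z x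
    have dI: "(I has_real_derivative (\<integral>(z, x). D t z x \<partial>zx)) (at t)" and iD: "integrable zx (\<lambda>(z, x). D t z x)"
      if "t \<in> {0<..<T}" for t
      using weak_form[OF F C12 that R0, of "D t"] unfolding I_def[abs_def] D_def by blast+
    have bound: "\<bar>\<integral>(z, x). D t z x \<partial>zx\<bar> \<le> q R" if t: "t \<in> {0<..<T}" for t
    proof -
      have t': "t \<in> {0<..T}" "t \<in> {0..T}" using t by auto
      have pw: "\<bar>D t z x\<bar> \<le> q R * m s t z x" for z x
      proof -
        have 0: "\<Psi>t t z x + (\<Sum>i\<in>UNIV. b t z x $ i * 0) + s * \<Psi>z t z x
              + \<sigma>\<^sup>2 / 2 * (- l\<^sup>2 * \<Psi> t z x) + \<sigma>'\<^sup>2 / 2 * (\<Sum>i::'n\<in>UNIV. 0) = 0"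
          by (simp add: \<Psi>t_def \<kappa>_def)
        have 1: "\<bar>s * \<Psi> t z x + \<sigma>\<^sup>2 * \<Psi>z t z x\<bar> \<le> \<bar>s\<bar> * E + \<sigma>\<^sup>2 * (\<bar>l\<bar> * E)"
        proof -
          have "\<bar>s * \<Psi> t z x\<bar> \<le> \<bar>s\<bar> * E"
            unfolding abs_mult by (rule mult_left_mono[OF E(1)[OF t'(2)] abs_ge_zero])
          moreover have "\<bar>\<sigma>\<^sup>2 * \<Psi>z t z x\<bar> \<le> \<sigma>\<^sup>2 * (\<bar>l\<bar> * E)"
            unfolding abs_mult[of "\<sigma>\<^sup>2"] abs_power2 by (rule mult_left_mono[OF E(2)[OF t'(2)] zero_le_power2])
          ultimately show ?thesis by linarith
        qed
        have 2: "\<bar>cutoff' R z * (s * \<Psi> t z x + \<sigma>\<^sup>2 * \<Psi>z t z x)\<bar> \<le> 6 / R * (\<bar>s\<bar> * E + \<sigma>\<^sup>2 * (\<bar>l\<bar> * E))"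
          unfolding abs_mult[of "cutoff' R z"] by (rule mult_mono[OF cutoff'_bound[OF R0] 1]) (use R0 in auto)
        have 3: "\<bar>\<sigma>\<^sup>2 / 2 * cutoff'' R z * \<Psi> t z x\<bar> \<le> \<sigma>\<^sup>2 / 2 * (30 / R\<^sup>2) * E"
          unfolding abs_mult by (intro mult_mono E(1)[OF t'(2)] cutoff''_bound[OF R0]) auto
        have "\<bar>cutoff' R z * (s * \<Psi> t z x + \<sigma>\<^sup>2 * \<Psi>z t z x) + \<sigma>\<^sup>2 / 2 * cutoff'' R z * \<Psi> t z x\<bar> \<le> q R"
          unfolding q_def using 2 3 by linarith
        then have "m s t z x * \<bar>cutoff' R z * (s * \<Psi> t z x + \<sigma>\<^sup>2 * \<Psi>z t z x) + \<sigma>\<^sup>2 / 2 * cutoff'' R z * \<Psi> t z x\<bar> \<le> m s t z x * q R"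
          by (rule mult_left_mono[OF _ m_nonneg[OF t'(1)]])
        then show ?thesis
          unfolding D_def 0 by (simp add: abs_mult m_abs[OF t'(1)] mult.commute)
      qed
      have "\<bar>\<integral>(z, x). D t z x \<partial>zx\<bar> \<le> (\<integral>(z, x). q R * m s t z x \<partial>zx)"
        by (rule zx_integrable_bound(2)[OF borel_measurable_integrable[OF iD[OF t]] zx_cmult(1)[OF m_integrable[OF t'(1)]] pw])
      also have "\<dots> = q R" by (simp add: zx_cmult(2) m_integral[OF t'(1)])
      finally show ?thesis .
    qed
    have Ic: "continuous_on {0<..T} I"
      unfolding I_def[abs_def] mult.assoc
      by (rule continuous_cutoff_integral[OF jc_mult[OF C12_withD(6)[OF C12] m_cont] R0])
    have inc: "\<bar>I t - I a\<bar> \<le> q R * t - q R * a" if a: "0 < a" "a \<le> t" for a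
    proof (rule abs_increment_bound[OF a(2) _ _ _ _ , where I' = "\<lambda>t. \<integral>(z, x). D t z x \<partial>zx" and h' = "\<lambda>t. q R" and h = "\<lambda>t. q R * t"])
      show "continuous_on {a..t} I"
        by (rule continuous_on_subset[OF Ic]) (use a t in auto)
      show "((\<lambda>t. q R * t) has_real_derivative q R) (at u)" for u
        using DERIV_cmult_Id by simp
      fix u assume "a < u" "u < t"
      then have u: "u \<in> {0<..<T}" using a t by auto
      show "(I has_real_derivative (\<integral>(z, x). D u z x \<partial>zx)) (at u)" by (rule dI[OF u])
      show "\<bar>\<integral>(z, x). D u z x \<partial>zx\<bar> \<le> q R" by (rule bound[OF u])
    qed (intro continuous_intros)
    have lim: "(I \<longlongrightarrow> cos \<theta>) (at_right 0)"
    proof -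
      have "((\<lambda>t. \<integral>(z, x). cutoff R z * \<Psi> t z x * m s t z x \<partial>zx) \<longlongrightarrow> cos \<theta>) (at 0 within {0<..<T})"
      proof (rule tendsto_test[where A = UNIV and K = 1])
        have c: "continuous_on UNIV (\<lambda>(z, x). cutoff R z * \<Psi> 0 z x)"
          by (rule jc_slice[OF jc_mult[OF jc_cutoff(1) C12_withD(6)[OF C12]] UNIV_I])
        have bd: "bounded (range (\<lambda>(z, x). cutoff R z * \<Psi> 0 z x))"
          unfolding bounded_iff
        proof (intro exI[of _ E] ballI)
          fix v assume "v \<in> range (\<lambda>(z, x). cutoff R z * \<Psi> 0 z x)"
          then obtain z x where v: "v = cutoff R z * \<Psi> 0 z x" by auto
          have "\<bar>cutoff R z\<bar> * \<bar>\<Psi> 0 z x\<bar> \<le> 1 * E"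
            using cutoff_nonneg[OF R0, of z] cutoff_le_1[OF R0, of z] E(1)[of 0 z x] T by (intro mult_mono) auto
          then show "norm v \<le> E" by (simp add: v abs_mult)
        qed
        have "cutoff R 0 * \<Psi> 0 0 x = cos \<theta>" for x
          by (simp add: cutoff_def \<Psi>_def)
        then show "((\<lambda>t. \<integral>(z, x). cutoff R z * \<Psi> 0 z x * m s t z x \<partial>zx) \<longlongrightarrow> cos \<theta>) (at 0 within {0<..<T})"
          using m_init[OF c bd, of s] by (simp add: at_within_Ioo_at_right[OF T] \<rho>0_integral_1)
        show "integrable zx (\<lambda>(z, x). m s t z x)" if "t \<in> {0<..<T}" for t
          by (rule m_integrable) (use that in auto)
        show "(\<integral>(z, x). \<bar>m s t z x\<bar> \<partial>zx) \<le> 1" if "t \<in> {0<..<T}" for t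
          using m_integral[of t s] that by (simp add: m_abs)
      qed (use R0 C12_withD(6)[OF C12] in auto)
      then show ?thesis unfolding I_def[abs_def] by (simp add: at_within_Ioo_at_right[OF T])
    qed
    have e1: "eventually (\<lambda>a. \<bar>I t - I a\<bar> \<le> q R * t - q R * a) (at_right 0)"
      using eventually_at_right_real[of 0 t] t by (auto elim!: eventually_mono intro!: inc)
    have e2: "((\<lambda>a. \<bar>I t - I a\<bar>) \<longlongrightarrow> \<bar>I t - cos \<theta>\<bar>) (at_right 0)"
      by (intro tendsto_intros lim)
    have e3: "((\<lambda>a. q R * t - q R * a) \<longlongrightarrow> q R * t - q R * 0) (at_right 0)"
      by (intro tendsto_intros)
    have "\<bar>I t - cos \<theta>\<bar> \<le> q R * t - q R * 0"
      by (rule tendsto_le[OF trivial_limit_at_right_real e3 e2 e1])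
    then show ?thesis by (simp add: I_def)
  qed
  have i\<Psi>: "integrable zx (\<lambda>(z, x). \<Psi> t z x * m s t z x)"
  proof (rule zx_integrable_bound(1)[OF _ zx_cmult(1)[OF m_integrable[OF t, of s], of E]])
    show "(\<lambda>(z, x). \<Psi> t z x * m s t z x) \<in> borel_measurable zx"
      by (rule measurable_jc[OF jc_mult[OF C12_withD(6)[OF C12] m_cont] t])
    show "\<bar>\<Psi> t z x * m s t z x\<bar> \<le> E * m s t z x" for z x
      unfolding abs_mult m_abs[OF t] by (rule mult_right_mono[OF E(1) m_nonneg[OF t]]) (use t in auto)
  qed
  have "(\<lambda>n. \<bar>(\<integral>(z, x). cutoff (real (Suc n)) z * (\<Psi> t z x * m s t z x) \<partial>zx) - cos \<theta>\<bar>) \<longlonglongrightarrow> \<bar>(\<integral>(z, x). \<Psi> t z x * m s t z x \<partial>zx) - cos \<theta>\<bar>"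
    by (intro tendsto_intros cutoff_integral_tendsto[OF i\<Psi>])
  moreover have "(\<lambda>n. q (real (Suc n)) * t) \<longlonglongrightarrow> (0 * (\<bar>s\<bar> * E + \<sigma>\<^sup>2 * (\<bar>l\<bar> * E)) + \<sigma>\<^sup>2 / 2 * 0 * E) * t"
    unfolding q_def by (intro tendsto_add tendsto_mult tendsto_const LIMSEQ_over_Suc)
  ultimately have "\<bar>(\<integral>(z, x). \<Psi> t z x * m s t z x \<partial>zx) - cos \<theta>\<bar> \<le> (0 * (\<bar>s\<bar> * E + \<sigma>\<^sup>2 * (\<bar>l\<bar> * E)) + \<sigma>\<^sup>2 / 2 * 0 * E) * t"
    by (rule LIMSEQ_le) (use step in \<open>auto simp: mult.assoc\<close>)
  then have "(\<integral>(z, x). \<Psi> t z x * m s t z x \<partial>zx) = cos \<theta>" by simp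
  moreover have "(\<integral>(z, x). \<Psi> t z x * m s t z x \<partial>zx) = exp (\<kappa> * t) * (\<integral>(z, x). cos (l * (z - s * t) + \<theta>) * m s t z x \<partial>zx)"
    unfolding \<Psi>_def mult.assoc by (rule zx_cmult(2))
  ultimately show ?thesis
    by (simp add: \<kappa>_def exp_minus field_simps)
qed

text \<open>\<open>marginal_cos\<close> with the offsets \<open>0\<close> and
  \<open>- pi / 2\<close> gives the real and imaginary parts of the characteristic function of the
  normalised signal. Levy's theorem then identifies the law.\<close>

lemma marginal_distr:
  assumes t: "t \<in> {0<..T}"
  shows "distr (density zx (\<lambda>(z, x). ennreal (m s t z x))) borel (\<lambda>(z, x). (z - s * t) / (\<sigma> * sqrt t)) = std_normal_distribution"
proof -
  let ?M = "density zx (\<lambda>(z, x). ennreal (m s t z x))"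
  let ?Y = "\<lambda>(z, x :: 'n torus). (z - s * t) / (\<sigma> * sqrt t)"
  have mm: "(\<lambda>(z, x). m s t z x) \<in> borel_measurable zx" by (rule m_measurable[OF t])
  have mE: "(\<lambda>(z, x). ennreal (m s t z x)) = (\<lambda>p. ennreal ((\<lambda>(z, x). m s t z x) p))" by auto
  have dm [measurable]: "(\<lambda>(z, x). ennreal (m s t z x)) \<in> borel_measurable zx"
    unfolding mE using mm by (rule measurable_compose[OF _ measurable_ennreal])
  have Y [measurable]: "?Y \<in> borel_measurable zx"
    unfolding split_def by measurable
  have pM: "prob_space ?M"
  proof (rule prob_spaceI)
    have "emeasure ?M (space ?M) = (\<integral>\<^sup>+p. (\<lambda>(z, x). ennreal (m s t z x)) p * indicator (space zx) p \<partial>zx)"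
      by (simp only: space_density emeasure_density[OF dm sets.top])
    also have "\<dots> = (\<integral>\<^sup>+(z, x). ennreal (m s t z x) \<partial>zx)"
      by (rule nn_integral_cong) simp
    finally show "emeasure ?M (space ?M) = 1" by (simp only: m_mass[OF t])
  qed
  interpret M: prob_space ?M by (rule pM)
  have "real_distribution (distr ?M borel ?Y)"
    by (rule M.real_distribution_distr) (simp add: Y)
  moreover have "char (distr ?M borel ?Y) = char std_normal_distribution"
  proof
    fix \<theta> :: real
    define l where "l = \<theta> / (\<sigma> * sqrt t)"
    have ly: "\<theta> * ((z - s * t) / (\<sigma> * sqrt t)) = l * (z - s * t)" for z by (simp add: l_def)
    have lt: "l\<^sup>2 * \<sigma>\<^sup>2 / 2 * t = \<theta>\<^sup>2 / 2"
      using t \<sigma> by (simp add: l_def power_divide power_mult_distrib)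
    have ex: "exp (- l\<^sup>2 * \<sigma>\<^sup>2 / 2 * t) = exp (- (\<theta>\<^sup>2) / 2)"
      using lt by simp
    let ?c = "\<lambda>p. (\<lambda>(z, x). cos (l * (z - s * t)) * m s t z x) p" and ?s = "\<lambda>p. (\<lambda>(z, x). sin (l * (z - s * t)) * m s t z x) p"
    have ic: "integrable zx ?c" and isn: "integrable zx ?s"
    proof -
      have "integrable zx (\<lambda>(z, x). cos (l * (z - s * t) + \<theta>') * m s t z x)" for \<theta>'
      proof (rule zx_integrable_bound(1)[OF _ m_integrable[OF t, of s]])
        have "(\<lambda>(z, x :: 'n torus). cos (l * (z - s * t) + \<theta>')) \<in> borel_measurable zx"
          unfolding split_def by measurable
        then show "(\<lambda>(z, x). cos (l * (z - s * t) + \<theta>') * m s t z x) \<in> borel_measurable zx"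
          using mm unfolding split_def by (rule borel_measurable_times)
        show "\<bar>cos (l * (z - s * t) + \<theta>') * m s t z x\<bar> \<le> m s t z x" for z x
          unfolding abs_mult m_abs[OF t] by (rule mult_left_le_one_le) (auto intro: m_nonneg[OF t])
      qed
      from this[of 0] this[of "- pi / 2"] show "integrable zx ?c" "integrable zx ?s"
        by (simp_all add: cos_diff)
    qed
    have "char (distr ?M borel ?Y) \<theta> = (\<integral>p. iexp (\<theta> * ?Y p) \<partial>?M)"
      unfolding char_def by (rule integral_distr) (auto simp: Y)
    also have "\<dots> = (\<integral>p. (\<lambda>(z, x). m s t z x) p *\<^sub>R iexp (\<theta> * ?Y p) \<partial>zx)"
      unfolding mE by (rule integral_density) (use mm m_nonneg[OF t] in \<open>auto intro!: AE_I2\<close>)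
    also have "\<dots> = (\<integral>p. complex_of_real (?c p) + \<i> * complex_of_real (?s p) \<partial>zx)"
    proof (rule Bochner_Integration.integral_cong[OF refl])
      have ie: "iexp u = complex_of_real (cos u) + \<i> * complex_of_real (sin u)" for u :: real
        by (simp add: cis_conv_exp[symmetric] complex_eq_iff)
      have "m s t z x *\<^sub>R iexp (\<theta> * ((z - s * t) / (\<sigma> * sqrt t)))
          = complex_of_real (cos (l * (z - s * t)) * m s t z x) + \<i> * complex_of_real (sin (l * (z - s * t)) * m s t z x)" for z x
        unfolding ly ie by (simp add: scaleR_conv_of_real algebra_simps)
      then show "(\<lambda>(z, x). m s t z x) p *\<^sub>R iexp (\<theta> * ?Y p) = complex_of_real (?c p) + \<i> * complex_of_real (?s p)" for p
        by (cases p) (simp only: prod.case)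
    qed
    also have "\<dots> = (\<integral>p. complex_of_real (?c p) \<partial>zx) + \<i> * (\<integral>p. complex_of_real (?s p) \<partial>zx)"
      by (subst Bochner_Integration.integral_add) (use ic isn in auto)
    also have "\<dots> = complex_of_real (\<integral>p. ?c p \<partial>zx) + \<i> * complex_of_real (\<integral>p. ?s p \<partial>zx)"
      by simp
    also have "(\<integral>p. ?c p \<partial>zx) = exp (- (\<theta>\<^sup>2) / 2)"
      using marginal_cos[OF t, of l s 0] ex by simp
    also have "(\<integral>p. ?s p \<partial>zx) = 0"
      using marginal_cos[OF t, of l s "- pi / 2"] by (simp add: cos_diff)
    finally show "char (distr ?M borel ?Y) \<theta> = char std_normal_distribution \<theta>"
      by (simp add: char_std_normal_distribution)
  qed
  ultimately show ?thesis
    using Levy_uniqueness real_dist_normal_dist by blast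
qed

lemma marginal_nn_integral:
  assumes t: "t \<in> {0<..T}" and h: "h \<in> borel_measurable borel"
  shows "(\<integral>\<^sup>+ (z, x). ennreal (m s t z x) * h z \<partial>zx) = (\<integral>\<^sup>+ y. h (s * t + \<sigma> * sqrt t * y) \<partial>std_normal_distribution)"
proof -
  let ?M = "density zx (\<lambda>(z, x). ennreal (m s t z x))"
  let ?Y = "\<lambda>(z, x :: 'n torus). (z - s * t) / (\<sigma> * sqrt t)"
  have mE: "(\<lambda>(z, x). ennreal (m s t z x)) = (\<lambda>p. ennreal ((\<lambda>(z, x). m s t z x) p))" by auto
  have mm: "(\<lambda>(z, x). ennreal (m s t z x)) \<in> borel_measurable zx"
    unfolding mE using m_measurable[OF t] by (rule measurable_compose[OF _ measurable_ennreal])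
  have h' [measurable]: "(\<lambda>y. h (s * t + \<sigma> * sqrt t * y)) \<in> borel_measurable borel"
    by (rule measurable_compose[OF _ h]) measurable
  have Y: "?Y \<in> borel_measurable zx" unfolding split_def by measurable
  have hz: "(\<lambda>(z, x :: 'n torus). h z) \<in> borel_measurable zx"
    unfolding split_def by (rule measurable_compose[OF measurable_fst]) (simp add: h)
  have "(\<integral>\<^sup>+ y. h (s * t + \<sigma> * sqrt t * y) \<partial>std_normal_distribution)
      = (\<integral>\<^sup>+ y. h (s * t + \<sigma> * sqrt t * y) \<partial>distr ?M borel ?Y)"
    by (simp only: marginal_distr[OF t])
  also have "\<dots> = (\<integral>\<^sup>+ p. h (s * t + \<sigma> * sqrt t * ?Y p) \<partial>?M)"
    by (rule nn_integral_distr) (use Y h' in auto)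
  also have "(\<lambda>p. h (s * t + \<sigma> * sqrt t * ?Y p)) = (\<lambda>(z, x). h z)"
    using t \<sigma> by (auto simp: fun_eq_iff)
  also have "(\<integral>\<^sup>+ p. (\<lambda>(z, x). h z) p \<partial>?M) = (\<integral>\<^sup>+ p. (\<lambda>(z, x). ennreal (m s t z x)) p * (\<lambda>(z, x). h z) p \<partial>zx)"
    by (rule nn_integral_density[OF mm hz])
  finally show ?thesis by (simp add: split_def)
qed

text \<open>In the variable \<open>y = z / (\<sigma> \<surd>t)\<close> the law of the signal for \<open>s = 0\<close> is standard normal.\<close>

lemma exp_moment:
  assumes "\<gamma> < 1 / 2"
  obtains K where "K \<ge> 0"
    "\<And>t. t \<in> {0<..T} \<Longrightarrow> integrable zx (\<lambda>(z, x). (1 + z\<^sup>2 / (\<sigma>\<^sup>2 * t)) * exp (\<gamma> * (z\<^sup>2 / (\<sigma>\<^sup>2 * t))) * m 0 t z x)"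
    "\<And>t. t \<in> {0<..T} \<Longrightarrow> (\<integral>(z, x). (1 + z\<^sup>2 / (\<sigma>\<^sup>2 * t)) * exp (\<gamma> * (z\<^sup>2 / (\<sigma>\<^sup>2 * t))) * m 0 t z x \<partial>zx) \<le> K"
proof -
  define K where "K = (\<integral>\<^sup>+y. ennreal ((1 + y\<^sup>2) * exp (\<gamma> * y\<^sup>2)) \<partial>std_normal_distribution)"
  have K: "K < \<infinity>" unfolding K_def by (rule gaussian_exp_moment[OF assms])
  have *: "integrable zx (\<lambda>(z, x). (1 + z\<^sup>2 / (\<sigma>\<^sup>2 * t)) * exp (\<gamma> * (z\<^sup>2 / (\<sigma>\<^sup>2 * t))) * m 0 t z x) \<and>
      (\<integral>(z, x). (1 + z\<^sup>2 / (\<sigma>\<^sup>2 * t)) * exp (\<gamma> * (z\<^sup>2 / (\<sigma>\<^sup>2 * t))) * m 0 t z x \<partial>zx) \<le> enn2real K" if t: "t \<in> {0<..T}" for t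
  proof -
    let ?h = "\<lambda>z. (1 + z\<^sup>2 / (\<sigma>\<^sup>2 * t)) * exp (\<gamma> * (z\<^sup>2 / (\<sigma>\<^sup>2 * t)))"
    have h0: "?h z \<ge> 0" for z using t by (intro mult_nonneg_nonneg add_nonneg_nonneg) auto
    have hm: "(\<lambda>z. ennreal (?h z)) \<in> borel_measurable borel" by measurable
    have "(\<integral>\<^sup>+ (z, x). ennreal (m 0 t z x) * ennreal (?h z) \<partial>zx) = (\<integral>\<^sup>+ y. ennreal (?h (0 * t + \<sigma> * sqrt t * y)) \<partial>std_normal_distribution)"
      by (rule marginal_nn_integral[OF t hm])
    also have "\<dots> = K"
      unfolding K_def using t \<sigma> by (intro nn_integral_cong) (simp add: power_mult_distrib)
    finally have nn: "(\<integral>\<^sup>+ (z, x). ennreal (?h z * m 0 t z x) \<partial>zx) = K"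
      using h0 m_nonneg[OF t] by (simp add: ennreal_mult' mult.commute)
    have meas: "(\<lambda>(z, x). ?h z * m 0 t z x) \<in> borel_measurable zx"
    proof -
      have "(\<lambda>(z, x :: 'n torus). ?h z) \<in> borel_measurable zx"
        unfolding split_def by measurable
      then show ?thesis
        using m_measurable[OF t, of 0] unfolding split_def by (rule borel_measurable_times)
    qed
    have nn': "(\<integral>\<^sup>+ p. ennreal ((\<lambda>(z, x). ?h z * m 0 t z x) p) \<partial>zx) = K"
      using nn by (simp add: split_def)
    have pos: "AE p in zx. 0 \<le> (\<lambda>(z, x). ?h z * m 0 t z x) p"
    proof (intro AE_I2)
      show "0 \<le> (\<lambda>(z, x). ?h z * m 0 t z x) p" for p
        using mult_nonneg_nonneg[OF h0 m_nonneg[OF t]] by (cases p) (simp only: prod.case)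
    qed
    have "integrable zx (\<lambda>(z, x). ?h z * m 0 t z x)"
      by (rule integrableI_nonneg[OF meas pos]) (use nn' K in simp)
    moreover have "(\<integral>(z, x). ?h z * m 0 t z x \<partial>zx) = enn2real K"
      using integral_eq_nn_integral[OF meas pos] nn' by simp
    ultimately show ?thesis by simp
  qed
  show thesis
    by (rule that[of "enn2real K"]) (use * in auto)
qed

end

section \<open>The change of state and uniqueness of the flow of densities\<close>

definition girsanov :: "real \<Rightarrow> real \<Rightarrow> real \<Rightarrow> real \<Rightarrow> real" where
  "girsanov \<sigma> s t z = exp (s * z / \<sigma>\<^sup>2 - s\<^sup>2 * t / (2 * \<sigma>\<^sup>2))"

lemma girsanov_pos: "girsanov \<sigma> s t z > 0"
  by (simp add: girsanov_def)

lemma jc_girsanov: "jointly_continuous_on A (\<lambda>t z x. girsanov \<sigma> s t z)"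
  unfolding girsanov_def divide_inverse by (rule jc_tz) (auto simp: split_def intro!: continuous_intros)

lemma FP_with_diff:
  assumes "FP_with T \<sigma> \<sigma>' s b \<mu> \<mu>t \<mu>z \<mu>zz \<mu>i \<mu>ii vi" "FP_with T \<sigma> \<sigma>' s b \<nu> \<nu>t \<nu>z \<nu>zz \<nu>i \<nu>ii wi"
  shows "FP_with T \<sigma> \<sigma>' s b (\<lambda>t z x. \<mu> t z x - \<nu> t z x) (\<lambda>t z x. \<mu>t t z x - \<nu>t t z x) (\<lambda>t z x. \<mu>z t z x - \<nu>z t z x)
     (\<lambda>t z x. \<mu>zz t z x - \<nu>zz t z x) (\<lambda>i t z x. \<mu>i i t z x - \<nu>i i t z x) (\<lambda>i t z x. \<mu>ii i t z x - \<nu>ii i t z x) (\<lambda>i t z x. vi i t z x - wi i t z x)"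
  unfolding FP_with_def C12_with_def left_diff_distrib
proof (intro conjI ballI allI)
  note c = C12_withD[OF FP_withD(1)[OF assms(1)]] and d = C12_withD[OF FP_withD(1)[OF assms(2)]]
  fix t z x i assume t: "t \<in> {0<..<T}"
  show "((\<lambda>t. \<mu> t z x - \<nu> t z x) has_real_derivative \<mu>t t z x - \<nu>t t z x) (at t)"
    by (rule DERIV_diff[OF c(1)[OF t] d(1)[OF t]])
  show "((\<lambda>z. \<mu> t z x - \<nu> t z x) has_real_derivative \<mu>z t z x - \<nu>z t z x) (at z)"
    by (rule DERIV_diff[OF c(2)[OF t] d(2)[OF t]])
  show "((\<lambda>z. \<mu>z t z x - \<nu>z t z x) has_real_derivative \<mu>zz t z x - \<nu>zz t z x) (at z)"
    by (rule DERIV_diff[OF c(3)[OF t] d(3)[OF t]])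
  show "has_tpartial i (\<lambda>x. \<mu> t z x - \<nu> t z x) (\<mu>i i t z x - \<nu>i i t z x) x"
    by (rule has_tpartial_diff[OF c(4)[OF t] d(4)[OF t]])
  show "has_tpartial i (\<lambda>x. \<mu>i i t z x - \<nu>i i t z x) (\<mu>ii i t z x - \<nu>ii i t z x) x"
    by (rule has_tpartial_diff[OF c(5)[OF t] d(5)[OF t]])
  show "has_tpartial i (\<lambda>x. \<mu> t z x * b t z x $ i - \<nu> t z x * b t z x $ i) (vi i t z x - wi i t z x) x"
    by (rule has_tpartial_diff[OF FP_withD(4)[OF assms(1) t] FP_withD(4)[OF assms(2) t]])
  show "\<mu>t t z x - \<nu>t t z x + (\<Sum>i\<in>UNIV. vi i t z x - wi i t z x) + s * (\<mu>z t z x - \<nu>z t z x)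
      - \<sigma>\<^sup>2 / 2 * (\<mu>zz t z x - \<nu>zz t z x) - \<sigma>'\<^sup>2 / 2 * (\<Sum>i\<in>UNIV. \<mu>ii i t z x - \<nu>ii i t z x) = 0"
    unfolding FP_withD(5)[OF assms(1) t] FP_withD(5)[OF assms(2) t] by (simp add: sum_subtractf algebra_simps add_divide_distrib diff_divide_distrib)
next
  note c = C12_withD[OF FP_withD(1)[OF assms(1)]] and d = C12_withD[OF FP_withD(1)[OF assms(2)]]
  fix i
  show "jointly_continuous_on {0<..<T} (\<lambda>t z x. \<mu> t z x - \<nu> t z x)" "jointly_continuous_on {0<..<T} (\<lambda>t z x. \<mu>t t z x - \<nu>t t z x)"
    "jointly_continuous_on {0<..<T} (\<lambda>t z x. \<mu>z t z x - \<nu>z t z x)" "jointly_continuous_on {0<..<T} (\<lambda>t z x. \<mu>zz t z x - \<nu>zz t z x)"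
    "jointly_continuous_on {0<..<T} (\<lambda>t z x. \<mu>i i t z x - \<nu>i i t z x)" "jointly_continuous_on {0<..<T} (\<lambda>t z x. \<mu>ii i t z x - \<nu>ii i t z x)"
    "jointly_continuous_on {0<..<T} (\<lambda>t z x. vi i t z x - wi i t z x)" "jointly_continuous_on {0<..<T} (\<lambda>t z x. b t z x $ i)"
    by (intro jc_diff c(6-11) d(6-11) FP_withD(2,3)[OF assms(1)] FP_withD(3)[OF assms(2)])+
qed

text \<open>The factor turns the \<open>z\<close>-derivative into itself plus
  \<open>s / \<sigma>\<^sup>2\<close>. In \<open>\<sigma>\<^sup>2 / 2\<close> times the second
  derivative the cross term is \<open>s * \<mu>z\<close>, the new transport term. The terms without
  derivatives, \<open>s\<^sup>2 / \<sigma>\<^sup>2\<close> from transport and twice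
  \<open>- s\<^sup>2 / (2 * \<sigma>\<^sup>2)\<close> from time derivative and diffusion,
  cancel.\<close>

lemma FP_with_girsanov:
  assumes F: "FP_with T \<sigma> \<sigma>' 0 b \<mu> \<mu>t \<mu>z \<mu>zz \<mu>i \<mu>ii vi" and \<sigma>: "\<sigma> > 0"
  shows "FP_with T \<sigma> \<sigma>' s b (\<lambda>t z x. girsanov \<sigma> s t z * \<mu> t z x)
     (\<lambda>t z x. girsanov \<sigma> s t z * (\<mu>t t z x - s\<^sup>2 / (2 * \<sigma>\<^sup>2) * \<mu> t z x))
     (\<lambda>t z x. girsanov \<sigma> s t z * (\<mu>z t z x + s / \<sigma>\<^sup>2 * \<mu> t z x))
     (\<lambda>t z x. girsanov \<sigma> s t z * (\<mu>zz t z x + 2 * (s / \<sigma>\<^sup>2) * \<mu>z t z x + (s / \<sigma>\<^sup>2)\<^sup>2 * \<mu> t z x))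
     (\<lambda>i t z x. girsanov \<sigma> s t z * \<mu>i i t z x) (\<lambda>i t z x. girsanov \<sigma> s t z * \<mu>ii i t z x)
     (\<lambda>i t z x. girsanov \<sigma> s t z * vi i t z x)"
  unfolding FP_with_def C12_with_def mult.assoc
proof (intro conjI ballI allI)
  note c = C12_withD[OF FP_withD(1)[OF F]]
  have g: "girsanov \<sigma> s t z = exp ((s / \<sigma>\<^sup>2) * z - (s\<^sup>2 / (2 * \<sigma>\<^sup>2)) * t)" for t z
    by (simp add: girsanov_def)
  have gt: "((\<lambda>t. girsanov \<sigma> s t z) has_real_derivative - (s\<^sup>2 / (2 * \<sigma>\<^sup>2)) * girsanov \<sigma> s t z) (at t)" for t z
    unfolding g
    by (rule DERIV_cong[OF DERIV_chain2[OF DERIV_exp DERIV_diff[OF DERIV_const DERIV_cmult_Id]]]) simp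
  have gz: "((\<lambda>z. girsanov \<sigma> s t z) has_real_derivative (s / \<sigma>\<^sup>2) * girsanov \<sigma> s t z) (at z)" for t z
    unfolding g
    by (rule DERIV_cong[OF DERIV_chain2[OF DERIV_exp DERIV_diff[OF DERIV_cmult_Id DERIV_const]]]) simp
  fix t z x i assume t: "t \<in> {0<..<T}"
  show "((\<lambda>t. girsanov \<sigma> s t z * \<mu> t z x) has_real_derivative girsanov \<sigma> s t z * (\<mu>t t z x - s\<^sup>2 / (2 * \<sigma>\<^sup>2) * \<mu> t z x)) (at t)"
    by (rule DERIV_cong[OF DERIV_mult[OF gt c(1)[OF t]]]) (simp add: algebra_simps)
  show "((\<lambda>z. girsanov \<sigma> s t z * \<mu> t z x) has_real_derivative girsanov \<sigma> s t z * (\<mu>z t z x + s / \<sigma>\<^sup>2 * \<mu> t z x)) (at z)"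
    by (rule DERIV_cong[OF DERIV_mult[OF gz c(2)[OF t]]]) (simp add: algebra_simps)
  show "((\<lambda>z. girsanov \<sigma> s t z * (\<mu>z t z x + s / \<sigma>\<^sup>2 * \<mu> t z x)) has_real_derivative
      girsanov \<sigma> s t z * (\<mu>zz t z x + 2 * (s / \<sigma>\<^sup>2 * \<mu>z t z x) + (s / \<sigma>\<^sup>2)\<^sup>2 * \<mu> t z x)) (at z)"
    by (rule DERIV_cong[OF DERIV_mult[OF gz DERIV_add[OF c(3)[OF t] DERIV_cmult[OF c(2)[OF t]]]]]) (simp add: algebra_simps power2_eq_square)
  show "has_tpartial i (\<lambda>x. girsanov \<sigma> s t z * \<mu> t z x) (girsanov \<sigma> s t z * \<mu>i i t z x) x"
    by (rule has_tpartial_cmult[OF c(4)[OF t]])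
  show "has_tpartial i (\<lambda>x. girsanov \<sigma> s t z * \<mu>i i t z x) (girsanov \<sigma> s t z * \<mu>ii i t z x) x"
    by (rule has_tpartial_cmult[OF c(5)[OF t]])
  show "has_tpartial i (\<lambda>x. girsanov \<sigma> s t z * (\<mu> t z x * b t z x $ i)) (girsanov \<sigma> s t z * vi i t z x) x"
    by (rule has_tpartial_cmult[OF FP_withD(4)[OF F t]])
  have "s / \<sigma>\<^sup>2 * \<sigma>\<^sup>2 = s" using \<sigma> by simp
  show "girsanov \<sigma> s t z * (\<mu>t t z x - s\<^sup>2 / (2 * \<sigma>\<^sup>2) * \<mu> t z x) + (\<Sum>i\<in>UNIV. girsanov \<sigma> s t z * vi i t z x) + s * (girsanov \<sigma> s t z * (\<mu>z t z x + s / \<sigma>\<^sup>2 * \<mu> t z x))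
      - \<sigma>\<^sup>2 / 2 * (girsanov \<sigma> s t z * (\<mu>zz t z x + 2 * (s / \<sigma>\<^sup>2 * \<mu>z t z x) + (s / \<sigma>\<^sup>2)\<^sup>2 * \<mu> t z x)) - \<sigma>'\<^sup>2 / 2 * (\<Sum>i\<in>UNIV. girsanov \<sigma> s t z * \<mu>ii i t z x) = 0"
    unfolding FP_withD(5)[OF F t] sum_distrib_left[symmetric] using \<sigma> by (simp add: field_simps power2_eq_square)
next
  note c = C12_withD[OF FP_withD(1)[OF F]]
  fix i
  show "jointly_continuous_on {0<..<T} (\<lambda>t z x. girsanov \<sigma> s t z * \<mu> t z x)"
    "jointly_continuous_on {0<..<T} (\<lambda>t z x. girsanov \<sigma> s t z * (\<mu>t t z x - s\<^sup>2 / (2 * \<sigma>\<^sup>2) * \<mu> t z x))"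
    "jointly_continuous_on {0<..<T} (\<lambda>t z x. girsanov \<sigma> s t z * (\<mu>z t z x + s / \<sigma>\<^sup>2 * \<mu> t z x))"
    "jointly_continuous_on {0<..<T} (\<lambda>t z x. girsanov \<sigma> s t z * (\<mu>zz t z x + 2 * (s / \<sigma>\<^sup>2 * \<mu>z t z x) + (s / \<sigma>\<^sup>2)\<^sup>2 * \<mu> t z x))"
    "jointly_continuous_on {0<..<T} (\<lambda>t z x. girsanov \<sigma> s t z * \<mu>i i t z x)"
    "jointly_continuous_on {0<..<T} (\<lambda>t z x. girsanov \<sigma> s t z * \<mu>ii i t z x)"
    "jointly_continuous_on {0<..<T} (\<lambda>t z x. girsanov \<sigma> s t z * vi i t z x)" "jointly_continuous_on {0<..<T} (\<lambda>t z x. b t z x $ i)"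
    by (intro jc_intros jc_girsanov c(6-11) FP_withD(2,3)[OF F])+
qed

text \<open>The equation holds on the open interval only; the time \<open>T\<close> is reached by
  continuity.\<close>

lemma eq_at_endpoint:
  fixes f g :: "real \<Rightarrow> real"
  assumes T: "T > 0" and c: "continuous_on {0<..T} f" "continuous_on {0<..T} g"
    and eq: "\<And>t. t \<in> {0<..<T} \<Longrightarrow> f t = g t" and t: "t \<in> {0<..T}"
  shows "f t = g t"
proof (cases "t = T")
  case True
  have sub: "at T within {0<..<T} \<le> at T within {0<..T}"
    by (rule at_le) auto
  have f: "(f \<longlongrightarrow> f T) (at T within {0<..<T})" and g: "(g \<longlongrightarrow> g T) (at T within {0<..<T})"
    using c T unfolding continuous_on_def by (auto intro!: tendsto_mono[OF sub])
  have "(f \<longlongrightarrow> g T) (at T within {0<..<T})"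
    by (rule Lim_transform_eventually[OF g]) (auto simp: eventually_at_filter eq)
  moreover have "at T within {0<..<T} \<noteq> bot"
    using T by (simp add: at_within_eq_bot_iff islimpt_greaterThanLessThan2)
  ultimately have "f T = g T"
    using f tendsto_unique by blast
  then show ?thesis using True by simp
qed (use t eq in auto)

context signal_flow
begin

lemma init_test:
  assumes \<Psi>: "jointly_continuous_on {0..<T} \<Psi>" and R: "R > 0"
  shows "((\<lambda>t. \<integral>(z, x). cutoff R z * \<Psi> t z x * m s t z x \<partial>zx) \<longlongrightarrow> (\<integral>x. \<Psi> 0 0 x * \<rho>0 x \<partial>torus_lebesgue)) (at_right 0)"
proof -
  have "((\<lambda>t. \<integral>(z, x). cutoff R z * \<Psi> t z x * m s t z x \<partial>zx) \<longlongrightarrow> (\<integral>x. \<Psi> 0 0 x * \<rho>0 x \<partial>torus_lebesgue)) (at 0 within {0<..<T})"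
  proof (rule tendsto_test[where A = "{0..<T}" and K = 1])
    have c: "continuous_on UNIV (\<lambda>(z, x). cutoff R z * \<Psi> 0 z x)"
      by (rule jc_slice[OF jc_mult[OF jc_cutoff(1) \<Psi>]]) (use T in auto)
    obtain B where B: "B \<ge> 0" "\<And>z x. \<bar>z\<bar> \<le> R \<Longrightarrow> \<bar>(\<lambda>(z, x). cutoff R z * \<Psi> 0 z x) (z, x)\<bar> \<le> B"
      by (rule continuous_bounded_strip[OF c, of R]) blast
    have "bounded (range (\<lambda>(z, x). cutoff R z * \<Psi> 0 z x))"
      unfolding bounded_iff
    proof (intro exI[of _ B] ballI)
      fix v assume "v \<in> range (\<lambda>(z, x). cutoff R z * \<Psi> 0 z x)"
      then obtain z x where v: "v = cutoff R z * \<Psi> 0 z x" by auto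
      show "norm v \<le> B"
        using B(2)[of z x] B(1) cutoff_supp[OF R, of z] by (cases "\<bar>z\<bar> \<le> R") (auto simp: v)
    qed
    from m_init[OF c this, of s]
    show "((\<lambda>t. \<integral>(z, x). cutoff R z * \<Psi> 0 z x * m s t z x \<partial>zx) \<longlongrightarrow> (\<integral>x. \<Psi> 0 0 x * \<rho>0 x \<partial>torus_lebesgue)) (at 0 within {0<..<T})"
      by (simp add: at_within_Ioo_at_right[OF T] cutoff_def)
    show "integrable zx (\<lambda>(z, x). m s t z x)" if "t \<in> {0<..<T}" for t
      by (rule m_integrable) (use that in auto)
    show "(\<integral>(z, x). \<bar>m s t z x\<bar> \<partial>zx) \<le> 1" if "t \<in> {0<..<T}" for t
      using m_integral[of t s] that by (simp add: m_abs)
  qed (use R T \<Psi> in auto)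
  then show ?thesis by (simp add: at_within_Ioo_at_right[OF T])
qed

text \<open>The initial measure sits on \<open>z = 0\<close>, where the bounded continuous test
  function \<open>min 1 (z\<^sup>2)\<close> vanishes.\<close>

lemma tail_m: "((\<lambda>t. \<integral>(z, x). min 1 (z\<^sup>2) * m s t z x \<partial>zx) \<longlongrightarrow> 0) (at_right 0)"
proof -
  have c: "continuous_on UNIV (\<lambda>(z :: real, x :: 'n torus). min 1 (z\<^sup>2))"
    unfolding split_def
    by (rule continuous_on_min[OF continuous_on_const continuous_on_power[OF continuous_on_fst[OF continuous_on_id]]])
  have b: "bounded (range (\<lambda>(z :: real, x :: 'n torus). min 1 (z\<^sup>2)))"
    unfolding bounded_iff by (intro exI[of _ 1]) auto
  show ?thesis using m_init[OF c b, of s] by simp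
qed

lemma z_sq_m_integrable:
  assumes t: "t \<in> {0<..T}"
  shows "integrable zx (\<lambda>(z, x). min 1 (z\<^sup>2) * m s t z x)"
proof (rule zx_integrable_bound(1)[OF _ m_integrable[OF t, of s]])
  have "(\<lambda>(z, x :: 'n torus). min 1 (z\<^sup>2)) \<in> borel_measurable zx"
    unfolding split_def by measurable
  then show "(\<lambda>(z, x). min 1 (z\<^sup>2) * m s t z x) \<in> borel_measurable zx"
    using m_measurable[OF t, of s] unfolding split_def by (rule borel_measurable_times)
  show "\<bar>min 1 (z\<^sup>2) * m s t z x\<bar> \<le> m s t z x" for z x
    unfolding abs_mult m_abs[OF t] by (rule mult_left_le_one_le) (auto intro: m_nonneg[OF t])
qed

text \<open>Expanding the square of \<open>z - 2 * s * t\<close> splits \<open>s * z\<close>. The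
  resulting coefficient \<open>1 / 4\<close> of \<open>z\<^sup>2 / (\<sigma>\<^sup>2 * t)\<close>
  stays below the threshold \<open>1 / 2\<close> of \<open>exp_moment\<close>.\<close>

lemma girsanov_le:
  assumes t: "t \<in> {0<..T}"
  shows "girsanov \<sigma> s t z \<le> exp (s\<^sup>2 * T / \<sigma>\<^sup>2) * exp (1 / 4 * (z\<^sup>2 / (\<sigma>\<^sup>2 * t)))"
proof -
  have "0 \<le> (z - 2 * s * t)\<^sup>2" by simp
  then have "4 * t * (s * z) \<le> z\<^sup>2 + 4 * s\<^sup>2 * t\<^sup>2"
    by (simp add: power2_eq_square algebra_simps)
  then have "s * z \<le> (z\<^sup>2 + 4 * s\<^sup>2 * t\<^sup>2) / (4 * t)"
    using t by (simp add: pos_le_divide_eq mult.commute)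
  also have "\<dots> = 1 / 4 * (z\<^sup>2 / t) + s\<^sup>2 * t"
    using t by (simp add: field_simps power2_eq_square)
  also have "\<dots> \<le> 1 / 4 * (z\<^sup>2 / t) + s\<^sup>2 * T"
    using t by (intro add_left_mono mult_left_mono) auto
  finally have "s * z / \<sigma>\<^sup>2 \<le> (1 / 4 * (z\<^sup>2 / t) + s\<^sup>2 * T) / \<sigma>\<^sup>2"
    by (rule divide_right_mono) simp
  moreover have "0 \<le> s\<^sup>2 * t / (2 * \<sigma>\<^sup>2)" using t by simp
  ultimately have "s * z / \<sigma>\<^sup>2 - s\<^sup>2 * t / (2 * \<sigma>\<^sup>2) \<le> s\<^sup>2 * T / \<sigma>\<^sup>2 + 1 / 4 * (z\<^sup>2 / (\<sigma>\<^sup>2 * t))"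
    by (simp add: add_divide_distrib mult_ac)
  then show ?thesis by (simp add: girsanov_def mult_exp_exp)
qed

text \<open>Both sides solve the equation of state \<open>s\<close> and start from the same measure,
  since the factor is 1 at \<open>t = 0\<close> and \<open>z = 0\<close>. \<open>FP_unique\<close>
  applies because the Gaussian moments of \<open>m 0\<close> control the mass and the tail of the
  right-hand side.\<close>

lemma girsanov_formula:
  assumes t: "t \<in> {0<..T}"
  shows "m s t z x = girsanov \<sigma> s t z * m 0 t z x"
proof -
  let ?w = "girsanov \<sigma> s"
  define E where "E = exp (s\<^sup>2 * T / \<sigma>\<^sup>2)"
  have E: "E > 0" by (simp add: E_def)
  obtain K where K: "K \<ge> 0"
    "\<And>t. t \<in> {0<..T} \<Longrightarrow> integrable zx (\<lambda>(z, x). (1 + z\<^sup>2 / (\<sigma>\<^sup>2 * t)) * exp (1 / 4 * (z\<^sup>2 / (\<sigma>\<^sup>2 * t))) * m 0 t z x)"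
    "\<And>t. t \<in> {0<..T} \<Longrightarrow> (\<integral>(z, x). (1 + z\<^sup>2 / (\<sigma>\<^sup>2 * t)) * exp (1 / 4 * (z\<^sup>2 / (\<sigma>\<^sup>2 * t))) * m 0 t z x \<partial>zx) \<le> K"
    by (rule exp_moment[of "1 / 4"]) (simp, blast)
  have wm: "(\<lambda>(z, x). ?w t z * m 0 t z x) \<in> borel_measurable zx" if "t \<in> {0<..T}" for t
    by (rule measurable_jc[OF jc_mult[OF jc_girsanov m_cont] that])
  \<comment> \<open>With \<open>y = z\<^sup>2 / (\<sigma>\<^sup>2 * t)\<close> the factor
    \<open>z\<^sup>2\<close> in \<open>b2\<close> becomes \<open>\<sigma>\<^sup>2 * t * y\<close>.
    The tail is therefore of order \<open>t\<close>, which is how it vanishes at the initial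
    time.\<close>
  have b1: "?w t z * m 0 t z x \<le> E * ((1 + z\<^sup>2 / (\<sigma>\<^sup>2 * t)) * exp (1 / 4 * (z\<^sup>2 / (\<sigma>\<^sup>2 * t))) * m 0 t z x)"
    and b2: "z\<^sup>2 * (?w t z * m 0 t z x) \<le> (E * \<sigma>\<^sup>2 * t) * ((1 + z\<^sup>2 / (\<sigma>\<^sup>2 * t)) * exp (1 / 4 * (z\<^sup>2 / (\<sigma>\<^sup>2 * t))) * m 0 t z x)"
    if t: "t \<in> {0<..T}" for t z x
  proof -
    let ?e = "exp (1 / 4 * (z\<^sup>2 / (\<sigma>\<^sup>2 * t)))" and ?y = "z\<^sup>2 / (\<sigma>\<^sup>2 * t)"
    have y: "?y \<ge> 0" using t by simp
    have w: "?w t z * m 0 t z x \<le> E * ?e * m 0 t z x"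
      unfolding E_def by (rule mult_right_mono[OF girsanov_le[OF t] m_nonneg[OF t]])
    have "E * (1 * ?e * m 0 t z x) \<le> E * ((1 + ?y) * ?e * m 0 t z x)"
      using E y by (intro mult_left_mono mult_right_mono m_nonneg[OF t]) auto
    then show "?w t z * m 0 t z x \<le> E * ((1 + ?y) * ?e * m 0 t z x)"
      using w by simp
    have z: "z\<^sup>2 = \<sigma>\<^sup>2 * t * ?y" using t \<sigma> by simp
    have "z\<^sup>2 * (?w t z * m 0 t z x) \<le> z\<^sup>2 * (E * ?e * m 0 t z x)"
      by (rule mult_left_mono[OF w]) simp
    also have "\<dots> = (E * \<sigma>\<^sup>2 * t) * (?y * ?e * m 0 t z x)"
      by (subst z) (simp only: mult_ac)
    also have "\<dots> \<le> (E * \<sigma>\<^sup>2 * t) * ((1 + ?y) * ?e * m 0 t z x)"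
      using E t by (intro mult_left_mono mult_right_mono m_nonneg[OF t]) auto
    finally show "z\<^sup>2 * (?w t z * m 0 t z x) \<le> (E * \<sigma>\<^sup>2 * t) * ((1 + ?y) * ?e * m 0 t z x)" .
  qed
  have w0: "0 \<le> ?w t z * m 0 t z x" if "t \<in> {0<..T}" for t z x
    using girsanov_pos[of \<sigma> s t z] m_nonneg[OF that, of 0 z x] by simp
  have iw: "integrable zx (\<lambda>(z, x). ?w t z * m 0 t z x)" and Iw: "(\<integral>(z, x). ?w t z * m 0 t z x \<partial>zx) \<le> E * K" if t: "t \<in> {0<..T}" for t
  proof -
    have "\<bar>?w t z * m 0 t z x\<bar> \<le> E * ((1 + z\<^sup>2 / (\<sigma>\<^sup>2 * t)) * exp (1 / 4 * (z\<^sup>2 / (\<sigma>\<^sup>2 * t))) * m 0 t z x)" for z x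
      using b1[OF t, of z x] w0[OF t, of z x] by simp
    note 1 = zx_integrable_bound[OF wm[OF t] zx_cmult(1)[OF K(2)[OF t]] this]
    show "integrable zx (\<lambda>(z, x). ?w t z * m 0 t z x)" by (rule 1(1))
    have "(\<integral>(z, x). ?w t z * m 0 t z x \<partial>zx) \<le> E * (\<integral>(z, x). (1 + z\<^sup>2 / (\<sigma>\<^sup>2 * t)) * exp (1 / 4 * (z\<^sup>2 / (\<sigma>\<^sup>2 * t))) * m 0 t z x \<partial>zx)"
      using 1(2) unfolding zx_cmult(2) by simp
    also have "\<dots> \<le> E * K"
      using E by (intro mult_left_mono K(3)[OF t]) auto
    finally show "(\<integral>(z, x). ?w t z * m 0 t z x \<partial>zx) \<le> E * K" .
  qed
  have iz: "integrable zx (\<lambda>(z, x). min 1 (z\<^sup>2) * (?w t z * m 0 t z x))" and Iz: "(\<integral>(z, x). min 1 (z\<^sup>2) * (?w t z * m 0 t z x) \<partial>zx) \<le> (E * \<sigma>\<^sup>2 * t) * K" if t: "t \<in> {0<..T}" for t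
  proof -
    have meas: "(\<lambda>(z, x). min 1 (z\<^sup>2) * (?w t z * m 0 t z x)) \<in> borel_measurable zx"
    proof -
      have "(\<lambda>(z, x :: 'n torus). min 1 (z\<^sup>2)) \<in> borel_measurable zx"
        unfolding split_def by measurable
      then show ?thesis
        using wm[OF t] unfolding split_def by (rule borel_measurable_times)
    qed
    have "\<bar>min 1 (z\<^sup>2) * (?w t z * m 0 t z x)\<bar> \<le> (E * \<sigma>\<^sup>2 * t) * ((1 + z\<^sup>2 / (\<sigma>\<^sup>2 * t)) * exp (1 / 4 * (z\<^sup>2 / (\<sigma>\<^sup>2 * t))) * m 0 t z x)" for z x
    proof -
      have "\<bar>min 1 (z\<^sup>2) * (?w t z * m 0 t z x)\<bar> = min 1 (z\<^sup>2) * (?w t z * m 0 t z x)"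
        using w0[OF t, of z x] by (simp add: abs_of_nonneg)
      also have "\<dots> \<le> z\<^sup>2 * (?w t z * m 0 t z x)"
        by (rule mult_right_mono[OF _ w0[OF t]]) simp
      also note b2[OF t, of z x]
      finally show ?thesis .
    qed
    note 1 = zx_integrable_bound[OF meas zx_cmult(1)[OF K(2)[OF t]] this]
    show "integrable zx (\<lambda>(z, x). min 1 (z\<^sup>2) * (?w t z * m 0 t z x))" by (rule 1(1))
    have "(\<integral>(z, x). min 1 (z\<^sup>2) * (?w t z * m 0 t z x) \<partial>zx) \<le> (E * \<sigma>\<^sup>2 * t) * (\<integral>(z, x). (1 + z\<^sup>2 / (\<sigma>\<^sup>2 * t)) * exp (1 / 4 * (z\<^sup>2 / (\<sigma>\<^sup>2 * t))) * m 0 t z x \<partial>zx)"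
      using 1(2) unfolding zx_cmult(2) by simp
    also have "\<dots> \<le> (E * \<sigma>\<^sup>2 * t) * K"
      using E t by (intro mult_left_mono K(3)[OF t]) auto
    finally show "(\<integral>(z, x). min 1 (z\<^sup>2) * (?w t z * m 0 t z x) \<partial>zx) \<le> (E * \<sigma>\<^sup>2 * t) * K" .
  qed
  obtain \<mu>t \<mu>z \<mu>zz \<mu>i \<mu>ii vi where F: "FP_with T \<sigma> \<sigma>' s b (m s) \<mu>t \<mu>z \<mu>zz \<mu>i \<mu>ii vi"
    using FP unfolding is_FP_def by blast
  obtain \<nu>t \<nu>z \<nu>zz \<nu>i \<nu>ii wi where F0: "FP_with T \<sigma> \<sigma>' 0 b (m 0) \<nu>t \<nu>z \<nu>zz \<nu>i \<nu>ii wi"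
    using FP unfolding is_FP_def by blast
  have eq: "m s t z x - ?w t z * m 0 t z x = 0" if t: "t \<in> {0<..<T}" for t z x
  proof (rule FP_unique[OF T \<sigma> \<sigma>' FP_with_diff[OF F FP_with_girsanov[OF F0 \<sigma>]] b _ _ _ _ t, where K = "1 + E * K"])
    fix t assume "t \<in> {0<..<T}"
    then have t: "t \<in> {0<..T}" by auto
    show i: "integrable zx (\<lambda>(z, x). m s t z x - ?w t z * m 0 t z x)"
      by (rule zx_diff(1)[OF m_integrable[OF t] iw[OF t]])
    have "(\<integral>(z, x). \<bar>m s t z x - ?w t z * m 0 t z x\<bar> \<partial>zx) \<le> (\<integral>(z, x). m s t z x + ?w t z * m 0 t z x \<partial>zx)"
      by (rule zx_integral_mono[OF zx_abs[OF i] zx_add(1)[OF m_integrable[OF t] iw[OF t]]])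
         (use m_nonneg[OF t] w0[OF t] in \<open>simp add: abs_le_iff\<close>)
    also have "\<dots> = 1 + (\<integral>(z, x). ?w t z * m 0 t z x \<partial>zx)"
      by (simp only: zx_add(2)[OF m_integrable[OF t] iw[OF t]] m_integral[OF t])
    finally show "(\<integral>(z, x). \<bar>m s t z x - ?w t z * m 0 t z x\<bar> \<partial>zx) \<le> 1 + E * K"
      using Iw[OF t] by linarith
  next
    fix f :: "real \<Rightarrow> 'n torus \<Rightarrow> real" assume f: "continuous_on UNIV (\<lambda>(z, x). f z x)"
    have jf: "jointly_continuous_on A (\<lambda>t z x. f z x)" for A
      unfolding jointly_continuous_on_def split_def
      by (rule continuous_on_compose2[OF f[unfolded split_def], where f = snd, simplified]) (auto intro: continuous_on_snd continuous_on_id)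
    have "((\<lambda>t. (\<integral>(z, x). cutoff 2 z * f z x * m s t z x \<partial>zx) - (\<integral>(z, x). cutoff 2 z * (?w t z * f z x) * m 0 t z x \<partial>zx))
        \<longlongrightarrow> (\<integral>x. f 0 x * \<rho>0 x \<partial>torus_lebesgue) - (\<integral>x. (?w 0 0 * f 0 x) * \<rho>0 x \<partial>torus_lebesgue)) (at_right 0)"
      by (intro tendsto_diff init_test jf jc_mult jc_girsanov) auto
    moreover have "(\<integral>x. f 0 x * \<rho>0 x \<partial>torus_lebesgue) - (\<integral>x. (?w 0 0 * f 0 x) * \<rho>0 x \<partial>torus_lebesgue) = 0"
      by (simp add: girsanov_def)
    moreover have "eventually (\<lambda>t. (\<integral>(z, x). cutoff 2 z * f z x * m s t z x \<partial>zx) - (\<integral>(z, x). cutoff 2 z * (?w t z * f z x) * m 0 t z x \<partial>zx)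
        = (\<integral>(z, x). cutoff 2 z * f z x * (m s t z x - ?w t z * m 0 t z x) \<partial>zx)) (at_right 0)"
    proof -
      have "(\<integral>(z, x). cutoff 2 z * f z x * m s t z x \<partial>zx) - (\<integral>(z, x). cutoff 2 z * (?w t z * f z x) * m 0 t z x \<partial>zx)
        = (\<integral>(z, x). cutoff 2 z * f z x * (m s t z x - ?w t z * m 0 t z x) \<partial>zx)" if t: "t \<in> {0<..<T}" for t
      proof -
        have t': "t \<in> {0<..T}" using t by auto
        have ic: "integrable zx (\<lambda>(z, x). cutoff 2 z * g t z x)" if "jointly_continuous_on {0<..T} g" for g
          by (rule integrable_continuous_strip[OF jc_slice[OF jc_mult[OF jc_cutoff(1) that] t'], of 2]) (auto simp: cutoff_supp)
        have i1: "integrable zx (\<lambda>(z, x). cutoff 2 z * f z x * m s t z x)"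
          unfolding mult.assoc by (rule ic[OF jc_mult[OF jf m_cont]])
        have i2: "integrable zx (\<lambda>(z, x). cutoff 2 z * (?w t z * f z x) * m 0 t z x)"
          unfolding mult.assoc by (rule ic[OF jc_mult[OF jc_girsanov jc_mult[OF jf m_cont]]])
        show ?thesis
          unfolding zx_diff(2)[OF i1 i2, symmetric] by (rule arg_cong[where f = "integral\<^sup>L zx"]) (auto simp: fun_eq_iff algebra_simps)
      qed
      then show ?thesis
        using eventually_at_right_real[OF T] by (auto elim!: eventually_mono)
    qed
    ultimately show "((\<lambda>t. \<integral>(z, x). cutoff 2 z * f z x * (m s t z x - ?w t z * m 0 t z x) \<partial>zx) \<longlongrightarrow> 0) (at_right 0)"
      using Lim_transform_eventually by fastforce
  next
    show "((\<lambda>t. \<integral>(z, x). min 1 (z\<^sup>2) * \<bar>m s t z x - ?w t z * m 0 t z x\<bar> \<partial>zx) \<longlongrightarrow> 0) (at_right 0)"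
    proof (rule tendsto_sandwich[where f = "\<lambda>_. 0"])
      have "((\<lambda>t. (\<integral>(z, x). min 1 (z\<^sup>2) * m s t z x \<partial>zx) + (E * \<sigma>\<^sup>2 * t) * K) \<longlongrightarrow> 0 + (E * \<sigma>\<^sup>2 * 0) * K) (at_right 0)"
        by (intro tendsto_intros tail_m)
      then show "((\<lambda>t. (\<integral>(z, x). min 1 (z\<^sup>2) * m s t z x \<partial>zx) + (E * \<sigma>\<^sup>2 * t) * K) \<longlongrightarrow> 0) (at_right 0)" by simp
      show "eventually (\<lambda>t. 0 \<le> (\<integral>(z, x). min 1 (z\<^sup>2) * \<bar>m s t z x - ?w t z * m 0 t z x\<bar> \<partial>zx)) (at_right 0)"
        by (intro always_eventually allI integral_nonneg_AE AE_I2) (auto simp: split_def)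
      have "(\<integral>(z, x). min 1 (z\<^sup>2) * \<bar>m s t z x - ?w t z * m 0 t z x\<bar> \<partial>zx) \<le> (\<integral>(z, x). min 1 (z\<^sup>2) * m s t z x \<partial>zx) + (E * \<sigma>\<^sup>2 * t) * K"
        if "t \<in> {0<..<T}" for t
      proof -
        have t: "t \<in> {0<..T}" using that by auto
        have pw: "\<bar>min 1 (z\<^sup>2) * \<bar>m s t z x - ?w t z * m 0 t z x\<bar>\<bar> \<le> min 1 (z\<^sup>2) * m s t z x + min 1 (z\<^sup>2) * (?w t z * m 0 t z x)" for z x
        proof -
          have "min 1 (z\<^sup>2) * \<bar>m s t z x - ?w t z * m 0 t z x\<bar> \<le> min 1 (z\<^sup>2) * (m s t z x + ?w t z * m 0 t z x)"
            using m_nonneg[OF t, of s z x] w0[OF t, of z x] by (intro mult_left_mono) auto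
          then show ?thesis by (simp add: distrib_left abs_mult)
        qed
        have meas: "(\<lambda>(z, x). min 1 (z\<^sup>2) * \<bar>m s t z x - ?w t z * m 0 t z x\<bar>) \<in> borel_measurable zx"
        proof -
          have "(\<lambda>(z, x :: 'n torus). min 1 (z\<^sup>2)) \<in> borel_measurable zx"
            unfolding split_def by measurable
          then show ?thesis
            using borel_measurable_integrable[OF zx_abs[OF zx_diff(1)[OF m_integrable[OF t] iw[OF t]]]]
            unfolding split_def by (rule borel_measurable_times)
        qed
        have "(\<integral>(z, x). min 1 (z\<^sup>2) * \<bar>m s t z x - ?w t z * m 0 t z x\<bar> \<partial>zx) \<le> (\<integral>(z, x). min 1 (z\<^sup>2) * m s t z x + min 1 (z\<^sup>2) * (?w t z * m 0 t z x) \<partial>zx)"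
          using zx_integrable_bound(2)[OF meas zx_add(1)[OF z_sq_m_integrable[OF t] iz[OF t]] pw] by simp
        also have "\<dots> = (\<integral>(z, x). min 1 (z\<^sup>2) * m s t z x \<partial>zx) + (\<integral>(z, x). min 1 (z\<^sup>2) * (?w t z * m 0 t z x) \<partial>zx)"
          by (rule zx_add(2)[OF z_sq_m_integrable[OF t] iz[OF t]])
        finally show ?thesis using Iz[OF t] by linarith
      qed
      then show "eventually (\<lambda>t. (\<integral>(z, x). min 1 (z\<^sup>2) * \<bar>m s t z x - ?w t z * m 0 t z x\<bar> \<partial>zx) \<le> (\<integral>(z, x). min 1 (z\<^sup>2) * m s t z x \<partial>zx) + (E * \<sigma>\<^sup>2 * t) * K) (at_right 0)"
        using eventually_at_right_real[OF T] by (auto elim!: eventually_mono)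
    qed simp
  qed
  show ?thesis
    by (rule eq_at_endpoint[OF T jc_slice_t[OF m_cont] jc_slice_t[OF jc_mult[OF jc_girsanov m_cont]] _ t])
       (use eq in auto)
qed

end

text \<open>Two flows with one drift and one initial density differ, in each state, by a solution of
  total variation at most 2. Its initial value vanishes weakly and its tail vanishes because both
  tails do.\<close>

lemma signal_flow_unique:
  assumes "signal_flow T \<sigma> \<sigma>' \<rho>0 b m" "signal_flow T \<sigma> \<sigma>' \<rho>0 b m'" and t: "t \<in> {0<..T}"
  shows "m s t z x = (m' s t z x :: real)"
proof -
  interpret A: signal_flow T \<sigma> \<sigma>' \<rho>0 b m by fact
  interpret B: signal_flow T \<sigma> \<sigma>' \<rho>0 b m' by fact
  obtain \<mu>t \<mu>z \<mu>zz \<mu>i \<mu>ii vi where F: "FP_with T \<sigma> \<sigma>' s b (m s) \<mu>t \<mu>z \<mu>zz \<mu>i \<mu>ii vi"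
    using A.FP unfolding is_FP_def by blast
  obtain \<nu>t \<nu>z \<nu>zz \<nu>i \<nu>ii wi where F': "FP_with T \<sigma> \<sigma>' s b (m' s) \<nu>t \<nu>z \<nu>zz \<nu>i \<nu>ii wi"
    using B.FP unfolding is_FP_def by blast
  have eq: "m s t z x - m' s t z x = 0" if t: "t \<in> {0<..<T}" for t z x
  proof (rule FP_unique[OF A.T A.\<sigma> A.\<sigma>' FP_with_diff[OF F F'] A.b _ _ _ _ t, where K = 2])
    fix t assume "t \<in> {0<..<T}"
    then have t: "t \<in> {0<..T}" by auto
    show i: "integrable zx (\<lambda>(z, x). m s t z x - m' s t z x)"
      by (rule zx_diff(1)[OF A.m_integrable[OF t] B.m_integrable[OF t]])
    have "(\<integral>(z, x). \<bar>m s t z x - m' s t z x\<bar> \<partial>zx) \<le> (\<integral>(z, x). m s t z x + m' s t z x \<partial>zx)"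
      by (rule zx_integral_mono[OF zx_abs[OF i] zx_add(1)[OF A.m_integrable[OF t] B.m_integrable[OF t]]])
         (use A.m_nonneg[OF t] B.m_nonneg[OF t] in \<open>simp add: abs_le_iff\<close>)
    then show "(\<integral>(z, x). \<bar>m s t z x - m' s t z x\<bar> \<partial>zx) \<le> 2"
      by (simp add: zx_add(2)[OF A.m_integrable[OF t] B.m_integrable[OF t]] A.m_integral[OF t] B.m_integral[OF t])
  next
    fix f :: "real \<Rightarrow> 'a torus \<Rightarrow> real" assume f: "continuous_on UNIV (\<lambda>(z, x). f z x)"
    have jf: "jointly_continuous_on A (\<lambda>t z x. f z x)" for A
      unfolding jointly_continuous_on_def split_def
      by (rule continuous_on_compose2[OF f[unfolded split_def], where f = snd, simplified]) (auto intro: continuous_on_snd continuous_on_id)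
    have "((\<lambda>t. (\<integral>(z, x). cutoff 2 z * f z x * m s t z x \<partial>zx) - (\<integral>(z, x). cutoff 2 z * f z x * m' s t z x \<partial>zx))
        \<longlongrightarrow> (\<integral>x. f 0 x * \<rho>0 x \<partial>torus_lebesgue) - (\<integral>x. f 0 x * \<rho>0 x \<partial>torus_lebesgue)) (at_right 0)"
      by (intro tendsto_diff A.init_test B.init_test jf) auto
    moreover have "eventually (\<lambda>t. (\<integral>(z, x). cutoff 2 z * f z x * m s t z x \<partial>zx) - (\<integral>(z, x). cutoff 2 z * f z x * m' s t z x \<partial>zx)
        = (\<integral>(z, x). cutoff 2 z * f z x * (m s t z x - m' s t z x) \<partial>zx)) (at_right 0)"
    proof -
      have "(\<integral>(z, x). cutoff 2 z * f z x * m s t z x \<partial>zx) - (\<integral>(z, x). cutoff 2 z * f z x * m' s t z x \<partial>zx)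
        = (\<integral>(z, x). cutoff 2 z * f z x * (m s t z x - m' s t z x) \<partial>zx)" if t: "t \<in> {0<..<T}" for t
      proof -
        have t': "t \<in> {0<..T}" using t by auto
        have ic: "integrable zx (\<lambda>(z, x). cutoff 2 z * g t z x)" if "jointly_continuous_on {0<..T} g" for g :: "real \<Rightarrow> real \<Rightarrow> 'a torus \<Rightarrow> real"
          by (rule integrable_continuous_strip[OF jc_slice[OF jc_mult[OF jc_cutoff(1) that] t'], of 2]) (auto simp: cutoff_supp)
        have i1: "integrable zx (\<lambda>(z, x). cutoff 2 z * f z x * m s t z x)"
          unfolding mult.assoc by (rule ic[OF jc_mult[OF jf A.m_cont]])
        have i2: "integrable zx (\<lambda>(z, x). cutoff 2 z * f z x * m' s t z x)"
          unfolding mult.assoc by (rule ic[OF jc_mult[OF jf B.m_cont]])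
        show ?thesis
          unfolding zx_diff(2)[OF i1 i2, symmetric] by (rule arg_cong[where f = "integral\<^sup>L zx"]) (auto simp: fun_eq_iff algebra_simps)
      qed
      then show ?thesis
        using eventually_at_right_real[OF A.T] by (auto elim!: eventually_mono)
    qed
    ultimately show "((\<lambda>t. \<integral>(z, x). cutoff 2 z * f z x * (m s t z x - m' s t z x) \<partial>zx) \<longlongrightarrow> 0) (at_right 0)"
      using Lim_transform_eventually by fastforce
  next
    show "((\<lambda>t. \<integral>(z, x). min 1 (z\<^sup>2) * \<bar>m s t z x - m' s t z x\<bar> \<partial>zx) \<longlongrightarrow> 0) (at_right 0)"
    proof (rule tendsto_sandwich[where f = "\<lambda>_. 0"])
      have "((\<lambda>t. (\<integral>(z, x). min 1 (z\<^sup>2) * m s t z x \<partial>zx) + (\<integral>(z, x). min 1 (z\<^sup>2) * m' s t z x \<partial>zx)) \<longlongrightarrow> 0 + 0) (at_right 0)"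
        by (intro tendsto_add A.tail_m B.tail_m)
      then show "((\<lambda>t. (\<integral>(z, x). min 1 (z\<^sup>2) * m s t z x \<partial>zx) + (\<integral>(z, x). min 1 (z\<^sup>2) * m' s t z x \<partial>zx)) \<longlongrightarrow> 0) (at_right 0)" by simp
      show "eventually (\<lambda>t. 0 \<le> (\<integral>(z, x). min 1 (z\<^sup>2) * \<bar>m s t z x - m' s t z x\<bar> \<partial>zx)) (at_right 0)"
        by (intro always_eventually allI integral_nonneg_AE AE_I2) (auto simp: split_def)
      have "(\<integral>(z, x). min 1 (z\<^sup>2) * \<bar>m s t z x - m' s t z x\<bar> \<partial>zx) \<le> (\<integral>(z, x). min 1 (z\<^sup>2) * m s t z x \<partial>zx) + (\<integral>(z, x). min 1 (z\<^sup>2) * m' s t z x \<partial>zx)"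
        if "t \<in> {0<..<T}" for t
      proof -
        have t: "t \<in> {0<..T}" using that by auto
        have pw: "\<bar>min 1 (z\<^sup>2) * \<bar>m s t z x - m' s t z x\<bar>\<bar> \<le> min 1 (z\<^sup>2) * m s t z x + min 1 (z\<^sup>2) * m' s t z x" for z x
        proof -
          have "min 1 (z\<^sup>2) * \<bar>m s t z x - m' s t z x\<bar> \<le> min 1 (z\<^sup>2) * (m s t z x + m' s t z x)"
            using A.m_nonneg[OF t, of s z x] B.m_nonneg[OF t, of s z x] by (intro mult_left_mono) auto
          then show ?thesis by (simp add: distrib_left abs_mult)
        qed
        have meas: "(\<lambda>(z, x). min 1 (z\<^sup>2) * \<bar>m s t z x - m' s t z x\<bar>) \<in> borel_measurable zx"
        proof -
          have "(\<lambda>(z, x :: 'a torus). min 1 (z\<^sup>2)) \<in> borel_measurable zx"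
            unfolding split_def by measurable
          then show ?thesis
            using borel_measurable_integrable[OF zx_abs[OF zx_diff(1)[OF A.m_integrable[OF t] B.m_integrable[OF t]]]]
            unfolding split_def by (rule borel_measurable_times)
        qed
        show ?thesis
          using zx_integrable_bound(2)[OF meas zx_add(1)[OF A.z_sq_m_integrable[OF t] B.z_sq_m_integrable[OF t]] pw]
          unfolding zx_add(2)[OF A.z_sq_m_integrable[OF t] B.z_sq_m_integrable[OF t]] by simp
      qed
      then show "eventually (\<lambda>t. (\<integral>(z, x). min 1 (z\<^sup>2) * \<bar>m s t z x - m' s t z x\<bar> \<partial>zx) \<le> (\<integral>(z, x). min 1 (z\<^sup>2) * m s t z x \<partial>zx) + (\<integral>(z, x). min 1 (z\<^sup>2) * m' s t z x \<partial>zx)) (at_right 0)"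
        using eventually_at_right_real[OF A.T] by (auto elim!: eventually_mono)
    qed simp
  qed
  show ?thesis
    by (rule eq_at_endpoint[OF A.T jc_slice_t[OF A.m_cont] jc_slice_t[OF B.m_cont] _ t])
       (use eq in auto)
qed

subsection \<open>Strong convexity of the Hamiltonian\<close>

text \<open>The linear form is represented by a vector, and uniqueness of derivatives makes this
  vector unique; hence the definite description in \<open>grad\<close> denotes it.\<close>

lemma GDERIV_grad:
  assumes "f differentiable (at p)"
  shows "GDERIV f p :> grad f (p :: 'a::euclidean_space)"
proof -
  obtain f' where f': "(f has_derivative f') (at p)"
    using assms unfolding differentiable_def by blast
  define D where "D = (\<Sum>b\<in>Basis. f' b *\<^sub>R b)"
  have lin: "linear f'" using f' by (rule has_derivative_linear)
  have "f' h = h \<bullet> D" for h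
  proof -
    have "f' h = f' (\<Sum>b\<in>Basis. (h \<bullet> b) *\<^sub>R b)"
      by (simp add: euclidean_representation)
    also have "\<dots> = (\<Sum>b\<in>Basis. (h \<bullet> b) * f' b)"
      by (simp add: linear_sum[OF lin] linear_scale[OF lin])
    finally show ?thesis by (simp add: D_def inner_sum_right mult.commute)
  qed
  then have "f' = (\<lambda>h. h \<bullet> D)" by blast
  then have D: "GDERIV f p :> D"
    using f' by (simp add: gderiv_def)
  moreover have "D' = D" if "GDERIV f p :> D'" for D'
  proof -
    have "(\<lambda>h. h \<bullet> D') = (\<lambda>h. h \<bullet> D)"
      using that D unfolding gderiv_def by (rule has_derivative_unique)
    then show ?thesis by (metis vector_eq_rdot inner_commute)
  qed
  ultimately show ?thesis
    unfolding grad_def by (rule theI)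
qed

lemma GDERIV_line:
  assumes "GDERIV f (p + t *\<^sub>R d) :> D"
  shows "((\<lambda>t. f (p + t *\<^sub>R d)) has_real_derivative d \<bullet> D) (at t)"
proof -
  have "((\<lambda>t. p + t *\<^sub>R d) has_derivative (\<lambda>h. h *\<^sub>R d)) (at t)"
    by (auto intro!: derivative_eq_intros)
  from has_derivative_compose[OF this assms[unfolded gderiv_def]]
  show ?thesis by (simp add: has_field_derivative_def mult.commute[of _ "d \<bullet> D"])
qed

text \<open>The symmetric sum of \<open>f\<close> along the line through \<open>p\<close> in
  direction \<open>d\<close> has derivative at most \<open>2 * t * L * (norm d)\<^sup>2\<close>,
  because the two gradient points are \<open>2 * t * norm d\<close> apart. Integration from 0 to 1
  gives the bound.\<close>

lemma semiconcave_of_Lipschitz_gradient: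
  fixes f :: "'a::euclidean_space \<Rightarrow> real"
  assumes diff: "\<And>p. f differentiable (at p)" and L: "L-lipschitz_on UNIV (grad f)"
  shows "f (p + d) + f (p - d) - 2 * f p \<le> L * (norm d)\<^sup>2"
proof -
  define \<phi> where "\<phi> t = f (p + t *\<^sub>R d) + f (p + t *\<^sub>R (- d))" for t
  define h where "h t = L * (norm d)\<^sup>2 * t\<^sup>2" for t
  have "\<phi> 1 - \<phi> 0 \<le> h 1 - h 0"
  proof (rule increment_bound[where I' = "\<lambda>t. d \<bullet> grad f (p + t *\<^sub>R d) + (- d) \<bullet> grad f (p + t *\<^sub>R (- d))" and h' = "\<lambda>t. L * (norm d)\<^sup>2 * (2 * t)"])
    have d\<phi>: "(\<phi> has_real_derivative d \<bullet> grad f (p + t *\<^sub>R d) + (- d) \<bullet> grad f (p + t *\<^sub>R (- d))) (at t)" for t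
      unfolding \<phi>_def[abs_def] by (intro DERIV_add GDERIV_line GDERIV_grad diff)
    have dh: "(h has_real_derivative L * (norm d)\<^sup>2 * (2 * t)) (at t)" for t
      unfolding h_def[abs_def] using DERIV_cmult[OF DERIV_pow[of 2 t], of "L * (norm d)\<^sup>2"] by simp
    show "continuous_on {0..1} \<phi>" "continuous_on {0..1} h"
      by (rule continuous_at_imp_continuous_on; use d\<phi> dh DERIV_isCont in blast)+
    fix t :: real assume t: "0 < t" "t < 1"
    show "(\<phi> has_real_derivative d \<bullet> grad f (p + t *\<^sub>R d) + (- d) \<bullet> grad f (p + t *\<^sub>R (- d))) (at t)" by (rule d\<phi>)
    show "(h has_real_derivative L * (norm d)\<^sup>2 * (2 * t)) (at t)" by (rule dh)
    have "d \<bullet> grad f (p + t *\<^sub>R d) + (- d) \<bullet> grad f (p + t *\<^sub>R (- d)) = d \<bullet> (grad f (p + t *\<^sub>R d) - grad f (p + t *\<^sub>R (- d)))"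
      by (simp add: inner_diff_right)
    also have "\<dots> \<le> norm d * norm (grad f (p + t *\<^sub>R d) - grad f (p + t *\<^sub>R (- d)))"
      by (rule norm_cauchy_schwarz)
    also have "\<dots> \<le> norm d * (L * norm ((p + t *\<^sub>R d) - (p + t *\<^sub>R (- d))))"
      by (rule mult_left_mono[OF lipschitz_onD[OF L UNIV_I UNIV_I, unfolded dist_norm] norm_ge_zero])
    also have "(p + t *\<^sub>R d) - (p + t *\<^sub>R (- d)) = (2 * t) *\<^sub>R d"
      unfolding mult_2 scaleR_left_distrib by simp
    also have "norm d * (L * norm ((2 * t) *\<^sub>R d)) = L * (norm d)\<^sup>2 * (2 * t)"
      using t by (simp add: power2_eq_square)
    finally show "d \<bullet> grad f (p + t *\<^sub>R d) + (- d) \<bullet> grad f (p + t *\<^sub>R (- d)) \<le> L * (norm d)\<^sup>2 * (2 * t)" .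
  qed simp
  then show ?thesis by (simp add: \<phi>_def h_def)
qed

text \<open>Duality between \<open>L\<close>-semiconcavity and \<open>1/L\<close>-strong convexity, in midpoint form: test the supremum
  at \<open>p \<plusminus> d\<close> with \<open>\<alpha> \<mp> d / L\<close>, where \<open>\<alpha>\<close> is nearly optimal at \<open>p\<close>.\<close>

lemma midpoint_strong_convexity:
  fixes c :: "'a::euclidean_space \<Rightarrow> real"
  defines "H \<equiv> \<lambda>p. SUP \<alpha>. - (\<alpha> \<bullet> p) - c \<alpha>"
  assumes bdd: "\<And>p. bdd_above (range (\<lambda>\<alpha>. - (\<alpha> \<bullet> p) - c \<alpha>))"
    and sc: "\<And>\<alpha> d. c (\<alpha> + d) + c (\<alpha> - d) - 2 * c \<alpha> \<le> L * (norm d)\<^sup>2" and L: "L > 0"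
  shows "2 * H p + (norm d)\<^sup>2 / L \<le> H (p + d) + H (p - d)"
proof -
  have H: "H p = (SUP \<alpha>. - (\<alpha> \<bullet> p) - c \<alpha>)" for p
    by (simp add: H_def)
  have "H p \<le> (H (p + d) + H (p - d) - (norm d)\<^sup>2 / L) / 2"
    unfolding H[of p]
  proof (rule cSUP_least)
    fix \<alpha>
    let ?e = "(1 / L) *\<^sub>R d"
    have 1: "- ((\<alpha> - ?e) \<bullet> (p + d)) - c (\<alpha> - ?e) \<le> H (p + d)"
      unfolding H_def by (rule cSUP_upper[OF UNIV_I bdd])
    have 2: "- ((\<alpha> + ?e) \<bullet> (p - d)) - c (\<alpha> + ?e) \<le> H (p - d)"
      unfolding H_def by (rule cSUP_upper[OF UNIV_I bdd])
    have 3: "c (\<alpha> + ?e) + c (\<alpha> - ?e) - 2 * c \<alpha> \<le> (norm d)\<^sup>2 / L"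
      using sc[of \<alpha> ?e] L by (simp add: power_divide power2_eq_square)
    have 4: "- ((\<alpha> - ?e) \<bullet> (p + d)) - ((\<alpha> + ?e) \<bullet> (p - d)) = - (2 * (\<alpha> \<bullet> p)) + 2 * ((norm d)\<^sup>2 / L)"
      by (simp add: inner_add_left inner_add_right inner_diff_left inner_diff_right power2_norm_eq_inner)
    have "2 * (- (\<alpha> \<bullet> p) - c \<alpha>) + (norm d)\<^sup>2 / L \<le> H (p + d) + H (p - d)"
    proof -
      define N where "N = (norm d)\<^sup>2 / L"
      show ?thesis using 1 2 3 4 unfolding N_def[symmetric] by argo
    qed
    then show "- (\<alpha> \<bullet> p) - c \<alpha> \<le> (H (p + d) + H (p - d) - (norm d)\<^sup>2 / L) / 2"
      by simp
  qed simp
  then show ?thesis by simp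
qed

text \<open>As a supremum of affine functions \<open>H\<close> is convex, so at the midpoint of
  \<open>p\<close> and \<open>q\<close> it lies above its tangent at \<open>p\<close>. Inserting
  this into the midpoint inequality with \<open>d = (q - p) / 2\<close> gives the constant
  \<open>1 / (4 * L)\<close>.\<close>

lemma strong_convexity_gradient:
  fixes c :: "'a::euclidean_space \<Rightarrow> real"
  defines "H \<equiv> \<lambda>p. SUP \<alpha>. - (\<alpha> \<bullet> p) - c \<alpha>"
  assumes bdd: "\<And>p. bdd_above (range (\<lambda>\<alpha>. - (\<alpha> \<bullet> p) - c \<alpha>))"
    and sc: "\<And>\<alpha> d. c (\<alpha> + d) + c (\<alpha> - d) - 2 * c \<alpha> \<le> L * (norm d)\<^sup>2" and L: "L > 0"
    and D: "GDERIV H p :> D"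
  shows "H p + D \<bullet> (q - p) + (norm (q - p))\<^sup>2 / (4 * L) \<le> H q"
proof -
  have H: "H p = (SUP \<alpha>. - (\<alpha> \<bullet> p) - c \<alpha>)" for p
    by (simp add: H_def)
  have convex: "H (u *\<^sub>R x + v *\<^sub>R y) \<le> u * H x + v * H y" if uv: "u \<ge> 0" "v \<ge> 0" "u + v = 1" for x y u v
    unfolding H[of "u *\<^sub>R x + v *\<^sub>R y"]
  proof (rule cSUP_least)
    fix \<alpha>
    have 1: "u * (- (\<alpha> \<bullet> x) - c \<alpha>) \<le> u * H x" "v * (- (\<alpha> \<bullet> y) - c \<alpha>) \<le> v * H y"
      unfolding H_def by (intro mult_left_mono cSUP_upper[OF UNIV_I bdd] uv)+
    have "- (\<alpha> \<bullet> (u *\<^sub>R x + v *\<^sub>R y)) - (u + v) * c \<alpha> = u * (- (\<alpha> \<bullet> x) - c \<alpha>) + v * (- (\<alpha> \<bullet> y) - c \<alpha>)"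
      by (simp add: inner_add_right algebra_simps)
    then show "- (\<alpha> \<bullet> (u *\<^sub>R x + v *\<^sub>R y)) - c \<alpha> \<le> u * H x + v * H y"
      using 1 uv(3) by simp
  qed simp
  define \<phi> where "\<phi> t = H (p + t *\<^sub>R (q - p))" for t
  have "convex_on UNIV \<phi>"
  proof (rule convex_onI)
    fix t x y :: real assume t: "0 < t" "t < 1"
    have "p + ((1 - t) *\<^sub>R x + t *\<^sub>R y) *\<^sub>R (q - p) = (1 - t) *\<^sub>R (p + x *\<^sub>R (q - p)) + t *\<^sub>R (p + y *\<^sub>R (q - p))"
      by (simp add: algebra_simps)
    then show "\<phi> ((1 - t) *\<^sub>R x + t *\<^sub>R y) \<le> (1 - t) * \<phi> x + t * \<phi> y"
      unfolding \<phi>_def using convex[of "1 - t" t] t by simp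
  qed simp
  moreover have "(\<phi> has_real_derivative (q - p) \<bullet> D) (at 0)"
    unfolding \<phi>_def[abs_def] by (rule GDERIV_line) (use D in simp)
  ultimately have "\<phi> (1 / 2) - \<phi> 0 \<ge> (q - p) \<bullet> D * (1 / 2 - 0)"
    by (intro convex_on_imp_above_tangent[of UNIV]) auto
  moreover have "\<phi> 0 = H p" by (simp add: \<phi>_def)
  moreover have "2 * \<phi> (1 / 2) + (norm ((1 / 2) *\<^sub>R (q - p)))\<^sup>2 / L \<le> H q + H p"
  proof -
    have "(p + (1 / 2) *\<^sub>R (q - p)) + (1 / 2) *\<^sub>R (q - p) = q" "(p + (1 / 2) *\<^sub>R (q - p)) - (1 / 2) *\<^sub>R (q - p) = p"
      by (simp_all add: scaleR_left_distrib[symmetric] add.assoc)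
    then show ?thesis
      using midpoint_strong_convexity[OF bdd sc L, of "p + (1 / 2) *\<^sub>R (q - p)" "(1 / 2) *\<^sub>R (q - p)"]
      unfolding \<phi>_def H_def by simp
  qed
  moreover have "(norm ((1 / 2) *\<^sub>R (q - p)))\<^sup>2 / L = (norm (q - p))\<^sup>2 / (4 * L)"
    by (simp add: power_mult_distrib power_divide)
  ultimately show ?thesis by (simp add: inner_commute)
qed

lemma post_density_nonneg: "0 \<le> post_density \<sigma> t z s"
  by (simp add: post_density_def gauss_def)

lemma integral_post_density:
  assumes "\<sigma> > 0" "t \<ge> 0"
  shows "integrable lborel (post_density \<sigma> t z)" "(\<integral>s. post_density \<sigma> t z s \<partial>lborel) = 1"
proof -
  have "0 < sqrt (post_var \<sigma> t)"
    using assms by (simp add: post_var_def add_pos_nonneg)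
  then show "integrable lborel (post_density \<sigma> t z)" "(\<integral>s. post_density \<sigma> t z s \<partial>lborel) = 1"
    unfolding post_density_def gauss_def by (auto simp: integrable_normal_density integral_normal_density)
qed

text \<open>The second-difference inequality is an inequality between values of \<open>C\<close>, so
  averaging over the posterior preserves it with the same constant, without differentiating under
  the integral. The constant is uniform in \<open>t\<close>, \<open>z\<close> and
  \<open>x\<close>.\<close>

lemma Hamiltonian_strongly_convex:
  assumes \<sigma>: "\<sigma> > 0" and wd: "Hamiltonian_well_defined T \<sigma> C" and lip: "uniformly_Lipschitz_gradient C"
  obtains \<kappa> where "\<kappa> > 0" "\<And>t z x p q. t \<in> {0..T} \<Longrightarrow>
     Hamiltonian \<sigma> C t z x p + grad (Hamiltonian \<sigma> C t z x) p \<bullet> (q - p) + \<kappa> * (norm (q - p))\<^sup>2 \<le> Hamiltonian \<sigma> C t z x q"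
proof -
  obtain L0 where L0: "\<And>s x \<alpha>. C s x differentiable (at \<alpha>)" "\<And>s x. L0-lipschitz_on UNIV (grad (C s x))"
    using lip unfolding uniformly_Lipschitz_gradient_def by blast
  \<comment> \<open>The Lipschitz constant may be 0, and the duality divides by
    \<open>L\<close>.\<close>
  define L where "L = L0 + 1"
  have L: "L > 0" "L0 \<le> L"
    using lipschitz_on_nonneg[OF L0(2)[of undefined undefined]] by (auto simp: L_def)
  show thesis
  proof (rule that[of "1 / (4 * L)"])
    fix t z x p q assume t: "t \<in> {0..T}"
    note w = wd[unfolded Hamiltonian_well_defined_def, THEN bspec, OF t, THEN spec, of z, THEN spec, of x]
    have pi: "integrable lborel (\<lambda>s. post_density \<sigma> t z s * C s x \<alpha>)" for \<alpha>
      using w[THEN conjunct1, THEN spec, of \<alpha>] by (simp only: post_integrable_def)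
    have bdd: "bdd_above (range (\<lambda>\<alpha>. - (\<alpha> \<bullet> p) - control_cost \<sigma> C t z x \<alpha>))" for p
      by (rule w[THEN conjunct2, THEN conjunct1, THEN spec])
    have sc: "control_cost \<sigma> C t z x (\<alpha> + d) + control_cost \<sigma> C t z x (\<alpha> - d) - 2 * control_cost \<sigma> C t z x \<alpha> \<le> L * (norm d)\<^sup>2" for \<alpha> d
    proof -
      have "(\<integral>s. post_density \<sigma> t z s * C s x (\<alpha> + d) + post_density \<sigma> t z s * C s x (\<alpha> - d) - 2 * (post_density \<sigma> t z s * C s x \<alpha>) \<partial>lborel)
          \<le> (\<integral>s. post_density \<sigma> t z s * (L * (norm d)\<^sup>2) \<partial>lborel)"
      proof (rule Bochner_Integration.integral_mono)
        show "integrable lborel (\<lambda>s. post_density \<sigma> t z s * C s x (\<alpha> + d) + post_density \<sigma> t z s * C s x (\<alpha> - d) - 2 * (post_density \<sigma> t z s * C s x \<alpha>))"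
          by (intro Bochner_Integration.integrable_diff Bochner_Integration.integrable_add integrable_mult_right pi)
        show "integrable lborel (\<lambda>s. post_density \<sigma> t z s * (L * (norm d)\<^sup>2))"
          using integral_post_density(1)[OF \<sigma>, of t z] t by simp
        fix s
        have "C s x (\<alpha> + d) + C s x (\<alpha> - d) - 2 * C s x \<alpha> \<le> L0 * (norm d)\<^sup>2"
          by (rule semiconcave_of_Lipschitz_gradient[OF L0])
        also have "\<dots> \<le> L * (norm d)\<^sup>2"
          using L by (intro mult_right_mono) auto
        finally have "post_density \<sigma> t z s * (C s x (\<alpha> + d) + C s x (\<alpha> - d) - 2 * C s x \<alpha>) \<le> post_density \<sigma> t z s * (L * (norm d)\<^sup>2)"
          by (rule mult_left_mono[OF _ post_density_nonneg])
        then show "post_density \<sigma> t z s * C s x (\<alpha> + d) + post_density \<sigma> t z s * C s x (\<alpha> - d) - 2 * (post_density \<sigma> t z s * C s x \<alpha>) \<le> post_density \<sigma> t z s * (L * (norm d)\<^sup>2)"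
          by (simp add: algebra_simps)
      qed
      also have "\<dots> = L * (norm d)\<^sup>2"
        using integral_post_density(2)[OF \<sigma>, of t z] t by simp
      finally show ?thesis
        unfolding control_cost_def post_expectation_def using pi by simp
    qed
    have H: "Hamiltonian \<sigma> C t z x = (\<lambda>p. SUP \<alpha>. - (\<alpha> \<bullet> p) - control_cost \<sigma> C t z x \<alpha>)"
      by (simp add: Hamiltonian_def fun_eq_iff)
    have "Hamiltonian \<sigma> C t z x differentiable (at p)"
      by (rule w[THEN conjunct2, THEN conjunct2, THEN spec])
    from GDERIV_grad[OF this]
    have "Hamiltonian \<sigma> C t z x p + grad (Hamiltonian \<sigma> C t z x) p \<bullet> (q - p) + (norm (q - p))\<^sup>2 / (4 * L) \<le> Hamiltonian \<sigma> C t z x q"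
      unfolding H by (rule strong_convexity_gradient[OF bdd sc L(1)])
    then show "Hamiltonian \<sigma> C t z x p + grad (Hamiltonian \<sigma> C t z x) p \<bullet> (q - p) + 1 / (4 * L) * (norm (q - p))\<^sup>2 \<le> Hamiltonian \<sigma> C t z x q"
      by simp
  qed (use L in simp)
qed

subsection \<open>The monotone pairing\<close>

text \<open>The normalising constant in Bayes' formula: the average of
  \<open>girsanov \<sigma> s t z\<close> over the standard normal prior on \<open>s\<close>.\<close>

definition weight :: "real \<Rightarrow> real \<Rightarrow> real \<Rightarrow> real" where
  "weight \<sigma> t z = sqrt (\<sigma>\<^sup>2 / (t + \<sigma>\<^sup>2)) * exp (z\<^sup>2 / (2 * \<sigma>\<^sup>2 * (t + \<sigma>\<^sup>2)))"

lemma weight_pos: "\<sigma> > 0 \<Longrightarrow> t \<ge> 0 \<Longrightarrow> weight \<sigma> t z > 0"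
  by (simp add: weight_def add_nonneg_pos)

text \<open>Bayes' formula for the prior \<open>N(0, 1)\<close> on the state.\<close>

lemma weight_post_density:
  assumes \<sigma>: "\<sigma> > 0" and t: "t \<ge> 0"
  shows "weight \<sigma> t z * post_density \<sigma> t z s = std_normal_density s * girsanov \<sigma> s t z"
proof -
  define D where "D = t + \<sigma>\<^sup>2"
  have D: "D > 0" using \<sigma> t by (simp add: D_def add_nonneg_pos)
  have v: "sqrt (post_var \<sigma> t) ^ 2 = \<sigma>\<^sup>2 / D"
    using \<sigma> D by (simp add: post_var_def D_def add.commute)
  have "sqrt (\<sigma>\<^sup>2 / D) * (1 / sqrt (2 * pi * (\<sigma>\<^sup>2 / D))) = 1 / sqrt (2 * pi)"
  proof -
    have "sqrt (2 * pi * (\<sigma>\<^sup>2 / D)) = sqrt (2 * pi) * sqrt (\<sigma>\<^sup>2 / D)"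
      by (rule real_sqrt_mult)
    moreover have "sqrt (\<sigma>\<^sup>2 / D) \<noteq> 0" using \<sigma> D by simp
    ultimately show ?thesis by simp
  qed
  moreover have "z\<^sup>2 / (2 * \<sigma>\<^sup>2 * D) + - (s - z / D)\<^sup>2 / (2 * (\<sigma>\<^sup>2 / D)) = - s\<^sup>2 / 2 + (s * z / \<sigma>\<^sup>2 - s\<^sup>2 * t / (2 * \<sigma>\<^sup>2))"
  proof -
    have t: "t = D - \<sigma>\<^sup>2" by (simp add: D_def)
    show ?thesis unfolding t using \<sigma> D by (simp add: field_simps power2_eq_square)
  qed
  then have "exp (z\<^sup>2 / (2 * \<sigma>\<^sup>2 * D)) * exp (- (s - z / D)\<^sup>2 / (2 * (\<sigma>\<^sup>2 / D))) = exp (- s\<^sup>2 / 2) * girsanov \<sigma> s t z"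
    by (simp only: girsanov_def mult_exp_exp)
  moreover have "weight \<sigma> t z * post_density \<sigma> t z s
      = (sqrt (\<sigma>\<^sup>2 / D) * (1 / sqrt (2 * pi * (\<sigma>\<^sup>2 / D)))) * (exp (z\<^sup>2 / (2 * \<sigma>\<^sup>2 * D)) * exp (- (s - z / D)\<^sup>2 / (2 * (\<sigma>\<^sup>2 / D))))"
    unfolding weight_def post_density_def gauss_def normal_density_def post_mean_def v D_def by (simp only: mult_ac)
  ultimately show ?thesis
    by (simp add: std_normal_density_def)
qed

lemma girsanov_measurable: "(\<lambda>(s, z). girsanov \<sigma> s t z) \<in> borel_measurable (borel \<Otimes>\<^sub>M borel)"
  unfolding girsanov_def split_def by measurable

context signal_flow
begin

text \<open>In terms of \<open>y = z / (\<sigma> * sqrt t)\<close> the weight has exponent at most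
  \<open>T / (2 * (T + \<sigma>\<^sup>2))\<close> times \<open>y\<^sup>2\<close>. This is
  \<open>\<sigma>\<^sup>2 / (2 * (T + \<sigma>\<^sup>2))\<close> short of the critical
  \<open>1 / 2\<close>, and the extra exponential uses half of the gap. The factor
  \<open>1 + z\<^sup>2\<close> is there to pay for the tails of the cutoff and for the linear growth
  of \<open>post_mean\<close>.\<close>

lemma weight_moment:
  obtains K where "K \<ge> 0"
    "\<And>t. t \<in> {0<..T} \<Longrightarrow> integrable zx (\<lambda>(z, x). (1 + z\<^sup>2) * exp (1 / (4 * T * (T + \<sigma>\<^sup>2)) * z\<^sup>2) * weight \<sigma> t z * m 0 t z x)"
    "\<And>t. t \<in> {0<..T} \<Longrightarrow> (\<integral>(z, x). (1 + z\<^sup>2) * exp (1 / (4 * T * (T + \<sigma>\<^sup>2)) * z\<^sup>2) * weight \<sigma> t z * m 0 t z x \<partial>zx) \<le> K"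
proof -
  define \<epsilon> where "\<epsilon> = 1 / (4 * T * (T + \<sigma>\<^sup>2))"
  define \<gamma> where "\<gamma> = T / (2 * (T + \<sigma>\<^sup>2)) + \<epsilon> * \<sigma>\<^sup>2 * T"
  have TS: "T + \<sigma>\<^sup>2 > 0" using T by (simp add: add_pos_nonneg)
  have "\<epsilon> * \<sigma>\<^sup>2 * T = \<sigma>\<^sup>2 / (4 * (T + \<sigma>\<^sup>2))" using T TS by (simp add: \<epsilon>_def)
  then have "\<gamma> < 1 / 2"
    using TS T \<sigma> by (simp add: \<gamma>_def field_simps)
  then obtain K where K: "K \<ge> 0"
    "\<And>t. t \<in> {0<..T} \<Longrightarrow> integrable zx (\<lambda>(z, x). (1 + z\<^sup>2 / (\<sigma>\<^sup>2 * t)) * exp (\<gamma> * (z\<^sup>2 / (\<sigma>\<^sup>2 * t))) * m 0 t z x)"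
    "\<And>t. t \<in> {0<..T} \<Longrightarrow> (\<integral>(z, x). (1 + z\<^sup>2 / (\<sigma>\<^sup>2 * t)) * exp (\<gamma> * (z\<^sup>2 / (\<sigma>\<^sup>2 * t))) * m 0 t z x \<partial>zx) \<le> K"
    by (rule exp_moment) blast
  define E where "E = 1 + \<sigma>\<^sup>2 * T"
  have E: "E \<ge> 1" using T by (simp add: E_def)
  have *: "integrable zx (\<lambda>(z, x). (1 + z\<^sup>2) * exp (\<epsilon> * z\<^sup>2) * weight \<sigma> t z * m 0 t z x) \<and>
    (\<integral>(z, x). (1 + z\<^sup>2) * exp (\<epsilon> * z\<^sup>2) * weight \<sigma> t z * m 0 t z x \<partial>zx) \<le> E * K" if t: "t \<in> {0<..T}" for t
  proof -
    have tS: "t + \<sigma>\<^sup>2 > 0" using t by (simp add: add_pos_nonneg)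
    have w: "exp (\<epsilon> * z\<^sup>2) * weight \<sigma> t z \<le> exp (\<gamma> * (z\<^sup>2 / (\<sigma>\<^sup>2 * t)))" for z
    proof -
      define y where "y = z\<^sup>2 / (\<sigma>\<^sup>2 * t)"
      have y: "y \<ge> 0" "z\<^sup>2 = \<sigma>\<^sup>2 * t * y" using t \<sigma> by (auto simp: y_def)
      have 1: "z\<^sup>2 / (2 * \<sigma>\<^sup>2 * (t + \<sigma>\<^sup>2)) = t / (2 * (t + \<sigma>\<^sup>2)) * y"
        unfolding y(2) using \<sigma> by simp
      have "t / (2 * (t + \<sigma>\<^sup>2)) \<le> T / (2 * (T + \<sigma>\<^sup>2))"
        using t tS TS \<sigma> by (simp add: divide_le_eq pos_le_divide_eq field_simps)
      then have 2: "t / (2 * (t + \<sigma>\<^sup>2)) * y \<le> T / (2 * (T + \<sigma>\<^sup>2)) * y"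
        by (rule mult_right_mono[OF _ y(1)])
      have \<epsilon>t: "\<epsilon> * \<sigma>\<^sup>2 * t \<le> \<epsilon> * \<sigma>\<^sup>2 * T"
        using t T TS by (intro mult_left_mono) (auto simp: \<epsilon>_def)
      then have 3: "\<epsilon> * z\<^sup>2 \<le> \<epsilon> * \<sigma>\<^sup>2 * T * y"
        unfolding y(2) using mult_right_mono[OF \<epsilon>t y(1)] by (simp add: mult.assoc)
      have "sqrt (\<sigma>\<^sup>2 / (t + \<sigma>\<^sup>2)) \<le> 1"
        using t tS by (simp add: divide_le_eq)
      then have "weight \<sigma> t z \<le> 1 * exp (z\<^sup>2 / (2 * \<sigma>\<^sup>2 * (t + \<sigma>\<^sup>2)))"
        unfolding weight_def by (rule mult_right_mono) simp
      then have "exp (\<epsilon> * z\<^sup>2) * weight \<sigma> t z \<le> exp (\<epsilon> * z\<^sup>2) * exp (z\<^sup>2 / (2 * \<sigma>\<^sup>2 * (t + \<sigma>\<^sup>2)))"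
        by simp
      also have "\<dots> = exp (\<epsilon> * z\<^sup>2 + t / (2 * (t + \<sigma>\<^sup>2)) * y)"
        unfolding 1 by (rule mult_exp_exp)
      also have "\<dots> \<le> exp (\<gamma> * y)"
        unfolding \<gamma>_def using 2 3 by (simp add: distrib_right)
      finally show ?thesis by (simp only: y_def)
    qed
    have q: "1 + z\<^sup>2 \<le> E * (1 + z\<^sup>2 / (\<sigma>\<^sup>2 * t))" for z
    proof -
      define y where "y = z\<^sup>2 / (\<sigma>\<^sup>2 * t)"
      have y: "y \<ge> 0" "z\<^sup>2 = \<sigma>\<^sup>2 * t * y" using t \<sigma> by (auto simp: y_def)
      have "\<sigma>\<^sup>2 * t * y \<le> \<sigma>\<^sup>2 * T * y"
        using t y by (intro mult_right_mono mult_left_mono) auto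
      moreover have "0 \<le> \<sigma>\<^sup>2 * T" "0 \<le> y" using T y by auto
      ultimately show ?thesis
        unfolding y_def[symmetric] unfolding y(2) E_def by (simp add: algebra_simps)
    qed
    have pw: "\<bar>(1 + z\<^sup>2) * exp (\<epsilon> * z\<^sup>2) * weight \<sigma> t z * m 0 t z x\<bar>
        \<le> E * ((1 + z\<^sup>2 / (\<sigma>\<^sup>2 * t)) * exp (\<gamma> * (z\<^sup>2 / (\<sigma>\<^sup>2 * t))) * m 0 t z x)" for z x
    proof -
      have wp: "0 \<le> weight \<sigma> t z" using weight_pos[OF \<sigma>, of t z] t by simp
      have "\<bar>(1 + z\<^sup>2) * exp (\<epsilon> * z\<^sup>2) * weight \<sigma> t z * m 0 t z x\<bar> = (1 + z\<^sup>2) * (exp (\<epsilon> * z\<^sup>2) * weight \<sigma> t z) * m 0 t z x"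
        using wp m_nonneg[OF t, of 0 z x] by (simp add: abs_mult)
      also have "\<dots> \<le> (E * (1 + z\<^sup>2 / (\<sigma>\<^sup>2 * t))) * exp (\<gamma> * (z\<^sup>2 / (\<sigma>\<^sup>2 * t))) * m 0 t z x"
        using E t wp by (intro mult_right_mono mult_mono q w m_nonneg[OF t] mult_nonneg_nonneg) auto
      finally show ?thesis by (simp only: mult.assoc)
    qed
    have meas: "(\<lambda>(z, x). (1 + z\<^sup>2) * exp (\<epsilon> * z\<^sup>2) * weight \<sigma> t z * m 0 t z x) \<in> borel_measurable zx"
    proof -
      have "(\<lambda>(z, x :: 'n torus). (1 + z\<^sup>2) * exp (\<epsilon> * z\<^sup>2) * weight \<sigma> t z) \<in> borel_measurable zx"
        unfolding split_def weight_def by measurable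
      then show ?thesis
        using m_measurable[OF t, of 0] unfolding split_def by (rule borel_measurable_times)
    qed
    note 1 = zx_integrable_bound[OF meas zx_cmult(1)[OF K(2)[OF t]] pw]
    have "(\<integral>(z, x). (1 + z\<^sup>2) * exp (\<epsilon> * z\<^sup>2) * weight \<sigma> t z * m 0 t z x \<partial>zx)
        \<le> E * (\<integral>(z, x). (1 + z\<^sup>2 / (\<sigma>\<^sup>2 * t)) * exp (\<gamma> * (z\<^sup>2 / (\<sigma>\<^sup>2 * t))) * m 0 t z x \<partial>zx)"
      using 1(2) unfolding zx_cmult(2) by linarith
    also have "\<dots> \<le> E * K"
      using E by (intro mult_left_mono K(3)[OF t]) auto
    finally show ?thesis using 1(1) by blast
  qed
  show thesis
    by (rule that[of "E * K"]) (use * E K(1) in \<open>auto simp: \<epsilon>_def\<close>)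
qed

text \<open>A solution carries no assumption of measurability in \<open>s\<close>. It follows from
  Girsanov's formula, which makes the dependence on the state explicit.\<close>

lemma m_measurable_state:
  assumes t: "t \<in> {0<..T}"
  shows "(\<lambda>(s, p). (\<lambda>(z, x). m s t z x) p) \<in> borel_measurable (lborel \<Otimes>\<^sub>M zx)"
proof -
  have 1: "(\<lambda>q. (\<lambda>(s, z). girsanov \<sigma> s t z) (fst q, fst (snd q))) \<in> borel_measurable (lborel \<Otimes>\<^sub>M zx)"
    by (rule measurable_compose[OF _ girsanov_measurable]) measurable
  have 2: "(\<lambda>q. (\<lambda>(z, x). m 0 t z x) (snd q)) \<in> borel_measurable (lborel \<Otimes>\<^sub>M zx)"
    by (rule measurable_compose[OF measurable_snd m_measurable[OF t]])
  have "(\<lambda>(s, p). (\<lambda>(z, x). m s t z x) p) = (\<lambda>q. (\<lambda>(s, z). girsanov \<sigma> s t z) (fst q, fst (snd q)) * (\<lambda>(z, x). m 0 t z x) (snd q))"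
    unfolding split_def fst_conv snd_conv by (rule ext) (rule girsanov_formula[OF t])
  then show ?thesis
    using borel_measurable_times[OF 1 2] by simp
qed

text \<open>As an image measure, the law of the position inherits total mass 1, and integrals
  against it become integrals of \<open>m s t\<close> over signal and position.\<close>

lemma position_law_eq_distr:
  assumes t: "t \<in> {0<..T}"
  shows "position_law m s t = distr (density zx (\<lambda>(z, x). ennreal (m s t z x))) borel snd"
proof (rule measure_eqI)
  fix A assume "A \<in> sets (position_law m s t)"
  then have A: "A \<in> sets borel" by (simp add: position_law_def)
  have mE: "(\<lambda>(z, x). ennreal (m s t z x)) = (\<lambda>p. ennreal ((\<lambda>(z, x). m s t z x) p))" by auto
  have mm: "(\<lambda>(z, x). ennreal (m s t z x)) \<in> borel_measurable zx"
    unfolding mE using m_measurable[OF t] by (rule measurable_compose[OF _ measurable_ennreal])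
  have mm1: "(\<lambda>z. ennreal (m s t z x)) \<in> borel_measurable lborel" for x
    using measurable_compose[OF measurable_Pair2'[of x torus_lebesgue lborel] mm] by simp
  have mz: "(\<lambda>x. \<integral>\<^sup>+z. ennreal (m s t z x) \<partial>lborel) \<in> borel_measurable torus_lebesgue"
  proof -
    have "(\<lambda>(x, z). (\<lambda>(z, x). ennreal (m s t z x)) (z, x)) \<in> borel_measurable (torus_lebesgue \<Otimes>\<^sub>M lborel)"
      unfolding split_def by (rule measurable_compose[OF _ mm[unfolded split_def], simplified]) measurable
    then show ?thesis
      by (intro lborel.borel_measurable_nn_integral) (simp add: split_def)
  qed
  have "emeasure (position_law m s t) A = (\<integral>\<^sup>+x. (\<integral>\<^sup>+z. ennreal (m s t z x) \<partial>lborel) * indicator A x \<partial>torus_lebesgue)"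
    unfolding position_law_def by (rule emeasure_density[OF mz]) (simp add: A)
  also have "\<dots> = (\<integral>\<^sup>+x. (\<integral>\<^sup>+z. (\<lambda>(z, x). ennreal (m s t z x) * indicator A x) (z, x) \<partial>lborel) \<partial>torus_lebesgue)"
    by (intro nn_integral_cong) (simp add: nn_integral_multc[OF mm1])
  also have "\<dots> = integral\<^sup>N zx (\<lambda>(z, x). ennreal (m s t z x) * indicator A x)"
  proof (rule zx.nn_integral_snd)
    have "(\<lambda>p. indicator A (snd p) :: ennreal) \<in> borel_measurable zx"
      using A by measurable
    then show "(\<lambda>(z, x). ennreal (m s t z x) * indicator A x) \<in> borel_measurable zx"
      using mm unfolding split_def by (intro borel_measurable_times_ennreal) auto
  qed
  also have "\<dots> = (\<integral>\<^sup>+p. (\<lambda>(z, x). ennreal (m s t z x)) p * indicator (snd -` A \<inter> space zx) p \<partial>zx)"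
    by (intro nn_integral_cong) (auto simp: space_pair_measure indicator_def)
  also have "\<dots> = emeasure (density zx (\<lambda>(z, x). ennreal (m s t z x))) (snd -` A \<inter> space zx)"
    by (rule emeasure_density[symmetric, OF mm]) (use A in measurable)
  also have "\<dots> = emeasure (distr (density zx (\<lambda>(z, x). ennreal (m s t z x))) borel snd) A"
    using A by (subst emeasure_distr) (auto simp: measurable_cong_sets[OF sets_density refl])
  finally show "emeasure (position_law m s t) A = emeasure (distr (density zx (\<lambda>(z, x). ennreal (m s t z x))) borel snd) A" .
qed (simp add: position_law_def)

lemma position_law_prob:
  assumes t: "t \<in> {0<..T}"
  shows "position_law m s t \<in> torus_probs"
proof -
  let ?M = "density zx (\<lambda>(z, x). ennreal (m s t z x))"
  have mE: "(\<lambda>(z, x). ennreal (m s t z x)) = (\<lambda>p. ennreal ((\<lambda>(z, x). m s t z x) p))" by auto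
  have mm: "(\<lambda>(z, x). ennreal (m s t z x)) \<in> borel_measurable zx"
    unfolding mE using m_measurable[OF t] by (rule measurable_compose[OF _ measurable_ennreal])
  have "prob_space ?M"
  proof (rule prob_spaceI)
    have "emeasure ?M (space ?M) = (\<integral>\<^sup>+p. (\<lambda>(z, x). ennreal (m s t z x)) p * indicator (space zx) p \<partial>zx)"
      by (simp only: space_density emeasure_density[OF mm sets.top])
    also have "\<dots> = (\<integral>\<^sup>+(z, x). ennreal (m s t z x) \<partial>zx)"
      by (rule nn_integral_cong) simp
    finally show "emeasure ?M (space ?M) = 1" by (simp only: m_mass[OF t])
  qed
  then have "prob_space (position_law m s t)"
    unfolding position_law_eq_distr[OF t]
    by (rule prob_space.prob_space_distr) (simp add: measurable_cong_sets[OF sets_density refl])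
  then show ?thesis
    by (simp add: torus_probs_def position_law_def)
qed

lemma position_law_integral:
  assumes t: "t \<in> {0<..T}" and h: "integrable (position_law m s t) h"
  shows "integrable zx (\<lambda>(z, x). m s t z x * h x)" "(\<integral>(z, x). m s t z x * h x \<partial>zx) = (\<integral>x. h x \<partial>position_law m s t)"
proof -
  have mE: "(\<lambda>(z, x). ennreal (m s t z x)) = (\<lambda>p. ennreal ((\<lambda>(z, x). m s t z x) p))" by auto
  have hm: "h \<in> borel_measurable borel"
    using borel_measurable_integrable[OF h] by (simp add: position_law_def measurable_cong_sets[OF sets_density refl] measurable_cong_sets[OF sets_torus_lebesgue refl])
  have hm': "(\<lambda>p. h (snd p)) \<in> borel_measurable (zx :: (real \<times> 'n torus) measure)"
    by (rule measurable_compose[OF measurable_snd]) (simp add: hm measurable_cong_sets[OF sets_torus_lebesgue refl])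
  have snd: "snd \<in> measurable (density zx (\<lambda>(z, x). ennreal (m s t z x))) borel"
    by (simp add: measurable_cong_sets[OF sets_density refl])
  have pos: "AE p in zx. 0 \<le> (\<lambda>(z, x). m s t z x) p"
    by (intro AE_I2) (auto intro: m_nonneg[OF t])
  have "integrable (density zx (\<lambda>(z, x). ennreal (m s t z x))) (\<lambda>p. h (snd p))"
    using h unfolding position_law_eq_distr[OF t] integrable_distr_eq[OF snd hm] .
  then have "integrable zx (\<lambda>p. (\<lambda>(z, x). m s t z x) p *\<^sub>R h (snd p))"
    unfolding mE using integrable_density[OF hm' m_measurable[OF t] pos] by simp
  then show "integrable zx (\<lambda>(z, x). m s t z x * h x)" by (simp add: split_def)
  have "(\<integral>x. h x \<partial>position_law m s t) = (\<integral>p. h (snd p) \<partial>density zx (\<lambda>(z, x). ennreal (m s t z x)))"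
    unfolding position_law_eq_distr[OF t] by (rule integral_distr[OF snd hm])
  also have "\<dots> = (\<integral>p. (\<lambda>(z, x). m s t z x) p *\<^sub>R h (snd p) \<partial>zx)"
    unfolding mE by (rule integral_density[OF hm' m_measurable[OF t] pos])
  finally show "(\<integral>(z, x). m s t z x * h x \<partial>zx) = (\<integral>x. h x \<partial>position_law m s t)"
    by (simp add: split_def)
qed

text \<open>This makes \<open>F s x (position_law m s t)\<close> measurable in \<open>(s, x)\<close>
  for a Borel cost, as Fubini's theorem over the states requires.\<close>

lemma position_law_measurable:
  assumes t: "t \<in> {0<..T}"
  shows "(\<lambda>s. position_law m s t) \<in> measurable borel (prob_algebra borel)"
proof (rule measurable_prob_algebraI)
  show "prob_space (position_law m s t)" for s
    using position_law_prob[OF t, of s] by (simp add: torus_probs_def)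
  show "(\<lambda>s. position_law m s t) \<in> measurable borel (subprob_algebra borel)"
  proof (rule measurable_subprob_algebra)
    show "subprob_space (position_law m s t)" for s
      using position_law_prob[OF t, of s] by (simp add: torus_probs_def prob_space_imp_subprob_space)
    show "sets (position_law m s t) = sets borel" for s
      by (simp add: position_law_def)
    fix A :: "'n torus set" assume A: "A \<in> sets borel"
    have mE: "(\<lambda>(z, x). ennreal (m s t z x)) = (\<lambda>p. ennreal ((\<lambda>(z, x). m s t z x) p))" for s by auto
    have mm: "(\<lambda>(z, x). ennreal (m s t z x)) \<in> borel_measurable zx" for s
      unfolding mE using m_measurable[OF t] by (rule measurable_compose[OF _ measurable_ennreal])
    have eq: "emeasure (position_law m s t) A = (\<integral>\<^sup>+p. (\<lambda>(s, p). ennreal ((\<lambda>(z, x). m s t z x) p) * indicator A (snd p)) (s, p) \<partial>zx)" for s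
    proof -
      have "emeasure (position_law m s t) A = emeasure (density zx (\<lambda>(z, x). ennreal (m s t z x))) (snd -` A \<inter> space zx)"
        unfolding position_law_eq_distr[OF t]
        using A by (subst emeasure_distr) (auto simp: measurable_cong_sets[OF sets_density refl])
      also have "\<dots> = (\<integral>\<^sup>+p. (\<lambda>(z, x). ennreal (m s t z x)) p * indicator (snd -` A \<inter> space zx) p \<partial>zx)"
        by (rule emeasure_density[OF mm]) (use A in measurable)
      also have "\<dots> = (\<integral>\<^sup>+p. (\<lambda>(s, p). ennreal ((\<lambda>(z, x). m s t z x) p) * indicator A (snd p)) (s, p) \<partial>zx)"
        by (intro nn_integral_cong) (auto simp: space_pair_measure indicator_def)
      finally show ?thesis .
    qed
    have 1: "(\<lambda>q. ennreal ((\<lambda>(s, p). (\<lambda>(z, x). m s t z x) p) q)) \<in> borel_measurable (lborel \<Otimes>\<^sub>M zx)"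
      using m_measurable_state[OF t] by (rule measurable_compose[OF _ measurable_ennreal])
    have 2: "(\<lambda>q. indicator A (snd (snd q)) :: ennreal) \<in> borel_measurable (lborel \<Otimes>\<^sub>M (zx :: (real \<times> 'n torus) measure))"
      using A by measurable
    have "(\<lambda>(s, p). ennreal ((\<lambda>(z, x). m s t z x) p) * indicator A (snd p)) \<in> borel_measurable (lborel \<Otimes>\<^sub>M zx)"
      using borel_measurable_times_ennreal[OF 1 2] by (simp add: split_def)
    then have "(\<lambda>s. emeasure (position_law m s t) A) \<in> borel_measurable lborel"
      unfolding eq by (intro sigma_finite_measure.borel_measurable_nn_integral[OF zx.P.sigma_finite_measure_axioms]) simp
    then show "(\<lambda>s. emeasure (position_law m s t) A) \<in> borel_measurable borel" by simp
  qed
qed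

lemma cost_measurable:
  assumes t: "t \<in> {0<..T}" and F: "Borel_cost F"
  shows "(\<lambda>(s, p). F s (snd p) (position_law m s t)) \<in> borel_measurable (lborel \<Otimes>\<^sub>M (zx :: (real \<times> 'n torus) measure))"
proof -
  have "(\<lambda>q. (fst q, snd (snd q), position_law m (fst q) t)) \<in> measurable (lborel \<Otimes>\<^sub>M (zx :: (real \<times> 'n torus) measure)) (borel \<Otimes>\<^sub>M borel \<Otimes>\<^sub>M prob_algebra borel)"
    by (intro measurable_Pair measurable_compose[OF _ position_law_measurable[OF t]]) measurable
  from measurable_compose[OF this F[unfolded Borel_cost_def]] show ?thesis
    by (simp add: split_def)
qed

end

interpretation zxs: pair_sigma_finite "zx :: (real \<times> ('n::finite) torus) measure" "lborel :: real measure"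
  by (intro pair_sigma_finite.intro zx.P.sigma_finite_measure_axioms lborel.sigma_finite_measure_axioms)

context signal_flow
begin

text \<open>By Bayes' formula, integrating over the prior at fixed signal and position leaves the
  weight, the density of state 0 and a posterior expectation. Applied to the absolute value, the
  assumed growth of this expectation is what \<open>weight_moment\<close> can integrate, so Fubini's
  theorem is available.\<close>

lemma pairing_integral:
  assumes t: "t \<in> {0<..T}"
    and f: "(\<lambda>(s, p). f s (snd p)) \<in> borel_measurable (lborel \<Otimes>\<^sub>M (zx :: (real \<times> 'n torus) measure))"
    and int: "\<And>z x. post_integrable \<sigma> t z (\<lambda>s. f s x)"
    and bound: "\<And>z x. post_expectation \<sigma> t z (\<lambda>s. \<bar>f s x\<bar>) \<le> K * exp (1 / (4 * T * (T + \<sigma>\<^sup>2)) * z\<^sup>2)"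
  shows "integrable (zx \<Otimes>\<^sub>M lborel) (\<lambda>(p, s). std_normal_density s * m s t (fst p) (snd p) * f s (snd p))"
    and "(\<integral>s. std_normal_density s * m s t z x * f s x \<partial>lborel) = weight \<sigma> t z * m 0 t z x * post_expectation \<sigma> t z (\<lambda>s. f s x)"
proof -
  define \<Phi> where "\<Phi> p s = std_normal_density s * m s t (fst p) (snd p) * f s (snd p)" for p s
  have bayes: "std_normal_density s * m s t z x * h = weight \<sigma> t z * m 0 t z x * (post_density \<sigma> t z s * h)" for s z x h
  proof -
    have "std_normal_density s * m s t z x * h = (std_normal_density s * girsanov \<sigma> s t z) * m 0 t z x * h"
      using girsanov_formula[OF t, of s z x] by simp
    also have "\<dots> = (weight \<sigma> t z * post_density \<sigma> t z s) * m 0 t z x * h"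
      using weight_post_density[OF \<sigma>, of t z s] t by simp
    finally show ?thesis by (simp only: mult_ac)
  qed
  show "(\<integral>s. std_normal_density s * m s t z x * f s x \<partial>lborel) = weight \<sigma> t z * m 0 t z x * post_expectation \<sigma> t z (\<lambda>s. f s x)" for z x
    unfolding bayes post_expectation_def by simp
  have pos: "0 \<le> weight \<sigma> t z * m 0 t z x" for z x
    using weight_pos[OF \<sigma>, of t z] m_nonneg[OF t, of 0 z x] t by simp
  have pd: "0 \<le> post_density \<sigma> t z s" for z s
    by (simp add: post_density_def gauss_def)
  have \<Phi>m: "(\<lambda>(p, s). \<Phi> p s) \<in> borel_measurable (zx \<Otimes>\<^sub>M lborel)"
  proof -
    have 1: "(\<lambda>q. (\<lambda>(s, p). (\<lambda>(z, x). m s t z x) p) q * (\<lambda>(s, p). f s (snd p)) q) \<in> borel_measurable (lborel \<Otimes>\<^sub>M zx)"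
      by (rule borel_measurable_times[OF m_measurable_state[OF t] f])
    have 2: "(\<lambda>q. std_normal_density (fst q)) \<in> borel_measurable (lborel \<Otimes>\<^sub>M (zx :: (real \<times> 'n torus) measure))"
      by measurable
    from measurable_pair_swap[OF borel_measurable_times[OF 2 1]] show ?thesis
      by (simp add: \<Phi>_def split_def mult.assoc)
  qed
  have norm\<Phi>: "norm (\<Phi> (z, x) s) = weight \<sigma> t z * m 0 t z x * (post_density \<sigma> t z s * \<bar>f s x\<bar>)" for z x s
    using bayes[of s z x "\<bar>f s x\<bar>"] m_nonneg[OF t, of s z x] by (simp add: \<Phi>_def abs_mult)
  obtain M where M: "M \<ge> 0"
    "\<And>t. t \<in> {0<..T} \<Longrightarrow> integrable zx (\<lambda>(z, x). (1 + z\<^sup>2) * exp (1 / (4 * T * (T + \<sigma>\<^sup>2)) * z\<^sup>2) * weight \<sigma> t z * m 0 t z x)"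
    "\<And>t. t \<in> {0<..T} \<Longrightarrow> (\<integral>(z, x). (1 + z\<^sup>2) * exp (1 / (4 * T * (T + \<sigma>\<^sup>2)) * z\<^sup>2) * weight \<sigma> t z * m 0 t z x \<partial>zx) \<le> M"
    by (rule weight_moment) blast
  \<comment> \<open>The sign is read off the assumption \<open>bound\<close>, whose left side is an
    integral of a nonnegative function.\<close>
  have K: "K * exp (1 / (4 * T * (T + \<sigma>\<^sup>2)) * z\<^sup>2) \<ge> 0" for z :: real
  proof -
    have "0 \<le> post_expectation \<sigma> t z (\<lambda>s. \<bar>f s undefined\<bar>)"
      unfolding post_expectation_def using pd by (intro integral_nonneg_AE) simp
    then show ?thesis using bound[of z undefined] by linarith
  qed
  have "integrable (zx \<Otimes>\<^sub>M lborel) (\<lambda>(p, s). \<Phi> p s)"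
  proof (rule zxs.Fubini_integrable[OF \<Phi>m])
    have nm: "(\<lambda>(z, x). \<integral>s. norm (\<Phi> (z, x) s) \<partial>lborel) \<in> borel_measurable zx"
    proof -
      have "(\<lambda>(p, s). norm (\<Phi> p s)) \<in> borel_measurable (zx \<Otimes>\<^sub>M lborel)"
        using measurable_compose[OF \<Phi>m borel_measurable_norm] by (simp add: split_def)
      from lborel.borel_measurable_lebesgue_integral[OF this] show ?thesis by simp
    qed
    have bnd: "\<bar>\<integral>s. norm (\<Phi> (z, x) s) \<partial>lborel\<bar> \<le> K * ((1 + z\<^sup>2) * exp (1 / (4 * T * (T + \<sigma>\<^sup>2)) * z\<^sup>2) * weight \<sigma> t z * m 0 t z x)" for z x
    proof -
      define E where "E = exp (1 / (4 * T * (T + \<sigma>\<^sup>2)) * z\<^sup>2)"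
      have "(\<integral>s. norm (\<Phi> (z, x) s) \<partial>lborel) = weight \<sigma> t z * m 0 t z x * post_expectation \<sigma> t z (\<lambda>s. \<bar>f s x\<bar>)"
        unfolding norm\<Phi> post_expectation_def by simp
      also have "\<dots> \<le> weight \<sigma> t z * m 0 t z x * (K * E)"
        unfolding E_def by (rule mult_left_mono[OF bound pos])
      also have "\<dots> \<le> weight \<sigma> t z * m 0 t z x * ((1 + z\<^sup>2) * (K * E))"
        using mult_right_mono[of 1 "1 + z\<^sup>2" "K * E"] K[of z]
        by (intro mult_left_mono[OF _ pos]) (simp add: E_def)
      finally have "(\<integral>s. norm (\<Phi> (z, x) s) \<partial>lborel) \<le> K * ((1 + z\<^sup>2) * E * weight \<sigma> t z * m 0 t z x)"
        by (simp only: mult_ac)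
      moreover have "0 \<le> (\<integral>s. norm (\<Phi> (z, x) s) \<partial>lborel)"
        by (rule integral_nonneg_AE) simp
      ultimately show ?thesis unfolding E_def by linarith
    qed
    from zx_integrable_bound(1)[OF nm zx_cmult(1)[OF M(2)[OF t]] bnd]
    show "integrable zx (\<lambda>p. \<integral>s. norm ((\<lambda>(p, s). \<Phi> p s) (p, s)) \<partial>lborel)"
      by (simp add: split_def)
    show "AE p in zx. integrable lborel (\<lambda>s. (\<lambda>(p, s). \<Phi> p s) (p, s))"
    proof (rule AE_I2)
      fix p :: "real \<times> 'n torus"
      obtain z x where p: "p = (z, x)" by (cases p)
      have "\<Phi> p s = weight \<sigma> t z * m 0 t z x * (post_density \<sigma> t z s * f s x)" for s
        unfolding p \<Phi>_def fst_conv snd_conv by (rule bayes)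
      moreover have "integrable lborel (\<lambda>s. weight \<sigma> t z * m 0 t z x * (post_density \<sigma> t z s * f s x))"
        using int[of z x] unfolding post_integrable_def by (rule integrable_mult_right)
      ultimately show "integrable lborel (\<lambda>s. (\<lambda>(p, s). \<Phi> p s) (p, s))" by simp
    qed
  qed
  then show "integrable (zx \<Otimes>\<^sub>M lborel) (\<lambda>(p, s). std_normal_density s * m s t (fst p) (snd p) * f s (snd p))"
    unfolding \<Phi>_def .
qed

end

text \<open>The integrand is a \<open>\<Phi> p s\<close> integrated over the states. In the other
  order the inner integral is the prior density at \<open>s\<close> times the monotonicity integral
  of the two position laws in state \<open>s\<close>, hence nonnegative.\<close>

lemma monotone_pairing:
  fixes F :: "real \<Rightarrow> ('n::finite) torus \<Rightarrow> 'n torus measure \<Rightarrow> real"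
  assumes A: "signal_flow T \<sigma> \<sigma>' \<rho>0 b1 m1" and B: "signal_flow T \<sigma> \<sigma>' \<rho>0 b2 m2"
    and t: "t \<in> {0<..T}" and F: "Borel_cost F" and mono: "state_by_state_monotone F"
    and int1: "\<And>z x. post_integrable \<sigma> t z (\<lambda>s. F s x (position_law m1 s t))"
    and int2: "\<And>z x. post_integrable \<sigma> t z (\<lambda>s. F s x (position_law m2 s t))"
    and bound1: "\<And>z x. crowd_cost \<sigma> (\<lambda>s x \<rho>. \<bar>F s x \<rho>\<bar>) m1 t z x \<le> K * exp (1 / (4 * T * (T + \<sigma>\<^sup>2)) * z\<^sup>2)"
    and bound2: "\<And>z x. crowd_cost \<sigma> (\<lambda>s x \<rho>. \<bar>F s x \<rho>\<bar>) m2 t z x \<le> K * exp (1 / (4 * T * (T + \<sigma>\<^sup>2)) * z\<^sup>2)"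
  shows "integrable zx (\<lambda>(z, x). weight \<sigma> t z * (crowd_cost \<sigma> F m1 t z x - crowd_cost \<sigma> F m2 t z x) * (m1 0 t z x - m2 0 t z x))"
    and "(\<integral>(z, x). weight \<sigma> t z * (crowd_cost \<sigma> F m1 t z x - crowd_cost \<sigma> F m2 t z x) * (m1 0 t z x - m2 0 t z x) \<partial>zx) \<ge> 0"
proof -
  interpret A: signal_flow T \<sigma> \<sigma>' \<rho>0 b1 m1 by fact
  interpret B: signal_flow T \<sigma> \<sigma>' \<rho>0 b2 m2 by fact
  define f1 where "f1 s x = F s x (position_law m1 s t)" for s x
  define f2 where "f2 s x = F s x (position_law m2 s t)" for s x
  have fm: "(\<lambda>(s, p). f1 s (snd p)) \<in> borel_measurable (lborel \<Otimes>\<^sub>M (zx :: (real \<times> 'n torus) measure))"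
    "(\<lambda>(s, p). f2 s (snd p)) \<in> borel_measurable (lborel \<Otimes>\<^sub>M (zx :: (real \<times> 'n torus) measure))"
    unfolding f1_def f2_def using A.cost_measurable[OF t F] B.cost_measurable[OF t F] .
  have fi: "post_integrable \<sigma> t z (\<lambda>s. f1 s x)" "post_integrable \<sigma> t z (\<lambda>s. f2 s x)" for z x
    unfolding f1_def f2_def using int1 int2 .
  have fb: "post_expectation \<sigma> t z (\<lambda>s. \<bar>f1 s x\<bar>) \<le> K * exp (1 / (4 * T * (T + \<sigma>\<^sup>2)) * z\<^sup>2)"
    "post_expectation \<sigma> t z (\<lambda>s. \<bar>f2 s x\<bar>) \<le> K * exp (1 / (4 * T * (T + \<sigma>\<^sup>2)) * z\<^sup>2)" for z x
    unfolding f1_def f2_def using bound1[of z x] bound2[of z x] unfolding crowd_cost_def .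
  \<comment> \<open>Expanding the product pairs each density with the cost along either flow, hence
    four instances.\<close>
  note P11 = A.pairing_integral[OF t fm(1) fi(1) fb(1)] and P12 = A.pairing_integral[OF t fm(2) fi(2) fb(2)]
    and P21 = B.pairing_integral[OF t fm(1) fi(1) fb(1)] and P22 = B.pairing_integral[OF t fm(2) fi(2) fb(2)]
  define \<Phi> where "\<Phi> p s = std_normal_density s * (m1 s t (fst p) (snd p) - m2 s t (fst p) (snd p)) * (f1 s (snd p) - f2 s (snd p))" for p s
  have \<Phi>int: "integrable (zx \<Otimes>\<^sub>M lborel) (\<lambda>(p, s). \<Phi> p s)"
  proof -
    have "integrable (zx \<Otimes>\<^sub>M lborel) (\<lambda>q. ((\<lambda>(p, s). std_normal_density s * m1 s t (fst p) (snd p) * f1 s (snd p)) q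
       - (\<lambda>(p, s). std_normal_density s * m1 s t (fst p) (snd p) * f2 s (snd p)) q)
       - ((\<lambda>(p, s). std_normal_density s * m2 s t (fst p) (snd p) * f1 s (snd p)) q
       - (\<lambda>(p, s). std_normal_density s * m2 s t (fst p) (snd p) * f2 s (snd p)) q))"
      by (intro Bochner_Integration.integrable_diff P11(1) P12(1) P21(1) P22(1))
    then show ?thesis
      by (simp add: \<Phi>_def split_def algebra_simps)
  qed
  have inner: "(\<integral>s. \<Phi> (z, x) s \<partial>lborel) = weight \<sigma> t z * (crowd_cost \<sigma> F m1 t z x - crowd_cost \<sigma> F m2 t z x) * (m1 0 t z x - m2 0 t z x)" for z x
  proof -
    have i: "integrable lborel (\<lambda>s. post_density \<sigma> t z s * f1 s x)" "integrable lborel (\<lambda>s. post_density \<sigma> t z s * f2 s x)"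
      using fi unfolding post_integrable_def by blast+
    have "\<Phi> (z, x) s = weight \<sigma> t z * (m1 0 t z x - m2 0 t z x) * (post_density \<sigma> t z s * f1 s x - post_density \<sigma> t z s * f2 s x)" for s
    proof -
      have "\<Phi> (z, x) s = (std_normal_density s * girsanov \<sigma> s t z) * (m1 0 t z x - m2 0 t z x) * (f1 s x - f2 s x)"
        unfolding \<Phi>_def fst_conv snd_conv A.girsanov_formula[OF t, of s] B.girsanov_formula[OF t, of s]
        by (simp add: algebra_simps)
      also have "\<dots> = (weight \<sigma> t z * post_density \<sigma> t z s) * (m1 0 t z x - m2 0 t z x) * (f1 s x - f2 s x)"
        using weight_post_density[OF A.\<sigma>, of t z s] t by simp
      finally show ?thesis by (simp add: algebra_simps)
    qed
    then have "(\<integral>s. \<Phi> (z, x) s \<partial>lborel) = weight \<sigma> t z * (m1 0 t z x - m2 0 t z x) *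
        ((\<integral>s. post_density \<sigma> t z s * f1 s x \<partial>lborel) - (\<integral>s. post_density \<sigma> t z s * f2 s x \<partial>lborel))"
      by (simp only: integral_mult_right_zero Bochner_Integration.integral_diff[OF i])
    then show ?thesis
      unfolding crowd_cost_def post_expectation_def f1_def f2_def by (simp only: mult_ac)
  qed
  have "integrable zx (\<lambda>p. \<integral>s. \<Phi> p s \<partial>lborel)"
    using zxs.integrable_fst'[OF \<Phi>int] by simp
  moreover have eq: "(\<lambda>p. \<integral>s. \<Phi> p s \<partial>lborel) = (\<lambda>(z, x). weight \<sigma> t z * (crowd_cost \<sigma> F m1 t z x - crowd_cost \<sigma> F m2 t z x) * (m1 0 t z x - m2 0 t z x))"
  proof (rule ext)
    show "(\<integral>s. \<Phi> p s \<partial>lborel) = (\<lambda>(z, x). weight \<sigma> t z * (crowd_cost \<sigma> F m1 t z x - crowd_cost \<sigma> F m2 t z x) * (m1 0 t z x - m2 0 t z x)) p" for p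
      using inner[of "fst p" "snd p"] by (simp add: split_def)
  qed
  ultimately show "integrable zx (\<lambda>(z, x). weight \<sigma> t z * (crowd_cost \<sigma> F m1 t z x - crowd_cost \<sigma> F m2 t z x) * (m1 0 t z x - m2 0 t z x))"
    by simp
  have "0 \<le> (\<integral>p. \<Phi> p s \<partial>zx)" for s
  \<comment> \<open>Monotonicity is assumed for distinct laws only. For equal laws the two costs
    coincide and the integrand vanishes.\<close>
  proof (cases "position_law m1 s t = position_law m2 s t")
    case True
    then show ?thesis by (simp add: \<Phi>_def f1_def f2_def)
  next
    case False
    define h where "h x = f1 s x - f2 s x" for x
    have h: "integrable (position_law m1 s t) h" "integrable (position_law m2 s t) h"
      "(\<integral>x. h x \<partial>position_law m1 s t) - (\<integral>x. h x \<partial>position_law m2 s t) \<ge> 0"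
      using mono[unfolded state_by_state_monotone_def, rule_format, OF A.position_law_prob[OF t, of s] B.position_law_prob[OF t, of s] False, of s]
      unfolding h_def f1_def f2_def by blast+
    note i1 = A.position_law_integral[OF t h(1)] and i2 = B.position_law_integral[OF t h(2)]
    have "(\<integral>p. \<Phi> p s \<partial>zx) = (\<integral>p. std_normal_density s * ((\<lambda>(z, x). m1 s t z x * h x) p - (\<lambda>(z, x). m2 s t z x * h x) p) \<partial>zx)"
      by (rule Bochner_Integration.integral_cong) (auto simp: \<Phi>_def h_def algebra_simps)
    also have "\<dots> = std_normal_density s * ((\<integral>x. h x \<partial>position_law m1 s t) - (\<integral>x. h x \<partial>position_law m2 s t))"
      by (simp only: integral_mult_right_zero Bochner_Integration.integral_diff[OF i1(1) i2(1)] i1(2) i2(2))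
    also have "\<dots> \<ge> 0" using h(3) by (intro mult_nonneg_nonneg) simp_all
    finally show ?thesis .
  qed
  then have "0 \<le> (\<integral>s. (\<integral>p. \<Phi> p s \<partial>zx) \<partial>lborel)"
    by (intro integral_nonneg_AE) simp
  also have "\<dots> = (\<integral>p. (\<integral>s. \<Phi> p s \<partial>lborel) \<partial>zx)"
    by (rule zxs.Fubini_integral[OF \<Phi>int])
  finally show "(\<integral>(z, x). weight \<sigma> t z * (crowd_cost \<sigma> F m1 t z x - crowd_cost \<sigma> F m2 t z x) * (m1 0 t z x - m2 0 t z x) \<partial>zx) \<ge> 0"
    unfolding eq .
qed

subsection \<open>The energy estimate\<close>

definition weight_t :: "real \<Rightarrow> real \<Rightarrow> real \<Rightarrow> real" where
  "weight_t \<sigma> t z = - (1 / (2 * (t + \<sigma>\<^sup>2)) + z\<^sup>2 / (2 * \<sigma>\<^sup>2 * (t + \<sigma>\<^sup>2)\<^sup>2)) * weight \<sigma> t z"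

definition weight_z :: "real \<Rightarrow> real \<Rightarrow> real \<Rightarrow> real" where
  "weight_z \<sigma> t z = z / (\<sigma>\<^sup>2 * (t + \<sigma>\<^sup>2)) * weight \<sigma> t z"

definition weight_zz :: "real \<Rightarrow> real \<Rightarrow> real \<Rightarrow> real" where
  "weight_zz \<sigma> t z = (1 / (\<sigma>\<^sup>2 * (t + \<sigma>\<^sup>2)) + z\<^sup>2 / (\<sigma>\<^sup>2 * (t + \<sigma>\<^sup>2))\<^sup>2) * weight \<sigma> t z"

text \<open>Both identities are visible from the weight as an average of
  \<open>girsanov \<sigma> s t z\<close> over the prior. Each such factor solves the backward heat
  equation, and its \<open>z\<close>-derivative is \<open>s / \<sigma>\<^sup>2\<close> times itself,
  so that averaging produces the posterior mean.\<close>

lemma weight_heat: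
  assumes "\<sigma> > 0" "t \<ge> 0"
  shows "weight_t \<sigma> t z + \<sigma>\<^sup>2 / 2 * weight_zz \<sigma> t z = 0"
    and "\<sigma>\<^sup>2 * weight_z \<sigma> t z = post_mean \<sigma> t z * weight \<sigma> t z"
proof -
  have D: "t + \<sigma>\<^sup>2 > 0" using assms by (simp add: add_nonneg_pos)
  have "S / 2 * (1 / (S * D) + z\<^sup>2 / (S * D)\<^sup>2) = 1 / (2 * D) + z\<^sup>2 / (2 * S * D\<^sup>2)" if "S > 0" "D > 0" for S D :: real
    using that by (simp add: field_simps power2_eq_square)
  from this[of "\<sigma>\<^sup>2" "t + \<sigma>\<^sup>2"]
  have "\<sigma>\<^sup>2 / 2 * (1 / (\<sigma>\<^sup>2 * (t + \<sigma>\<^sup>2)) + z\<^sup>2 / (\<sigma>\<^sup>2 * (t + \<sigma>\<^sup>2))\<^sup>2)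
      = 1 / (2 * (t + \<sigma>\<^sup>2)) + z\<^sup>2 / (2 * \<sigma>\<^sup>2 * (t + \<sigma>\<^sup>2)\<^sup>2)"
    using assms(1) D by simp
  then have "\<sigma>\<^sup>2 / 2 * weight_zz \<sigma> t z = (1 / (2 * (t + \<sigma>\<^sup>2)) + z\<^sup>2 / (2 * \<sigma>\<^sup>2 * (t + \<sigma>\<^sup>2)\<^sup>2)) * weight \<sigma> t z"
    unfolding weight_zz_def mult.assoc[symmetric] by (rule arg_cong2[where f = "(*)"]) simp
  then show "weight_t \<sigma> t z + \<sigma>\<^sup>2 / 2 * weight_zz \<sigma> t z = 0"
    unfolding weight_t_def by (simp add: algebra_simps)
  show "\<sigma>\<^sup>2 * weight_z \<sigma> t z = post_mean \<sigma> t z * weight \<sigma> t z"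
    using assms(1) by (simp add: weight_z_def post_mean_def)
qed

lemma DERIV_weight:
  assumes "\<sigma> > 0" "t \<ge> 0"
  shows "((\<lambda>z. weight \<sigma> t z) has_real_derivative weight_z \<sigma> t z) (at z)"
    and "((\<lambda>z. weight_z \<sigma> t z) has_real_derivative weight_zz \<sigma> t z) (at z)"
    and "((\<lambda>t. weight \<sigma> t z) has_real_derivative weight_t \<sigma> t z) (at t)"
proof -
  have D: "t + \<sigma>\<^sup>2 > 0" using assms by (simp add: add_nonneg_pos)
  have w: "weight \<sigma> t z = sqrt (\<sigma>\<^sup>2 / (t + \<sigma>\<^sup>2)) * exp (1 / (2 * \<sigma>\<^sup>2 * (t + \<sigma>\<^sup>2)) * z\<^sup>2)" for t z
    by (simp add: weight_def)
  have *: "((\<lambda>z. a * exp (c * z\<^sup>2)) has_real_derivative a * (exp (c * z\<^sup>2) * (c * (2 * z)))) (at z)" for a c :: real and z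
    by (auto intro!: derivative_eq_intros)
  show wz: "((\<lambda>z. weight \<sigma> t z) has_real_derivative weight_z \<sigma> t z) (at z)" for z
  proof -
    have "sqrt (\<sigma>\<^sup>2 / (t + \<sigma>\<^sup>2)) * (exp (1 / (2 * \<sigma>\<^sup>2 * (t + \<sigma>\<^sup>2)) * z\<^sup>2) * (1 / (2 * \<sigma>\<^sup>2 * (t + \<sigma>\<^sup>2)) * (2 * z))) = weight_z \<sigma> t z"
      unfolding weight_z_def w by simp
    then show ?thesis using *[of "sqrt (\<sigma>\<^sup>2 / (t + \<sigma>\<^sup>2))" "1 / (2 * \<sigma>\<^sup>2 * (t + \<sigma>\<^sup>2))" z] unfolding w by simp
  qed
  have "((\<lambda>z. (1 / (\<sigma>\<^sup>2 * (t + \<sigma>\<^sup>2)) * z) * weight \<sigma> t z) has_real_derivative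
      1 / (\<sigma>\<^sup>2 * (t + \<sigma>\<^sup>2)) * weight \<sigma> t z + weight_z \<sigma> t z * (1 / (\<sigma>\<^sup>2 * (t + \<sigma>\<^sup>2)) * z)) (at z)"
    by (rule DERIV_mult[OF DERIV_cmult_Id wz])
  moreover have "1 / (\<sigma>\<^sup>2 * (t + \<sigma>\<^sup>2)) * weight \<sigma> t z + weight_z \<sigma> t z * (1 / (\<sigma>\<^sup>2 * (t + \<sigma>\<^sup>2)) * z) = weight_zz \<sigma> t z"
    unfolding weight_zz_def weight_z_def by (simp add: distrib_right power2_eq_square)
  ultimately show "((\<lambda>z. weight_z \<sigma> t z) has_real_derivative weight_zz \<sigma> t z) (at z)"
    by (simp add: weight_z_def)
  define f where "f y = \<sigma> / sqrt (y + \<sigma>\<^sup>2) * exp (z\<^sup>2 / (2 * \<sigma>\<^sup>2) * inverse (y + \<sigma>\<^sup>2))" for y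
  have f: "(\<lambda>t. weight \<sigma> t z) = f"
    using assms(1) by (auto simp: f_def weight_def real_sqrt_divide field_simps)
  have 1: "((\<lambda>y. \<sigma> / sqrt (y + \<sigma>\<^sup>2)) has_real_derivative - (1 / (2 * (t + \<sigma>\<^sup>2))) * (\<sigma> / sqrt (t + \<sigma>\<^sup>2))) (at t)"
  proof -
    have "((\<lambda>y. sqrt (y + \<sigma>\<^sup>2)) has_real_derivative inverse (sqrt (t + \<sigma>\<^sup>2)) / 2) (at t)"
      using D by (auto intro!: derivative_eq_intros)
    from DERIV_cmult[OF DERIV_inverse'[OF this], of \<sigma>]
    have "((\<lambda>y. \<sigma> * inverse (sqrt (y + \<sigma>\<^sup>2))) has_real_derivative \<sigma> * - (inverse (sqrt (t + \<sigma>\<^sup>2)) * (inverse (sqrt (t + \<sigma>\<^sup>2)) / 2) * inverse (sqrt (t + \<sigma>\<^sup>2)))) (at t)"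
      using D by simp
    moreover have "c * - (inverse r * (inverse r / 2) * inverse r) = - (1 / (2 * (r * r))) * (c / r)" for c r :: real
      by (simp add: field_simps)
    ultimately have "((\<lambda>y. \<sigma> * inverse (sqrt (y + \<sigma>\<^sup>2))) has_real_derivative - (1 / (2 * (sqrt (t + \<sigma>\<^sup>2) * sqrt (t + \<sigma>\<^sup>2)))) * (\<sigma> / sqrt (t + \<sigma>\<^sup>2))) (at t)"
      by (simp only:)
    moreover have "sqrt (t + \<sigma>\<^sup>2) * sqrt (t + \<sigma>\<^sup>2) = t + \<sigma>\<^sup>2" using D by simp
    ultimately show ?thesis by (simp only: divide_inverse[of \<sigma>])
  qed
  have 2: "((\<lambda>y. exp (z\<^sup>2 / (2 * \<sigma>\<^sup>2) * inverse (y + \<sigma>\<^sup>2))) has_real_derivative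
      - (z\<^sup>2 / (2 * \<sigma>\<^sup>2 * (t + \<sigma>\<^sup>2)\<^sup>2)) * exp (z\<^sup>2 / (2 * \<sigma>\<^sup>2) * inverse (t + \<sigma>\<^sup>2))) (at t)"
  proof -
    have "((\<lambda>y. y + \<sigma>\<^sup>2) has_real_derivative 1) (at t)"
      by (auto intro!: derivative_eq_intros)
    from DERIV_cmult[OF DERIV_inverse'[OF this], of "z\<^sup>2 / (2 * \<sigma>\<^sup>2)"]
    have "((\<lambda>y. z\<^sup>2 / (2 * \<sigma>\<^sup>2) * inverse (y + \<sigma>\<^sup>2)) has_real_derivative z\<^sup>2 / (2 * \<sigma>\<^sup>2) * - (inverse (t + \<sigma>\<^sup>2) * 1 * inverse (t + \<sigma>\<^sup>2))) (at t)"
      using D by simp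
    moreover have "q / r * - (inverse D * 1 * inverse D) = - (q / (r * D\<^sup>2))" for q r D :: real
      by (simp add: divide_inverse power2_eq_square)
    ultimately have "((\<lambda>y. z\<^sup>2 / (2 * \<sigma>\<^sup>2) * inverse (y + \<sigma>\<^sup>2)) has_real_derivative - (z\<^sup>2 / (2 * \<sigma>\<^sup>2 * (t + \<sigma>\<^sup>2)\<^sup>2))) (at t)"
      by (simp only:)
    from DERIV_fun_exp[OF this] show ?thesis by (rule DERIV_cong) (rule mult.commute)
  qed
  from DERIV_mult[OF 1 2] have "(f has_real_derivative weight_t \<sigma> t z) (at t)"
    unfolding f_def[symmetric] weight_t_def f[THEN fun_cong]
    by (rule DERIV_cong) (simp only: f_def, algebra)
  then show "((\<lambda>t. weight \<sigma> t z) has_real_derivative weight_t \<sigma> t z) (at t)"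
    unfolding f .
qed

lemma jc_weight:
  assumes "\<sigma> > 0" "A \<subseteq> {0..}"
  shows "jointly_continuous_on A (\<lambda>t z x. weight \<sigma> t z)" "jointly_continuous_on A (\<lambda>t z x. weight_t \<sigma> t z)"
    "jointly_continuous_on A (\<lambda>t z x. weight_z \<sigma> t z)" "jointly_continuous_on A (\<lambda>t z x. weight_zz \<sigma> t z)"
proof -
  have D: "t + \<sigma>\<^sup>2 \<noteq> 0" if "t \<in> A" for t
    using assms that by (smt (verit) atLeast_iff subsetD zero_less_power)
  have D': "2 * t + 2 * \<sigma>\<^sup>2 \<noteq> 0" if "t \<in> A" for t
    using D[OF that] by simp
  show "jointly_continuous_on A (\<lambda>t z x. weight \<sigma> t z)"
    by (rule jc_tz) (use assms(1) in \<open>force simp: weight_t_def weight_z_def weight_zz_def weight_def split_def D D' intro!: continuous_intros\<close>)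
  show "jointly_continuous_on A (\<lambda>t z x. weight_t \<sigma> t z)"
    by (rule jc_tz) (use assms(1) in \<open>force simp: weight_t_def weight_z_def weight_zz_def weight_def split_def D D' intro!: continuous_intros\<close>)
  show "jointly_continuous_on A (\<lambda>t z x. weight_z \<sigma> t z)"
    by (rule jc_tz) (use assms(1) in \<open>force simp: weight_t_def weight_z_def weight_zz_def weight_def split_def D D' intro!: continuous_intros\<close>)
  show "jointly_continuous_on A (\<lambda>t z x. weight_zz \<sigma> t z)"
    by (rule jc_tz) (use assms(1) in \<open>force simp: weight_t_def weight_z_def weight_zz_def weight_def split_def D D' intro!: continuous_intros\<close>)
qed

lemma C12_with_weight:
  assumes \<sigma>: "\<sigma> > 0" and A: "A \<subseteq> {0..}" and U: "C12_with A U Ut Uz Uzz Ui Uii"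
  shows "C12_with A (\<lambda>t z x. weight \<sigma> t z * U t z x)
     (\<lambda>t z x. weight_t \<sigma> t z * U t z x + weight \<sigma> t z * Ut t z x)
     (\<lambda>t z x. weight_z \<sigma> t z * U t z x + weight \<sigma> t z * Uz t z x)
     (\<lambda>t z x. weight_zz \<sigma> t z * U t z x + 2 * (weight_z \<sigma> t z * Uz t z x) + weight \<sigma> t z * Uzz t z x)
     (\<lambda>i t z x. weight \<sigma> t z * Ui i t z x) (\<lambda>i t z x. weight \<sigma> t z * Uii i t z x)"
  unfolding C12_with_def
proof (intro conjI ballI allI)
  note u = C12_withD[OF U]
  fix t z x i assume t: "t \<in> A"
  then have t0: "t \<ge> 0" using A by auto
  show "((\<lambda>t. weight \<sigma> t z * U t z x) has_real_derivative weight_t \<sigma> t z * U t z x + weight \<sigma> t z * Ut t z x) (at t)"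
    using DERIV_mult[OF DERIV_weight(3)[OF \<sigma> t0] u(1)[OF t]] by (rule DERIV_cong) simp
  show "((\<lambda>z. weight \<sigma> t z * U t z x) has_real_derivative weight_z \<sigma> t z * U t z x + weight \<sigma> t z * Uz t z x) (at z)"
    using DERIV_mult[OF DERIV_weight(1)[OF \<sigma> t0] u(2)[OF t]] by (rule DERIV_cong) simp
  show "((\<lambda>z. weight_z \<sigma> t z * U t z x + weight \<sigma> t z * Uz t z x) has_real_derivative
      weight_zz \<sigma> t z * U t z x + 2 * (weight_z \<sigma> t z * Uz t z x) + weight \<sigma> t z * Uzz t z x) (at z)"
    using DERIV_add[OF DERIV_mult[OF DERIV_weight(2)[OF \<sigma> t0] u(2)[OF t]] DERIV_mult[OF DERIV_weight(1)[OF \<sigma> t0] u(3)[OF t]]]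
    by (rule DERIV_cong) simp
  show "has_tpartial i (\<lambda>x. weight \<sigma> t z * U t z x) (weight \<sigma> t z * Ui i t z x) x"
    by (rule has_tpartial_cmult[OF u(4)[OF t]])
  show "has_tpartial i (\<lambda>x. weight \<sigma> t z * Ui i t z x) (weight \<sigma> t z * Uii i t z x) x"
    by (rule has_tpartial_cmult[OF u(5)[OF t]])
qed (intro jc_intros jc_weight[OF \<sigma> A] C12_withD[OF U])+

lemma C12_with_of_C12_on:
  assumes "C12_on A f"
  shows "C12_with A f (d_t f) (d_z f) (d_z (d_z f)) (\<lambda>i. d_x i f) (\<lambda>i. d_x i (d_x i f))"
  unfolding C12_with_def
proof (intro conjI ballI allI)
  fix t z x i assume t: "t \<in> A"
  note f = assms[unfolded C12_on_def, THEN conjunct1, rule_format, OF t]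
  show "((\<lambda>t. f t z x) has_real_derivative d_t f t z x) (at t)"
    using f[of z x] unfolding d_t_def DERIV_deriv_iff_real_differentiable by blast
  show "((\<lambda>z. f t z x) has_real_derivative d_z f t z x) (at z)"
    using f[of z x] unfolding d_z_def DERIV_deriv_iff_real_differentiable by blast
  have "(\<lambda>z. d_z f t z x) differentiable (at z)" using f[of z x] by blast
  then show "((\<lambda>z. d_z f t z x) has_real_derivative d_z (d_z f) t z x) (at z)"
    unfolding d_z_def[of "d_z f"] DERIV_deriv_iff_real_differentiable .
  have "tdifferentiable i (f t z) x" "tdifferentiable i (d_x i f t z) x" using f[of z x] by blast+
  then show "has_tpartial i (f t z) (d_x i f t z x) x" "has_tpartial i (d_x i f t z) (d_x i (d_x i f) t z x) x"
    unfolding has_tpartial_def d_x_def[of i f t z] d_x_def[of i "d_x i f"] tpartial_def tdifferentiable_def DERIV_deriv_iff_real_differentiable .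
qed (use assms in \<open>auto simp: C12_on_def\<close>)

lemma C12_with_diff:
  assumes "C12_with A f ft fz fzz fi fii" "C12_with A g gt gz gzz gi gii"
  shows "C12_with A (\<lambda>t z x. f t z x - g t z x) (\<lambda>t z x. ft t z x - gt t z x) (\<lambda>t z x. fz t z x - gz t z x)
     (\<lambda>t z x. fzz t z x - gzz t z x) (\<lambda>i t z x. fi i t z x - gi i t z x) (\<lambda>i t z x. fii i t z x - gii i t z x)"
  unfolding C12_with_def
proof (intro conjI ballI allI)
  fix t z x i assume t: "t \<in> A"
  note f = C12_withD(1-5)[OF assms(1) t] and g = C12_withD(1-5)[OF assms(2) t]
  show "((\<lambda>t. f t z x - g t z x) has_real_derivative ft t z x - gt t z x) (at t)"
    "((\<lambda>z. f t z x - g t z x) has_real_derivative fz t z x - gz t z x) (at z)"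
    "((\<lambda>z. fz t z x - gz t z x) has_real_derivative fzz t z x - gzz t z x) (at z)"
    by (rule DERIV_diff[OF f(1) g(1)] DERIV_diff[OF f(2) g(2)] DERIV_diff[OF f(3) g(3)])+
  show "has_tpartial i (\<lambda>x. f t z x - g t z x) (fi i t z x - gi i t z x) x"
    "has_tpartial i (\<lambda>x. fi i t z x - gi i t z x) (fii i t z x - gii i t z x) x"
    by (rule has_tpartial_diff[OF f(4) g(4)] has_tpartial_diff[OF f(5) g(5)])+
qed (intro jc_diff C12_withD[OF assms(1)] C12_withD[OF assms(2)])+

locale mfg_solution =
  fixes T \<sigma> \<sigma>' :: real
    and F G :: "real \<Rightarrow> ('n::finite) torus \<Rightarrow> 'n torus measure \<Rightarrow> real"
    and C :: "real \<Rightarrow> 'n torus \<Rightarrow> real ^ 'n \<Rightarrow> real"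
    and \<rho>0 :: "'n torus \<Rightarrow> real"
    and u :: "real \<Rightarrow> real \<Rightarrow> 'n torus \<Rightarrow> real"
    and m :: "real \<Rightarrow> real \<Rightarrow> real \<Rightarrow> 'n torus \<Rightarrow> real"
  assumes T: "T > 0" and \<sigma>: "\<sigma> > 0" and \<sigma>': "\<sigma>' > 0"
    and \<rho>0: "torus_density \<rho>0"
    and solution: "classical_solution T \<sigma> \<sigma>' F G C \<rho>0 u m"
begin

lemma u_jc: "jointly_continuous_on {0..T} u"
  and u_C12: "C12_with {0<..<T} u (d_t u) (d_z u) (d_z (d_z u)) (\<lambda>i. d_x i u) (\<lambda>i. d_x i (d_x i u))"
  and u_growth: "subgaussian_growth {0..T} u" "subgaussian_growth {0<..<T} (d_z u)"
  and F_growth: "subgaussian_growth {0<..<T} (crowd_cost \<sigma> (\<lambda>s x \<rho>. \<bar>F s x \<rho>\<bar>) m)"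
  and G_growth: "subgaussian_growth {T} (crowd_cost \<sigma> (\<lambda>s x \<rho>. \<bar>G s x \<rho>\<bar>) m)"
  and hjb: "t \<in> {0<..<T} \<Longrightarrow> d_t u t z x + post_mean \<sigma> t z * d_z u t z x + \<sigma>\<^sup>2 / 2 * d_z (d_z u) t z x
      + \<sigma>'\<^sup>2 / 2 * (\<Sum>i\<in>UNIV. d_x i (d_x i u) t z x) = Hamiltonian \<sigma> C t z x (D_x u t z x) - crowd_cost \<sigma> F m t z x"
  and F_int: "t \<in> {0<..<T} \<Longrightarrow> post_integrable \<sigma> t z (\<lambda>s. F s x (position_law m s t))"
  and u_T: "u T z x = crowd_cost \<sigma> G m T z x"
  and G_int: "post_integrable \<sigma> T z (\<lambda>s. G s x (position_law m s T))"
proof -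
  have h: "HJB T \<sigma> \<sigma>' F G C u m" using solution unfolding classical_solution_def by blast
  show "jointly_continuous_on {0..T} u"
    "subgaussian_growth {0..T} u" "subgaussian_growth {0<..<T} (d_z u)"
    "subgaussian_growth {0<..<T} (crowd_cost \<sigma> (\<lambda>s x \<rho>. \<bar>F s x \<rho>\<bar>) m)"
    "subgaussian_growth {T} (crowd_cost \<sigma> (\<lambda>s x \<rho>. \<bar>G s x \<rho>\<bar>) m)"
    using solution unfolding classical_solution_def by blast+
  have "C12_on {0<..<T} u" using solution unfolding classical_solution_def by blast
  then show "C12_with {0<..<T} u (d_t u) (d_z u) (d_z (d_z u)) (\<lambda>i. d_x i u) (\<lambda>i. d_x i (d_x i u))"
    by (rule C12_with_of_C12_on)
  show "u T z x = crowd_cost \<sigma> G m T z x" "post_integrable \<sigma> T z (\<lambda>s. G s x (position_law m s T))"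
    using h unfolding HJB_def by blast+
  assume t: "t \<in> {0<..<T}"
  show "post_integrable \<sigma> t z (\<lambda>s. F s x (position_law m s t))"
    using h t unfolding HJB_def by blast
  have "- d_t u t z x + Hamiltonian \<sigma> C t z x (D_x u t z x)
          - post_mean \<sigma> t z * d_z u t z x - \<sigma>\<^sup>2 / 2 * d_z (d_z u) t z x
          - \<sigma>'\<^sup>2 / 2 * laplacian_x u t z x
        = crowd_cost \<sigma> F m t z x"
    using h t unfolding HJB_def by blast
  then show "d_t u t z x + post_mean \<sigma> t z * d_z u t z x + \<sigma>\<^sup>2 / 2 * d_z (d_z u) t z x
      + \<sigma>'\<^sup>2 / 2 * (\<Sum>i\<in>UNIV. d_x i (d_x i u) t z x) = Hamiltonian \<sigma> C t z x (D_x u t z x) - crowd_cost \<sigma> F m t z x"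
    unfolding laplacian_x_def by linarith
qed

text \<open>The flux derivatives asked for by \<open>FP_with\<close> are those of the product of
  density and drift, whose regularity is part of \<open>classical_solution\<close>.\<close>

sublocale flow: signal_flow T \<sigma> \<sigma>' \<rho>0 "drift \<sigma> C u" m
proof (unfold_locales)
  fix s
  let ?b = "drift \<sigma> C u"
  let ?V = "\<lambda>i t z x. (m s t z x *\<^sub>R ?b t z x) $ i"
  have fp: "Fokker_Planck T \<sigma> \<sigma>' \<rho>0 ?b s (m s)"
    using solution unfolding classical_solution_def by blast
  have jb: "jointly_continuous_on {0..<T} ?b"
    using solution unfolding classical_solution_def by blast
  show b: "jointly_continuous_on {0..<T} (\<lambda>t z x. ?b t z x $ i)" for i
    by (rule jc_vec_nth[OF jb])
  have "C12_on {0<..<T} (m s)"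
    using solution unfolding classical_solution_def by blast
  note c = C12_with_of_C12_on[OF this]
  have "\<forall>s i. let V = (\<lambda>t z x. (m s t z x *\<^sub>R drift \<sigma> C u t z x) $ i) in
        (\<forall>t\<in>{0<..<T}. \<forall>z x. tdifferentiable i (V t z) x) \<and>
        jointly_continuous_on {0<..<T} (d_x i V)"
    using solution unfolding classical_solution_def by blast
  then have V: "\<And>i t z x. t \<in> {0<..<T} \<Longrightarrow> tdifferentiable i (?V i t z) x"
    "\<And>i. jointly_continuous_on {0<..<T} (d_x i (?V i))"
    unfolding Let_def by blast+
  have "FP_with T \<sigma> \<sigma>' s ?b (m s) (d_t (m s)) (d_z (m s)) (d_z (d_z (m s))) (\<lambda>i. d_x i (m s)) (\<lambda>i. d_x i (d_x i (m s))) (\<lambda>i. d_x i (?V i))"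
    unfolding FP_with_def
  proof (intro conjI allI ballI c V(2))
    show "jointly_continuous_on {0<..<T} (\<lambda>t z x. ?b t z x $ i)" for i
      by (rule jc_subset[OF b]) auto
    fix t z x i assume t: "t \<in> {0<..<T}"
    show "has_tpartial i (\<lambda>x. m s t z x * ?b t z x $ i) (d_x i (?V i) t z x) x"
      using V(1)[OF t, of i z x]
      unfolding has_tpartial_def tdifferentiable_def d_x_def tpartial_def by (simp add: DERIV_deriv_iff_real_differentiable)
    have "d_t (m s) t z x + div_x (\<lambda>t z x. m s t z x *\<^sub>R ?b t z x) t z x
          + s * d_z (m s) t z x - \<sigma>\<^sup>2 / 2 * d_z (d_z (m s)) t z x
          - \<sigma>'\<^sup>2 / 2 * laplacian_x (m s) t z x = 0"
      using fp t unfolding Fokker_Planck_def by blast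
    then show "d_t (m s) t z x + (\<Sum>i\<in>UNIV. d_x i (?V i) t z x) + s * d_z (m s) t z x
          - \<sigma>\<^sup>2 / 2 * d_z (d_z (m s)) t z x - \<sigma>'\<^sup>2 / 2 * (\<Sum>i\<in>UNIV. d_x i (d_x i (m s)) t z x) = 0"
      unfolding div_x_def laplacian_x_def .
  qed
  then show "is_FP T \<sigma> \<sigma>' s ?b (m s)" unfolding is_FP_def by blast
  show "jointly_continuous_on {0<..T} (m s)"
    using solution unfolding classical_solution_def by blast
  show "0 \<le> m s t z x" "(\<integral>\<^sup>+ (z, x). ennreal (m s t z x) \<partial>zx) = 1" if "t \<in> {0<..T}" for t z x
    using solution that unfolding classical_solution_def by blast+
  fix f :: "real \<times> 'n torus \<Rightarrow> real" assume f: "continuous_on UNIV f" "bounded (range f)"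
  show "((\<lambda>t. \<integral>(z, x). f (z, x) * m s t z x \<partial>zx) \<longlongrightarrow> (\<integral>x. f (0, x) * \<rho>0 x \<partial>torus_lebesgue)) (at_right 0)"
    using fp f unfolding Fokker_Planck_def by blast
qed (rule T \<sigma> \<sigma>' \<rho>0)+

end

section \<open>Comparison of two solutions\<close>

lemma cutoff_mono:
  assumes "0 < R" "R \<le> R'"
  shows "cutoff R z \<le> cutoff R' z"
proof -
  have "(z / R')\<^sup>2 \<le> (z / R)\<^sup>2"
    unfolding power_divide using assms by (intro divide_left_mono power_mono mult_pos_pos) auto
  then show ?thesis
    unfolding cutoff_def by (intro power_mono) auto
qed

lemma abs_post_mean_le:
  assumes "\<sigma> > 0" "t \<ge> 0"
  shows "\<bar>post_mean \<sigma> t z\<bar> \<le> 1 / \<sigma>\<^sup>2 * \<bar>z\<bar>"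
proof -
  have "\<bar>z\<bar> / \<bar>t + \<sigma>\<^sup>2\<bar> \<le> \<bar>z\<bar> / \<sigma>\<^sup>2"
    using assms by (intro divide_left_mono mult_pos_pos) (auto simp: add_nonneg_pos)
  then show ?thesis by (simp add: post_mean_def abs_divide)
qed

lemma abs_crowd_cost_le: "\<bar>crowd_cost \<sigma> F m t z x\<bar> \<le> crowd_cost \<sigma> (\<lambda>s x \<rho>. \<bar>F s x \<rho>\<bar>) m t z x"
proof -
  have "\<bar>crowd_cost \<sigma> F m t z x\<bar> \<le> (\<integral>s. \<bar>post_density \<sigma> t z s * F s x (position_law m s t)\<bar> \<partial>lborel)"
    unfolding crowd_cost_def post_expectation_def by (rule integral_abs_bound)
  also have "\<dots> = crowd_cost \<sigma> (\<lambda>s x \<rho>. \<bar>F s x \<rho>\<bar>) m t z x"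
    unfolding crowd_cost_def post_expectation_def by (simp only: abs_mult abs_of_nonneg[OF post_density_nonneg])
  finally show ?thesis .
qed

lemma norm_D_x_diff: "(norm (D_x f t z x - D_x g t z x))\<^sup>2 = (\<Sum>i\<in>UNIV. (d_x i f t z x - d_x i g t z x)\<^sup>2)"
  by (simp add: norm_vec_def L2_set_def D_x_def sum_nonneg)

locale mfg_pair =
  A: mfg_solution T \<sigma> \<sigma>' F G C \<rho>0 u1 m1 + B: mfg_solution T \<sigma> \<sigma>' F G C \<rho>0 u2 m2
  for T \<sigma> \<sigma>' :: real
    and F G :: "real \<Rightarrow> ('n::finite) torus \<Rightarrow> 'n torus measure \<Rightarrow> real"
    and C :: "real \<Rightarrow> 'n torus \<Rightarrow> real ^ 'n \<Rightarrow> real"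
    and \<rho>0 :: "'n torus \<Rightarrow> real"
    and u1 u2 :: "real \<Rightarrow> real \<Rightarrow> 'n torus \<Rightarrow> real"
    and m1 m2 :: "real \<Rightarrow> real \<Rightarrow> real \<Rightarrow> 'n torus \<Rightarrow> real" +
  assumes Borel_F: "Borel_cost F" and Borel_G: "Borel_cost G"
    and wd: "Hamiltonian_well_defined T \<sigma> C" and lip: "uniformly_Lipschitz_gradient C"
    and mono_F: "state_by_state_monotone F" and mono_G: "state_by_state_monotone G"
begin

abbreviation \<epsilon> where "\<epsilon> \<equiv> 1 / (4 * T * (T + \<sigma>\<^sup>2))"
abbreviation U where "U t z x \<equiv> u1 t z x - u2 t z x"
abbreviation Ut where "Ut t z x \<equiv> d_t u1 t z x - d_t u2 t z x"
abbreviation Uz where "Uz t z x \<equiv> d_z u1 t z x - d_z u2 t z x"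
abbreviation Uzz where "Uzz t z x \<equiv> d_z (d_z u1) t z x - d_z (d_z u2) t z x"
abbreviation Ui where "Ui i t z x \<equiv> d_x i u1 t z x - d_x i u2 t z x"
abbreviation Uii where "Uii i t z x \<equiv> d_x i (d_x i u1) t z x - d_x i (d_x i u2) t z x"

text \<open>A common majorant, up to a constant over \<open>R\<close>, of everything lost to the
  cutoff. Its integral is bounded uniformly in time by \<open>envelope_moment\<close>.\<close>

definition envelope :: "real \<Rightarrow> real \<Rightarrow> 'n torus \<Rightarrow> real" where
  "envelope t z x = (1 + z\<^sup>2) * exp (\<epsilon> * z\<^sup>2) * weight \<sigma> t z * (m1 0 t z x + m2 0 t z x)"

definition dissipation :: "real \<Rightarrow> real \<Rightarrow> 'n torus \<Rightarrow> real" where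
  "dissipation t z x = weight \<sigma> t z * (m1 0 t z x + m2 0 t z x) * (\<Sum>i\<in>UNIV. (Ui i t z x)\<^sup>2)"

text \<open>Two integrals, since \<open>m1 0\<close> and \<open>m2 0\<close> satisfy equations with
  different drifts and the weak form is applied to each separately. State 0 is enough: the other
  states enter through the weight.\<close>

definition energy :: "real \<Rightarrow> real \<Rightarrow> real" where
  "energy R t = (\<integral>(z, x). cutoff R z * (weight \<sigma> t z * U t z x) * m1 0 t z x \<partial>zx)
     - (\<integral>(z, x). cutoff R z * (weight \<sigma> t z * U t z x) * m2 0 t z x \<partial>zx)"

lemma eps_pos: "\<epsilon> > 0"
  using A.T by (simp add: add_pos_nonneg)

lemma U_C12: "C12_with {0<..<T} U Ut Uz Uzz Ui Uii"
  by (rule C12_with_diff[OF A.u_C12 B.u_C12])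

lemma U_jc: "jointly_continuous_on {0..T} U"
  by (rule jc_diff[OF A.u_jc B.u_jc])

lemma U_equation:
  "t \<in> {0<..<T} \<Longrightarrow> Ut t z x + post_mean \<sigma> t z * Uz t z x + \<sigma>\<^sup>2 / 2 * Uzz t z x + \<sigma>'\<^sup>2 / 2 * (\<Sum>i\<in>UNIV. Uii i t z x)
    = (Hamiltonian \<sigma> C t z x (D_x u1 t z x) - Hamiltonian \<sigma> C t z x (D_x u2 t z x))
      - (crowd_cost \<sigma> F m1 t z x - crowd_cost \<sigma> F m2 t z x)"
  using A.hjb[of t z x] B.hjb[of t z x] by (simp add: sum_subtractf right_diff_distrib)

lemma envelope_moment:
  obtains M where "M \<ge> 0" "\<And>t. t \<in> {0<..T} \<Longrightarrow> integrable zx (\<lambda>(z, x). envelope t z x)"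
    "\<And>t. t \<in> {0<..T} \<Longrightarrow> (\<integral>(z, x). envelope t z x \<partial>zx) \<le> M"
proof -
  obtain M1 where M1: "M1 \<ge> 0"
    "\<And>t. t \<in> {0<..T} \<Longrightarrow> integrable zx (\<lambda>(z, x). (1 + z\<^sup>2) * exp (\<epsilon> * z\<^sup>2) * weight \<sigma> t z * m1 0 t z x)"
    "\<And>t. t \<in> {0<..T} \<Longrightarrow> (\<integral>(z, x). (1 + z\<^sup>2) * exp (\<epsilon> * z\<^sup>2) * weight \<sigma> t z * m1 0 t z x \<partial>zx) \<le> M1"
    by (rule A.flow.weight_moment) blast
  obtain M2 where M2: "M2 \<ge> 0"
    "\<And>t. t \<in> {0<..T} \<Longrightarrow> integrable zx (\<lambda>(z, x). (1 + z\<^sup>2) * exp (\<epsilon> * z\<^sup>2) * weight \<sigma> t z * m2 0 t z x)"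
    "\<And>t. t \<in> {0<..T} \<Longrightarrow> (\<integral>(z, x). (1 + z\<^sup>2) * exp (\<epsilon> * z\<^sup>2) * weight \<sigma> t z * m2 0 t z x \<partial>zx) \<le> M2"
    by (rule B.flow.weight_moment) blast
  show thesis
  proof (rule that)
    show "M1 + M2 \<ge> 0" using M1(1) M2(1) by simp
    fix t assume t: "t \<in> {0<..T}"
    note s = zx_add[OF M1(2)[OF t] M2(2)[OF t]]
    have e: "envelope t z x = (1 + z\<^sup>2) * exp (\<epsilon> * z\<^sup>2) * weight \<sigma> t z * m1 0 t z x + (1 + z\<^sup>2) * exp (\<epsilon> * z\<^sup>2) * weight \<sigma> t z * m2 0 t z x" for z x
      unfolding envelope_def by (rule distrib_left)
    show "integrable zx (\<lambda>(z, x). envelope t z x)"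
      unfolding e by (rule s(1))
    show "(\<integral>(z, x). envelope t z x \<partial>zx) \<le> M1 + M2"
      unfolding e s(2) using M1(3)[OF t] M2(3)[OF t] by (rule add_mono)
  qed
qed

lemma growth_constant:
  obtains K where "K \<ge> 0"
    "\<And>t z x. t \<in> {0..T} \<Longrightarrow> \<bar>U t z x\<bar> \<le> K * exp (\<epsilon> * z\<^sup>2)"
    "\<And>t z x. t \<in> {0<..<T} \<Longrightarrow> \<bar>Uz t z x\<bar> \<le> K * exp (\<epsilon> * z\<^sup>2)"
    "\<And>t z x. t \<in> {0<..<T} \<Longrightarrow> crowd_cost \<sigma> (\<lambda>s x \<rho>. \<bar>F s x \<rho>\<bar>) m1 t z x \<le> K * exp (\<epsilon> * z\<^sup>2)"
    "\<And>t z x. t \<in> {0<..<T} \<Longrightarrow> crowd_cost \<sigma> (\<lambda>s x \<rho>. \<bar>F s x \<rho>\<bar>) m2 t z x \<le> K * exp (\<epsilon> * z\<^sup>2)"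
    "\<And>z x. crowd_cost \<sigma> (\<lambda>s x \<rho>. \<bar>G s x \<rho>\<bar>) m1 T z x \<le> K * exp (\<epsilon> * z\<^sup>2)"
    "\<And>z x. crowd_cost \<sigma> (\<lambda>s x \<rho>. \<bar>G s x \<rho>\<bar>) m2 T z x \<le> K * exp (\<epsilon> * z\<^sup>2)"
proof -
  have ex: "\<exists>K\<ge>0. \<forall>t\<in>S. \<forall>z x. \<bar>f t z x\<bar> \<le> K * exp (\<epsilon> * z\<^sup>2)" if sg: "subgaussian_growth S f"
    for S and f :: "real \<Rightarrow> real \<Rightarrow> 'n torus \<Rightarrow> real"
  proof -
    obtain K where K: "\<forall>t\<in>S. \<forall>z x. \<bar>f t z x\<bar> \<le> K * exp (\<epsilon> * z\<^sup>2)"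
      using sg eps_pos unfolding subgaussian_growth_def by blast
    have "\<bar>f t z x\<bar> \<le> \<bar>K\<bar> * exp (\<epsilon> * z\<^sup>2)" if "t \<in> S" for t z x
      using K that by (intro order_trans[OF _ mult_right_mono[OF abs_ge_self]]) auto
    then show ?thesis by (intro exI[of _ "\<bar>K\<bar>"]) simp
  qed
  obtain a1 where a1: "a1 \<ge> 0" "\<forall>t\<in>{0..T}. \<forall>z x. \<bar>u1 t z x\<bar> \<le> a1 * exp (\<epsilon> * z\<^sup>2)" using ex[OF A.u_growth(1)] by blast
  obtain a2 where a2: "a2 \<ge> 0" "\<forall>t\<in>{0..T}. \<forall>z x. \<bar>u2 t z x\<bar> \<le> a2 * exp (\<epsilon> * z\<^sup>2)" using ex[OF B.u_growth(1)] by blast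
  obtain a3 where a3: "a3 \<ge> 0" "\<forall>t\<in>{0<..<T}. \<forall>z x. \<bar>d_z u1 t z x\<bar> \<le> a3 * exp (\<epsilon> * z\<^sup>2)" using ex[OF A.u_growth(2)] by blast
  obtain a4 where a4: "a4 \<ge> 0" "\<forall>t\<in>{0<..<T}. \<forall>z x. \<bar>d_z u2 t z x\<bar> \<le> a4 * exp (\<epsilon> * z\<^sup>2)" using ex[OF B.u_growth(2)] by blast
  obtain a5 where a5: "a5 \<ge> 0" "\<forall>t\<in>{0<..<T}. \<forall>z x. \<bar>crowd_cost \<sigma> (\<lambda>s x \<rho>. \<bar>F s x \<rho>\<bar>) m1 t z x\<bar> \<le> a5 * exp (\<epsilon> * z\<^sup>2)" using ex[OF A.F_growth] by blast
  obtain a6 where a6: "a6 \<ge> 0" "\<forall>t\<in>{0<..<T}. \<forall>z x. \<bar>crowd_cost \<sigma> (\<lambda>s x \<rho>. \<bar>F s x \<rho>\<bar>) m2 t z x\<bar> \<le> a6 * exp (\<epsilon> * z\<^sup>2)" using ex[OF B.F_growth] by blast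
  obtain a7 where a7: "a7 \<ge> 0" "\<forall>t\<in>{T}. \<forall>z x. \<bar>crowd_cost \<sigma> (\<lambda>s x \<rho>. \<bar>G s x \<rho>\<bar>) m1 t z x\<bar> \<le> a7 * exp (\<epsilon> * z\<^sup>2)" using ex[OF A.G_growth] by blast
  obtain a8 where a8: "a8 \<ge> 0" "\<forall>t\<in>{T}. \<forall>z x. \<bar>crowd_cost \<sigma> (\<lambda>s x \<rho>. \<bar>G s x \<rho>\<bar>) m2 t z x\<bar> \<le> a8 * exp (\<epsilon> * z\<^sup>2)" using ex[OF B.G_growth] by blast
  define K where "K = a1 + a2 + a3 + a4 + a5 + a6 + a7 + a8"
  have le: "a * exp (\<epsilon> * z\<^sup>2) \<le> K * exp (\<epsilon> * z\<^sup>2)" if "a \<le> K" for a z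
    by (rule mult_right_mono[OF that]) simp
  have dif: "\<bar>v - w\<bar> \<le> K * exp (\<epsilon> * z\<^sup>2)" if "\<bar>v\<bar> \<le> a * exp (\<epsilon> * z\<^sup>2)" "\<bar>w\<bar> \<le> b * exp (\<epsilon> * z\<^sup>2)" "a + b \<le> K" for v w a b z
    using that(1,2) le[OF that(3), of z] by (simp add: distrib_right)
  show thesis
  proof (rule that[of K])
    show "K \<ge> 0" using a1(1) a2(1) a3(1) a4(1) a5(1) a6(1) a7(1) a8(1) by (simp add: K_def)
    show "\<bar>U t z x\<bar> \<le> K * exp (\<epsilon> * z\<^sup>2)" if "t \<in> {0..T}" for t z x
      by (rule dif[OF a1(2)[rule_format, OF that] a2(2)[rule_format, OF that]])
         (use a3(1) a4(1) a5(1) a6(1) a7(1) a8(1) in \<open>simp add: K_def\<close>)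
    show "\<bar>Uz t z x\<bar> \<le> K * exp (\<epsilon> * z\<^sup>2)" if "t \<in> {0<..<T}" for t z x
      by (rule dif[OF a3(2)[rule_format, OF that] a4(2)[rule_format, OF that]])
         (use a1(1) a2(1) a5(1) a6(1) a7(1) a8(1) in \<open>simp add: K_def\<close>)
    show "crowd_cost \<sigma> (\<lambda>s x \<rho>. \<bar>F s x \<rho>\<bar>) m1 t z x \<le> K * exp (\<epsilon> * z\<^sup>2)" if "t \<in> {0<..<T}" for t z x
      by (rule order_trans[OF abs_ge_self order_trans[OF a5(2)[rule_format, OF that] le]])
         (use a1(1) a2(1) a3(1) a4(1) a6(1) a7(1) a8(1) in \<open>simp add: K_def\<close>)
    show "crowd_cost \<sigma> (\<lambda>s x \<rho>. \<bar>F s x \<rho>\<bar>) m2 t z x \<le> K * exp (\<epsilon> * z\<^sup>2)" if "t \<in> {0<..<T}" for t z x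
      by (rule order_trans[OF abs_ge_self order_trans[OF a6(2)[rule_format, OF that] le]])
         (use a1(1) a2(1) a3(1) a4(1) a5(1) a7(1) a8(1) in \<open>simp add: K_def\<close>)
    show "crowd_cost \<sigma> (\<lambda>s x \<rho>. \<bar>G s x \<rho>\<bar>) m1 T z x \<le> K * exp (\<epsilon> * z\<^sup>2)" for z x
      by (rule order_trans[OF abs_ge_self order_trans[OF a7(2)[rule_format, OF singletonI] le]])
         (use a1(1) a2(1) a3(1) a4(1) a5(1) a6(1) a8(1) in \<open>simp add: K_def\<close>)
    show "crowd_cost \<sigma> (\<lambda>s x \<rho>. \<bar>G s x \<rho>\<bar>) m2 T z x \<le> K * exp (\<epsilon> * z\<^sup>2)" for z x
      by (rule order_trans[OF abs_ge_self order_trans[OF a8(2)[rule_format, OF singletonI] le]])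
         (use a1(1) a2(1) a3(1) a4(1) a5(1) a6(1) a7(1) in \<open>simp add: K_def\<close>)
  qed
qed

text \<open>Monotonicity controls the pairing only without cutoff. Inserting the cutoff costs
  \<open>(1 - cutoff R z)\<close> times the pairing; the first factor is at most
  \<open>3 * (1 + z\<^sup>2) / R\<close>, and the two values \<open>g1\<close>, \<open>g2\<close>
  contribute \<open>2 * K\<close>.\<close>

lemma cutoff_pairing_bound:
  assumes R: "R \<ge> 1" and t: "t \<in> {0<..T}" and K: "K \<ge> 0"
    and g: "\<bar>g1\<bar> \<le> K * exp (\<epsilon> * z\<^sup>2)" "\<bar>g2\<bar> \<le> K * exp (\<epsilon> * z\<^sup>2)"
  shows "weight \<sigma> t z * (g1 - g2) * (m1 0 t z x - m2 0 t z x) - 6 * K / R * envelope t z x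
    \<le> cutoff R z * (weight \<sigma> t z * (g1 - g2) * (m1 0 t z x - m2 0 t z x))"
proof -
  define P where "P = weight \<sigma> t z * (g1 - g2) * (m1 0 t z x - m2 0 t z x)"
  define E where "E = exp (\<epsilon> * z\<^sup>2)"
  define W where "W = weight \<sigma> t z * (m1 0 t z x + m2 0 t z x)"
  have R0: "R > 0" using R by simp
  have w: "weight \<sigma> t z \<ge> 0" using weight_pos[OF A.\<sigma>, of t z] t by simp
  have mm: "0 \<le> m1 0 t z x" "0 \<le> m2 0 t z x" using A.flow.m_nonneg[OF t] B.flow.m_nonneg[OF t] by auto
  have "\<bar>P\<bar> = weight \<sigma> t z * \<bar>g1 - g2\<bar> * \<bar>m1 0 t z x - m2 0 t z x\<bar>"
    unfolding P_def using w by (simp add: abs_mult)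
  also have "\<dots> \<le> weight \<sigma> t z * (2 * K * E) * (m1 0 t z x + m2 0 t z x)"
    using w mm g K by (intro mult_mono mult_left_mono mult_nonneg_nonneg) (auto simp: E_def)
  finally have P: "\<bar>P\<bar> \<le> 2 * K * (E * W)" by (simp only: W_def mult_ac)
  have tail: "1 - cutoff R z \<le> 3 * (1 + z\<^sup>2) / R"
  proof -
    have "1 - cutoff R z \<le> 3 * z\<^sup>2 / R\<^sup>2" by (rule cutoff_tail[OF R0])
    also have "\<dots> \<le> 3 * (1 + z\<^sup>2) / R"
      using R by (intro frac_le) (auto simp: power2_eq_square)
    finally show ?thesis .
  qed
  have "(1 - cutoff R z) * P \<le> (1 - cutoff R z) * \<bar>P\<bar>"
    using cutoff_le_1[OF R0, of z] by (intro mult_left_mono) auto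
  also have "\<dots> \<le> 3 * (1 + z\<^sup>2) / R * (2 * K * (E * W))"
    using P tail R0 by (intro mult_mono) (auto intro!: divide_nonneg_pos)
  also have "\<dots> = 6 * K / R * envelope t z x"
    unfolding envelope_def E_def W_def by (simp add: field_simps)
  finally show ?thesis unfolding P_def[symmetric] by (simp add: algebra_simps)
qed

end

context mfg_pair
begin

text \<open>The terms with factor 0 are the transport of state 0; they are kept so that the left
  side is literally the integrand of \<open>weak_form\<close>. The derivatives of the weight cancel
  or turn into \<open>post_mean\<close> by \<open>weight_heat\<close>.\<close>

lemma weighted_generator:
  assumes t: "t \<in> {0<..<T}"
  shows "\<mu> * (\<theta> * ((weight_t \<sigma> t z * U t z x + weight \<sigma> t z * Ut t z x) + (\<Sum>i\<in>UNIV. b $ i * (weight \<sigma> t z * Ui i t z x))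
        + 0 * (weight_z \<sigma> t z * U t z x + weight \<sigma> t z * Uz t z x)
        + \<sigma>\<^sup>2 / 2 * (weight_zz \<sigma> t z * U t z x + 2 * (weight_z \<sigma> t z * Uz t z x) + weight \<sigma> t z * Uzz t z x)
        + \<sigma>'\<^sup>2 / 2 * (\<Sum>i\<in>UNIV. weight \<sigma> t z * Uii i t z x))
      + \<theta>' * (0 * (weight \<sigma> t z * U t z x) + \<sigma>\<^sup>2 * (weight_z \<sigma> t z * U t z x + weight \<sigma> t z * Uz t z x))
      + \<sigma>\<^sup>2 / 2 * \<theta>'' * (weight \<sigma> t z * U t z x))
    = weight \<sigma> t z * \<mu> * (\<theta> * ((Hamiltonian \<sigma> C t z x (D_x u1 t z x) - Hamiltonian \<sigma> C t z x (D_x u2 t z x))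
        + b \<bullet> (D_x u1 t z x - D_x u2 t z x) - (crowd_cost \<sigma> F m1 t z x - crowd_cost \<sigma> F m2 t z x))
      + (\<theta>' * (post_mean \<sigma> t z * U t z x + \<sigma>\<^sup>2 * Uz t z x) + \<sigma>\<^sup>2 / 2 * \<theta>'' * U t z x))"
proof -
  have t0: "t \<ge> 0" using t by simp
  have b: "(\<Sum>i\<in>UNIV. b $ i * (weight \<sigma> t z * Ui i t z x)) = weight \<sigma> t z * (b \<bullet> (D_x u1 t z x - D_x u2 t z x))"
    by (simp add: inner_vec_def D_x_def sum_distrib_left mult_ac)
  have l: "(\<Sum>i\<in>UNIV. weight \<sigma> t z * Uii i t z x) = weight \<sigma> t z * (\<Sum>i\<in>UNIV. Uii i t z x)"
    by (rule sum_distrib_left[symmetric])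
  have alg: "\<mu> * (\<theta> * ((kt * w + k * wt) + k * B + 0 * (kz * w + k * wz) + S / 2 * (kzz * w + 2 * (kz * wz) + k * wzz) + S' / 2 * (k * L))
      + \<theta>' * (0 * (k * w) + S * (kz * w + k * wz)) + S / 2 * \<theta>'' * (k * w))
    = k * \<mu> * (\<theta> * (h + B - f) + (\<theta>' * (r * w + S * wz) + S / 2 * \<theta>'' * w))"
    if "kt + S / 2 * kzz = 0" "S * kz = r * k" "wt + r * wz + S / 2 * wzz + S' / 2 * L = h - f"
    for kt kz kzz k w wt wz wzz B L h f r S S' :: real
  proof -
    have kt: "kt = - (S / 2 * kzz)" and wt: "wt = h - f - r * wz - S / 2 * wzz - S' / 2 * L"
      using that by linarith+
    have kz: "S * (kz * y) = r * (k * y)" for y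
      using that(2) by (simp only: mult.assoc[symmetric])
    show ?thesis
      unfolding kt wt by (simp add: algebra_simps kz)
  qed
  show ?thesis
    unfolding b l by (rule alg[OF weight_heat[OF A.\<sigma> t0] U_equation[OF t]])
qed

text \<open>The drift is minus the gradient of the Hamiltonian. Strong convexity is used twice,
  expanding at \<open>D_x u1\<close> for the first inequality and at \<open>D_x u2\<close> for the
  second.\<close>

lemma Hamiltonian_gap:
  obtains \<kappa> where "\<kappa> > 0"
    "\<And>t z x. t \<in> {0<..<T} \<Longrightarrow> (Hamiltonian \<sigma> C t z x (D_x u1 t z x) - Hamiltonian \<sigma> C t z x (D_x u2 t z x))
       + drift \<sigma> C u1 t z x \<bullet> (D_x u1 t z x - D_x u2 t z x) \<le> - \<kappa> * (\<Sum>i\<in>UNIV. (Ui i t z x)\<^sup>2)"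
    "\<And>t z x. t \<in> {0<..<T} \<Longrightarrow> \<kappa> * (\<Sum>i\<in>UNIV. (Ui i t z x)\<^sup>2) \<le> (Hamiltonian \<sigma> C t z x (D_x u1 t z x) - Hamiltonian \<sigma> C t z x (D_x u2 t z x))
       + drift \<sigma> C u2 t z x \<bullet> (D_x u1 t z x - D_x u2 t z x)"
proof -
  obtain \<kappa> where \<kappa>: "\<kappa> > 0" and sc: "\<And>t z x p q. t \<in> {0..T} \<Longrightarrow>
     Hamiltonian \<sigma> C t z x p + grad (Hamiltonian \<sigma> C t z x) p \<bullet> (q - p) + \<kappa> * (norm (q - p))\<^sup>2 \<le> Hamiltonian \<sigma> C t z x q"
    by (rule Hamiltonian_strongly_convex[OF A.\<sigma> wd lip]) blast
  show thesis
  proof (rule that[OF \<kappa>])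
    fix t z x assume "t \<in> {0<..<T}"
    then have t: "t \<in> {0..T}" by simp
    show "(Hamiltonian \<sigma> C t z x (D_x u1 t z x) - Hamiltonian \<sigma> C t z x (D_x u2 t z x))
       + drift \<sigma> C u1 t z x \<bullet> (D_x u1 t z x - D_x u2 t z x) \<le> - \<kappa> * (\<Sum>i\<in>UNIV. (Ui i t z x)\<^sup>2)"
      using sc[OF t, of z x "D_x u1 t z x" "D_x u2 t z x"]
      unfolding norm_minus_commute[of "D_x u2 t z x"] norm_D_x_diff drift_def by (simp add: inner_diff_right)
    show "\<kappa> * (\<Sum>i\<in>UNIV. (Ui i t z x)\<^sup>2) \<le> (Hamiltonian \<sigma> C t z x (D_x u1 t z x) - Hamiltonian \<sigma> C t z x (D_x u2 t z x))
       + drift \<sigma> C u2 t z x \<bullet> (D_x u1 t z x - D_x u2 t z x)"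
      using sc[OF t, of z x "D_x u2 t z x" "D_x u1 t z x"]
      unfolding norm_D_x_diff drift_def by (simp add: inner_diff_right)
  qed
qed

text \<open>This is where the growth of the \<open>z\<close>-derivative of the value enters. The
  bound \<open>6 / R\<close> on \<open>cutoff'\<close> multiplies
  \<open>1 / \<sigma>\<^sup>2\<close> from \<open>post_mean\<close> and
  \<open>\<sigma>\<^sup>2\<close> from the derivative; the bound
  \<open>30 / R\<^sup>2 \<le> 30 / R\<close> on \<open>cutoff''\<close> adds
  \<open>15 * \<sigma>\<^sup>2\<close>, whence
  \<open>6 / \<sigma>\<^sup>2 + 21 * \<sigma>\<^sup>2\<close>.\<close>

lemma commutator_bound:
  assumes R: "R \<ge> 1" and t: "t \<in> {0<..<T}" and K: "K \<ge> 0"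
    and g: "\<bar>U t z x\<bar> \<le> K * exp (\<epsilon> * z\<^sup>2)" "\<bar>Uz t z x\<bar> \<le> K * exp (\<epsilon> * z\<^sup>2)"
  shows "weight \<sigma> t z * (m1 0 t z x - m2 0 t z x) * (cutoff' R z * (post_mean \<sigma> t z * U t z x + \<sigma>\<^sup>2 * Uz t z x) + \<sigma>\<^sup>2 / 2 * cutoff'' R z * U t z x)
    \<le> K * (6 / \<sigma>\<^sup>2 + 21 * \<sigma>\<^sup>2) / R * envelope t z x"
proof -
  define E where "E = exp (\<epsilon> * z\<^sup>2)"
  have t': "t \<in> {0<..T}" "t \<ge> 0" using t by auto
  have R0: "R > 0" using R by simp
  have w: "weight \<sigma> t z \<ge> 0" using weight_pos[OF A.\<sigma> t'(2), of z] by simp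
  have mm: "0 \<le> m1 0 t z x" "0 \<le> m2 0 t z x" using A.flow.m_nonneg[OF t'(1)] B.flow.m_nonneg[OF t'(1)] by auto
  have KE: "0 \<le> K * E" using K by (simp add: E_def)
  have zz: "\<bar>z\<bar> \<le> 1 + z\<^sup>2"
    using zero_le_power2[of "\<bar>z\<bar> - 1"] by (simp add: power2_eq_square algebra_simps)
  have g1: "\<bar>post_mean \<sigma> t z * U t z x\<bar> \<le> (1 / \<sigma>\<^sup>2 * (1 + z\<^sup>2)) * (K * E)"
  proof -
    have "\<bar>post_mean \<sigma> t z\<bar> \<le> 1 / \<sigma>\<^sup>2 * (1 + z\<^sup>2)"
      using abs_post_mean_le[OF A.\<sigma> t'(2), of z] mult_left_mono[OF zz, of "1 / \<sigma>\<^sup>2"] by simp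
    then show ?thesis unfolding abs_mult E_def using g(1) by (intro mult_mono) auto
  qed
  have g2: "\<bar>\<sigma>\<^sup>2 * Uz t z x\<bar> \<le> (\<sigma>\<^sup>2 * (1 + z\<^sup>2)) * (K * E)"
  proof -
    have "\<sigma>\<^sup>2 * 1 \<le> \<sigma>\<^sup>2 * (1 + z\<^sup>2)" by (intro mult_left_mono) auto
    then show ?thesis unfolding abs_mult E_def using g(2) by (intro mult_mono) auto
  qed
  have h1: "\<bar>cutoff' R z * (post_mean \<sigma> t z * U t z x + \<sigma>\<^sup>2 * Uz t z x)\<bar> \<le> 6 / R * ((1 / \<sigma>\<^sup>2 * (1 + z\<^sup>2)) * (K * E) + (\<sigma>\<^sup>2 * (1 + z\<^sup>2)) * (K * E))"
    unfolding abs_mult[of "cutoff' R z"]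
    by (intro mult_mono cutoff'_bound[OF R0] order_trans[OF abs_triangle_ineq add_mono[OF g1 g2]]) (use R0 in auto)
  have h2: "\<bar>\<sigma>\<^sup>2 / 2 * cutoff'' R z * U t z x\<bar> \<le> 15 * \<sigma>\<^sup>2 / R * ((1 + z\<^sup>2) * (K * E))"
  proof -
    have "30 / R\<^sup>2 \<le> 30 / R" using R by (intro divide_left_mono) (auto simp: power2_eq_square)
    then have "\<bar>cutoff'' R z\<bar> \<le> 30 / R" using cutoff''_bound[OF R0, of z] by linarith
    then have "\<bar>\<sigma>\<^sup>2 / 2 * cutoff'' R z\<bar> \<le> \<sigma>\<^sup>2 / 2 * (30 / R)"
      unfolding abs_mult by (intro mult_mono) auto
    moreover have "\<bar>U t z x\<bar> \<le> (1 + z\<^sup>2) * (K * E)"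
      using g(1) mult_right_mono[of 1 "1 + z\<^sup>2" "K * E"] KE by (simp add: E_def)
    ultimately have "\<bar>\<sigma>\<^sup>2 / 2 * cutoff'' R z * U t z x\<bar> \<le> \<sigma>\<^sup>2 / 2 * (30 / R) * ((1 + z\<^sup>2) * (K * E))"
      unfolding abs_mult[of _ "U t z x"] using R0 by (intro mult_mono) auto
    then show ?thesis by simp
  qed
  define S where "S = cutoff' R z * (post_mean \<sigma> t z * U t z x + \<sigma>\<^sup>2 * Uz t z x) + \<sigma>\<^sup>2 / 2 * cutoff'' R z * U t z x"
  have S: "\<bar>S\<bar> \<le> 6 / R * ((1 / \<sigma>\<^sup>2 * (1 + z\<^sup>2)) * (K * E) + (\<sigma>\<^sup>2 * (1 + z\<^sup>2)) * (K * E)) + 15 * \<sigma>\<^sup>2 / R * ((1 + z\<^sup>2) * (K * E))"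
    unfolding S_def by (rule order_trans[OF abs_triangle_ineq add_mono[OF h1 h2]])
  also have "\<dots> = K * (6 / \<sigma>\<^sup>2 + 21 * \<sigma>\<^sup>2) / R * ((1 + z\<^sup>2) * E)"
    by (simp add: add_divide_distrib algebra_simps)
  finally have S: "\<bar>S\<bar> \<le> K * (6 / \<sigma>\<^sup>2 + 21 * \<sigma>\<^sup>2) / R * ((1 + z\<^sup>2) * E)" .
  have "weight \<sigma> t z * (m1 0 t z x - m2 0 t z x) * S \<le> \<bar>weight \<sigma> t z * (m1 0 t z x - m2 0 t z x) * S\<bar>"
    by (rule abs_ge_self)
  also have "\<dots> = weight \<sigma> t z * \<bar>m1 0 t z x - m2 0 t z x\<bar> * \<bar>S\<bar>"
    using w by (simp add: abs_mult)
  also have "\<dots> \<le> weight \<sigma> t z * (m1 0 t z x + m2 0 t z x) * (K * (6 / \<sigma>\<^sup>2 + 21 * \<sigma>\<^sup>2) / R * ((1 + z\<^sup>2) * E))"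
    using w mm S by (intro mult_mono mult_left_mono mult_nonneg_nonneg) auto
  also have "\<dots> = K * (6 / \<sigma>\<^sup>2 + 21 * \<sigma>\<^sup>2) / R * envelope t z x"
    unfolding envelope_def E_def by (simp only: mult_ac)
  finally show ?thesis unfolding S_def .
qed

lemma dissipation_jc: "jointly_continuous_on {0<..<T} dissipation"
proof -
  have j: "jointly_continuous_on {0<..<T} (m1 0)" "jointly_continuous_on {0<..<T} (m2 0)"
    by (rule jc_subset[OF A.flow.m_cont] jc_subset[OF B.flow.m_cont], force)+
  have w: "jointly_continuous_on {0<..<T} (\<lambda>t z x. weight \<sigma> t z)"
    by (rule jc_weight(1)[OF A.\<sigma>]) auto
  show ?thesis
    unfolding dissipation_def[abs_def] power2_eq_square
    by (intro jc_intros w j C12_withD(10)[OF U_C12])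
qed

lemma dissipation_nonneg: "t \<in> {0<..<T} \<Longrightarrow> 0 \<le> dissipation t z x"
  using weight_pos[OF A.\<sigma>, of t z] A.flow.m_nonneg[of t 0 z x] B.flow.m_nonneg[of t 0 z x]
  by (auto simp: dissipation_def intro!: mult_nonneg_nonneg sum_nonneg)

lemma integrable_cutoff_dissipation:
  "R > 0 \<Longrightarrow> t \<in> {0<..<T} \<Longrightarrow> integrable zx (\<lambda>(z, x). cutoff R z * dissipation t z x)"
  by (rule integrable_continuous_strip[where R = R, OF jc_slice[OF jc_mult[OF jc_cutoff(1) dissipation_jc]]])
     (auto simp: cutoff_supp)

text \<open>The Lasry--Lions estimate with explicit errors of order \<open>1 / R\<close>. The
  derivative bound combines strong convexity with the monotonicity of \<open>F\<close>; the lower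
  bound at \<open>T\<close> is the monotonicity of \<open>G\<close>, since there the difference of
  the values is the difference of the terminal costs.\<close>

lemma energy_inequality:
  obtains \<kappa> c where "\<kappa> > 0" "c \<ge> 0"
    "\<And>R t. R \<ge> 1 \<Longrightarrow> t \<in> {0<..<T} \<Longrightarrow> \<exists>e. (energy R has_real_derivative e) (at t)
        \<and> e \<le> c / R - \<kappa> * (\<integral>(z, x). cutoff R z * dissipation t z x \<partial>zx)"
    "\<And>R. R \<ge> 1 \<Longrightarrow> - (c / R) \<le> energy R T"
proof -
  obtain \<kappa> where \<kappa>: "\<kappa> > 0"
    "\<And>t z x. t \<in> {0<..<T} \<Longrightarrow> (Hamiltonian \<sigma> C t z x (D_x u1 t z x) - Hamiltonian \<sigma> C t z x (D_x u2 t z x))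
       + drift \<sigma> C u1 t z x \<bullet> (D_x u1 t z x - D_x u2 t z x) \<le> - \<kappa> * (\<Sum>i\<in>UNIV. (Ui i t z x)\<^sup>2)"
    "\<And>t z x. t \<in> {0<..<T} \<Longrightarrow> \<kappa> * (\<Sum>i\<in>UNIV. (Ui i t z x)\<^sup>2) \<le> (Hamiltonian \<sigma> C t z x (D_x u1 t z x) - Hamiltonian \<sigma> C t z x (D_x u2 t z x))
       + drift \<sigma> C u2 t z x \<bullet> (D_x u1 t z x - D_x u2 t z x)"
    by (rule Hamiltonian_gap) blast
  obtain M where M: "M \<ge> 0" "\<And>t. t \<in> {0<..T} \<Longrightarrow> integrable zx (\<lambda>(z, x). envelope t z x)"
    "\<And>t. t \<in> {0<..T} \<Longrightarrow> (\<integral>(z, x). envelope t z x \<partial>zx) \<le> M"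
    by (rule envelope_moment) blast
  obtain K where K: "K \<ge> 0"
    "\<And>t z x. t \<in> {0..T} \<Longrightarrow> \<bar>U t z x\<bar> \<le> K * exp (\<epsilon> * z\<^sup>2)"
    "\<And>t z x. t \<in> {0<..<T} \<Longrightarrow> \<bar>Uz t z x\<bar> \<le> K * exp (\<epsilon> * z\<^sup>2)"
    "\<And>t z x. t \<in> {0<..<T} \<Longrightarrow> crowd_cost \<sigma> (\<lambda>s x \<rho>. \<bar>F s x \<rho>\<bar>) m1 t z x \<le> K * exp (\<epsilon> * z\<^sup>2)"
    "\<And>t z x. t \<in> {0<..<T} \<Longrightarrow> crowd_cost \<sigma> (\<lambda>s x \<rho>. \<bar>F s x \<rho>\<bar>) m2 t z x \<le> K * exp (\<epsilon> * z\<^sup>2)"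
    "\<And>z x. crowd_cost \<sigma> (\<lambda>s x \<rho>. \<bar>G s x \<rho>\<bar>) m1 T z x \<le> K * exp (\<epsilon> * z\<^sup>2)"
    "\<And>z x. crowd_cost \<sigma> (\<lambda>s x \<rho>. \<bar>G s x \<rho>\<bar>) m2 T z x \<le> K * exp (\<epsilon> * z\<^sup>2)"
    by (rule growth_constant) blast
  define a where "a = K * (6 / \<sigma>\<^sup>2 + 21 * \<sigma>\<^sup>2)"
  define c where "c = (6 * K + a) * M"
  have a: "a \<ge> 0" using K(1) by (simp add: a_def)
  have c: "c \<ge> 0" using K(1) a M(1) by (simp add: c_def)
  have TT: "T \<in> {0<..T}" using A.T by simp
  have env: "(6 * K + a) / R * (\<integral>(z, x). envelope t z x \<partial>zx) \<le> c / R" if "R \<ge> 1" "t \<in> {0<..T}" for R t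
    using mult_left_mono[OF M(3)[OF that(2)], of "(6 * K + a) / R"] K(1) a that(1) by (simp add: c_def)
  show thesis
  proof (rule that[OF \<kappa>(1) c])
    fix R t assume R: "R \<ge> (1 :: real)" and t: "t \<in> {0<..<T}"
    have R0: "R > 0" using R by simp
    have t': "t \<in> {0<..T}" "t \<ge> 0" "t \<in> {0..T}" using t by auto
    have P: "integrable zx (\<lambda>(z, x). weight \<sigma> t z * (crowd_cost \<sigma> F m1 t z x - crowd_cost \<sigma> F m2 t z x) * (m1 0 t z x - m2 0 t z x))"
      "(\<integral>(z, x). weight \<sigma> t z * (crowd_cost \<sigma> F m1 t z x - crowd_cost \<sigma> F m2 t z x) * (m1 0 t z x - m2 0 t z x) \<partial>zx) \<ge> 0"
      by (rule monotone_pairing[OF A.flow.signal_flow_axioms B.flow.signal_flow_axioms t'(1) Borel_F mono_F A.F_int[OF t] B.F_int[OF t] K(4)[OF t] K(5)[OF t]])+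
    define D where "D b \<mu> z x = \<mu> t z x * (cutoff R z * ((weight_t \<sigma> t z * U t z x + weight \<sigma> t z * Ut t z x) + (\<Sum>i\<in>UNIV. b t z x $ i * (weight \<sigma> t z * Ui i t z x))
        + 0 * (weight_z \<sigma> t z * U t z x + weight \<sigma> t z * Uz t z x)
        + \<sigma>\<^sup>2 / 2 * (weight_zz \<sigma> t z * U t z x + 2 * (weight_z \<sigma> t z * Uz t z x) + weight \<sigma> t z * Uzz t z x)
        + \<sigma>'\<^sup>2 / 2 * (\<Sum>i\<in>UNIV. weight \<sigma> t z * Uii i t z x))
      + cutoff' R z * (0 * (weight \<sigma> t z * U t z x) + \<sigma>\<^sup>2 * (weight_z \<sigma> t z * U t z x + weight \<sigma> t z * Uz t z x))
      + \<sigma>\<^sup>2 / 2 * cutoff'' R z * (weight \<sigma> t z * U t z x))" for b :: "real \<Rightarrow> real \<Rightarrow> 'n torus \<Rightarrow> real ^ 'n" and \<mu> z x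
    have \<Psi>: "C12_with {0<..<T} (\<lambda>t z x. weight \<sigma> t z * U t z x)
     (\<lambda>t z x. weight_t \<sigma> t z * U t z x + weight \<sigma> t z * Ut t z x)
     (\<lambda>t z x. weight_z \<sigma> t z * U t z x + weight \<sigma> t z * Uz t z x)
     (\<lambda>t z x. weight_zz \<sigma> t z * U t z x + 2 * (weight_z \<sigma> t z * Uz t z x) + weight \<sigma> t z * Uzz t z x)
     (\<lambda>i t z x. weight \<sigma> t z * Ui i t z x) (\<lambda>i t z x. weight \<sigma> t z * Uii i t z x)"
      by (rule C12_with_weight[OF A.\<sigma> _ U_C12]) auto
    have w: "((\<lambda>t. \<integral>(z, x). cutoff R z * (weight \<sigma> t z * U t z x) * \<mu> t z x \<partial>zx) has_real_derivative (\<integral>(z, x). D b \<mu> z x \<partial>zx)) (at t)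
        \<and> integrable zx (\<lambda>(z, x). D b \<mu> z x)" if fp: "is_FP T \<sigma> \<sigma>' 0 b \<mu>" for b \<mu>
    proof -
      obtain \<mu>t \<mu>z \<mu>zz \<mu>i \<mu>ii vi where FP: "FP_with T \<sigma> \<sigma>' 0 b \<mu> \<mu>t \<mu>z \<mu>zz \<mu>i \<mu>ii vi"
        using fp unfolding is_FP_def by blast
      show ?thesis
        by (intro conjI weak_form[OF FP \<Psi> t R0, of "D b \<mu>"]) (simp_all only: D_def)
    qed
    define D1 where "D1 = D (drift \<sigma> C u1) (m1 0)"
    define D2 where "D2 = D (drift \<sigma> C u2) (m2 0)"
    note w1 = w[OF A.flow.FP, folded D1_def] and w2 = w[OF B.flow.FP, folded D2_def]
    note iE = zx_cmult(1)[OF M(2)[OF t'(1)], of "(6 * K + a) / R"]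
    note iJ = zx_cmult(1)[OF integrable_cutoff_dissipation[OF R0 t], of \<kappa>]
    have pw: "D1 z x - D2 z x \<le> ((6 * K + a) / R * envelope t z x - \<kappa> * (cutoff R z * dissipation t z x))
        - weight \<sigma> t z * (crowd_cost \<sigma> F m1 t z x - crowd_cost \<sigma> F m2 t z x) * (m1 0 t z x - m2 0 t z x)" for z x
    proof -
      define \<theta> where "\<theta> = cutoff R z"
      define k where "k = weight \<sigma> t z"
      define h where "h = Hamiltonian \<sigma> C t z x (D_x u1 t z x) - Hamiltonian \<sigma> C t z x (D_x u2 t z x)"
      define f where "f = crowd_cost \<sigma> F m1 t z x - crowd_cost \<sigma> F m2 t z x"
      define e1 where "e1 = h + drift \<sigma> C u1 t z x \<bullet> (D_x u1 t z x - D_x u2 t z x)"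
      define e2 where "e2 = h + drift \<sigma> C u2 t z x \<bullet> (D_x u1 t z x - D_x u2 t z x)"
      define S where "S = cutoff' R z * (post_mean \<sigma> t z * U t z x + \<sigma>\<^sup>2 * Uz t z x) + \<sigma>\<^sup>2 / 2 * cutoff'' R z * U t z x"
      define v where "v = (\<Sum>i\<in>UNIV. (Ui i t z x)\<^sup>2)"
      have k: "0 \<le> k" using weight_pos[OF A.\<sigma> t'(2), of z] by (simp add: k_def)
      have \<theta>: "0 \<le> \<theta>" unfolding \<theta>_def by (rule cutoff_nonneg[OF R0])
      have mm: "0 \<le> m1 0 t z x" "0 \<le> m2 0 t z x" using A.flow.m_nonneg[OF t'(1)] B.flow.m_nonneg[OF t'(1)] by auto
      have d1: "D1 z x = k * m1 0 t z x * (\<theta> * (e1 - f) + S)"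
        unfolding D1_def D_def weighted_generator[OF t] k_def \<theta>_def e1_def h_def f_def S_def ..
      have d2: "D2 z x = k * m2 0 t z x * (\<theta> * (e2 - f) + S)"
        unfolding D2_def D_def weighted_generator[OF t] k_def \<theta>_def e2_def h_def f_def S_def ..
      have e1: "(k * m1 0 t z x * \<theta>) * e1 \<le> (k * m1 0 t z x * \<theta>) * (- \<kappa> * v)"
        using \<kappa>(2)[OF t, of z x] k \<theta> mm by (intro mult_left_mono mult_nonneg_nonneg) (auto simp: e1_def h_def v_def)
      have e2: "(k * m2 0 t z x * \<theta>) * (\<kappa> * v) \<le> (k * m2 0 t z x * \<theta>) * e2"
        using \<kappa>(3)[OF t, of z x] k \<theta> mm by (intro mult_left_mono mult_nonneg_nonneg) (auto simp: e2_def h_def v_def)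
      have cb: "k * (m1 0 t z x - m2 0 t z x) * S \<le> a / R * envelope t z x"
        unfolding k_def S_def a_def by (rule commutator_bound[OF R t K(1) K(2)[OF t'(3)] K(3)[OF t]])
      have pb: "k * f * (m1 0 t z x - m2 0 t z x) - 6 * K / R * envelope t z x \<le> \<theta> * (k * f * (m1 0 t z x - m2 0 t z x))"
        unfolding k_def f_def \<theta>_def
        by (rule cutoff_pairing_bound[OF R t'(1) K(1) order_trans[OF abs_crowd_cost_le K(4)[OF t]] order_trans[OF abs_crowd_cost_le K(5)[OF t]]])
      have dis: "cutoff R z * dissipation t z x = k * \<theta> * (m1 0 t z x + m2 0 t z x) * v"
        unfolding dissipation_def k_def \<theta>_def v_def by (simp only: mult_ac)
      \<comment> \<open>In the difference the running costs and the commutators meet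
        \<open>m1 0 - m2 0\<close>, while the two convexity gaps are multiplied by
        \<open>m1 0\<close> and \<open>m2 0\<close> with opposite signs and so add up to a
        dissipation in \<open>m1 0 + m2 0\<close>.\<close>
      have "D1 z x - D2 z x = (k * m1 0 t z x * \<theta>) * e1 - (k * m2 0 t z x * \<theta>) * e2
          - \<theta> * (k * f * (m1 0 t z x - m2 0 t z x)) + k * (m1 0 t z x - m2 0 t z x) * S"
        unfolding d1 d2 by (simp add: algebra_simps)
      also have "\<dots> \<le> (k * m1 0 t z x * \<theta>) * (- \<kappa> * v) - (k * m2 0 t z x * \<theta>) * (\<kappa> * v)
          - (k * f * (m1 0 t z x - m2 0 t z x) - 6 * K / R * envelope t z x) + a / R * envelope t z x"
        by (intro add_mono diff_mono e1 e2 cb pb)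
      also have "\<dots> = ((6 * K + a) / R * envelope t z x - \<kappa> * (k * \<theta> * (m1 0 t z x + m2 0 t z x) * v)) - k * f * (m1 0 t z x - m2 0 t z x)"
        by (simp add: add_divide_distrib algebra_simps)
      finally show ?thesis unfolding dis k_def f_def .
    qed
    have "(\<integral>(z, x). D1 z x \<partial>zx) - (\<integral>(z, x). D2 z x \<partial>zx) = (\<integral>(z, x). D1 z x - D2 z x \<partial>zx)"
      by (rule zx_diff(2)[symmetric]) (use w1 w2 in auto)
    also have "\<dots> \<le> (\<integral>(z, x). ((6 * K + a) / R * envelope t z x - \<kappa> * (cutoff R z * dissipation t z x))
        - weight \<sigma> t z * (crowd_cost \<sigma> F m1 t z x - crowd_cost \<sigma> F m2 t z x) * (m1 0 t z x - m2 0 t z x) \<partial>zx)"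
      by (rule zx_integral_mono[OF zx_diff(1)[OF conjunct2[OF w1] conjunct2[OF w2]] zx_diff(1)[OF zx_diff(1)[OF iE iJ] P(1)] pw])
    also have "\<dots> = ((6 * K + a) / R * (\<integral>(z, x). envelope t z x \<partial>zx) - \<kappa> * (\<integral>(z, x). cutoff R z * dissipation t z x \<partial>zx))
        - (\<integral>(z, x). weight \<sigma> t z * (crowd_cost \<sigma> F m1 t z x - crowd_cost \<sigma> F m2 t z x) * (m1 0 t z x - m2 0 t z x) \<partial>zx)"
      unfolding zx_diff(2)[OF zx_diff(1)[OF iE iJ] P(1)] zx_diff(2)[OF iE iJ] zx_cmult(2) ..
    finally have le: "(\<integral>(z, x). D1 z x \<partial>zx) - (\<integral>(z, x). D2 z x \<partial>zx) \<le> c / R - \<kappa> * (\<integral>(z, x). cutoff R z * dissipation t z x \<partial>zx)"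
      using P(2) env[OF R t'(1)] by linarith
    have "(energy R has_real_derivative (\<integral>(z, x). D1 z x \<partial>zx) - (\<integral>(z, x). D2 z x \<partial>zx)) (at t)"
      unfolding energy_def[abs_def] by (rule DERIV_diff[OF conjunct1[OF w1] conjunct1[OF w2]])
    with le show "\<exists>e. (energy R has_real_derivative e) (at t)
        \<and> e \<le> c / R - \<kappa> * (\<integral>(z, x). cutoff R z * dissipation t z x \<partial>zx)"
      by blast
  next
    fix R assume R: "R \<ge> (1 :: real)"
    have R0: "R > 0" using R by simp
    define g where "g z x = crowd_cost \<sigma> G m1 T z x - crowd_cost \<sigma> G m2 T z x" for z x
    have P: "integrable zx (\<lambda>(z, x). weight \<sigma> T z * g z x * (m1 0 T z x - m2 0 T z x))"
      "(\<integral>(z, x). weight \<sigma> T z * g z x * (m1 0 T z x - m2 0 T z x) \<partial>zx) \<ge> 0"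
      unfolding g_def
      by (rule monotone_pairing[OF A.flow.signal_flow_axioms B.flow.signal_flow_axioms TT Borel_G mono_G A.G_int B.G_int K(6) K(7)])+
    have Ug: "U T z x = g z x" for z x unfolding g_def A.u_T B.u_T ..
    have j: "jointly_continuous_on {0<..T} (\<lambda>t z x. cutoff R z * (weight \<sigma> t z * U t z x) * m1 0 t z x)"
      "jointly_continuous_on {0<..T} (\<lambda>t z x. cutoff R z * (weight \<sigma> t z * U t z x) * m2 0 t z x)"
      by (intro jc_mult jc_cutoff jc_weight(1)[OF A.\<sigma>] jc_subset[OF U_jc] A.flow.m_cont B.flow.m_cont; auto)+
    have i: "integrable zx (\<lambda>(z, x). cutoff R z * (weight \<sigma> T z * U T z x) * m1 0 T z x)"
      "integrable zx (\<lambda>(z, x). cutoff R z * (weight \<sigma> T z * U T z x) * m2 0 T z x)"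
      by (rule integrable_continuous_strip[where R = R, OF jc_slice[OF j(1) TT]] integrable_continuous_strip[where R = R, OF jc_slice[OF j(2) TT]]; simp add: cutoff_supp[OF R0])+
    note iE = zx_cmult(1)[OF M(2)[OF TT], of "6 * K / R"]
    have "0 - (c / R) \<le> (\<integral>(z, x). weight \<sigma> T z * g z x * (m1 0 T z x - m2 0 T z x) \<partial>zx) - 6 * K / R * (\<integral>(z, x). envelope T z x \<partial>zx)"
    proof (rule diff_mono[OF P(2)])
      have "6 * K / R * (\<integral>(z, x). envelope T z x \<partial>zx) \<le> 6 * K / R * M"
        using K(1) R0 by (intro mult_left_mono M(3)[OF TT]) auto
      also have "\<dots> \<le> c / R"
        using a M(1) R0 by (simp add: c_def divide_right_mono distrib_right)
      finally show "6 * K / R * (\<integral>(z, x). envelope T z x \<partial>zx) \<le> c / R" .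
    qed
    also have "\<dots> = (\<integral>(z, x). weight \<sigma> T z * g z x * (m1 0 T z x - m2 0 T z x) - 6 * K / R * envelope T z x \<partial>zx)"
      unfolding zx_diff(2)[OF P(1) iE] zx_cmult(2) ..
    also have "\<dots> \<le> (\<integral>(z, x). cutoff R z * (weight \<sigma> T z * U T z x) * m1 0 T z x - cutoff R z * (weight \<sigma> T z * U T z x) * m2 0 T z x \<partial>zx)"
    proof (rule zx_integral_mono[OF zx_diff(1)[OF P(1) iE] zx_diff(1)[OF i]])
      fix z x
      have "weight \<sigma> T z * g z x * (m1 0 T z x - m2 0 T z x) - 6 * K / R * envelope T z x \<le> cutoff R z * (weight \<sigma> T z * g z x * (m1 0 T z x - m2 0 T z x))"
        unfolding g_def
        by (rule cutoff_pairing_bound[OF R TT K(1) order_trans[OF abs_crowd_cost_le K(6)] order_trans[OF abs_crowd_cost_le K(7)]])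
      also have "\<dots> = cutoff R z * (weight \<sigma> T z * U T z x) * m1 0 T z x - cutoff R z * (weight \<sigma> T z * U T z x) * m2 0 T z x"
        unfolding Ug by (simp add: algebra_simps)
      finally show "weight \<sigma> T z * g z x * (m1 0 T z x - m2 0 T z x) - 6 * K / R * envelope T z x \<le> \<dots>" .
    qed
    also have "\<dots> = energy R T"
      unfolding energy_def by (rule zx_diff(2)[OF i])
    finally show "- (c / R) \<le> energy R T" by simp
  qed
qed

end

context mfg_pair
begin

section \<open>From the energy estimate to uniqueness\<close>

lemma energy_continuous:
  assumes R: "R > 0"
  shows "continuous_on {0<..T} (energy R)"
proof -
  have j: "jointly_continuous_on {0<..T} (\<lambda>t z x. (weight \<sigma> t z * U t z x) * m1 0 t z x)"
    "jointly_continuous_on {0<..T} (\<lambda>t z x. (weight \<sigma> t z * U t z x) * m2 0 t z x)"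
    by (intro jc_mult jc_weight(1)[OF A.\<sigma>] jc_subset[OF U_jc] A.flow.m_cont B.flow.m_cont; force)+
  from continuous_on_diff[OF continuous_cutoff_integral[OF j(1) R] continuous_cutoff_integral[OF j(2) R]]
  show ?thesis
    unfolding energy_def[abs_def] by (simp only: mult.assoc)
qed

text \<open>Both densities start from the same measure, so the two limits cancel; the value
  difference is only required to be continuous at time 0.\<close>

lemma energy_initial:
  assumes R: "R > 0"
  shows "(energy R \<longlongrightarrow> 0) (at_right 0)"
proof -
  have j: "jointly_continuous_on {0..<T} (\<lambda>t z x. weight \<sigma> t z * U t z x)"
    by (intro jc_mult jc_weight(1)[OF A.\<sigma>] jc_subset[OF U_jc]; force)
  from tendsto_diff[OF A.flow.init_test[OF j R, of 0] B.flow.init_test[OF j R, of 0]]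
  show ?thesis
    unfolding energy_def[abs_def] by simp
qed

text \<open>The energy starts from 0, ends above \<open>- (c / R)\<close>, and can rise by at most
  \<open>c / R * T\<close>. A positive dissipation near \<open>t0\<close> would force a drop
  independent of \<open>R\<close>, which is impossible for large \<open>R\<close>.\<close>

lemma dissipation_zero:
  assumes t0: "t0 \<in> {0<..<T}"
  shows "dissipation t0 z0 x0 = 0"
proof (rule ccontr)
  assume nz: "dissipation t0 z0 x0 \<noteq> 0"
  define J where "J R t = (\<integral>(z, x). cutoff R z * dissipation t z x \<partial>zx)" for R t
  obtain \<kappa> c where \<kappa>: "\<kappa> > 0" and c: "c \<ge> 0"
    and ineq: "\<And>R t. R \<ge> 1 \<Longrightarrow> t \<in> {0<..<T} \<Longrightarrow> \<exists>e. (energy R has_real_derivative e) (at t) \<and> e \<le> c / R - \<kappa> * J R t"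
    and fin: "\<And>R. R \<ge> 1 \<Longrightarrow> - (c / R) \<le> energy R T"
    unfolding J_def by (rule energy_inequality) blast
  have der: "(energy R has_real_derivative deriv (energy R) t) (at t)" "deriv (energy R) t \<le> c / R - \<kappa> * J R t"
    if "R \<ge> 1" "t \<in> {0<..<T}" for R t
  proof -
    obtain e where "(energy R has_real_derivative e) (at t)" "e \<le> c / R - \<kappa> * J R t"
      using ineq[OF \<open>R \<ge> 1\<close> \<open>t \<in> {0<..<T}\<close>] by blast
    then show "(energy R has_real_derivative deriv (energy R) t) (at t)" "deriv (energy R) t \<le> c / R - \<kappa> * J R t"
      by (simp_all add: DERIV_imp_deriv)
  qed
  have inc: "energy R b - energy R a \<le> B * (b - a)"
    if "R \<ge> 1" "0 < a" "a \<le> b" "b \<le> T" and bnd: "\<And>t. a < t \<Longrightarrow> t < b \<Longrightarrow> c / R - \<kappa> * J R t \<le> B" for R a b B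
  proof -
    have "energy R b - energy R a \<le> (\<lambda>t. B * t) b - (\<lambda>t. B * t) a"
    proof (rule increment_bound[OF \<open>a \<le> b\<close>, where I' = "deriv (energy R)" and h' = "\<lambda>t. B"])
      show "continuous_on {a..b} (energy R)"
        by (rule continuous_on_subset[OF energy_continuous]) (use that in auto)
      show "((\<lambda>t. B * t) has_real_derivative B) (at t)" for t by (rule DERIV_cmult_Id)
      show "(energy R has_real_derivative deriv (energy R) t) (at t)" if "a < t" "t < b" for t
        by (rule der(1)) (use that \<open>R \<ge> 1\<close> \<open>0 < a\<close> \<open>b \<le> T\<close> in auto)
      show "deriv (energy R) t \<le> B" if t: "a < t" "t < b" for t
      proof -
        have "t \<in> {0<..<T}" using t \<open>0 < a\<close> \<open>b \<le> T\<close> by auto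
        from order_trans[OF der(2)[OF \<open>R \<ge> 1\<close> this] bnd[OF t]] show ?thesis .
      qed
    qed (intro continuous_intros)
    then show ?thesis by (simp add: right_diff_distrib)
  qed
  have J_nonneg: "0 \<le> J R t" if "R \<ge> 1" "t \<in> {0<..<T}" for R t
    unfolding J_def using cutoff_nonneg[of R] dissipation_nonneg[OF that(2)] that(1)
    by (intro integral_nonneg_AE AE_I2) (auto intro!: mult_nonneg_nonneg)
  \<comment> \<open>With this radius the cutoff is positive at \<open>z0\<close>. Cutoffs increase
    with the radius, so the dissipation seen through \<open>R1\<close> is a lower bound valid for
    all larger \<open>R\<close>.\<close>
  define R1 where "R1 = \<bar>z0\<bar> + 1"
  have R1: "R1 \<ge> 1" by (simp add: R1_def)
  have J_mono: "J R1 t \<le> J R t" if "R \<ge> R1" "t \<in> {0<..<T}" for R t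
    unfolding J_def
  proof (rule zx_integral_mono)
    show "cutoff R1 z * dissipation t z x \<le> cutoff R z * dissipation t z x" for z x
      by (rule mult_right_mono[OF cutoff_mono dissipation_nonneg]) (use that R1 in auto)
  qed (use that R1 in \<open>auto intro!: integrable_cutoff_dissipation\<close>)
  have "J R1 t0 \<noteq> 0"
  proof
    assume "J R1 t0 = 0"
    have "(\<lambda>(z, x). cutoff R1 z * dissipation t0 z x) (z0, x0) = 0"
    proof (rule continuous_integral_zero)
      show "continuous_on UNIV (\<lambda>(z, x). cutoff R1 z * dissipation t0 z x)"
        by (rule jc_slice[OF jc_mult[OF jc_cutoff(1) dissipation_jc] t0])
      show "integrable zx (\<lambda>(z, x). cutoff R1 z * dissipation t0 z x)"
        by (rule integrable_cutoff_dissipation[OF _ t0]) (use R1 in simp)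
      show "0 \<le> (\<lambda>(z, x). cutoff R1 z * dissipation t0 z x) p" for p
        using cutoff_nonneg[of R1] dissipation_nonneg[OF t0] R1 by (auto simp: split_def intro!: mult_nonneg_nonneg)
      show "(\<integral>(z, x). cutoff R1 z * dissipation t0 z x \<partial>zx) = 0"
        using \<open>J R1 t0 = 0\<close> by (simp only: J_def)
    qed
    moreover have "cutoff R1 z0 \<noteq> 0"
    proof -
      have "\<bar>z0 / R1\<bar> < 1" unfolding R1_def by (simp add: abs_divide)
      then have "(z0 / R1)\<^sup>2 < 1" by (simp add: abs_square_less_1)
      then show ?thesis by (simp add: cutoff_def)
    qed
    ultimately show False using nz by simp
  qed
  then have j: "J R1 t0 > 0" using J_nonneg[OF R1 t0] by simp
  obtain \<delta> where \<delta>: "\<delta> > 0" "0 < t0 - \<delta>" "t0 + \<delta> < T" "\<And>t. t0 - \<delta> < t \<Longrightarrow> t < t0 + \<delta> \<Longrightarrow> J R1 t0 / 2 \<le> J R1 t"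
  proof -
    have "continuous_on {0<..<T} (J R1)"
      unfolding J_def[abs_def] by (rule continuous_cutoff_integral[OF dissipation_jc]) (use R1 in simp)
    then have cont: "isCont (J R1) t0"
      using t0 by (simp add: continuous_on_eq_continuous_at)
    have "0 < J R1 t0 / 2" using j by simp
    then obtain d where d: "d > 0" "\<And>t. dist t t0 < d \<Longrightarrow> dist (J R1 t) (J R1 t0) < J R1 t0 / 2"
      using cont[unfolded continuous_at_eps_delta, rule_format, of "J R1 t0 / 2"] by blast
    define \<delta> where "\<delta> = min d (min (t0 / 2) ((T - t0) / 2))"
    show thesis
    proof (rule that[of \<delta>])
      show "\<delta> > 0" using d t0 by (simp add: \<delta>_def)
      have "\<delta> \<le> t0 / 2" "\<delta> \<le> (T - t0) / 2" unfolding \<delta>_def by linarith+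
      moreover have "0 < t0" "t0 < T" using t0 by auto
      ultimately show "0 < t0 - \<delta>" "t0 + \<delta> < T" by simp_all
      fix t assume "t0 - \<delta> < t" "t < t0 + \<delta>"
      moreover have "\<delta> \<le> d" unfolding \<delta>_def by linarith
      ultimately have "dist t t0 < d" unfolding dist_real_def by linarith
      from d(2)[OF this] show "J R1 t0 / 2 \<le> J R1 t" unfolding dist_real_def by linarith
    qed
  qed
  \<comment> \<open>On the interval of length \<open>2 * \<delta>\<close> around \<open>t0\<close>
    the dissipation is at least half its value at \<open>t0\<close>, which gives
    \<open>\<kappa> * \<delta> * J R1 t0\<close>; elsewhere it is only used as nonnegative.\<close>
  have key: "\<kappa> * \<delta> * J R1 t0 \<le> c / R * (T + 1)" if R: "R \<ge> R1" for R
  proof -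
    have R': "R \<ge> 1" "R > 0" using R R1 by auto
    have cR: "c / R \<ge> 0" using c R' by simp
    \<comment> \<open>The estimate starts at a time \<open>a > 0\<close>, since the energy is
      differentiated and continuous for positive times only; then \<open>a\<close> tends to
      0.\<close>
    have le: "- (c / R) - c / R * T + \<kappa> * \<delta> * J R1 t0 \<le> energy R a" if a: "0 < a" "a < t0 - \<delta>" for a
    proof -
      have "energy R (t0 - \<delta>) - energy R a \<le> c / R * (t0 - \<delta> - a)"
        by (rule inc) (use R' a \<delta> \<kappa> J_nonneg[OF R'(1)] in \<open>auto intro!: mult_nonneg_nonneg\<close>)
      moreover have "energy R (t0 + \<delta>) - energy R (t0 - \<delta>) \<le> (c / R - \<kappa> * (J R1 t0 / 2)) * (t0 + \<delta> - (t0 - \<delta>))"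
      proof (rule inc)
        fix t assume t: "t0 - \<delta> < t" "t < t0 + \<delta>"
        then have "t \<in> {0<..<T}" using \<delta> by auto
        then have "J R1 t0 / 2 \<le> J R t" using \<delta>(4)[OF t] J_mono[OF R] by force
        from mult_left_mono[OF this, of \<kappa>] show "c / R - \<kappa> * J R t \<le> c / R - \<kappa> * (J R1 t0 / 2)" using \<kappa> by simp
      qed (use R' \<delta> in auto)
      moreover have "energy R T - energy R (t0 + \<delta>) \<le> c / R * (T - (t0 + \<delta>))"
        by (rule inc) (use R' \<delta> \<kappa> J_nonneg[OF R'(1)] in \<open>auto intro!: mult_nonneg_nonneg\<close>)
      moreover have "- (c / R) \<le> energy R T" by (rule fin[OF R'(1)])
      moreover have "A * (t0 - \<delta> - a) + (A - \<kappa> * (J R1 t0 / 2)) * (t0 + \<delta> - (t0 - \<delta>)) + A * (T - (t0 + \<delta>))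
          = A * T - A * a - \<kappa> * \<delta> * J R1 t0" for A
        by (simp add: algebra_simps)
      from this[of "c / R"] calculation
      have "- (c / R) - energy R a \<le> c / R * T - c / R * a - \<kappa> * \<delta> * J R1 t0"
        by linarith
      moreover have "0 \<le> c / R * a" using cR a by (intro mult_nonneg_nonneg) auto
      ultimately show ?thesis by linarith
    qed
    have "eventually (\<lambda>a. - (c / R) - c / R * T + \<kappa> * \<delta> * J R1 t0 \<le> energy R a) (at_right 0)"
      unfolding eventually_at_right_field using \<delta>(2) le by (intro exI[of _ "t0 - \<delta>"]) auto
    from tendsto_lowerbound[OF energy_initial[OF R'(2)] this]
    have "- (c / R) - c / R * T + \<kappa> * \<delta> * J R1 t0 \<le> 0" by simp
    then show ?thesis by (simp add: distrib_left)
  qed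
  define q where "q = \<kappa> * \<delta> * J R1 t0"
  have q: "q > 0" using \<kappa> \<delta>(1) j by (simp add: q_def)
  \<comment> \<open>The estimate \<open>key\<close> says \<open>q * R \<le> c * (T + 1)\<close>, and
    this radius makes \<open>q * R\<close> at least twice the right-hand side.\<close>
  define R where "R = max R1 (2 * (c * (T + 1)) / q)"
  have R0: "R > 0" using R1 by (auto simp: R_def max_def)
  have "q \<le> c / R * (T + 1)" unfolding q_def by (rule key) (simp add: R_def)
  then have 1: "q * R \<le> c * (T + 1)" using R0 by (simp add: field_simps)
  have "2 * (c * (T + 1)) / q \<le> R" by (simp add: R_def)
  then have "2 * (c * (T + 1)) \<le> q * R" using q by (simp add: field_simps)
  with 1 have "q * R \<le> 0" by linarith
  then show False using mult_pos_pos[OF q R0] by linarith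
qed

text \<open>The dissipation knows only state 0, but by Girsanov's formula a density that is nonzero
  in state \<open>s\<close> is nonzero in state 0. There the gradients coincide, and the drift
  depends on the value through its gradient alone.\<close>

lemma drift_eq:
  assumes t: "t \<in> {0<..<T}" and m: "m2 s t z x \<noteq> 0"
  shows "drift \<sigma> C u1 t z x = drift \<sigma> C u2 t z x"
proof -
  have t': "t \<in> {0<..T}" "t \<ge> 0" using t by auto
  have "m2 0 t z x \<noteq> 0"
    using m B.flow.girsanov_formula[OF t'(1), of s z x] by auto
  then have "m1 0 t z x + m2 0 t z x > 0"
    using A.flow.m_nonneg[OF t'(1), of 0 z x] B.flow.m_nonneg[OF t'(1), of 0 z x] by linarith
  then have "weight \<sigma> t z * (m1 0 t z x + m2 0 t z x) \<noteq> 0"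
    using weight_pos[OF A.\<sigma> t'(2), of z] by simp
  then have "(norm (D_x u1 t z x - D_x u2 t z x))\<^sup>2 = 0"
    using dissipation_zero[OF t, of z x] unfolding dissipation_def norm_D_x_diff by simp
  then have "D_x u1 t z x = D_x u2 t z x" by simp
  then show ?thesis by (simp add: drift_def)
qed

text \<open>It suffices that \<open>m2\<close> solves the forward equation with the drift of
  \<open>u1\<close>; then both flows have one drift and \<open>signal_flow_unique\<close>
  applies.\<close>

lemma densities_agree:
  assumes t: "t \<in> {0<..T}"
  shows "m1 s t z x = m2 s t z x"
proof -
  have fp: "is_FP T \<sigma> \<sigma>' s (drift \<sigma> C u1) (m2 s)" for s
  proof -
    obtain \<mu>t \<mu>z \<mu>zz \<mu>i \<mu>ii vi where FP: "FP_with T \<sigma> \<sigma>' s (drift \<sigma> C u2) (m2 s) \<mu>t \<mu>z \<mu>zz \<mu>i \<mu>ii vi"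
      using B.flow.FP unfolding is_FP_def by blast
    \<comment> \<open>The products of density and drift agree everywhere, also where
      \<open>m2\<close> vanishes and the drifts may differ. As functions of \<open>x\<close> they
      are equal, so they have the same derivatives.\<close>
    have eq: "(\<lambda>x. m2 s t z x * drift \<sigma> C u1 t z x $ i) = (\<lambda>x. m2 s t z x * drift \<sigma> C u2 t z x $ i)" if "t \<in> {0<..<T}" for t z i
    proof
      fix x show "m2 s t z x * drift \<sigma> C u1 t z x $ i = m2 s t z x * drift \<sigma> C u2 t z x $ i"
        using drift_eq[OF that, of s z x] by (cases "m2 s t z x = 0") auto
    qed
    have "FP_with T \<sigma> \<sigma>' s (drift \<sigma> C u1) (m2 s) \<mu>t \<mu>z \<mu>zz \<mu>i \<mu>ii vi"
      unfolding FP_with_def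
    proof (intro conjI allI ballI)
      show "jointly_continuous_on {0<..<T} (\<lambda>t z x. drift \<sigma> C u1 t z x $ i)" for i
        by (rule jc_subset[OF A.flow.b]) auto
      show "has_tpartial i (\<lambda>x. m2 s t z x * drift \<sigma> C u1 t z x $ i) (vi i t z x) x" if "t \<in> {0<..<T}" for i t z x
        unfolding eq[OF that] by (rule FP_withD(4)[OF FP that])
    qed (use FP in \<open>unfold FP_with_def; blast\<close>)+
    then show ?thesis unfolding is_FP_def by blast
  qed
  have "signal_flow T \<sigma> \<sigma>' \<rho>0 (drift \<sigma> C u1) m2"
    by (unfold_locales; fact A.T A.\<sigma> A.\<sigma>' A.\<rho>0 fp A.flow.b B.flow.m_cont B.flow.m_nonneg B.flow.m_mass B.flow.m_init)
  from signal_flow_unique[OF A.flow.signal_flow_axioms this t] show ?thesis .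
qed

lemma crowd_cost_eq: "t \<in> {0<..T} \<Longrightarrow> crowd_cost \<sigma> f m1 t z x = crowd_cost \<sigma> f m2 t z x"
  unfolding crowd_cost_def position_law_def by (simp add: densities_agree)

text \<open>Once the densities agree the costs cancel. At a point where the
  \<open>x\<close>-derivatives of \<open>u1 - u2\<close> vanish the two Hamiltonians also coincide,
  so the inequality required by \<open>maximum_principle\<close> holds there with equality.\<close>

lemma values_ordered:
  assumes t: "t \<in> {0<..T}"
  shows "U t z x \<le> 0"
proof -
  have sub: "{t..<T} \<subseteq> {0<..<T}" "{t..T} \<subseteq> {0..T}" "{t..T} \<subseteq> {0<..T}" using t by auto
  note u = C12_withD(1-5)[OF U_C12]
  show ?thesis
  proof (rule maximum_principle[where a = t and b = T and W = U and Wt = Ut and Wz = Uz and Wzz = Uzz and Wi = Ui and Wii = Uii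
        and r = "post_mean \<sigma>" and c = "\<sigma>\<^sup>2 / 2" and d = "\<sigma>'\<^sup>2 / 2" and \<rho> = "1 / \<sigma>\<^sup>2"])
    show "jointly_continuous_on {t..T} U" by (rule jc_subset[OF U_jc sub(2)])
    fix t' z x i assume "t' \<in> {t..<T}"
    then have t': "t' \<in> {0<..<T}" using sub(1) by blast
    show "((\<lambda>t. U t z x) has_real_derivative Ut t' z x) (at t')"
      "((\<lambda>z. U t' z x) has_real_derivative Uz t' z x) (at z)"
      "((\<lambda>z. Uz t' z x) has_real_derivative Uzz t' z x) (at z)"
      "has_tpartial i (U t' z) (Ui i t' z x) x" "has_tpartial i (Ui i t' z) (Uii i t' z x) x"
      by (rule u[OF t'])+
    show "\<bar>post_mean \<sigma> t' z\<bar> \<le> 1 / \<sigma>\<^sup>2 * \<bar>z\<bar>"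
      by (rule abs_post_mean_le[OF A.\<sigma>]) (use t' in auto)
  next
    fix t' z x assume "t' \<in> {t..<T}" and crit: "\<And>i. Ui i t' z x = 0"
    then have t': "t' \<in> {0<..<T}" using sub(1) by blast
    have "D_x u1 t' z x = D_x u2 t' z x"
      using crit by (simp add: D_x_def vec_eq_iff)
    moreover have "crowd_cost \<sigma> F m1 t' z x = crowd_cost \<sigma> F m2 t' z x"
      by (rule crowd_cost_eq) (use t' in auto)
    ultimately show "0 \<le> Ut t' z x + post_mean \<sigma> t' z * Uz t' z x + \<sigma>\<^sup>2 / 2 * Uzz t' z x + \<sigma>'\<^sup>2 / 2 * (\<Sum>i\<in>UNIV. Uii i t' z x)"
      unfolding U_equation[OF t'] by simp
  next
    have "crowd_cost \<sigma> G m1 T z x = crowd_cost \<sigma> G m2 T z x" for z x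
      by (rule crowd_cost_eq) (use A.T in auto)
    then show "U T z x \<le> 0" for z x unfolding A.u_T B.u_T by simp
    fix e :: real assume e: "e > 0"
    obtain K1 where K1: "\<forall>t\<in>{0..T}. \<forall>z x. \<bar>u1 t z x\<bar> \<le> K1 * exp (e * z\<^sup>2)"
      using A.u_growth(1) e unfolding subgaussian_growth_def by blast
    obtain K2 where K2: "\<forall>t\<in>{0..T}. \<forall>z x. \<bar>u2 t z x\<bar> \<le> K2 * exp (e * z\<^sup>2)"
      using B.u_growth(1) e unfolding subgaussian_growth_def by blast
    have "U t' z x \<le> (K1 + K2) * exp (e * z\<^sup>2)" if "t' \<in> {t..T}" for t' z x
    proof -
      have "t' \<in> {0..T}" using that sub(2) by blast
      from K1[rule_format, OF this, of z x] K2[rule_format, OF this, of z x] show ?thesis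
        unfolding distrib_right by linarith
    qed
    then show "\<exists>K. \<forall>t'\<in>{t..T}. \<forall>z x. U t' z x \<le> K * exp (e * z\<^sup>2)" by blast
  qed (use t in auto)
qed

end

theorem theorem4p1:
  fixes T \<sigma> \<sigma>' :: real
    and F G :: "real \<Rightarrow> ('n::finite) torus \<Rightarrow> 'n torus measure \<Rightarrow> real"
    and C :: "real \<Rightarrow> 'n torus \<Rightarrow> real ^ 'n \<Rightarrow> real"
    and \<rho>0 :: "'n torus \<Rightarrow> real"
    and u1 u2 :: "real \<Rightarrow> real \<Rightarrow> 'n torus \<Rightarrow> real"
    and m1 m2 :: "real \<Rightarrow> real \<Rightarrow> real \<Rightarrow> 'n torus \<Rightarrow> real"
  assumes "T > 0" and "\<sigma> > 0" and "\<sigma>' > 0"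
    and "torus_density \<rho>0"
    and "Borel_cost F" and "Borel_cost G"
    and "Hamiltonian_well_defined T \<sigma> C"
    and "uniformly_Lipschitz_gradient C"
    and "state_by_state_monotone F" and "state_by_state_monotone G"
    and "classical_solution T \<sigma> \<sigma>' F G C \<rho>0 u1 m1"
    and "classical_solution T \<sigma> \<sigma>' F G C \<rho>0 u2 m2"
  shows "(\<forall>t\<in>{0..T}. \<forall>z x. u1 t z x = u2 t z x) \<and>
         (AE (s, t) in lborel \<Otimes>\<^sub>M lborel. t \<in> {0..T} \<longrightarrow> (\<forall>z x. m1 s t z x = m2 s t z x))"
proof
  interpret P: mfg_pair T \<sigma> \<sigma>' F G C \<rho>0 u1 u2 m1 m2
    by (unfold_locales; fact assms)
  \<comment> \<open>Exchanging the two solutions gives the reverse inequality between the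
    values.\<close>
  interpret P': mfg_pair T \<sigma> \<sigma>' F G C \<rho>0 u2 u1 m2 m1
    by (unfold_locales; fact assms)
  have eq: "u1 t z x = u2 t z x" if "t \<in> {0<..T}" for t z x
    using P.values_ordered[OF that, of z x] P'.values_ordered[OF that, of z x] by linarith
  show "\<forall>t\<in>{0..T}. \<forall>z x. u1 t z x = u2 t z x"
  proof (intro ballI allI)
    fix t z x assume t: "t \<in> {0..T}"
    show "u1 t z x = u2 t z x"
    proof (cases "t = 0")
      case True
      \<comment> \<open>No equation holds at \<open>t = 0\<close>; equality comes from the
        continuity of the values up to the initial time.\<close>
      have "continuous_on {0..T} (\<lambda>t. u1 t z x - u2 t z x)"
        by (rule jc_slice_t[OF P.U_jc])
      then have "((\<lambda>t. u1 t z x - u2 t z x) \<longlongrightarrow> u1 0 z x - u2 0 z x) (at 0 within {0..T})"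
        using assms(1) by (simp add: continuous_on_def)
      then have "((\<lambda>t. u1 t z x - u2 t z x) \<longlongrightarrow> u1 0 z x - u2 0 z x) (at_right 0)"
        unfolding at_within_Icc_at_right[OF assms(1)] .
      moreover have "eventually (\<lambda>t. u1 t z x - u2 t z x = 0) (at_right 0)"
        unfolding eventually_at_right_field using assms(1) eq by (intro exI[of _ T]) auto
      then have "((\<lambda>t. u1 t z x - u2 t z x) \<longlongrightarrow> 0) (at_right 0)"
        by (rule tendsto_eventually)
      ultimately have "u1 0 z x - u2 0 z x = 0"
        by (rule tendsto_unique[OF trivial_limit_at_right_real])
      then show ?thesis using True by simp
    next
      case False
      then show ?thesis using t eq by simp
    qed
  qed
  \<comment> \<open>The densities agree for every \<open>s\<close> and every \<open>t > 0\<close>.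
    Only the line \<open>t = 0\<close>, a null set, has to be excluded: there the datum is a measure
    without density.\<close>
  have "AE p in lborel \<Otimes>\<^sub>M lborel. p \<notin> (UNIV :: real set) \<times> {0 :: real}"
  proof (rule AE_not_in)
    have "emeasure (lborel \<Otimes>\<^sub>M lborel) (UNIV \<times> {0} :: (real \<times> real) set) = emeasure lborel (UNIV :: real set) * emeasure lborel {0 :: real}"
      by (rule lborel.emeasure_pair_measure_Times) simp_all
    then show "UNIV \<times> {0} \<in> null_sets (lborel \<Otimes>\<^sub>M lborel :: (real \<times> real) measure)"
      by (simp add: null_sets_def)
  qed
  then show "AE (s, t) in lborel \<Otimes>\<^sub>M lborel. t \<in> {0..T} \<longrightarrow> (\<forall>z x. m1 s t z x = m2 s t z x)"
  proof (rule AE_mp)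
    show "AE p in lborel \<Otimes>\<^sub>M lborel. p \<notin> UNIV \<times> {0} \<longrightarrow> (\<lambda>(s, t). t \<in> {0..T} \<longrightarrow> (\<forall>z x. m1 s t z x = m2 s t z x)) p"
      by (rule AE_I2) (auto intro: P.densities_agree)
  qed
qed

end
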